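(* Let $(X_t)_{t\in\mathbb{R}^d}$ be a centered stationary Gaussian field with $\mathbb{E}[X_t^2]=1$ for all $t\in\mathbb{R}^d$ and with covariance function $\phi$, that is, $\mathrm{Cov}(X_s,X_t)=\phi(|s-t|)$ for all $s,t\in\mathbb{R}^d$, where $\phi:[0,+\infty)\to\mathbb{R}$ and $|\cdot|$ is the Euclidean norm. Assume that $t\mapsto\phi(t)$ is non-increasing and that $\phi(1)<1/2$. For a subset $A$ of $\mathbb{R}^d$, denote by $N(A)$ the minimal number of balls of radius $1$ needed to cover $A$, and set $M(A)=\sup_{s\in A}X_s$. Then there exist $C=C(\phi,d)>0$ and $c=c(\phi,d)>0$, depending only on $\phi$ and $d$, such that for all $A\subset\mathbb{R}^d$ with $N(A)>1$, $$ \mathbb{P}\left(|M(A)-\mathbb{E}[M(A)]|\ge t\right)\le 6\,e^{-ct/\sqrt{K_{N(A)}}},\qquad t\ge 0, $$ where $$ K_{N(A)}=\max\left(\phi\left(N(A)^{C}\right),\,\frac{1}{\log N(A)}\right). $$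
   Context: Balls are Euclidean balls in $\mathbb{R}^d$. A Gaussian field is a family of random variables indexed by $\mathbb{R}^d$, on a common probability space, whose finite-dimensional distributions are all Gaussian.
   Formalization: Adds that the supremum of X over each nonempty bounded set is a.s. finite and a.s. equals the supremum over a countable subset (true for a.s. continuous paths); A is taken bounded and M(A) measurable. Without the regularity the claim fails, e.g. for a smooth field plus pointwise white noise. *)

theory Defs
  imports "HOL-Probability.Probability"
begin

text \<open>Degenerate (Dirac) laws count as Gaussian: the covariance matrix of finitely many values of
  a Gaussian field may be singular.\<close>

definition gaussian_law :: "real measure \<Rightarrow> bool" where
  "gaussian_law \<mu> \<longleftrightarrow>
     (\<exists>m \<sigma>. 0 \<le> \<sigma> \<and>
        \<mu> = (if \<sigma> = 0 then return borel m else density lborel (\<lambda>x. ennreal (normal_density m \<sigma> x))))"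

text \<open>A finite family of random variables has a Gaussian joint law iff, by definition, all its
  linear combinations are Gaussian.  The set \<open>T\<close> ranges over the finite index sets of the
  finite-dimensional distributions.\<close>

definition gaussian_field :: "'w measure \<Rightarrow> ('t \<Rightarrow> 'w \<Rightarrow> real) \<Rightarrow> bool" where
  "gaussian_field P X \<longleftrightarrow>
     (\<forall>T a. finite T \<longrightarrow> gaussian_law (distr P borel (\<lambda>\<omega>. \<Sum>t\<in>T. a t * X t \<omega>)))"

definition stationary_field :: "'w measure \<Rightarrow> ('t::ab_group_add \<Rightarrow> 'w \<Rightarrow> real) \<Rightarrow> bool" where
  "stationary_field P X \<longleftrightarrow>
     (\<forall>T h. finite T \<longrightarrow>
        distr P (PiM T (\<lambda>_. borel)) (\<lambda>\<omega>. \<lambda>t\<in>T. X (t + h) \<omega>) =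
        distr P (PiM T (\<lambda>_. borel)) (\<lambda>\<omega>. \<lambda>t\<in>T. X t \<omega>))"

definition field_sup :: "('t \<Rightarrow> 'w \<Rightarrow> real) \<Rightarrow> 't set \<Rightarrow> 'w \<Rightarrow> real" where
  "field_sup X A \<omega> = (SUP s\<in>A. X s \<omega>)"

text \<open>The usual convention that gives the supremum over an arbitrary bounded index set a meaning.
  The finite-dimensional distributions alone do not determine the supremum over an uncountable set,
  nor do they make it finite; so the supremum over each bounded set is required to be almost surely
  finite and almost surely equal to the supremum over a countable subset.
  Almost sure continuity of the sample paths suffices, see \<open>regular_suprema_if_continuous\<close>.

  Finiteness is required of all bounded sets and not only of the one at hand: if \<open>X = Y + W\<close> with
  \<open>Y\<close> smooth and \<open>W\<close> an independent white noise indexed by points, then on finite sets that consist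
  of a very large cluster in one small ball together with \<open>n\<close> far away points, the variance of the
  maximum does not tend to 0 as \<open>n\<close> grows.\<close>

definition regular_suprema :: "'w measure \<Rightarrow> ('t::metric_space \<Rightarrow> 'w \<Rightarrow> real) \<Rightarrow> bool" where
  "regular_suprema P X \<longleftrightarrow>
     (\<forall>A. bounded A \<and> A \<noteq> {} \<longrightarrow>
        (\<exists>D. countable D \<and> D \<noteq> {} \<and> D \<subseteq> A \<and>
           (AE \<omega> in P. bdd_above ((\<lambda>s. X s \<omega>) ` A) \<and> field_sup X A \<omega> = field_sup X D \<omega>)))"

lemma regular_suprema_if_continuous:
  fixes X :: "'t::euclidean_space \<Rightarrow> 'w \<Rightarrow> real"
  assumes "AE \<omega> in P. continuous_on UNIV (\<lambda>t. X t \<omega>)"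
  shows "regular_suprema P X"
  unfolding regular_suprema_def
proof (intro allI impI)
  fix A :: "'t set"
  assume A: "bounded A \<and> A \<noteq> {}"
  obtain D where D: "countable D" "D \<subseteq> A" "A \<subseteq> closure D"
    using separable by blast
  have D_ne: "D \<noteq> {}"
    using A D(3) by auto
  have *: "bdd_above (f ` A) \<and> (SUP s\<in>A. f s) = (SUP s\<in>D. f s)"
    if f: "continuous_on UNIV f" for f :: "'t \<Rightarrow> real"
  proof -
    have "compact (f ` closure A)"
      using A f by (intro compact_continuous_image) (auto intro: continuous_on_subset)
    then have "bdd_above (f ` closure A)"
      by (simp add: bounded_imp_bdd_above compact_imp_bounded)
    then have bA: "bdd_above (f ` A)"
      by (rule bdd_above_mono) (use closure_subset in blast)
    then have bD: "bdd_above (f ` D)"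
      by (rule bdd_above_mono) (use D in blast)
    have "closed {x. f x \<le> (SUP s\<in>D. f s)}"
      using f by (intro closed_Collect_le) auto
    moreover have "D \<subseteq> {x. f x \<le> (SUP s\<in>D. f s)}"
      using bD by (auto intro: cSUP_upper)
    ultimately have "closure D \<subseteq> {x. f x \<le> (SUP s\<in>D. f s)}"
      by (simp add: closure_minimal)
    then have "(SUP s\<in>A. f s) \<le> (SUP s\<in>D. f s)"
      using A D(3) by (intro cSUP_least) auto
    moreover have "(SUP s\<in>D. f s) \<le> (SUP s\<in>A. f s)"
      using bA D(2) D_ne by (intro cSUP_subset_mono) auto
    ultimately show ?thesis
      using bA by simp
  qed
  have "AE \<omega> in P. bdd_above ((\<lambda>s. X s \<omega>) ` A) \<and> field_sup X A \<omega> = field_sup X D \<omega>"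
    using assms by eventually_elim (simp add: field_sup_def *)
  then show "\<exists>D. countable D \<and> D \<noteq> {} \<and> D \<subseteq> A \<and>
      (AE \<omega> in P. bdd_above ((\<lambda>s. X s \<omega>) ` A) \<and> field_sup X A \<omega> = field_sup X D \<omega>)"
    using D D_ne by blast
qed

locale unit_stationary_gaussian_field = prob_space P
  for P :: "'w measure" and X :: "real ^ 'n \<Rightarrow> 'w \<Rightarrow> real" and \<phi> :: "real \<Rightarrow> real" +
  assumes random_variable: "random_variable borel (X t)"
    and gaussian: "gaussian_field P X"
    and stationary: "stationary_field P X"
    and centered: "expectation (X t) = 0"
    and second_moment: "expectation (\<lambda>\<omega>. (X t \<omega>)\<^sup>2) = 1"
    and covariance:
      "expectation (\<lambda>\<omega>. (X s \<omega> - expectation (X s)) * (X t \<omega> - expectation (X t))) = \<phi> (norm (s - t))"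
    and regular: "regular_suprema P X"

text \<open>Balls are closed.  The minimum is meaningful for bounded sets, which are those with a finite
  cover.\<close>

definition covering_number :: "(real ^ 'n) set \<Rightarrow> nat" where
  "covering_number A = (LEAST k. \<exists>Z. finite Z \<and> card Z = k \<and> A \<subseteq> (\<Union>z\<in>Z. cball z 1))"

definition K_rate :: "(real \<Rightarrow> real) \<Rightarrow> real \<Rightarrow> nat \<Rightarrow> real" where
  "K_rate \<phi> C k = max (\<phi> (real k powr C)) (1 / ln (real k))"

text \<open>The constants \<open>C\<close> and \<open>c\<close> work for all fields with covariance function \<open>\<phi>\<close> that are defined on a
  probability space over the type \<open>'w\<close>, and for all index sets \<open>A\<close>.  Unbounded sets are
  excluded: they have no finite cover, and their supremum is almost surely infinite when
  \<open>\<phi> 1 < 1/2\<close>.\<close>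

definition superconcentration_constants ::
    "'w itself \<Rightarrow> 'n::finite itself \<Rightarrow> (real \<Rightarrow> real) \<Rightarrow> real \<Rightarrow> real \<Rightarrow> bool" where
  "superconcentration_constants _ _ \<phi> C c \<longleftrightarrow>
     (\<forall>(P :: 'w measure) (X :: real ^ 'n \<Rightarrow> 'w \<Rightarrow> real) A t.
        unit_stationary_gaussian_field P X \<phi> \<and>
        bounded A \<and> 1 < covering_number A \<and> field_sup X A \<in> borel_measurable P \<and> 0 \<le> t \<longrightarrow>
        measure P {\<omega> \<in> space P. t \<le> \<bar>field_sup X A \<omega> - integral\<^sup>L P (field_sup X A)\<bar>}
          \<le> 6 * exp (- c * t / sqrt (K_rate \<phi> C (covering_number A))))"

text \<open>The type of sample paths.  Types cannot be quantified inside a formula, so the fact that the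
  constants do not depend on the underlying probability space is expressed by taking them
  from this one type and asserting that they are then good for every type of outcomes.\<close>

type_synonym 'n path = "real ^ 'n \<Rightarrow> real"

end

theory Submission
  imports Defs
begin

text \<open>For a finite set \<open>T\<close> the maximum is approximated by the soft maximum \<open>smax \<beta> T\<close>.  The covariance
  formula along the Ornstein-Uhlenbeck semigroup writes the variance of \<open>F = exp (k * smax \<beta> T)\<close> as an
  integral of correlations of the partial derivatives of \<open>F\<close> at sites \<open>s\<close> and \<open>t\<close>, weighted with the
  covariance of the field.  Sites at distance at least \<open>N\<^sup>C\<close> contribute at most \<open>\<phi> (N\<^sup>C)\<close>; all other
  pairs lie in a common patch of diameter comparable to \<open>N\<^sup>C\<close>, and the patches have bounded overlap.  If the (soft)
  maximiser lies in a given patch with probability at most \<open>exp (- L)\<close>, hypercontractivity bounds the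
  contribution of the patches by a multiple of \<open>1 / L\<close>.

  It remains to see that \<open>L\<close> can be of order \<open>log N\<close>.  The expected maximum over a unit ball is bounded,
  because suprema over bounded sets are finite.  On the other hand \<open>A\<close> contains \<open>N\<close> points at mutual
  distance larger than 1, whose correlations are at most \<open>\<phi> 1 < 1/2\<close>, so that the expected maximum over
  \<open>A\<close> is at least of order \<open>sqrt (log N)\<close>.  By Gaussian concentration a unit ball contains the maximiser
  with probability at most a negative power of \<open>N\<close>, and for small \<open>C\<close> the number of unit balls
  needed for a patch is a smaller power of \<open>N\<close>.

  Hence the variance of \<open>F\<close> is at most a constant times \<open>k\<^sup>2 * K\<close> times the mean of \<open>F\<^sup>2\<close>, and iterating
  this over \<open>k, k / 2, k / 4, \<dots>\<close> bounds the exponential moments of the centred maximum at scale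
  \<open>1 / sqrt K\<close>.  The bound passes to the supremum over a countable subset by monotone limits.\<close>

section \<open>Laws on the path space\<close>

text \<open>The covariance of finitely many sites may be singular, so densities and Gaussian
  integration by parts are avoided. Laws on the product space are identified by their characteristic
  functionals, and the Gaussian calculus rests on one fact: two independent copies are invariant
  under orthogonal 2x2 matrices. The covariance formula takes a finite form: rotating by an angle
  \<open>h\<close> compares the correlations at parameters \<open>r * r\<close> and
  \<open>r * r * cos h\<close>. The parameters run through 16^(-1/2^j), each the square of the next.
  Cauchy-Schwarz halves the exponent of decay at each scale, and summation over the scales, a
  Riemann sum of an exponential, produces the factor 1/L. Uniformity is the other obstacle: the
  assumption only makes the supremum over a unit ball finite. A level \<open>a\<close> is extracted
  that bounds the field on finite subsets of any unit ball with probability at least 1/2. This is a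
  property of the law on paths, which \<phi> determines, so \<open>a\<close> and all constants built
  from it depend on \<phi> and the dimension alone. The 6 is two tails times the bound 3 \<ge> e for
  an exponential moment.\<close>

lemma weighted_law_eq_1d:
  fixes X :: "'a \<Rightarrow> real" and Y :: "'b \<Rightarrow> real"
  assumes M: "prob_space M" and N: "prob_space N"
    and [measurable]: "X \<in> borel_measurable M" "Y \<in> borel_measurable N"
      "u \<in> borel_measurable M" "v \<in> borel_measurable N"
    and u: "\<And>x. 0 \<le> u x" "\<And>x. u x \<le> b" and v: "\<And>x. 0 \<le> v x" "\<And>x. v x \<le> b"
    and cos_eq: "\<And>s. (\<integral>x. u x * cos (s * X x) \<partial>M) = (\<integral>y. v y * cos (s * Y y) \<partial>N)"
    and sin_eq: "\<And>s. (\<integral>x. u x * sin (s * X x) \<partial>M) = (\<integral>y. v y * sin (s * Y y) \<partial>N)"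
    and [measurable]: "B \<in> sets borel"
  shows "(\<integral>x. u x * indicator B (X x) \<partial>M) = (\<integral>y. v y * indicator B (Y y) \<partial>N)"
proof -
  interpret M: prob_space M by fact
  interpret N: prob_space N by fact
  have bnd: "\<bar>a * y\<bar> \<le> b" if "0 \<le> a" "a \<le> b" "\<bar>y\<bar> \<le> 1" for a y :: real
    using that mult_mono[of a b "\<bar>y\<bar>" 1] by (simp add: abs_mult)
  have iu: "integrable M (\<lambda>x. u x * f x)" if [measurable]: "f \<in> borel_measurable M" and "\<And>x. \<bar>f x\<bar> \<le> 1"
    for f :: "'a \<Rightarrow> real"
    by (rule M.integrable_const_bound[where B = b])
      (use that u bnd in \<open>auto intro!: AE_I2\<close>)
  have iv: "integrable N (\<lambda>x. v x * f x)" if [measurable]: "f \<in> borel_measurable N" and "\<And>x. \<bar>f x\<bar> \<le> 1"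
    for f :: "'b \<Rightarrow> real"
    by (rule N.integrable_const_bound[where B = b])
      (use that v bnd in \<open>auto intro!: AE_I2\<close>)
  define c where "c = (\<integral>x. u x \<partial>M)"
  have cv: "c = (\<integral>y. v y \<partial>N)"
    using cos_eq[of 0] by (simp add: c_def)
  have c0: "0 \<le> c" unfolding c_def by (simp add: u)
  have int_u: "integrable M u" and int_v: "integrable N v"
    using iu[of "\<lambda>_. 1"] iv[of "\<lambda>_. 1"] by auto
  show ?thesis
  proof (cases "c = 0")
    case True
    have "AE x in M. u x = 0"
      using True int_u u by (subst (asm) c_def, subst (asm) integral_nonneg_eq_0_iff_AE) auto
    then have "(\<integral>x. u x * indicator B (X x) \<partial>M) = (\<integral>x. 0 \<partial>M)"
      by (intro integral_cong_AE) auto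
    moreover have "AE x in N. v x = 0"
      using True int_v v by (subst (asm) cv, subst (asm) integral_nonneg_eq_0_iff_AE) auto
    then have "(\<integral>x. v x * indicator B (Y x) \<partial>N) = (\<integral>x. 0 \<partial>N)"
      by (intro integral_cong_AE) auto
    ultimately show ?thesis by simp
  next
    case False
    then have c: "c > 0" using c0 by simp
    \<comment> \<open>Normalising the weights turns the claim into equality of two probability laws
      on the line, to which uniqueness of characteristic functions applies. Total mass 0 was split
      off for this reason.\<close>
    define D where "D = distr (density M (\<lambda>x. ennreal (u x / c))) borel X"
    define E where "E = distr (density N (\<lambda>x. ennreal (v x / c))) borel Y"
    have intD: "(\<integral>x. f x \<partial>D) = (\<integral>x. u x * f (X x) \<partial>M) / c"
      if [measurable]: "f \<in> borel_measurable borel" for f :: "real \<Rightarrow> real"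
      unfolding D_def using c u by (subst integral_distr, simp, simp, subst integral_density)
        (auto intro!: AE_I2 divide_nonneg_pos)
    have intE: "(\<integral>x. f x \<partial>E) = (\<integral>x. v x * f (Y x) \<partial>N) / c"
      if [measurable]: "f \<in> borel_measurable borel" for f :: "real \<Rightarrow> real"
      unfolding E_def using c v by (subst integral_distr, simp, simp, subst integral_density)
        (auto intro!: AE_I2 divide_nonneg_pos)
    have "prob_space (density M (\<lambda>x. ennreal (u x / c)))"
      by (rule prob_spaceI, subst emeasure_density)
        (use c u int_u in \<open>auto simp: nn_integral_eq_integral c_def[symmetric] cong: nn_integral_cong\<close>)
    then have D: "real_distribution D"
      unfolding D_def real_distribution_def real_distribution_axioms_def
      by (auto intro: prob_space.prob_space_distr)
    have "prob_space (density N (\<lambda>x. ennreal (v x / c)))"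
      by (rule prob_spaceI, subst emeasure_density)
        (use c v int_v in \<open>auto simp: nn_integral_eq_integral cv[symmetric] cong: nn_integral_cong\<close>)
    then have E: "real_distribution E"
      unfolding E_def real_distribution_def real_distribution_axioms_def
      by (auto intro: prob_space.prob_space_distr)
    have char: "char H t = of_real (\<integral>x. cos (t * x) \<partial>H) + \<i> * of_real (\<integral>x. sin (t * x) \<partial>H)"
      if "real_distribution H" for H :: "real measure" and t
    proof -
      interpret H: real_distribution H by fact
      have [measurable_cong]: "sets H = sets borel" by simp
      have i: "integrable H (\<lambda>x. cos (t * x))" "integrable H (\<lambda>x. sin (t * x))"
        by (auto intro!: H.integrable_const_bound[where B = 1])
      have "char H t = (\<integral>x. (of_real (cos (t * x)) + \<i> * of_real (sin (t * x))) \<partial>H)"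
        unfolding char_def by (intro Bochner_Integration.integral_cong) (auto simp: cis_conv_exp[symmetric] complex_eq_iff simp del: of_real_mult)
      also have "\<dots> = of_real (\<integral>x. cos (t * x) \<partial>H) + \<i> * of_real (\<integral>x. sin (t * x) \<partial>H)"
        using i by (subst Bochner_Integration.integral_add) auto
      finally show ?thesis .
    qed
    have "char D = char E"
      by (intro ext) (simp add: char[OF D] char[OF E] intD intE cos_eq sin_eq)
    then have "D = E" by (rule Levy_uniqueness[OF D E])
    then have "(\<integral>x. u x * indicator B (X x) \<partial>M) / c = (\<integral>y. v y * indicator B (Y y) \<partial>N) / c"
      using intD[of "indicator B"] intE[of "indicator B"] by (metis borel_measurable_indicator assms(13))
    then show ?thesis using c by simp
  qed
qed

abbreviation path_space :: "('t \<Rightarrow> real) measure" where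
  "path_space \<equiv> PiM UNIV (\<lambda>_. borel)"

lemma space_path_space: "space path_space = UNIV"
  by (simp add: space_PiM)

lemma measurable_into_path_space:
  assumes "\<And>t. (\<lambda>\<omega>. f \<omega> t) \<in> borel_measurable M"
  shows "f \<in> measurable M path_space"
  using measurable_abs_UNIV[of "\<lambda>t \<omega>. f \<omega> t" M "\<lambda>_. borel"] assms by simp

text \<open>The Cramer-Wold principle, derived from the one-dimensional uniqueness theorem.
  Coordinates are confined to Borel sets one at a time: by induction on \<open>J\<close>, the weight
  \<open>w B J\<close> times a sine or cosine of any linear form has the same integral under both
  laws, and such products determine the weighted law of the next coordinate.\<close>

lemma path_law_eqI:
  fixes M N :: "('t \<Rightarrow> real) measure"
  assumes M: "prob_space M" and N: "prob_space N"
    and sM: "sets M = sets path_space" and sN: "sets N = sets path_space"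
    and cos_eq: "\<And>K a. finite K \<Longrightarrow> (\<integral>x. cos (\<Sum>t\<in>K. a t * x t) \<partial>M) = (\<integral>x. cos (\<Sum>t\<in>K. a t * x t) \<partial>N)"
    and sin_eq: "\<And>K a. finite K \<Longrightarrow> (\<integral>x. sin (\<Sum>t\<in>K. a t * x t) \<partial>M) = (\<integral>x. sin (\<Sum>t\<in>K. a t * x t) \<partial>N)"
  shows "M = N"
proof -
  interpret M: prob_space M by fact
  interpret N: prob_space N by fact
  note [measurable_cong] = sM sN
  have [measurable]: "(\<lambda>x. x t) \<in> borel_measurable M" "(\<lambda>x. x t) \<in> borel_measurable N" for t
    using measurable_component_singleton[of t UNIV "\<lambda>_. borel::real measure"]
    by (simp_all add: measurable_cong_sets[OF sM refl] measurable_cong_sets[OF sN refl])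
  define w where "w B J x = (\<Prod>j\<in>J. indicator (B j) (x j) :: real)" for B :: "'t \<Rightarrow> real set" and J and x :: "'t \<Rightarrow> real"
  have w01: "0 \<le> w B J x" "w B J x \<le> 1" for B J x
    by (auto simp: w_def indicator_def intro!: prod_nonneg prod_le_1)
  have wM: "w B J \<in> borel_measurable M" and wN: "w B J \<in> borel_measurable N"
    if [measurable]: "\<And>j. B j \<in> sets borel" for B J
    by (unfold w_def) measurable
  have main: "(\<integral>x. w B J x * cos (\<Sum>t\<in>K. a t * x t) \<partial>M) = (\<integral>x. w B J x * cos (\<Sum>t\<in>K. a t * x t) \<partial>N)
     \<and> (\<integral>x. w B J x * sin (\<Sum>t\<in>K. a t * x t) \<partial>M) = (\<integral>x. w B J x * sin (\<Sum>t\<in>K. a t * x t) \<partial>N)"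
    if "finite J" "finite K" and B[measurable]: "\<And>j. B j \<in> sets borel" for J K a B
    using that(1,2)
  proof (induction J arbitrary: K a rule: finite_induct)
    case empty
    then show ?case using cos_eq sin_eq by (simp add: w_def)
  next
    case (insert j J)
    note [measurable] = wM[OF B] wN[OF B]
    define S where "S x = (\<Sum>t\<in>K. a t * x t)" for x :: "'t \<Rightarrow> real"
    have [measurable]: "S \<in> borel_measurable M" "S \<in> borel_measurable N"
      unfolding S_def by measurable
    \<comment> \<open>The index \<open>j\<close> may already occur in \<open>K\<close>, so
      coefficients at \<open>j\<close> are added.\<close>
    have comb: "(\<Sum>t\<in>insert j K. ((if t \<in> K then c * a t else 0) + (if t = j then s else 0)) * x t) = c * S x + s * x j"
      for s c x
    proof -
      have "(\<Sum>t\<in>insert j K. ((if t \<in> K then c * a t else 0) + (if t = j then s else 0)) * x t)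
        = (\<Sum>t\<in>insert j K. (if t \<in> K then c * a t * x t else 0)) + (\<Sum>t\<in>insert j K. (if t = j then s * x t else 0))"
        by (subst sum.distrib[symmetric]) (intro sum.cong, auto simp: algebra_simps)
      also have "(\<Sum>t\<in>insert j K. (if t \<in> K then c * a t * x t else 0)) = (\<Sum>t\<in>K. c * a t * x t)"
        using insert.prems by (intro sum.mono_neutral_cong_right) auto
      also have "(\<Sum>t\<in>insert j K. (if t = j then s * x t else 0)) = s * x j"
        using insert.prems by (subst sum.delta) auto
      finally show ?thesis by (simp add: S_def sum_distrib_left mult_ac)
    qed
    have C: "(\<integral>x. w B J x * cos (c * S x + s * x j) \<partial>M) = (\<integral>x. w B J x * cos (c * S x + s * x j) \<partial>N)" for c s
      using insert.IH[of "insert j K" "\<lambda>t. (if t \<in> K then c * a t else 0) + (if t = j then s else 0)"] insert.prems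
      by (simp only: comb finite_insert)
    have D: "(\<integral>x. w B J x * sin (c * S x + s * x j) \<partial>M) = (\<integral>x. w B J x * sin (c * S x + s * x j) \<partial>N)" for c s
      using insert.IH[of "insert j K" "\<lambda>t. (if t \<in> K then c * a t else 0) + (if t = j then s else 0)"] insert.prems
      by (simp only: comb finite_insert)
    have iM: "integrable M (\<lambda>x. w B J x * f x)" if [measurable]: "f \<in> borel_measurable M" and "\<And>x. \<bar>f x\<bar> \<le> 1" for f
      by (rule M.integrable_const_bound[where B = 1])
        (use that w01 in \<open>auto simp: abs_mult intro!: AE_I2 mult_le_one\<close>)
    have iN: "integrable N (\<lambda>x. w B J x * f x)" if [measurable]: "f \<in> borel_measurable N" and "\<And>x. \<bar>f x\<bar> \<le> 1" for f
      by (rule N.integrable_const_bound[where B = 1])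
        (use that w01 in \<open>auto simp: abs_mult intro!: AE_I2 mult_le_one\<close>)
    \<comment> \<open>The one-dimensional lemma wants nonnegative weights, so
      \<open>1 + cos (S x)\<close> and \<open>1 + sin (S x)\<close> stand in for the signed factors.
      The product formulas rewrite the integrands as sines and cosines of
      \<open>c * S x + s * x j\<close> with \<open>c\<close> equal to 0 or 1, where the induction
      hypothesis applies. Subtracting the plain weight at the end recovers the signed
      factor.\<close>
    have e1: "w B J x * (1 + cos (S x)) * cos (s * x j) =
       w B J x * cos (0 * S x + s * x j) + (w B J x * cos (1 * S x + s * x j) + w B J x * cos (1 * S x + (-s) * x j)) / 2" for x s
      by (simp add: cos_add cos_diff algebra_simps)
    have e2: "w B J x * (1 + cos (S x)) * sin (s * x j) =
       w B J x * sin (0 * S x + s * x j) + (w B J x * sin (1 * S x + s * x j) + - (w B J x * sin (1 * S x + (-s) * x j))) / 2" for x s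
      by (simp add: sin_add sin_diff algebra_simps)
    have e3: "w B J x * (1 + sin (S x)) * cos (s * x j) =
       w B J x * cos (0 * S x + s * x j) + (w B J x * sin (1 * S x + s * x j) + w B J x * sin (1 * S x + (-s) * x j)) / 2" for x s
      by (simp add: sin_add sin_diff algebra_simps)
    have e4: "w B J x * (1 + sin (S x)) * sin (s * x j) =
       w B J x * sin (0 * S x + s * x j) + (w B J x * cos (1 * S x + (-s) * x j) + - (w B J x * cos (1 * S x + s * x j))) / 2" for x s
      by (simp add: cos_add cos_diff algebra_simps)
    note ii = iM iN Bochner_Integration.integral_add Bochner_Integration.integrable_add
    have i0: "(\<integral>x. w B J x * indicator (B j) (x j) \<partial>M) = (\<integral>x. w B J x * indicator (B j) (x j) \<partial>N)"
      by (rule weighted_law_eq_1d[OF M N, where b = 1]) (use w01 C[of 0] D[of 0] in auto)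
    have le2: "w B J x * (1 + cos y) \<le> 2" "w B J x * (1 + sin y) \<le> 2" for x y
      using w01[of B J x] mult_mono[of "w B J x" 1 "1 + cos y" 2] mult_mono[of "w B J x" 1 "1 + sin y" 2]
        cos_le_one[of y] sin_le_one[of y] cos_ge_minus_one[of y] sin_ge_minus_one[of y] by linarith+
    have ge0: "0 \<le> w B J x * (1 + cos y)" "0 \<le> w B J x * (1 + sin y)" for x y
      using w01[of B J x] cos_ge_minus_one[of y] sin_ge_minus_one[of y] by (auto intro!: mult_nonneg_nonneg, linarith+)
    have i1: "(\<integral>x. w B J x * (1 + cos (S x)) * indicator (B j) (x j) \<partial>M) = (\<integral>x. w B J x * (1 + cos (S x)) * indicator (B j) (x j) \<partial>N)"
    proof (rule weighted_law_eq_1d[OF M N, where b = 2])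
      show "(\<integral>x. w B J x * (1 + cos (S x)) * cos (s * x j) \<partial>M) = (\<integral>x. w B J x * (1 + cos (S x)) * cos (s * x j) \<partial>N)" for s
        unfolding e1 by (simp add: ii C[of 0 s, simplified] C[of 1 s, simplified] C[of 1 "-s", simplified])
      show "(\<integral>x. w B J x * (1 + cos (S x)) * sin (s * x j) \<partial>M) = (\<integral>x. w B J x * (1 + cos (S x)) * sin (s * x j) \<partial>N)" for s
        unfolding e2 by (simp add: ii D[of 0 s, simplified] D[of 1 s, simplified] D[of 1 "-s", simplified])
    qed (use le2 ge0 in auto)
    have i2: "(\<integral>x. w B J x * (1 + sin (S x)) * indicator (B j) (x j) \<partial>M) = (\<integral>x. w B J x * (1 + sin (S x)) * indicator (B j) (x j) \<partial>N)"
    proof (rule weighted_law_eq_1d[OF M N, where b = 2])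
      show "(\<integral>x. w B J x * (1 + sin (S x)) * cos (s * x j) \<partial>M) = (\<integral>x. w B J x * (1 + sin (S x)) * cos (s * x j) \<partial>N)" for s
        unfolding e3 by (simp add: ii C[of 0 s, simplified] D[of 1 s, simplified] D[of 1 "-s", simplified])
      show "(\<integral>x. w B J x * (1 + sin (S x)) * sin (s * x j) \<partial>M) = (\<integral>x. w B J x * (1 + sin (S x)) * sin (s * x j) \<partial>N)" for s
        unfolding e4 by (simp add: ii D[of 0 s, simplified] C[of 1 s, simplified] C[of 1 "-s", simplified])
    qed (use le2 ge0 in auto)
    have ins: "w B (insert j J) x = w B J x * indicator (B j) (x j)" for x
      using insert.hyps by (simp add: w_def mult.commute)
    have f1: "w B J x * indicator (B j) (x j) * cos (S x) = w B J x * (1 + cos (S x)) * indicator (B j) (x j) - w B J x * indicator (B j) (x j)" for x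
      by (simp add: algebra_simps)
    have f2: "w B J x * indicator (B j) (x j) * sin (S x) = w B J x * (1 + sin (S x)) * indicator (B j) (x j) - w B J x * indicator (B j) (x j)" for x
      by (simp add: algebra_simps)
    have jM: "integrable M (\<lambda>x. w B J x * indicator (B j) (x j))" "integrable N (\<lambda>x. w B J x * indicator (B j) (x j))"
      by (auto intro!: iM iN simp: indicator_def)
    have jj: "integrable M (\<lambda>x. w B J x * (1 + cos (S x)) * indicator (B j) (x j))" "integrable M (\<lambda>x. w B J x * (1 + sin (S x)) * indicator (B j) (x j))"
      by (rule M.integrable_const_bound[where B = 2]; use ge0 le2 in \<open>auto simp: indicator_def intro!: AE_I2\<close>)+
    have kk: "integrable N (\<lambda>x. w B J x * (1 + cos (S x)) * indicator (B j) (x j))" "integrable N (\<lambda>x. w B J x * (1 + sin (S x)) * indicator (B j) (x j))"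
      by (rule N.integrable_const_bound[where B = 2]; use ge0 le2 in \<open>auto simp: indicator_def intro!: AE_I2\<close>)+
    show ?case
      unfolding S_def[symmetric] ins f1 f2 using jM jj kk
      by (simp add: Bochner_Integration.integral_diff i0 i1 i2)
  qed
  show ?thesis
  proof (rule measure_eqI_PiM_infinite[OF sM sN])
    show "finite_measure M" by unfold_locales
    fix A :: "'t \<Rightarrow> real set" and J :: "'t set"
    assume J: "finite J" and A: "\<And>i. i \<in> J \<Longrightarrow> A i \<in> sets borel"
    define B where "B i = (if i \<in> J then A i else {})" for i
    have B: "B j \<in> sets borel" for j by (simp add: B_def A)
    define P where "P = prod_emb UNIV (\<lambda>_. borel) J (Pi\<^sub>E J A)"
    have ind: "indicator P x = w B J x" for x
    proof -
      have "x \<in> P \<longleftrightarrow> (\<forall>j\<in>J. x j \<in> B j)"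
        by (auto simp: P_def prod_emb_def B_def PiE_iff)
      then show ?thesis
        unfolding w_def using J by (auto simp: indicator_def intro!: prod.neutral[symmetric] prod_zero[symmetric])
    qed
    have P: "P \<in> sets path_space"
      unfolding P_def using J A by (intro sets_PiM_I) auto
    have "(\<integral>x. indicat_real P x \<partial>M) = (\<integral>x. indicat_real P x \<partial>N)"
      unfolding ind using main[of J "{}" B "\<lambda>_. 0"] J B by simp
    moreover have "P \<in> sets M" "P \<in> sets N" using P sM sN by auto
    ultimately have "measure M P = measure N P"
      by (simp add: sets.Int_space_eq2)
    then show "emeasure M (prod_emb UNIV (\<lambda>_. borel) J (Pi\<^sub>E J A)) = emeasure N (prod_emb UNIV (\<lambda>_. borel) J (Pi\<^sub>E J A))"
      by (simp add: M.emeasure_eq_measure N.emeasure_eq_measure P_def)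
  qed
qed

lemma measurable_coord [measurable]: "(\<lambda>x. x t) \<in> borel_measurable path_space"
  using measurable_component_singleton[of t UNIV "\<lambda>_. borel::real measure"] by simp

lemma measurable_fst_coord [measurable]: "(\<lambda>p. fst p t) \<in> borel_measurable (path_space \<Otimes>\<^sub>M N)"
  by (rule measurable_compose[OF measurable_fst measurable_coord])

lemma measurable_snd_coord [measurable]: "(\<lambda>p. snd p t) \<in> borel_measurable (N \<Otimes>\<^sub>M path_space)"
  by (rule measurable_compose[OF measurable_snd measurable_coord])

lemma Plus_vimage: "(Inl -` K) <+> (Inr -` K) = K"
proof (rule set_eqI)
  fix x :: "'a + 'b" show "x \<in> (Inl -` K) <+> (Inr -` K) \<longleftrightarrow> x \<in> K" by (cases x) auto
qed

text \<open>A pair of paths is one path indexed by the disjoint sum \<open>'t + 't\<close>;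
  \<open>j\<close> and \<open>k\<close> are the two directions of this identification.\<close>

lemma pair_path_law_eqI:
  fixes M N :: "(('t \<Rightarrow> real) \<times> ('t \<Rightarrow> real)) measure"
  assumes M: "prob_space M" and N: "prob_space N"
    and sM: "sets M = sets (path_space \<Otimes>\<^sub>M path_space)" and sN: "sets N = sets (path_space \<Otimes>\<^sub>M path_space)"
    and cos_eq: "\<And>K a b. finite K \<Longrightarrow>
      (\<integral>p. cos ((\<Sum>t\<in>K. a t * fst p t) + (\<Sum>t\<in>K. b t * snd p t)) \<partial>M) =
      (\<integral>p. cos ((\<Sum>t\<in>K. a t * fst p t) + (\<Sum>t\<in>K. b t * snd p t)) \<partial>N)"
    and sin_eq: "\<And>K a b. finite K \<Longrightarrow>
      (\<integral>p. sin ((\<Sum>t\<in>K. a t * fst p t) + (\<Sum>t\<in>K. b t * snd p t)) \<partial>M) =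
      (\<integral>p. sin ((\<Sum>t\<in>K. a t * fst p t) + (\<Sum>t\<in>K. b t * snd p t)) \<partial>N)"
  shows "M = N"
proof -
  note [measurable_cong] = sM sN
  define j where "j = (\<lambda>p :: ('t \<Rightarrow> real) \<times> ('t \<Rightarrow> real). case_sum (fst p) (snd p))"
  define k where "k = (\<lambda>z :: 't + 't \<Rightarrow> real. (\<lambda>t. z (Inl t), \<lambda>t. z (Inr t)))"
  have j: "j \<in> measurable (path_space \<Otimes>\<^sub>M path_space) path_space"
  proof (rule measurable_into_path_space)
    fix t :: "'t + 't"
    show "(\<lambda>p. j p t) \<in> borel_measurable (path_space \<Otimes>\<^sub>M path_space)"
      by (cases t) (simp_all add: j_def)
  qed
  have k: "k \<in> measurable path_space (path_space \<Otimes>\<^sub>M path_space)"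
    unfolding k_def by (intro measurable_Pair measurable_into_path_space) simp_all
  have [measurable]: "j \<in> measurable M path_space" "j \<in> measurable N path_space"
    using j by (simp_all add: measurable_cong_sets[OF sM refl] measurable_cong_sets[OF sN refl])
  have kj: "k (j p) = p" for p by (simp add: k_def j_def)
  have sum_split: "(\<Sum>t\<in>K. a t * j p t) = (\<Sum>t\<in>Inl -` K \<union> Inr -` K. (if Inl t \<in> K then a (Inl t) else 0) * fst p t)
      + (\<Sum>t\<in>Inl -` K \<union> Inr -` K. (if Inr t \<in> K then a (Inr t) else 0) * snd p t)"
    and fin: "finite (Inl -` K \<union> Inr -` K)"
    if K: "finite K" for K :: "('t + 't) set" and a p
  proof -
    show fin: "finite (Inl -` K \<union> Inr -` K)"
      using K by (auto intro!: finite_vimageI)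
    have "(\<Sum>t\<in>K. a t * j p t) = (\<Sum>t\<in>(Inl -` K) <+> (Inr -` K). a t * j p t)"
      by (simp only: Plus_vimage)
    also have "\<dots> = (\<Sum>t\<in>Inl -` K. a (Inl t) * fst p t) + (\<Sum>t\<in>Inr -` K. a (Inr t) * snd p t)"
      using K by (subst sum.Plus) (auto simp: j_def intro!: finite_vimageI)
    also have "(\<Sum>t\<in>Inl -` K. a (Inl t) * fst p t) = (\<Sum>t\<in>Inl -` K \<union> Inr -` K. (if Inl t \<in> K then a (Inl t) else 0) * fst p t)"
      using fin by (intro sum.mono_neutral_cong_left) auto
    also have "(\<Sum>t\<in>Inr -` K. a (Inr t) * snd p t) = (\<Sum>t\<in>Inl -` K \<union> Inr -` K. (if Inr t \<in> K then a (Inr t) else 0) * snd p t)"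
      using fin by (intro sum.mono_neutral_cong_left) auto
    finally show "(\<Sum>t\<in>K. a t * j p t) = (\<Sum>t\<in>Inl -` K \<union> Inr -` K. (if Inl t \<in> K then a (Inl t) else 0) * fst p t)
      + (\<Sum>t\<in>Inl -` K \<union> Inr -` K. (if Inr t \<in> K then a (Inr t) else 0) * snd p t)" .
  qed
  have eq: "distr M path_space j = distr N path_space j"
  proof (rule path_law_eqI)
    show "prob_space (distr M path_space j)" "prob_space (distr N path_space j)"
      using M N by (auto intro: prob_space.prob_space_distr)
    fix K :: "('t + 't) set" and a :: "'t + 't \<Rightarrow> real"
    assume K: "finite K"
    show "(\<integral>x. cos (\<Sum>t\<in>K. a t * x t) \<partial>distr M path_space j) = (\<integral>x. cos (\<Sum>t\<in>K. a t * x t) \<partial>distr N path_space j)"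
      by (simp add: integral_distr) (simp only: sum_split[OF K] cos_eq[OF fin[OF K]])
    show "(\<integral>x. sin (\<Sum>t\<in>K. a t * x t) \<partial>distr M path_space j) = (\<integral>x. sin (\<Sum>t\<in>K. a t * x t) \<partial>distr N path_space j)"
      by (simp add: integral_distr) (simp only: sum_split[OF K] sin_eq[OF fin[OF K]])
  qed simp_all
  have inv_j: "distr (distr H path_space j) (path_space \<Otimes>\<^sub>M path_space) k = H"
    if [measurable]: "j \<in> measurable H path_space" and sH: "sets H = sets (path_space \<Otimes>\<^sub>M path_space)" for H
    using k sH by (subst distr_distr) (simp_all add: o_def kj distr_id2)
  have "M = distr (distr M path_space j) (path_space \<Otimes>\<^sub>M path_space) k"
    by (rule inv_j[symmetric]) (simp_all add: sM)
  also have "\<dots> = N"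
    unfolding eq by (rule inv_j) (simp_all add: sN)
  finally show ?thesis .
qed

lemma integral_CauchySchwarz:
  fixes f g :: "'a \<Rightarrow> real"
  assumes [measurable]: "f \<in> borel_measurable M" "g \<in> borel_measurable M"
    and f: "integrable M (\<lambda>x. (f x)\<^sup>2)" and g: "integrable M (\<lambda>x. (g x)\<^sup>2)"
  shows "(\<integral>x. f x * g x \<partial>M)\<^sup>2 \<le> (\<integral>x. (f x)\<^sup>2 \<partial>M) * (\<integral>x. (g x)\<^sup>2 \<partial>M)"
    and "integrable M (\<lambda>x. f x * g x)"
proof -
  have le: "\<bar>f x * g x\<bar> \<le> (f x)\<^sup>2 + (g x)\<^sup>2" for x
    using sum_squares_bound[of "\<bar>f x\<bar>" "\<bar>g x\<bar>"] mult_nonneg_nonneg[of "\<bar>f x\<bar>" "\<bar>g x\<bar>"]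
    unfolding abs_mult power2_abs by linarith
  show i: "integrable M (\<lambda>x. f x * g x)"
    by (rule Bochner_Integration.integrable_bound[OF Bochner_Integration.integrable_add[OF f g]])
      (use le in \<open>auto simp: intro!: AE_I2\<close>)
  define A where "A = (\<integral>x. (f x)\<^sup>2 \<partial>M)"
  define B where "B = (\<integral>x. (g x)\<^sup>2 \<partial>M)"
  define C where "C = (\<integral>x. f x * g x \<partial>M)"
  have q: "0 \<le> A - 2 * l * C + l\<^sup>2 * B" for l
  proof -
    have "0 \<le> (\<integral>x. (f x - l * g x)\<^sup>2 \<partial>M)" by simp
    also have "\<dots> = (\<integral>x. (f x)\<^sup>2 - 2 * l * (f x * g x) + l\<^sup>2 * (g x)\<^sup>2 \<partial>M)"
      by (intro Bochner_Integration.integral_cong) (auto simp: power2_eq_square algebra_simps)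
    also have "\<dots> = A - 2 * l * C + l\<^sup>2 * B"
      using f g i by (simp add: A_def B_def C_def)
    finally show ?thesis .
  qed
  have A0: "0 \<le> A" and B0: "0 \<le> B" by (simp_all add: A_def B_def)
  have "C\<^sup>2 \<le> A * B"
  proof (cases "B = 0")
    case True
    have "C = 0"
    proof (rule ccontr)
      assume "C \<noteq> 0"
      \<comment> \<open>For \<open>B = 0\<close> the quadratic is affine in \<open>l\<close>, and
        this \<open>l\<close> gives it the value -1.\<close>
      then show False using q[of "(A + 1) / (2 * C)"] True by (simp add: field_simps)
    qed
    then show ?thesis using A0 B0 by simp
  next
    case False
    then have "B > 0" using B0 by simp
    then show ?thesis using q[of "C / B"] by (simp add: field_simps power2_eq_square)
  qed
  then show "(\<integral>x. f x * g x \<partial>M)\<^sup>2 \<le> (\<integral>x. (f x)\<^sup>2 \<partial>M) * (\<integral>x. (g x)\<^sup>2 \<partial>M)"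
    by (simp add: A_def B_def C_def)
qed

lemma (in prob_space) integral_sq_le:
  fixes f :: "'a \<Rightarrow> real"
  assumes [measurable]: "f \<in> borel_measurable M" and "integrable M (\<lambda>x. (f x)\<^sup>2)"
  shows "(\<integral>x. f x \<partial>M)\<^sup>2 \<le> (\<integral>x. (f x)\<^sup>2 \<partial>M)"
  using integral_CauchySchwarz(1)[of f M "\<lambda>_. 1"] assms by (simp add: prob_space)

section \<open>Gaussian laws on the path space and rotations of two independent copies\<close>

lemma std_normal_exp_moment:
  "has_bochner_integral std_normal_distribution (\<lambda>x. exp (l * x)) (exp (l\<^sup>2 / 2))"
proof -
  have eq: "std_normal_density x * exp (l * x) = exp (l\<^sup>2 / 2) * normal_density l 1 x" for x
    by (simp add: normal_density_def std_normal_density_def exp_add[symmetric] power2_eq_square field_simps)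
      
  have "has_bochner_integral lborel (\<lambda>x. exp (l\<^sup>2 / 2) * normal_density l 1 x) (exp (l\<^sup>2 / 2) * 1)"
    by (intro has_bochner_integral_mult_right) (auto simp: has_bochner_integral_iff)
  then show ?thesis
    by (subst has_bochner_integral_density) (auto simp: eq)
qed

text \<open>Gaussianity is recorded as the real and imaginary part of the characteristic functional.
  Degenerate covariances then need no case distinction, and laws can be compared by
  \<open>path_law_eqI\<close>.\<close>

locale gaussian_path_law = prob_space \<mu> for \<mu> :: "('t \<Rightarrow> real) measure" +
  fixes \<Gamma> :: "'t \<Rightarrow> 't \<Rightarrow> real"
  assumes sets_mu: "sets \<mu> = sets path_space"
    and cos_char: "finite K \<Longrightarrow> (\<integral>x. cos (\<Sum>t\<in>K. a t * x t) \<partial>\<mu>) = exp (- (\<Sum>s\<in>K. \<Sum>t\<in>K. a s * a t * \<Gamma> s t) / 2)"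
    and sin_char: "finite K \<Longrightarrow> (\<integral>x. sin (\<Sum>t\<in>K. a t * x t) \<partial>\<mu>) = 0"
    and unit_var: "\<Gamma> t t = 1"
    and cov: "(\<integral>x. x s * x t \<partial>\<mu>) = \<Gamma> s t"
begin

lemmas [measurable_cong] = sets_mu

lemma space_mu: "space \<mu> = UNIV"
  using sets_eq_imp_space_eq[OF sets_mu] by (simp add: space_path_space)

lemma cov_sym: "\<Gamma> s t = \<Gamma> t s"
  using cov[of s t] cov[of t s] by (simp add: mult.commute)

sublocale PP: pair_prob_space \<mu> \<mu> ..

lemma sets_pair: "sets (\<mu> \<Otimes>\<^sub>M \<mu>) = sets (path_space \<Otimes>\<^sub>M path_space)"
  by (intro sets_pair_measure_cong sets_mu)

abbreviation lin :: "real \<Rightarrow> ('t \<Rightarrow> real) \<Rightarrow> real \<Rightarrow> ('t \<Rightarrow> real) \<Rightarrow> 't \<Rightarrow> real" where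
  "lin a x b y \<equiv> \<lambda>t. a * x t + b * y t"

lemma measurable_lin [measurable]:
  "(\<lambda>p. lin a (fst p) b (snd p)) \<in> measurable (path_space \<Otimes>\<^sub>M path_space) path_space"
  by (rule measurable_into_path_space) measurable

definition qf :: "'t set \<Rightarrow> ('t \<Rightarrow> real) \<Rightarrow> ('t \<Rightarrow> real) \<Rightarrow> real" where
  "qf K a b = (\<Sum>s\<in>K. \<Sum>t\<in>K. a s * b t * \<Gamma> s t)"

lemma qf_sym: "qf K a b = qf K b a"
  unfolding qf_def by (subst sum.swap) (simp add: cov_sym mult_ac)

lemma qf_lin: "qf K (lin a e b f) (lin a e b f) = a\<^sup>2 * qf K e e + 2 * a * b * qf K e f + b\<^sup>2 * qf K f f"
proof -
  have "qf K (lin a e b f) (lin a e b f) = a\<^sup>2 * qf K e e + a * b * qf K e f + a * b * qf K f e + b\<^sup>2 * qf K f f"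
    unfolding qf_def sum_distrib_left sum.distrib[symmetric]
    by (intro sum.cong refl) (simp add: algebra_simps power2_eq_square)
  then show ?thesis by (simp add: qf_sym[of K f e])
qed

lemma bounded_integrable:
  fixes f :: "'a \<Rightarrow> real"
  assumes "prob_space M" "f \<in> borel_measurable M" "\<And>x. \<bar>f x\<bar> \<le> 1"
  shows "integrable M f"
  by (rule finite_measure.integrable_const_bound[where B = 1])
    (use assms prob_space_def in \<open>auto simp: prob_space.finite_measure\<close>)

lemma pair_char:
  assumes K: "finite K"
  shows "(\<integral>p. cos ((\<Sum>t\<in>K. a t * fst p t) + (\<Sum>t\<in>K. b t * snd p t)) \<partial>(\<mu> \<Otimes>\<^sub>M \<mu>)) = exp (- (qf K a a + qf K b b) / 2)"
    and "(\<integral>p. sin ((\<Sum>t\<in>K. a t * fst p t) + (\<Sum>t\<in>K. b t * snd p t)) \<partial>(\<mu> \<Otimes>\<^sub>M \<mu>)) = 0"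
proof -
  let ?S = "\<lambda>a x. \<Sum>t\<in>K. a t * x t :: real"
  have c: "(\<integral>x. cos (?S a x) \<partial>\<mu>) = exp (- qf K a a / 2)" "(\<integral>x. sin (?S a x) \<partial>\<mu>) = 0" for a
    using cos_char[OF K] sin_char[OF K] by (simp_all add: qf_def)
  have i: "integrable \<mu> (\<lambda>x. cos (?S a x))" "integrable \<mu> (\<lambda>x. sin (?S a x))"
     "integrable \<mu> (\<lambda>x. z * cos (?S a x))" "integrable \<mu> (\<lambda>x. z * sin (?S a x))" for a z
    by (auto intro!: bounded_integrable prob_space_axioms integrable_mult_right)
  have j: "integrable (\<mu> \<Otimes>\<^sub>M \<mu>) (\<lambda>p. cos (?S a (fst p) + ?S b (snd p)))"
    "integrable (\<mu> \<Otimes>\<^sub>M \<mu>) (\<lambda>p. sin (?S a (fst p) + ?S b (snd p)))"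
    by (auto intro!: bounded_integrable PP.prob_space_axioms)
  show "(\<integral>p. cos (?S a (fst p) + ?S b (snd p)) \<partial>(\<mu> \<Otimes>\<^sub>M \<mu>)) = exp (- (qf K a a + qf K b b) / 2)"
    using PP.integral_fst'[OF j(1)] i c[of a] c[of b]
    by (simp add: cos_add exp_add[symmetric] diff_divide_distrib)
  show "(\<integral>p. sin (?S a (fst p) + ?S b (snd p)) \<partial>(\<mu> \<Otimes>\<^sub>M \<mu>)) = 0"
    using PP.integral_fst'[OF j(2)] i c[of a] c[of b]
    by (simp add: sin_add)
qed

lemma lin_lin_sum:
  "(\<Sum>t\<in>K. e t * lin a x b y t) + (\<Sum>t\<in>K. f t * lin c x d y t) = (\<Sum>t\<in>K. lin a e c f t * x t) + (\<Sum>t\<in>K. lin b e d f t * y t)"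
  unfolding sum.distrib[symmetric] by (intro sum.cong refl) (simp add: algebra_simps)

text \<open>The sum of the quadratic forms of the two copies is preserved: the rows of the matrix
  have length 1, and the mixed term carries their inner product, which is 0. Reversibility of the
  semigroup, concentration and the energy increments all come from this invariance.\<close>

lemma distr_orthogonal:
  assumes "a\<^sup>2 + b\<^sup>2 = 1" "c\<^sup>2 + d\<^sup>2 = 1" "a * c + b * d = 0"
  shows "distr (\<mu> \<Otimes>\<^sub>M \<mu>) (path_space \<Otimes>\<^sub>M path_space) (\<lambda>p. (lin a (fst p) b (snd p), lin c (fst p) d (snd p))) = \<mu> \<Otimes>\<^sub>M \<mu>"
proof (rule pair_path_law_eqI)
  have [measurable]: "(\<lambda>p. (lin a (fst p) b (snd p), lin c (fst p) d (snd p))) \<in> measurable (\<mu> \<Otimes>\<^sub>M \<mu>) (path_space \<Otimes>\<^sub>M path_space)"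
    using measurable_Pair[OF measurable_lin measurable_lin] by (simp add: measurable_cong_sets[OF sets_pair refl])
  show "prob_space (distr (\<mu> \<Otimes>\<^sub>M \<mu>) (path_space \<Otimes>\<^sub>M path_space) (\<lambda>p. (lin a (fst p) b (snd p), lin c (fst p) d (snd p))))"
    by (rule PP.prob_space_distr) simp
  show "prob_space (\<mu> \<Otimes>\<^sub>M \<mu>)" by (rule PP.prob_space_axioms)
  show "sets (\<mu> \<Otimes>\<^sub>M \<mu>) = sets (path_space \<Otimes>\<^sub>M path_space)" by (rule sets_pair)
  fix K :: "'t set" and e f :: "'t \<Rightarrow> real" assume K: "finite K"
  have "qf K (lin a e c f) (lin a e c f) + qf K (lin b e d f) (lin b e d f) =
      (a\<^sup>2 + b\<^sup>2) * qf K e e + 2 * (a * c + b * d) * qf K e f + (c\<^sup>2 + d\<^sup>2) * qf K f f"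
    unfolding qf_lin by (simp add: algebra_simps)
  then have q: "qf K (lin a e c f) (lin a e c f) + qf K (lin b e d f) (lin b e d f) = qf K e e + qf K f f"
    using assms by simp
  show "(\<integral>p. cos ((\<Sum>t\<in>K. e t * fst p t) + (\<Sum>t\<in>K. f t * snd p t)) \<partial>distr (\<mu> \<Otimes>\<^sub>M \<mu>) (path_space \<Otimes>\<^sub>M path_space) (\<lambda>p. (lin a (fst p) b (snd p), lin c (fst p) d (snd p)))) =
      (\<integral>p. cos ((\<Sum>t\<in>K. e t * fst p t) + (\<Sum>t\<in>K. f t * snd p t)) \<partial>(\<mu> \<Otimes>\<^sub>M \<mu>))"
    by (subst integral_distr, simp, simp, simp only: fst_conv snd_conv lin_lin_sum pair_char[OF K] q)
  show "(\<integral>p. sin ((\<Sum>t\<in>K. e t * fst p t) + (\<Sum>t\<in>K. f t * snd p t)) \<partial>distr (\<mu> \<Otimes>\<^sub>M \<mu>) (path_space \<Otimes>\<^sub>M path_space) (\<lambda>p. (lin a (fst p) b (snd p), lin c (fst p) d (snd p)))) =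
      (\<integral>p. sin ((\<Sum>t\<in>K. e t * fst p t) + (\<Sum>t\<in>K. f t * snd p t)) \<partial>(\<mu> \<Otimes>\<^sub>M \<mu>))"
    by (subst integral_distr, simp, simp, simp only: fst_conv snd_conv lin_lin_sum pair_char[OF K] q)
qed simp

text \<open>Serves the composition law \<open>OU_OU\<close>, where two independent noises merge into
  one.\<close>

lemma distr_lin:
  assumes n: "n\<^sup>2 = a\<^sup>2 + b\<^sup>2"
  shows "distr (\<mu> \<Otimes>\<^sub>M \<mu>) path_space (\<lambda>p. lin a (fst p) b (snd p)) = distr \<mu> path_space (\<lambda>x t. n * x t)"
proof (rule path_law_eqI)
  have [measurable]: "(\<lambda>x t. n * x t) \<in> measurable \<mu> path_space" 
    by (rule measurable_into_path_space) measurable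
  have [measurable]: "(\<lambda>p. lin a (fst p) b (snd p)) \<in> measurable (\<mu> \<Otimes>\<^sub>M \<mu>) path_space"
    using measurable_lin by (simp add: measurable_cong_sets[OF sets_pair refl])
  show "prob_space (distr (\<mu> \<Otimes>\<^sub>M \<mu>) path_space (\<lambda>p. lin a (fst p) b (snd p)))"
    by (rule PP.prob_space_distr) simp
  show "prob_space (distr \<mu> path_space (\<lambda>x t. n * x t))"
    by (rule prob_space_distr) simp
  fix K :: "'t set" and e :: "'t \<Rightarrow> real" assume K: "finite K"
  have s1: "(\<Sum>t\<in>K. e t * lin a x b y t) = (\<Sum>t\<in>K. lin a e 0 e t * x t) + (\<Sum>t\<in>K. lin b e 0 e t * y t)" for x y
    unfolding sum.distrib[symmetric] by (intro sum.cong refl) (simp add: algebra_simps)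
  have s2: "(\<Sum>t\<in>K. e t * (n * x t)) = (\<Sum>t\<in>K. lin n e 0 e t * x t)" for x
    by (intro sum.cong refl) (simp add: algebra_simps)
  have q: "qf K (lin a e 0 e) (lin a e 0 e) + qf K (lin b e 0 e) (lin b e 0 e) = qf K (lin n e 0 e) (lin n e 0 e)"
    unfolding qf_lin n by (simp add: algebra_simps)
  show "(\<integral>x. cos (\<Sum>t\<in>K. e t * x t) \<partial>distr (\<mu> \<Otimes>\<^sub>M \<mu>) path_space (\<lambda>p. lin a (fst p) b (snd p))) =
      (\<integral>x. cos (\<Sum>t\<in>K. e t * x t) \<partial>distr \<mu> path_space (\<lambda>x t. n * x t))"
    by (simp add: integral_distr) (simp only: s1 s2 pair_char[OF K] cos_char[OF K] q qf_def[symmetric])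
  show "(\<integral>x. sin (\<Sum>t\<in>K. e t * x t) \<partial>distr (\<mu> \<Otimes>\<^sub>M \<mu>) path_space (\<lambda>p. lin a (fst p) b (snd p))) =
      (\<integral>x. sin (\<Sum>t\<in>K. e t * x t) \<partial>distr \<mu> path_space (\<lambda>x t. n * x t))"
    by (simp add: integral_distr) (simp only: s1 s2 pair_char[OF K] sin_char[OF K])
qed simp_all

lemma distr_coord: "distr \<mu> borel (\<lambda>x. x t) = std_normal_distribution"
proof (rule Levy_uniqueness)
  show D: "real_distribution (distr \<mu> borel (\<lambda>x. x t))"
    unfolding real_distribution_def real_distribution_axioms_def by (auto intro!: prob_space_distr)
  show "real_distribution std_normal_distribution" by (rule real_dist_normal_dist)
  show "char (distr \<mu> borel (\<lambda>x. x t)) = char std_normal_distribution"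
  proof
    fix s :: real
    have i: "integrable \<mu> (\<lambda>x. cos (s * x t))" "integrable \<mu> (\<lambda>x. sin (s * x t))"
      by (auto intro!: bounded_integrable prob_space_axioms)
    have "char (distr \<mu> borel (\<lambda>x. x t)) s = (\<integral>x. iexp (s * x t) \<partial>\<mu>)"
      unfolding char_def by (subst integral_distr) auto
    also have "\<dots> = (\<integral>x. (of_real (cos (s * x t)) + \<i> * of_real (sin (s * x t))) \<partial>\<mu>)"
      by (intro Bochner_Integration.integral_cong) (auto simp: cis_conv_exp[symmetric] complex_eq_iff simp del: of_real_mult)
    also have "\<dots> = of_real (\<integral>x. cos (s * x t) \<partial>\<mu>) + \<i> * of_real (\<integral>x. sin (s * x t) \<partial>\<mu>)"
      using i by (subst Bochner_Integration.integral_add) auto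
    also have "\<dots> = char std_normal_distribution s"
      using cos_char[of "{t}" "\<lambda>_. s"] sin_char[of "{t}" "\<lambda>_. s"]
      by (simp add: char_std_normal_distribution unit_var power2_eq_square)
    finally show "char (distr \<mu> borel (\<lambda>x. x t)) s = char std_normal_distribution s" .
  qed
qed

lemma exp_moment: "has_bochner_integral \<mu> (\<lambda>x. exp (l * x t)) (exp (l\<^sup>2 / 2))"
  using std_normal_exp_moment[of l] unfolding distr_coord[of t, symmetric]
  by (simp add: has_bochner_integral_iff integrable_distr_eq integral_distr)

end

section \<open>The Ornstein-Uhlenbeck semigroup\<close>

text \<open>A class of functions that contains the integrands and is closed under sums, products,
  sections, integration of one variable and the semigroup. Membership gives integrability for finite
  \<open>T\<close>, since Gaussian laws have all exponential moments.\<close>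

definition edom :: "'t set \<Rightarrow> (('t \<Rightarrow> real) \<Rightarrow> real) \<Rightarrow> bool" where
  "edom T f \<longleftrightarrow> f \<in> borel_measurable path_space \<and>
     (\<exists>C k. 0 \<le> C \<and> 0 \<le> k \<and> (\<forall>x. \<bar>f x\<bar> \<le> C * exp (k * (\<Sum>t\<in>T. \<bar>x t\<bar>))))"

text \<open>The bound is a product of one-variable bounds, so that Fubini's theorem and integration
  in one variable stay inside the class.\<close>

definition edom2 :: "'t set \<Rightarrow> (('t \<Rightarrow> real) \<times> ('t \<Rightarrow> real) \<Rightarrow> real) \<Rightarrow> bool" where
  "edom2 T F \<longleftrightarrow> F \<in> borel_measurable (path_space \<Otimes>\<^sub>M path_space) \<and>
     (\<exists>C k. 0 \<le> C \<and> 0 \<le> k \<and> (\<forall>x y. \<bar>F (x, y)\<bar> \<le> C * (exp (k * (\<Sum>t\<in>T. \<bar>x t\<bar>)) * exp (k * (\<Sum>t\<in>T. \<bar>y t\<bar>)))))"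

lemma edomI:
  assumes "f \<in> borel_measurable path_space" "0 \<le> C" "0 \<le> k" "\<And>x. \<bar>f x\<bar> \<le> C * exp (k * (\<Sum>t\<in>T. \<bar>x t\<bar>))"
  shows "edom T f"
  using assms unfolding edom_def by blast

lemma edom_measurable: "edom T f \<Longrightarrow> f \<in> borel_measurable path_space"
  by (simp add: edom_def)

lemma edom2_measurable: "edom2 T F \<Longrightarrow> F \<in> borel_measurable (path_space \<Otimes>\<^sub>M path_space)"
  by (simp add: edom2_def)

lemma edom_mono:
  assumes f: "edom T f" and g: "g \<in> borel_measurable path_space" and le: "\<And>x. \<bar>g x\<bar> \<le> \<bar>f x\<bar>"
  shows "edom T g"
proof -
  obtain C k where "0 \<le> C" "0 \<le> k" "\<And>x. \<bar>f x\<bar> \<le> C * exp (k * (\<Sum>t\<in>T. \<bar>x t\<bar>))"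
    using f unfolding edom_def by blast
  then show ?thesis using g le by (intro edomI[where C = C and k = k]) (blast intro: order_trans)+
qed

lemma edom_bounded:
  assumes "f \<in> borel_measurable path_space" "\<And>x. \<bar>f x\<bar> \<le> C"
  shows "edom T f"
  by (rule edomI[where C = C and k = 0]) (use assms order_trans[OF abs_ge_zero assms(2)] in auto)

lemma edom_const: "edom T (\<lambda>_. c)"
  by (rule edom_bounded) auto

lemma edom_mult:
  assumes f: "edom T f" and g: "edom T g"
  shows "edom T (\<lambda>x. f x * g x)"
proof -
  obtain C k where 1: "0 \<le> C" "0 \<le> k" "\<And>x. \<bar>f x\<bar> \<le> C * exp (k * (\<Sum>t\<in>T. \<bar>x t\<bar>))"
    using f unfolding edom_def by blast
  obtain D l where 2: "0 \<le> D" "0 \<le> l" "\<And>x. \<bar>g x\<bar> \<le> D * exp (l * (\<Sum>t\<in>T. \<bar>x t\<bar>))"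
    using g unfolding edom_def by blast
  note [measurable] = edom_measurable[OF f] edom_measurable[OF g]
  have "\<bar>f x * g x\<bar> \<le> (C * D) * exp ((k + l) * (\<Sum>t\<in>T. \<bar>x t\<bar>))" for x
  proof -
    have "\<bar>f x * g x\<bar> \<le> (C * exp (k * (\<Sum>t\<in>T. \<bar>x t\<bar>))) * (D * exp (l * (\<Sum>t\<in>T. \<bar>x t\<bar>)))"
      unfolding abs_mult using 1 2 by (intro mult_mono) auto
    then show ?thesis by (simp add: distrib_right exp_add mult_ac)
  qed
  then show ?thesis
    using 1 2 by (intro edomI[where C = "C * D" and k = "k + l"]) auto
qed

lemma edom_add:
  assumes f: "edom T f" and g: "edom T g"
  shows "edom T (\<lambda>x. f x + g x)"
proof -
  obtain C k where 1: "0 \<le> C" "0 \<le> k" "\<And>x. \<bar>f x\<bar> \<le> C * exp (k * (\<Sum>t\<in>T. \<bar>x t\<bar>))"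
    using f unfolding edom_def by blast
  obtain D l where 2: "0 \<le> D" "0 \<le> l" "\<And>x. \<bar>g x\<bar> \<le> D * exp (l * (\<Sum>t\<in>T. \<bar>x t\<bar>))"
    using g unfolding edom_def by blast
  note [measurable] = edom_measurable[OF f] edom_measurable[OF g]
  have "\<bar>f x + g x\<bar> \<le> (C + D) * exp ((k + l) * (\<Sum>t\<in>T. \<bar>x t\<bar>))" for x
  proof -
    have s: "0 \<le> (\<Sum>t\<in>T. \<bar>x t\<bar>)" by (simp add: sum_nonneg)
    have "exp (k * (\<Sum>t\<in>T. \<bar>x t\<bar>)) \<le> exp ((k + l) * (\<Sum>t\<in>T. \<bar>x t\<bar>))"
      and "exp (l * (\<Sum>t\<in>T. \<bar>x t\<bar>)) \<le> exp ((k + l) * (\<Sum>t\<in>T. \<bar>x t\<bar>))"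
      using 1 2 s by (auto intro!: mult_right_mono)
    then have "C * exp (k * (\<Sum>t\<in>T. \<bar>x t\<bar>)) + D * exp (l * (\<Sum>t\<in>T. \<bar>x t\<bar>)) \<le> (C + D) * exp ((k + l) * (\<Sum>t\<in>T. \<bar>x t\<bar>))"
      using 1 2 by (auto simp: distrib_right intro!: add_mono mult_left_mono)
    then show ?thesis using 1(3)[of x] 2(3)[of x] by linarith
  qed
  then show ?thesis
    using 1 2 by (intro edomI[where C = "C + D" and k = "k + l"]) auto
qed

lemma edom_cmult: "edom T f \<Longrightarrow> edom T (\<lambda>x. c * f x)"
  by (rule edom_mult[OF edom_const])

lemma edom_sum: "(\<And>i. i \<in> A \<Longrightarrow> edom T (f i)) \<Longrightarrow> edom T (\<lambda>x. \<Sum>i\<in>A. f i x)"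
  by (induction A rule: infinite_finite_induct) (auto intro: edom_const edom_add)

lemma edom_diff: "edom T f \<Longrightarrow> edom T g \<Longrightarrow> edom T (\<lambda>x. f x - g x)"
  using edom_add[of T f "\<lambda>x. (-1) * g x"] edom_cmult[of T g "-1"] by simp

lemma edom_power2: "edom T f \<Longrightarrow> edom T (\<lambda>x. (f x)\<^sup>2)"
  using edom_mult[of T f f] by (simp add: power2_eq_square)

lemma edom_coord:
  assumes "finite T" "t \<in> T" shows "edom T (\<lambda>x. x t)"
proof (rule edomI[where C = 1 and k = 1])
  fix x :: "'a \<Rightarrow> real"
  have "\<bar>x t\<bar> \<le> (\<Sum>t\<in>T. \<bar>x t\<bar>)" using assms by (intro member_le_sum) auto
  also have "\<dots> \<le> exp (\<Sum>t\<in>T. \<bar>x t\<bar>)" using exp_ge_add_one_self[of "\<Sum>t\<in>T. \<bar>x t\<bar>"] by linarith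
  finally show "\<bar>x t\<bar> \<le> 1 * exp (1 * (\<Sum>t\<in>T. \<bar>x t\<bar>))" by simp
qed auto

lemma edom2_mult:
  assumes f: "edom2 T f" and g: "edom2 T g"
  shows "edom2 T (\<lambda>x. f x * g x)"
proof -
  let ?E = "\<lambda>k x y. exp (k * (\<Sum>t\<in>T. \<bar>x t\<bar>)) * exp (k * (\<Sum>t\<in>T. \<bar>y t :: real\<bar>)) :: real"
  obtain C k where 1: "0 \<le> C" "0 \<le> k" "\<And>x y. \<bar>f (x, y)\<bar> \<le> C * ?E k x y"
    using f unfolding edom2_def by blast
  obtain D l where 2: "0 \<le> D" "0 \<le> l" "\<And>x y. \<bar>g (x, y)\<bar> \<le> D * ?E l x y"
    using g unfolding edom2_def by blast
  note [measurable] = edom2_measurable[OF f] edom2_measurable[OF g]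
  have "\<bar>f (x, y) * g (x, y)\<bar> \<le> (C * D) * ?E (k + l) x y" for x y
  proof -
    have "\<bar>f (x, y) * g (x, y)\<bar> \<le> (C * ?E k x y) * (D * ?E l x y)"
      unfolding abs_mult using 1 2 by (intro mult_mono) auto
    then show ?thesis by (simp add: distrib_right exp_add mult_ac)
  qed
  moreover have "(\<lambda>x. f x * g x) \<in> borel_measurable (path_space \<Otimes>\<^sub>M path_space)" by measurable
  ultimately show ?thesis
    using 1 2 unfolding edom2_def by (intro conjI exI[of _ "C * D"] exI[of _ "k + l"]) auto
qed

context gaussian_path_law begin

lemma edom2_lin:
  assumes f: "edom T f" 
  shows "edom2 T (\<lambda>p. f (lin a (fst p) b (snd p)))"
proof -
  obtain C k where 1: "0 \<le> C" "0 \<le> k" "\<And>x. \<bar>f x\<bar> \<le> C * exp (k * (\<Sum>t\<in>T. \<bar>x t\<bar>))"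
    using f unfolding edom_def by blast
  have m: "(\<lambda>p. f (lin a (fst p) b (snd p))) \<in> borel_measurable (path_space \<Otimes>\<^sub>M path_space)"
    by (rule measurable_compose[OF measurable_lin edom_measurable[OF f]])
  let ?l = "k * (\<bar>a\<bar> + \<bar>b\<bar>)"
  have "\<bar>f (lin a x b y)\<bar> \<le> C * (exp (?l * (\<Sum>t\<in>T. \<bar>x t\<bar>)) * exp (?l * (\<Sum>t\<in>T. \<bar>y t\<bar>)))" for x y
  proof -
    have le: "\<bar>lin a x b y t\<bar> \<le> (\<bar>a\<bar> + \<bar>b\<bar>) * \<bar>x t\<bar> + (\<bar>a\<bar> + \<bar>b\<bar>) * \<bar>y t\<bar>" for t
    proof -
      have "\<bar>lin a x b y t\<bar> \<le> \<bar>a\<bar> * \<bar>x t\<bar> + \<bar>b\<bar> * \<bar>y t\<bar>"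
        by (metis abs_mult abs_triangle_ineq)
      moreover have "\<bar>a\<bar> * \<bar>x t\<bar> \<le> (\<bar>a\<bar> + \<bar>b\<bar>) * \<bar>x t\<bar>" "\<bar>b\<bar> * \<bar>y t\<bar> \<le> (\<bar>a\<bar> + \<bar>b\<bar>) * \<bar>y t\<bar>"
        by (auto intro!: mult_right_mono)
      ultimately show ?thesis by linarith
    qed
    have "(\<Sum>t\<in>T. \<bar>lin a x b y t\<bar>) \<le> (\<bar>a\<bar> + \<bar>b\<bar>) * (\<Sum>t\<in>T. \<bar>x t\<bar>) + (\<bar>a\<bar> + \<bar>b\<bar>) * (\<Sum>t\<in>T. \<bar>y t\<bar>)"
      unfolding sum_distrib_left sum.distrib[symmetric] by (intro sum_mono le)
    then have "k * (\<Sum>t\<in>T. \<bar>lin a x b y t\<bar>) \<le> ?l * (\<Sum>t\<in>T. \<bar>x t\<bar>) + ?l * (\<Sum>t\<in>T. \<bar>y t\<bar>)"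
      using mult_left_mono[OF _ 1(2)] by (fastforce simp: algebra_simps)
    then have "C * exp (k * (\<Sum>t\<in>T. \<bar>lin a x b y t\<bar>)) \<le> C * exp (?l * (\<Sum>t\<in>T. \<bar>x t\<bar>) + ?l * (\<Sum>t\<in>T. \<bar>y t\<bar>))"
      using 1 by (intro mult_left_mono) auto
    then show ?thesis using 1(3)[of "lin a x b y"] unfolding exp_add by linarith
  qed
  then show ?thesis
    unfolding edom2_def using 1 m by (intro conjI exI[of _ C] exI[of _ ?l]) auto
qed

lemma edom2_fst: fixes f :: "('t \<Rightarrow> real) \<Rightarrow> real" shows "edom T f \<Longrightarrow> edom2 T (\<lambda>p. f (fst p))"
  using edom2_lin[of T f 1 0] by simp

lemma edom2_snd: fixes f :: "('t \<Rightarrow> real) \<Rightarrow> real" shows "edom T f \<Longrightarrow> edom2 T (\<lambda>p. f (snd p))"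
  using edom2_lin[of T f 0 1] by simp

context
  fixes T :: "'t set" assumes T: "finite T"
begin

text \<open>Only one-dimensional moments enter: the sum is at most \<open>card T\<close> times its
  largest term, and the exponential of the largest term is dominated by the sum over all sites of
  the exponentials with both signs.\<close>

lemma integrable_exp_abs: "integrable \<mu> (\<lambda>x. exp (k * (\<Sum>t\<in>T. \<bar>x t\<bar>)))" if k: "0 \<le> k"
proof (cases "T = {}")
  case False
  define m where "m = k * real (card T)"
  have "integrable \<mu> (\<lambda>x. \<Sum>t\<in>T. exp (m * x t) + exp ((- m) * x t))"
    using exp_moment[of m] exp_moment[of "- m"] unfolding has_bochner_integral_iff
    by (intro Bochner_Integration.integrable_sum Bochner_Integration.integrable_add) blast+
  moreover have "norm (exp (k * (\<Sum>t\<in>T. \<bar>x t\<bar>))) \<le> norm (\<Sum>t\<in>T. exp (m * x t) + exp ((- m) * x t))" for x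
  proof -
    have "Max ((\<lambda>s. \<bar>x s\<bar>) ` T) \<in> (\<lambda>s. \<bar>x s\<bar>) ` T"
      using T False by (intro Max_in) auto
    then obtain t where "t \<in> T" and Max: "Max ((\<lambda>s. \<bar>x s\<bar>) ` T) = \<bar>x t\<bar>" by blast
    then have t: "t \<in> T" "\<And>s. s \<in> T \<Longrightarrow> \<bar>x s\<bar> \<le> \<bar>x t\<bar>"
      unfolding Max[symmetric] using T by (auto intro!: Max_ge)
    have "k * (\<Sum>t\<in>T. \<bar>x t\<bar>) \<le> m * \<bar>x t\<bar>"
      using sum_bounded_above[of T "\<lambda>s. \<bar>x s\<bar>" "\<bar>x t\<bar>", OF t(2)] k by (simp add: m_def mult_left_mono mult.assoc)
    then have "exp (k * (\<Sum>t\<in>T. \<bar>x t\<bar>)) \<le> exp (m * \<bar>x t\<bar>)" by simp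
    also have "\<dots> \<le> exp (m * x t) + exp ((- m) * x t)" by (cases "x t \<ge> 0") auto
    also have "\<dots> \<le> (\<Sum>t\<in>T. exp (m * x t) + exp ((- m) * x t))"
      using T t(1) by (intro member_le_sum) (auto intro: add_nonneg_nonneg)
    finally show ?thesis by simp
  qed
  ultimately show ?thesis
    by (elim Bochner_Integration.integrable_bound) auto
qed simp

lemma integrable_edom: assumes f: "edom T f" shows "integrable \<mu> f"
proof -
  obtain C k where 1: "0 \<le> C" "0 \<le> k" "\<And>x. \<bar>f x\<bar> \<le> C * exp (k * (\<Sum>t\<in>T. \<bar>x t\<bar>))"
    using f unfolding edom_def by blast
  note [measurable] = edom_measurable[OF f]
  show ?thesis
  proof (rule Bochner_Integration.integrable_bound[OF integrable_mult_right[OF integrable_exp_abs[OF 1(2)], of C]])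
    show "AE x in \<mu>. norm (f x) \<le> norm (C * exp (k * (\<Sum>t\<in>T. \<bar>x t\<bar>)))"
      using 1(1) 1(3) by simp
  qed simp
qed

lemma integrable_edom2: assumes f: "edom2 T f" shows "integrable (\<mu> \<Otimes>\<^sub>M \<mu>) f"
proof -
  obtain C k where 1: "0 \<le> C" "0 \<le> k" "\<And>x y. \<bar>f (x, y)\<bar> \<le> C * (exp (k * (\<Sum>t\<in>T. \<bar>x t\<bar>)) * exp (k * (\<Sum>t\<in>T. \<bar>y t\<bar>)))"
    using f unfolding edom2_def by blast
  have [measurable]: "f \<in> borel_measurable (\<mu> \<Otimes>\<^sub>M \<mu>)"
    using edom2_measurable[OF f] by (simp add: measurable_cong_sets[OF sets_pair refl])
  let ?E = "\<lambda>x. exp (k * (\<Sum>t\<in>T. \<bar>x t\<bar>)) :: real"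
  have E: "integrable \<mu> ?E" by (rule integrable_exp_abs[OF 1(2)])
  have "integrable (\<mu> \<Otimes>\<^sub>M \<mu>) (\<lambda>p. ?E (fst p) * ?E (snd p))"
  proof (rule PP.Fubini_integrable)
    show "(\<lambda>p. ?E (fst p) * ?E (snd p)) \<in> borel_measurable (\<mu> \<Otimes>\<^sub>M \<mu>)" by measurable
    show "integrable \<mu> (\<lambda>x. \<integral>y. norm (?E (fst (x, y)) * ?E (snd (x, y))) \<partial>\<mu>)"
      using E by (simp add: norm_mult)
    show "AE x in \<mu>. integrable \<mu> (\<lambda>y. ?E (fst (x, y)) * ?E (snd (x, y)))"
      using E by simp
  qed
  then have "integrable (\<mu> \<Otimes>\<^sub>M \<mu>) (\<lambda>p. C * (?E (fst p) * ?E (snd p)))"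
    by (rule integrable_mult_right)
  then show ?thesis
  proof (rule Bochner_Integration.integrable_bound)
    have "norm (f p) \<le> norm (C * (?E (fst p) * ?E (snd p)))" for p
      using 1(3)[of "fst p" "snd p"] 1(1) by simp
    then show "AE p in \<mu> \<Otimes>\<^sub>M \<mu>. norm (f p) \<le> norm (C * (?E (fst p) * ?E (snd p)))" by simp
  qed simp
qed

lemma edom_section: assumes f: "edom2 T f" shows "edom T (\<lambda>y. f (x, y))"
proof -
  obtain C k where 1: "0 \<le> C" "0 \<le> k" "\<And>x y. \<bar>f (x, y)\<bar> \<le> C * (exp (k * (\<Sum>t\<in>T. \<bar>x t\<bar>)) * exp (k * (\<Sum>t\<in>T. \<bar>y t\<bar>)))"
    using f unfolding edom2_def by blast
  have "(\<lambda>y. f (x, y)) \<in> borel_measurable path_space"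
    by (rule measurable_Pair2[OF edom2_measurable[OF f]]) (simp add: space_path_space)
  then show ?thesis
    using 1 by (intro edomI[where C = "C * exp (k * (\<Sum>t\<in>T. \<bar>x t\<bar>))" and k = k]) (auto simp: mult.assoc)
qed

lemma edom_integral: assumes f: "edom2 T f" shows "edom T (\<lambda>x. \<integral>y. f (x, y) \<partial>\<mu>)"
proof -
  obtain C k where 1: "0 \<le> C" "0 \<le> k" "\<And>x y. \<bar>f (x, y)\<bar> \<le> C * (exp (k * (\<Sum>t\<in>T. \<bar>x t\<bar>)) * exp (k * (\<Sum>t\<in>T. \<bar>y t\<bar>)))"
    using f unfolding edom2_def by blast
  note [measurable] = edom2_measurable[OF f]
  define I where "I = (\<integral>y. exp (k * (\<Sum>t\<in>T. \<bar>y t\<bar>)) \<partial>\<mu>)"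
  show ?thesis
  proof (rule edomI[where C = "C * I" and k = k])
    have "(\<lambda>p. f p) \<in> borel_measurable (path_space \<Otimes>\<^sub>M \<mu>)"
      using edom2_measurable[OF f] by (simp only: measurable_cong_sets[OF sets_pair_measure_cong[OF refl sets_mu] refl])
    then show "(\<lambda>x. \<integral>y. f (x, y) \<partial>\<mu>) \<in> borel_measurable path_space"
      by (intro borel_measurable_lebesgue_integral) simp
    show "0 \<le> C * I" using 1 by (simp add: I_def)
    show "0 \<le> k" by fact
    fix x :: "'t \<Rightarrow> real"
    have "\<bar>\<integral>y. f (x, y) \<partial>\<mu>\<bar> \<le> (\<integral>y. \<bar>f (x, y)\<bar> \<partial>\<mu>)" by simp
    also have "\<dots> \<le> (\<integral>y. (C * exp (k * (\<Sum>t\<in>T. \<bar>x t\<bar>))) * exp (k * (\<Sum>t\<in>T. \<bar>y t\<bar>)) \<partial>\<mu>)"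
      using 1 by (intro integral_mono integrable_abs integrable_edom edom_section f integrable_mult_right integrable_exp_abs) (auto simp: mult.assoc)
    also have "\<dots> = C * I * exp (k * (\<Sum>t\<in>T. \<bar>x t\<bar>))"
      by (simp add: I_def mult_ac)
    finally show "\<bar>\<integral>y. f (x, y) \<partial>\<mu>\<bar> \<le> C * I * exp (k * (\<Sum>t\<in>T. \<bar>x t\<bar>))" .
  qed
qed

lemma integral_fst_edom2: "edom2 T F \<Longrightarrow> (\<integral>p. F p \<partial>(\<mu> \<Otimes>\<^sub>M \<mu>)) = (\<integral>x. \<integral>y. F (x, y) \<partial>\<mu> \<partial>\<mu>)"
  by (rule PP.integral_fst'[symmetric]) (rule integrable_edom2)

end

text \<open>Mehler's formula, parametrised by the correlation \<open>r\<close> instead of the time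
  \<open>- ln r\<close>, so that composition multiplies parameters.\<close>

definition OU :: "real \<Rightarrow> (('t \<Rightarrow> real) \<Rightarrow> real) \<Rightarrow> ('t \<Rightarrow> real) \<Rightarrow> real" where
  "OU r f y = (\<integral>w. f (lin r y (sqrt (1 - r\<^sup>2)) w) \<partial>\<mu>)"

lemma integral_orthogonal:
  fixes F :: "('t \<Rightarrow> real) \<times> ('t \<Rightarrow> real) \<Rightarrow> real"
  assumes "a\<^sup>2 + b\<^sup>2 = 1" "c\<^sup>2 + d\<^sup>2 = 1" "a * c + b * d = 0"
    and [measurable]: "F \<in> borel_measurable (path_space \<Otimes>\<^sub>M path_space)"
  shows "(\<integral>p. F (lin a (fst p) b (snd p), lin c (fst p) d (snd p)) \<partial>(\<mu> \<Otimes>\<^sub>M \<mu>)) = (\<integral>p. F p \<partial>(\<mu> \<Otimes>\<^sub>M \<mu>))"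
proof -
  have "(\<lambda>p. (lin a (fst p) b (snd p), lin c (fst p) d (snd p))) \<in> measurable (\<mu> \<Otimes>\<^sub>M \<mu>) (path_space \<Otimes>\<^sub>M path_space)"
    using measurable_Pair[OF measurable_lin measurable_lin] by (simp add: measurable_cong_sets[OF sets_pair refl])
  then show ?thesis
    by (subst (2) distr_orthogonal[OF assms(1-3), symmetric]) (simp add: integral_distr)
qed

lemma nn_integral_orthogonal:
  fixes F :: "('t \<Rightarrow> real) \<times> ('t \<Rightarrow> real) \<Rightarrow> ennreal"
  assumes "a\<^sup>2 + b\<^sup>2 = 1" "c\<^sup>2 + d\<^sup>2 = 1" "a * c + b * d = 0"
    and [measurable]: "F \<in> borel_measurable (path_space \<Otimes>\<^sub>M path_space)"
  shows "(\<integral>\<^sup>+p. F (lin a (fst p) b (snd p), lin c (fst p) d (snd p)) \<partial>(\<mu> \<Otimes>\<^sub>M \<mu>)) = (\<integral>\<^sup>+p. F p \<partial>(\<mu> \<Otimes>\<^sub>M \<mu>))"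
proof -
  have "(\<lambda>p. (lin a (fst p) b (snd p), lin c (fst p) d (snd p))) \<in> measurable (\<mu> \<Otimes>\<^sub>M \<mu>) (path_space \<Otimes>\<^sub>M path_space)"
    using measurable_Pair[OF measurable_lin measurable_lin] by (simp add: measurable_cong_sets[OF sets_pair refl])
  then show ?thesis
    by (subst (2) distr_orthogonal[OF assms(1-3), symmetric]) (simp add: nn_integral_distr)
qed

lemma OU_nonneg: "(\<And>x. 0 \<le> f x) \<Longrightarrow> 0 \<le> OU r f y"
  by (simp add: OU_def)

lemma OU_zero: "OU 0 f y = (\<integral>x. f x \<partial>\<mu>)"
  by (simp add: OU_def)

lemma OU_one: "OU 1 f = f"
  by (simp add: OU_def prob_space fun_eq_iff)

context
  fixes T :: "'t set" assumes T: "finite T"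
begin

lemma edom_lin_right: assumes f: "edom T f" shows "edom T (\<lambda>w. f (lin r y q w))"
  using edom_section[OF T edom2_lin[OF f, of r q], of y] by simp

lemma edom_OU: assumes f: "edom T f" shows "edom T (OU r f)"
  using edom_integral[OF T edom2_lin[OF f, of r "sqrt (1 - r\<^sup>2)"]] unfolding OU_def by simp

lemma OU_sum:
  assumes "\<And>i. i \<in> A \<Longrightarrow> edom T (f i)"
  shows "OU r (\<lambda>x. \<Sum>i\<in>A. f i x) y = (\<Sum>i\<in>A. OU r (f i) y)"
  unfolding OU_def using assms
  by (intro Bochner_Integration.integral_sum integrable_edom[OF T] edom_lin_right)

lemma integral_mult_OU:
  assumes f: "edom T f" and g: "edom T g"
  shows "(\<integral>x. g x * OU r f x \<partial>\<mu>) = (\<integral>p. g (fst p) * f (lin r (fst p) (sqrt (1 - r\<^sup>2)) (snd p)) \<partial>(\<mu> \<Otimes>\<^sub>M \<mu>))"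
  by (subst integral_fst_edom2[OF T edom2_mult[OF edom2_fst[OF g] edom2_lin[OF f]]]) (simp add: OU_def)

text \<open>With \<open>q = sqrt (1 - r^2)\<close>, the reflection taking (x, y) to (r x + q y, q x
  - r y) is orthogonal and exchanges x with r x + q y; so the joint law of these two is
  symmetric.\<close>

lemma OU_adjoint:
  assumes f: "edom T f" and g: "edom T g" and r: "0 \<le> r" "r \<le> 1"
  shows "(\<integral>x. g x * OU r f x \<partial>\<mu>) = (\<integral>x. f x * OU r g x \<partial>\<mu>)"
proof -
  let ?q = "sqrt (1 - r\<^sup>2)"
  have r2: "r\<^sup>2 \<le> 1" using r by (simp add: power_le_one)
  have q: "?q\<^sup>2 = 1 - r\<^sup>2" using r2 by simp
  let ?F = "\<lambda>p. g (fst p) * f (lin r (fst p) ?q (snd p))"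
  have F: "edom2 T ?F" by (rule edom2_mult[OF edom2_fst[OF g] edom2_lin[OF f]])
  have s: "r * (r * u + ?q * v) + ?q * (?q * u + (- r) * v) = u" for u v
  proof -
    have "r * (r * u + ?q * v) + ?q * (?q * u + (- r) * v) = (r\<^sup>2 + ?q\<^sup>2) * u"
      by (simp add: power2_eq_square algebra_simps)
    then show ?thesis using q by simp
  qed
  have "(\<integral>x. g x * OU r f x \<partial>\<mu>) = (\<integral>p. ?F p \<partial>(\<mu> \<Otimes>\<^sub>M \<mu>))" by (rule integral_mult_OU[OF f g])
  also have "\<dots> = (\<integral>p. ?F (lin r (fst p) ?q (snd p), lin ?q (fst p) (- r) (snd p)) \<partial>(\<mu> \<Otimes>\<^sub>M \<mu>))"
    by (rule integral_orthogonal[symmetric]) (use q edom2_measurable[OF F] in auto)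
  also have "\<dots> = (\<integral>p. f (fst p) * g (lin r (fst p) ?q (snd p)) \<partial>(\<mu> \<Otimes>\<^sub>M \<mu>))"
    by (simp only: fst_conv snd_conv s) (simp only: mult.commute)
  also have "\<dots> = (\<integral>x. f x * OU r g x \<partial>\<mu>)" by (rule integral_mult_OU[OF g f, symmetric])
  finally show ?thesis .
qed

lemma OU_OU:
  assumes f: "edom T f" and r: "0 \<le> r" "r \<le> 1" and s: "0 \<le> s" "s \<le> 1"
  shows "OU r (OU s f) y = OU (r * s) f y"
proof -
  let ?q = "sqrt (1 - r\<^sup>2)" and ?p = "sqrt (1 - s\<^sup>2)"
  have r2: "r\<^sup>2 \<le> 1" "s\<^sup>2 \<le> 1" "(r * s)\<^sup>2 \<le> 1" using r s by (auto intro!: power_le_one mult_le_one)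
  define g where "g u = f (lin (r * s) y 1 u)" for u
  have g: "edom T g" unfolding g_def by (rule edom_lin_right[OF f])
  have [measurable]: "g \<in> borel_measurable path_space" by (rule edom_measurable[OF g])
  have e: "s * (r * a + ?q * b) + ?p * c = r * s * a + 1 * ((s * ?q) * b + ?p * c)" for a b c
    by (simp add: algebra_simps)
  have "OU r (OU s f) y = (\<integral>w. \<integral>v. g (lin (s * ?q) w ?p v) \<partial>\<mu> \<partial>\<mu>)"
    unfolding OU_def g_def by (simp only: e)
  also have "\<dots> = (\<integral>p. g (lin (s * ?q) (fst p) ?p (snd p)) \<partial>(\<mu> \<Otimes>\<^sub>M \<mu>))"
    by (subst integral_fst_edom2[OF T edom2_lin[OF g]]) simp
  also have "\<dots> = (\<integral>x. g x \<partial>distr (\<mu> \<Otimes>\<^sub>M \<mu>) path_space (\<lambda>p. lin (s * ?q) (fst p) ?p (snd p)))"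
    using measurable_lin by (subst integral_distr) (simp_all add: measurable_cong_sets[OF sets_pair refl])
  \<comment> \<open>The squares of the two noise amplitudes, s^2 (1 - r^2) and 1 - s^2, add up to 1
    - (r s)^2.\<close>
  also have "\<dots> = (\<integral>x. g x \<partial>distr \<mu> path_space (\<lambda>x t. sqrt (1 - (r * s)\<^sup>2) * x t))"
    by (subst distr_lin[of "sqrt (1 - (r * s)\<^sup>2)"]) (use r2 in \<open>simp_all add: power_mult_distrib algebra_simps\<close>)
  also have "\<dots> = (\<integral>x. g (\<lambda>t. sqrt (1 - (r * s)\<^sup>2) * x t) \<partial>\<mu>)"
    by (subst integral_distr) (auto intro!: measurable_into_path_space)
  also have "\<dots> = OU (r * s) f y" unfolding OU_def g_def by simp
  finally show ?thesis .
qed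

lemma integral_OU:
  assumes f: "edom T f" and r: "0 \<le> r" "r \<le> 1"
  shows "(\<integral>x. OU r f x \<partial>\<mu>) = (\<integral>x. f x \<partial>\<mu>)"
  using OU_adjoint[OF f edom_const r, of 1] by (simp add: OU_def prob_space)

lemma integral_OU_sq:
  assumes f: "edom T f" and r: "0 \<le> r" "r \<le> 1"
  shows "(\<integral>x. (OU r f x)\<^sup>2 \<partial>\<mu>) \<le> (\<integral>x. (f x)\<^sup>2 \<partial>\<mu>)"
proof -
  have "(OU r f x)\<^sup>2 \<le> OU r (\<lambda>x. (f x)\<^sup>2) x" for x
    unfolding OU_def using edom_lin_right[OF edom_power2[OF f]] edom_measurable[OF edom_lin_right[OF f]]
    by (intro integral_sq_le integrable_edom[OF T]) simp_all
  then have "(\<integral>x. (OU r f x)\<^sup>2 \<partial>\<mu>) \<le> (\<integral>x. OU r (\<lambda>x. (f x)\<^sup>2) x \<partial>\<mu>)"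
    by (intro integral_mono integrable_edom[OF T] edom_power2 edom_OU f)
  then show ?thesis using integral_OU[OF edom_power2[OF f] r] by simp
qed

lemma integral_OU_OU:
  assumes f: "edom T f" and g: "edom T g" and r: "0 \<le> r" "r \<le> 1" and s: "0 \<le> s" "s \<le> 1"
  shows "(\<integral>x. OU r g x * OU s f x \<partial>\<mu>) = (\<integral>x. g x * OU (r * s) f x \<partial>\<mu>)"
proof -
  have "(\<integral>x. OU r g x * OU s f x \<partial>\<mu>) = (\<integral>x. OU s f x * OU r g x \<partial>\<mu>)"
    by (simp only: mult.commute)
  also have "\<dots> = (\<integral>x. g x * OU r (OU s f) x \<partial>\<mu>)"
    by (rule OU_adjoint[OF g edom_OU[OF f] r])
  finally show ?thesis by (simp only: OU_OU[OF f r s])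
qed

end

end

section \<open>The soft maximum\<close>

text \<open>In terms of the Gibbs measure on \<open>T\<close> with energy \<open>- x t\<close> and
  inverse temperature \<beta>: \<open>smz\<close> is the partition function, \<open>smax\<close> the
  free energy up to sign, and \<open>smp\<close> the Gibbs probability of a site, which is also the
  partial derivative of \<open>smax\<close>.\<close>

definition smz :: "real \<Rightarrow> 't set \<Rightarrow> ('t \<Rightarrow> real) \<Rightarrow> real" where
  "smz \<beta> T x = (\<Sum>t\<in>T. exp (\<beta> * x t))"

definition smax :: "real \<Rightarrow> 't set \<Rightarrow> ('t \<Rightarrow> real) \<Rightarrow> real" where
  "smax \<beta> T x = ln (smz \<beta> T x) / \<beta>"

definition smp :: "real \<Rightarrow> 't set \<Rightarrow> 't \<Rightarrow> ('t \<Rightarrow> real) \<Rightarrow> real" where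
  "smp \<beta> T t x = exp (\<beta> * x t) / smz \<beta> T x"

lemma smz_measurable [measurable]: "smz \<beta> T \<in> borel_measurable path_space"
  unfolding smz_def by measurable

lemma smax_measurable [measurable]: "smax \<beta> T \<in> borel_measurable path_space"
  unfolding smax_def by measurable

lemma smp_measurable [measurable]: "smp \<beta> T t \<in> borel_measurable path_space"
  unfolding smp_def by measurable

context
  fixes T :: "'t set" and \<beta> :: real
  assumes T: "finite T" "T \<noteq> {}" and \<beta>: "0 < \<beta>"
begin

lemma smz_pos: "0 < smz \<beta> T x"
  unfolding smz_def using T by (intro sum_pos) auto

lemma smp_nonneg: "0 \<le> smp \<beta> T t x"
  unfolding smp_def using smz_pos[of x] by simp

lemma smp_sum: "(\<Sum>t\<in>T. smp \<beta> T t x) = 1"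
  unfolding smp_def sum_divide_distrib[symmetric] using smz_pos[of x] by (simp add: smz_def)

lemma smp_le_1: "t \<in> T \<Longrightarrow> smp \<beta> T t x \<le> 1"
  using member_le_sum[of t T "\<lambda>t. smp \<beta> T t x"] T smp_nonneg smp_sum[of x] by simp

lemma smax_ge: "t \<in> T \<Longrightarrow> x t \<le> smax \<beta> T x"
proof -
  assume t: "t \<in> T"
  have "exp (\<beta> * x t) \<le> smz \<beta> T x"
    unfolding smz_def using T t by (intro member_le_sum) auto
  then have "\<beta> * x t \<le> ln (smz \<beta> T x)"
    using smz_pos[of x] ln_ge_iff by blast
  then show ?thesis using \<beta> by (simp add: smax_def field_simps)
qed

lemma smax_le: 
  assumes "\<And>t. t \<in> T \<Longrightarrow> x t \<le> m"
  shows "smax \<beta> T x \<le> m + ln (card T) / \<beta>"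
proof -
  have "smz \<beta> T x \<le> card T * exp (\<beta> * m)"
    unfolding smz_def using sum_bounded_above[of T "\<lambda>t. exp (\<beta> * x t)" "exp (\<beta> * m)"] assms \<beta> by simp
  then have "ln (smz \<beta> T x) \<le> ln (card T * exp (\<beta> * m))"
    using smz_pos[of x] by (subst ln_le_cancel_iff) auto
  also have "\<dots> = ln (card T) + \<beta> * m"
    using T by (subst ln_mult_pos) (auto simp: card_gt_0_iff)
  finally show ?thesis using \<beta> by (simp add: smax_def field_simps)
qed

lemma smax_abs_le: "\<bar>smax \<beta> T x\<bar> \<le> (\<Sum>t\<in>T. \<bar>x t\<bar>) + ln (card T) / \<beta>"
proof -
  obtain t where t: "t \<in> T" using T by blast
  have le: "\<bar>x t\<bar> \<le> (\<Sum>t\<in>T. \<bar>x t\<bar>)" if "t \<in> T" for t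
    using T that by (intro member_le_sum) auto
  have "0 \<le> ln (card T) / \<beta>" using T \<beta> by (simp add: Suc_leI card_gt_0_iff)
  then have "- smax \<beta> T x \<le> (\<Sum>t\<in>T. \<bar>x t\<bar>) + ln (card T) / \<beta>"
    using smax_ge[OF t, of x] le[OF t] by linarith
  moreover have "smax \<beta> T x \<le> (\<Sum>t\<in>T. \<bar>x t\<bar>) + ln (card T) / \<beta>"
    by (rule smax_le) (use le in \<open>auto intro: order_trans[OF abs_ge_self]\<close>)
  ultimately show ?thesis by linarith
qed

lemma edom_exp_smax: "edom T (\<lambda>x. exp (k * smax \<beta> T x))"
proof (rule edomI[where C = "exp (\<bar>k\<bar> * (ln (card T) / \<beta>))" and k = "\<bar>k\<bar>"])
  fix x :: "'t \<Rightarrow> real"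
  have "k * smax \<beta> T x \<le> \<bar>k\<bar> * \<bar>smax \<beta> T x\<bar>" by (metis abs_ge_self abs_mult)
  also have "\<dots> \<le> \<bar>k\<bar> * ((\<Sum>t\<in>T. \<bar>x t\<bar>) + ln (card T) / \<beta>)"
    by (intro mult_left_mono smax_abs_le) simp
  finally show "\<bar>exp (k * smax \<beta> T x)\<bar> \<le> exp (\<bar>k\<bar> * (ln (card T) / \<beta>)) * exp (\<bar>k\<bar> * (\<Sum>t\<in>T. \<bar>x t\<bar>))"
    by (simp add: exp_add[symmetric] distrib_left add.commute)
qed auto

lemma edom_smp: "t \<in> T \<Longrightarrow> edom T (smp \<beta> T t)"
  by (rule edom_bounded[where C = 1]) (use smp_nonneg smp_le_1 in auto)

lemma edom_smax: "edom T (smax \<beta> T)"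
proof -
  have "edom T (\<lambda>x. exp (1 * smax \<beta> T x) + exp (- 1 * smax \<beta> T x))"
    by (intro edom_add edom_exp_smax)
  then show ?thesis
  proof (rule edom_mono)
    fix x :: "'t \<Rightarrow> real"
    have "\<bar>smax \<beta> T x\<bar> \<le> exp \<bar>smax \<beta> T x\<bar>"
      using exp_ge_add_one_self[of "\<bar>smax \<beta> T x\<bar>"] by linarith
    also have "\<dots> \<le> exp (1 * smax \<beta> T x) + exp (- 1 * smax \<beta> T x)"
      by (cases "smax \<beta> T x \<ge> 0") auto
    finally show "\<bar>smax \<beta> T x\<bar> \<le> \<bar>exp (1 * smax \<beta> T x) + exp (- 1 * smax \<beta> T x)\<bar>" by simp
  qed simp
qed

lemma smax_deriv:
  assumes u: "\<And>t. t \<in> T \<Longrightarrow> ((\<lambda>\<tau>. u \<tau> t) has_real_derivative u' t) (at \<tau>)"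
  shows "((\<lambda>\<tau>. smax \<beta> T (u \<tau>)) has_real_derivative (\<Sum>t\<in>T. smp \<beta> T t (u \<tau>) * u' t)) (at \<tau>)"
proof -
  have z: "((\<lambda>\<tau>. smz \<beta> T (u \<tau>)) has_real_derivative (\<Sum>t\<in>T. exp (\<beta> * u \<tau> t) * (\<beta> * u' t))) (at \<tau>)"
    unfolding smz_def using u
    by (intro DERIV_sum DERIV_fun_exp DERIV_cmult) auto
  have "((\<lambda>\<tau>. ln (smz \<beta> T (u \<tau>))) has_real_derivative (1 / smz \<beta> T (u \<tau>)) * (\<Sum>t\<in>T. exp (\<beta> * u \<tau> t) * (\<beta> * u' t))) (at \<tau>)"
    by (rule DERIV_chain2[OF DERIV_ln_divide z]) (rule smz_pos)
  then have "((\<lambda>\<tau>. ln (smz \<beta> T (u \<tau>)) / \<beta>) has_real_derivative (1 / smz \<beta> T (u \<tau>)) * (\<Sum>t\<in>T. exp (\<beta> * u \<tau> t) * (\<beta> * u' t)) / \<beta>) (at \<tau>)"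
    by (rule DERIV_cdivide)
  also have "(1 / smz \<beta> T (u \<tau>)) * (\<Sum>t\<in>T. exp (\<beta> * u \<tau> t) * (\<beta> * u' t)) / \<beta> = (\<Sum>t\<in>T. smp \<beta> T t (u \<tau>) * u' t)"
    unfolding sum_distrib_left sum_divide_distrib smp_def using \<beta> by (intro sum.cong refl) (simp add: field_simps)
  finally show ?thesis by (simp add: smax_def)
qed

lemma isCont_smp:
  assumes u: "\<And>t. t \<in> T \<Longrightarrow> isCont (\<lambda>\<tau>. u \<tau> t) (\<tau>::real)" and s: "s \<in> T"
  shows "isCont (\<lambda>\<tau>. smp \<beta> T s (u \<tau>)) \<tau>"
  unfolding smp_def using u s smz_pos[of "u \<tau>"] unfolding smz_def
  by (intro continuous_intros) auto

lemma isCont_smax: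
  assumes u: "\<And>t. t \<in> T \<Longrightarrow> isCont (\<lambda>\<tau>. u \<tau> t) (\<tau>::real)"
  shows "isCont (\<lambda>\<tau>. smax \<beta> T (u \<tau>)) \<tau>"
  unfolding smax_def using u smz_pos[of "u \<tau>"] \<beta> unfolding smz_def
  by (intro continuous_intros) auto

end

section \<open>Random rotation angles and Gaussian concentration of the soft maximum\<close>

definition unif :: "real \<Rightarrow> real measure" where
  "unif h = uniform_measure lborel {0..h}"

lemma sets_unif [measurable_cong]: "sets (unif h) = sets borel"
  by (simp add: unif_def)

lemma prob_space_unif: "0 < h \<Longrightarrow> prob_space (unif h)"
  unfolding unif_def by (rule prob_space_uniform_measure) auto

text \<open>The fundamental theorem of calculus in averaged form: an increment along an arc becomes
  an expectation over a random angle, to which Jensen, Cauchy-Schwarz and Fubini apply.\<close>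

lemma integral_unif_deriv:
  fixes F F' :: "real \<Rightarrow> real"
  assumes h: "0 < h" and F: "\<And>\<tau>. DERIV F \<tau> :> F' \<tau>" and F': "\<And>\<tau>. isCont F' \<tau>"
  shows "(\<integral>\<tau>. F' \<tau> \<partial>unif h) = (F h - F 0) / h"
proof -
  have [measurable]: "F' \<in> borel_measurable borel"
    using F' by (intro borel_measurable_continuous_onI continuous_at_imp_continuous_on) auto
  have "(\<integral>\<tau>. F' \<tau> \<partial>unif h) = (\<integral>\<tau>. F' \<tau> * indicator {0..h} \<tau> \<partial>lborel) / h"
  proof -
    have "unif h = density lborel (\<lambda>\<tau>. ennreal (indicator {0..h} \<tau> / h))"
      unfolding unif_def uniform_measure_def using h
      by (intro density_cong) (auto simp: divide_ennreal ennreal_indicator[symmetric] simp del: ennreal_indicator split: split_indicator)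
    then show ?thesis
      using h by (simp add: integral_density integral_divide_zero[symmetric] mult.commute del: integral_divide_zero)
  qed
  also have "(\<integral>\<tau>. F' \<tau> * indicator {0..h} \<tau> \<partial>lborel) = F h - F 0"
    using h by (intro integral_FTC_Icc_real F F') auto
  finally show ?thesis .
qed

context gaussian_path_law begin

text \<open>The second component is the derivative of the first in the angle, and at every fixed
  angle the two components are again independent copies.\<close>

abbreviation rot :: "real \<Rightarrow> ('t \<Rightarrow> real) \<times> ('t \<Rightarrow> real) \<Rightarrow> ('t \<Rightarrow> real) \<times> ('t \<Rightarrow> real)" where
  "rot \<tau> p \<equiv> (lin (cos \<tau>) (fst p) (sin \<tau>) (snd p), lin (- sin \<tau>) (fst p) (cos \<tau>) (snd p))"

lemma measurable_rot [measurable]: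
  "(\<lambda>z. rot (snd z) (fst z)) \<in> measurable ((path_space \<Otimes>\<^sub>M path_space) \<Otimes>\<^sub>M borel) (path_space \<Otimes>\<^sub>M path_space)"
proof -
  have [measurable]: "(\<lambda>z. fst (fst z) t) \<in> borel_measurable ((path_space \<Otimes>\<^sub>M path_space) \<Otimes>\<^sub>M borel)"
    "(\<lambda>z. snd (fst z) t) \<in> borel_measurable ((path_space \<Otimes>\<^sub>M path_space) \<Otimes>\<^sub>M borel)" for t
    using measurable_compose[OF measurable_fst measurable_fst_coord] measurable_compose[OF measurable_fst measurable_snd_coord]
    by auto
  show ?thesis by (intro measurable_Pair measurable_into_path_space) measurable
qed

text \<open>The form with nonnegative integrals leaves only measurability to be checked for the
  exchange of angle and copies.\<close>

lemma nn_integral_rot: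
  assumes h: "0 < h" and F[measurable]: "F \<in> borel_measurable (path_space \<Otimes>\<^sub>M path_space)"
  shows "(\<integral>\<^sup>+p. \<integral>\<^sup>+\<tau>. F (rot \<tau> p) \<partial>unif h \<partial>(\<mu> \<Otimes>\<^sub>M \<mu>)) = (\<integral>\<^sup>+p. F p \<partial>(\<mu> \<Otimes>\<^sub>M \<mu>))"
proof -
  interpret U: prob_space "unif h" by (rule prob_space_unif[OF h])
  interpret Q: pair_sigma_finite "\<mu> \<Otimes>\<^sub>M \<mu>" "unif h" ..
  have s: "sets ((\<mu> \<Otimes>\<^sub>M \<mu>) \<Otimes>\<^sub>M unif h) = sets ((path_space \<Otimes>\<^sub>M path_space) \<Otimes>\<^sub>M borel)"
    by (intro sets_pair_measure_cong sets_mu sets_unif)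
  have "(\<lambda>z. F (rot (snd z) (fst z))) \<in> borel_measurable ((path_space \<Otimes>\<^sub>M path_space) \<Otimes>\<^sub>M borel)"
    by (rule measurable_compose[OF measurable_rot F])
  then have m: "(\<lambda>(p, \<tau>). F (rot \<tau> p)) \<in> borel_measurable ((\<mu> \<Otimes>\<^sub>M \<mu>) \<Otimes>\<^sub>M unif h)"
    by (simp add: split_beta measurable_cong_sets[OF s refl])
  have "(\<integral>\<^sup>+p. \<integral>\<^sup>+\<tau>. F (rot \<tau> p) \<partial>unif h \<partial>(\<mu> \<Otimes>\<^sub>M \<mu>)) = (\<integral>\<^sup>+\<tau>. \<integral>\<^sup>+p. F (rot \<tau> p) \<partial>(\<mu> \<Otimes>\<^sub>M \<mu>) \<partial>unif h)"
    by (rule Q.Fubini'[OF m, symmetric])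
  also have "\<dots> = (\<integral>\<^sup>+\<tau>. (\<integral>\<^sup>+p. F p \<partial>(\<mu> \<Otimes>\<^sub>M \<mu>)) \<partial>unif h)"
    by (intro nn_integral_cong nn_integral_orthogonal F) (simp_all add: algebra_simps)
  finally show ?thesis by (simp add: U.emeasure_space_1)
qed

lemma rot_coord_le:
  assumes "finite T" "t \<in> T"
  shows "\<bar>fst (rot \<tau> p) t\<bar> \<le> \<bar>fst p t\<bar> + \<bar>snd p t\<bar>" "\<bar>snd (rot \<tau> p) t\<bar> \<le> \<bar>fst p t\<bar> + \<bar>snd p t\<bar>"
proof -
  have "\<bar>a * u + b * v\<bar> \<le> \<bar>u\<bar> + \<bar>v\<bar>" if "\<bar>a\<bar> \<le> 1" "\<bar>b\<bar> \<le> 1" for a b u v :: real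
  proof -
    have "\<bar>a * u + b * v\<bar> \<le> \<bar>a\<bar> * \<bar>u\<bar> + \<bar>b\<bar> * \<bar>v\<bar>" by (metis abs_mult abs_triangle_ineq)
    also have "\<dots> \<le> 1 * \<bar>u\<bar> + 1 * \<bar>v\<bar>" using that by (intro add_mono mult_right_mono) auto
    finally show ?thesis by simp
  qed
  then show "\<bar>fst (rot \<tau> p) t\<bar> \<le> \<bar>fst p t\<bar> + \<bar>snd p t\<bar>" "\<bar>snd (rot \<tau> p) t\<bar> \<le> \<bar>fst p t\<bar> + \<bar>snd p t\<bar>"
    by (simp_all only: fst_conv snd_conv abs_cos_le_one abs_sin_le_one abs_minus_cancel)
qed

lemma rot_deriv: "((\<lambda>\<tau>. fst (rot \<tau> p) t) has_real_derivative snd (rot \<tau> p) t) (at \<tau>)"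
  by (auto intro!: derivative_eq_intros)

lemma rot_isCont: "isCont (\<lambda>\<tau>. fst (rot \<tau> p) t) \<tau>" "isCont (\<lambda>\<tau>. snd (rot \<tau> p) t) \<tau>"
  by (auto intro!: continuous_intros)

context
  fixes T :: "'t set" and \<beta> :: real
  assumes T: "finite T" "T \<noteq> {}" and \<beta>: "0 < \<beta>"
begin

text \<open>Differentiating along the quarter circle from \<open>x\<close> to \<open>y\<close> (Maurey and Pisier) and using
  convexity of \<open>exp\<close> reduces the claim to the exponential moments of single coordinates.\<close>

lemma smax_pair_exp:
  "(\<integral>p. exp (l * (smax \<beta> T (snd p) - smax \<beta> T (fst p))) \<partial>(\<mu> \<Otimes>\<^sub>M \<mu>)) \<le> exp (l\<^sup>2 * pi\<^sup>2 / 8)"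
proof -
  define h where "h = pi / 2"
  have h: "0 < h" by (simp add: h_def)
  interpret U: prob_space "unif h" by (rule prob_space_unif[OF h])
  \<comment> \<open>\<open>G\<close> dominates the exponential of \<open>l * h\<close> times the
    angular derivative of \<open>smax\<close>, by convexity with the weights \<open>smp\<close>. The
    copies are independent and the weights sum to 1, so the mean of \<open>G\<close> is one
    coordinate moment, with exponent (l h)^2 / 2 for the quarter circle
    \<open>h = pi / 2\<close>.\<close>
  define G where "G p = (\<Sum>t\<in>T. smp \<beta> T t (fst p) * exp ((l * h) * snd p t))" for p :: "('t \<Rightarrow> real) \<times> ('t \<Rightarrow> real)"
  have ex: "edom T (\<lambda>x. exp ((l * h) * x t))" if t: "t \<in> T" for t
  proof (rule edomI[where C = 1 and k = "\<bar>l * h\<bar>"])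
    fix x :: "'t \<Rightarrow> real"
    have "\<bar>x t\<bar> \<le> (\<Sum>t\<in>T. \<bar>x t\<bar>)" using T t by (intro member_le_sum) auto
    then have "\<bar>l * h\<bar> * \<bar>x t\<bar> \<le> \<bar>l * h\<bar> * (\<Sum>t\<in>T. \<bar>x t\<bar>)" by (rule mult_left_mono) simp
    moreover have "(l * h) * x t \<le> \<bar>l * h\<bar> * \<bar>x t\<bar>" by (metis abs_ge_self abs_mult)
    ultimately show "\<bar>exp ((l * h) * x t)\<bar> \<le> 1 * exp (\<bar>l * h\<bar> * (\<Sum>t\<in>T. \<bar>x t\<bar>))" by simp
  qed auto
  have e2: "edom2 T (\<lambda>p. smp \<beta> T t (fst p) * exp ((l * h) * snd p t))" if "t \<in> T" for t
    using edom2_mult[OF edom2_fst[OF edom_smp[OF T \<beta> that]] edom2_snd[OF ex[OF that]]] .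
  have i2: "integrable (\<mu> \<Otimes>\<^sub>M \<mu>) (\<lambda>p. smp \<beta> T t (fst p) * exp ((l * h) * snd p t))" if "t \<in> T" for t
    by (rule integrable_edom2[OF T(1) e2[OF that]])
  have G_int: "integrable (\<mu> \<Otimes>\<^sub>M \<mu>) G"
    unfolding G_def by (intro Bochner_Integration.integrable_sum i2)
  have G0: "0 \<le> G p" for p
    unfolding G_def using smp_nonneg[OF T \<beta>] by (intro sum_nonneg) auto
  have G_meas[measurable]: "G \<in> borel_measurable (path_space \<Otimes>\<^sub>M path_space)"
    unfolding G_def by measurable
  have "(\<integral>p. G p \<partial>(\<mu> \<Otimes>\<^sub>M \<mu>)) = (\<Sum>t\<in>T. \<integral>p. smp \<beta> T t (fst p) * exp ((l * h) * snd p t) \<partial>(\<mu> \<Otimes>\<^sub>M \<mu>))"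
    unfolding G_def by (rule Bochner_Integration.integral_sum[OF i2])
  also have "\<dots> = (\<Sum>t\<in>T. (\<integral>x. smp \<beta> T t x \<partial>\<mu>) * exp ((l * h)\<^sup>2 / 2))"
    using exp_moment[of "l * h"] by (intro sum.cong refl) (subst integral_fst_edom2[OF T(1) e2], auto simp: has_bochner_integral_iff)
  also have "\<dots> = (\<integral>x. (\<Sum>t\<in>T. smp \<beta> T t x) \<partial>\<mu>) * exp ((l * h)\<^sup>2 / 2)"
    by (subst Bochner_Integration.integral_sum) (auto intro!: integrable_edom[OF T(1)] edom_smp T \<beta> simp: sum_distrib_right)
  also have "\<dots> = exp (l\<^sup>2 * pi\<^sup>2 / 8)"
    by (simp add: smp_sum[OF T \<beta>] prob_space h_def power_mult_distrib power_divide)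
  finally have G_val: "(\<integral>p. G p \<partial>(\<mu> \<Otimes>\<^sub>M \<mu>)) = exp (l\<^sup>2 * pi\<^sup>2 / 8)" .
  have G_rot: "exp (l * (smax \<beta> T (snd p) - smax \<beta> T (fst p))) \<le> (\<integral>\<tau>. G (rot \<tau> p) \<partial>unif h)"
    and G_rot_int: "integrable (unif h) (\<lambda>\<tau>. G (rot \<tau> p))" for p
  proof -
    define a where "a = l * (smax \<beta> T (snd p) - smax \<beta> T (fst p))"
    define \<psi> where "\<psi> \<tau> = (\<Sum>t\<in>T. smp \<beta> T t (fst (rot \<tau> p)) * snd (rot \<tau> p) t)" for \<tau>
    have cont: "isCont \<psi> \<tau>" for \<tau>
      unfolding \<psi>_def by (intro continuous_intros isCont_smp T \<beta> rot_isCont)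
    have "(\<integral>\<tau>. \<psi> \<tau> \<partial>unif h) = (smax \<beta> T (fst (rot h p)) - smax \<beta> T (fst (rot 0 p))) / h"
    proof (rule integral_unif_deriv[OF h _ cont])
      show "((\<lambda>\<tau>. smax \<beta> T (fst (rot \<tau> p))) has_real_derivative \<psi> \<tau>) (at \<tau>)" for \<tau>
        unfolding \<psi>_def by (rule smax_deriv[OF T \<beta> rot_deriv])
    qed
    then have \<psi>_int: "l * h * (\<integral>\<tau>. \<psi> \<tau> \<partial>unif h) = a"
      using h by (simp add: a_def h_def)
    have "continuous_on UNIV \<psi>" using cont by (simp add: continuous_on_eq_continuous_at)
    then have [measurable]: "\<psi> \<in> borel_measurable borel" by (rule borel_measurable_continuous_onI)
    have "isCont (\<lambda>\<tau>. G (rot \<tau> p)) \<tau>" for \<tau>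
      unfolding G_def by (intro continuous_intros isCont_smp[OF T \<beta> rot_isCont(1)] rot_isCont(2))
    then have "continuous_on UNIV (\<lambda>\<tau>. G (rot \<tau> p))" by (simp add: continuous_on_eq_continuous_at)
    then have Gm: "(\<lambda>\<tau>. G (rot \<tau> p)) \<in> borel_measurable borel" by (rule borel_measurable_continuous_onI)
    define B where "B = (\<Sum>t\<in>T. \<bar>fst p t\<bar> + \<bar>snd p t\<bar>)"
    have r_le: "\<bar>snd (rot \<tau> p) t\<bar> \<le> B" if "t \<in> T" for t \<tau>
    proof -
      have "\<bar>fst p t\<bar> + \<bar>snd p t\<bar> \<le> B" unfolding B_def using T that by (intro member_le_sum) auto
      then show ?thesis using rot_coord_le(2)[OF T(1) that, of \<tau> p] by linarith
    qed
    have "\<bar>\<psi> \<tau>\<bar> \<le> B" for \<tau>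
    proof -
      have "\<bar>\<psi> \<tau>\<bar> \<le> (\<Sum>t\<in>T. \<bar>smp \<beta> T t (fst (rot \<tau> p)) * snd (rot \<tau> p) t\<bar>)"
        unfolding \<psi>_def by (rule sum_abs)
      also have "\<dots> \<le> (\<Sum>t\<in>T. smp \<beta> T t (fst (rot \<tau> p)) * B)"
        unfolding abs_mult using smp_nonneg[OF T \<beta>] by (intro sum_mono mult_mono r_le) auto
      finally show ?thesis by (simp add: sum_distrib_right[symmetric] smp_sum[OF T \<beta>])
    qed
    then have ip: "integrable (unif h) \<psi>"
      by (intro U.integrable_const_bound[where B = B]) (auto simp: measurable_cong_sets[OF sets_unif refl])
    show iG: "integrable (unif h) (\<lambda>\<tau>. G (rot \<tau> p))"
    proof (rule U.integrable_const_bound[where B = "exp (\<bar>l * h\<bar> * B)"])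
      have "G (rot \<tau> p) \<le> (\<Sum>t\<in>T. smp \<beta> T t (fst (rot \<tau> p)) * exp (\<bar>l * h\<bar> * B))" for \<tau>
        unfolding G_def
      proof (intro sum_mono mult_left_mono)
        fix t assume t: "t \<in> T"
        have "(l * h) * snd (rot \<tau> p) t \<le> \<bar>l * h\<bar> * \<bar>snd (rot \<tau> p) t\<bar>" unfolding abs_mult[symmetric] by (rule abs_ge_self)
        also have "\<dots> \<le> \<bar>l * h\<bar> * B" using r_le[OF t] by (intro mult_left_mono) auto
        finally show "exp ((l * h) * snd (rot \<tau> p) t) \<le> exp (\<bar>l * h\<bar> * B)" by simp
      qed (rule smp_nonneg[OF T \<beta>])
      then show "AE \<tau> in unif h. norm (G (rot \<tau> p)) \<le> exp (\<bar>l * h\<bar> * B)"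
        using G0 by (simp add: sum_distrib_right[symmetric] smp_sum[OF T \<beta>])
    qed (simp only: measurable_cong_sets[OF sets_unif refl] Gm)
    \<comment> \<open>The tangent line of \<open>exp\<close> at \<open>a\<close>. The mean of
      \<open>l * h * \<psi> \<tau>\<close> over the angle is exactly \<open>a\<close>, so averaging
      this bound is Jensen's inequality in the angle and over the weights at once.\<close>
    have tangent: "exp a * (1 - a + l * h * \<psi> \<tau>) \<le> G (rot \<tau> p)" for \<tau>
    proof -
      have "exp a * (1 - a + l * h * \<psi> \<tau>) = (\<Sum>t\<in>T. smp \<beta> T t (fst (rot \<tau> p)) * (exp a * (1 + ((l * h) * snd (rot \<tau> p) t - a))))"
      proof -
        have "(\<Sum>t\<in>T. smp \<beta> T t (fst (rot \<tau> p)) * (exp a * (1 + ((l * h) * snd (rot \<tau> p) t - a)))) =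
          exp a * (1 - a) * (\<Sum>t\<in>T. smp \<beta> T t (fst (rot \<tau> p))) + exp a * (l * h) * \<psi> \<tau>"
          unfolding \<psi>_def sum_distrib_left sum.distrib[symmetric] by (intro sum.cong refl) (simp add: algebra_simps)
        then show ?thesis unfolding smp_sum[OF T \<beta>] by (simp add: algebra_simps)
      qed
      also have "\<dots> \<le> G (rot \<tau> p)"
        unfolding G_def
      proof (intro sum_mono mult_left_mono smp_nonneg[OF T \<beta>])
        fix t
        have "exp a * (1 + ((l * h) * snd (rot \<tau> p) t - a)) \<le> exp a * exp ((l * h) * snd (rot \<tau> p) t - a)"
          by (intro mult_left_mono exp_ge_add_one_self) auto
        then show "exp a * (1 + ((l * h) * snd (rot \<tau> p) t - a)) \<le> exp ((l * h) * snd (rot \<tau> p) t)"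
          by (simp add: exp_add[symmetric])
      qed
      finally show ?thesis .
    qed
    have "exp a = (\<integral>\<tau>. exp a * (1 - a + l * h * \<psi> \<tau>) \<partial>unif h)"
      using ip \<psi>_int by (simp add: U.prob_space)
    also have "\<dots> \<le> (\<integral>\<tau>. G (rot \<tau> p) \<partial>unif h)"
      using ip iG tangent by (intro integral_mono) auto
    finally show "exp (l * (smax \<beta> T (snd p) - smax \<beta> T (fst p))) \<le> (\<integral>\<tau>. G (rot \<tau> p) \<partial>unif h)"
      by (simp add: a_def)
  qed
  have "ennreal (\<integral>p. exp (l * (smax \<beta> T (snd p) - smax \<beta> T (fst p))) \<partial>(\<mu> \<Otimes>\<^sub>M \<mu>)) = (\<integral>\<^sup>+p. ennreal (exp (l * (smax \<beta> T (snd p) - smax \<beta> T (fst p)))) \<partial>(\<mu> \<Otimes>\<^sub>M \<mu>))"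
  proof (rule nn_integral_eq_integral[symmetric])
    have "integrable (\<mu> \<Otimes>\<^sub>M \<mu>) (\<lambda>p. exp (- l * smax \<beta> T (fst p)) * exp (l * smax \<beta> T (snd p)))"
      by (intro integrable_edom2[OF T(1)] edom2_mult edom2_fst edom2_snd edom_exp_smax T \<beta>)
    then show "integrable (\<mu> \<Otimes>\<^sub>M \<mu>) (\<lambda>p. exp (l * (smax \<beta> T (snd p) - smax \<beta> T (fst p))))"
      by (simp add: exp_add[symmetric] algebra_simps)
  qed simp
  also have "\<dots> \<le> (\<integral>\<^sup>+p. \<integral>\<^sup>+\<tau>. ennreal (G (rot \<tau> p)) \<partial>unif h \<partial>(\<mu> \<Otimes>\<^sub>M \<mu>))"
    using G_rot G_rot_int G0 by (intro nn_integral_mono) (simp add: nn_integral_eq_integral)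
  also have "\<dots> = (\<integral>\<^sup>+p. ennreal (G p) \<partial>(\<mu> \<Otimes>\<^sub>M \<mu>))"
    by (rule nn_integral_rot[OF h]) simp
  also have "\<dots> = ennreal (exp (l\<^sup>2 * pi\<^sup>2 / 8))"
    using G_int G0 G_val by (simp add: nn_integral_eq_integral)
  finally show ?thesis by simp
qed

text \<open>Jensen's inequality replaces the mean by an independent copy, which leaves the pair
  estimate. The constant \<open>pi^2 / 8\<close> exceeds the optimal 1/2 but affects only numerical
  factors later.\<close>

lemma smax_exp_concentration:
  "(\<integral>x. exp (l * (smax \<beta> T x - (\<integral>y. smax \<beta> T y \<partial>\<mu>))) \<partial>\<mu>) \<le> exp (l\<^sup>2 * pi\<^sup>2 / 8)"
proof -
  define m where "m = (\<integral>y. smax \<beta> T y \<partial>\<mu>)"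
  have i: "integrable \<mu> (smax \<beta> T)" "integrable \<mu> (\<lambda>x. exp (k * smax \<beta> T x))" for k
    by (intro integrable_edom[OF T(1)] edom_smax edom_exp_smax T \<beta>)+
  have "exp (- l * m) = (\<integral>x. exp (- l * m) * (1 + (- l * smax \<beta> T x + l * m)) \<partial>\<mu>)"
    using i(1) by (simp add: prob_space m_def)
  also have "\<dots> \<le> (\<integral>x. exp (- l * smax \<beta> T x) \<partial>\<mu>)"
  proof (rule integral_mono)
    show "integrable \<mu> (\<lambda>x. exp (- l * m) * (1 + (- l * smax \<beta> T x + l * m)))" using i(1) by simp
    show "integrable \<mu> (\<lambda>x. exp (- l * smax \<beta> T x))" by (rule i(2))
    fix x
    have "exp (- l * m) * (1 + (- l * smax \<beta> T x + l * m)) \<le> exp (- l * m) * exp (- l * smax \<beta> T x + l * m)"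
      by (intro mult_left_mono exp_ge_add_one_self) auto
    then show "exp (- l * m) * (1 + (- l * smax \<beta> T x + l * m)) \<le> exp (- l * smax \<beta> T x)"
      by (simp add: exp_add[symmetric])
  qed
  finally have J: "exp (- l * m) \<le> (\<integral>x. exp (- l * smax \<beta> T x) \<partial>\<mu>)" .
  have "(\<integral>x. exp (l * (smax \<beta> T x - m)) \<partial>\<mu>) = exp (- l * m) * (\<integral>x. exp (l * smax \<beta> T x) \<partial>\<mu>)"
    by (simp add: exp_add[symmetric] algebra_simps flip: integral_mult_right_zero)
  also have "\<dots> \<le> (\<integral>x. exp (- l * smax \<beta> T x) \<partial>\<mu>) * (\<integral>x. exp (l * smax \<beta> T x) \<partial>\<mu>)"
    using J by (intro mult_right_mono) auto
  also have "\<dots> = (\<integral>p. exp (- l * smax \<beta> T (fst p)) * exp (l * smax \<beta> T (snd p)) \<partial>(\<mu> \<Otimes>\<^sub>M \<mu>))"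
    by (subst integral_fst_edom2[OF T(1) edom2_mult[OF edom2_fst[OF edom_exp_smax[OF T \<beta>, of "- l"]] edom2_snd[OF edom_exp_smax[OF T \<beta>, of l]]]]) simp
  also have "\<dots> = (\<integral>p. exp (l * (smax \<beta> T (snd p) - smax \<beta> T (fst p))) \<partial>(\<mu> \<Otimes>\<^sub>M \<mu>))"
    by (simp add: exp_add[symmetric] algebra_simps)
  also have "\<dots> \<le> exp (l\<^sup>2 * pi\<^sup>2 / 8)" by (rule smax_pair_exp)
  finally show ?thesis by (simp add: m_def)
qed

end

end

section \<open>The Dirichlet energy and the increments of the correlation function\<close>

lemma edom2_add:
  fixes F G :: "('t \<Rightarrow> real) \<times> ('t \<Rightarrow> real) \<Rightarrow> real"
  assumes F: "edom2 T F" and G: "edom2 T G"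
  shows "edom2 T (\<lambda>p. F p + G p)"
proof -
  let ?S = "\<lambda>x. (\<Sum>t\<in>T. \<bar>x t\<bar>) :: real"
  let ?E = "\<lambda>k x y. exp (k * ?S x) * exp (k * ?S y) :: real"
  obtain C k where 1: "0 \<le> C" "0 \<le> k" "\<And>x y. \<bar>F (x, y)\<bar> \<le> C * ?E k x y"
    using F unfolding edom2_def by blast
  obtain D l where 2: "0 \<le> D" "0 \<le> l" "\<And>x y. \<bar>G (x, y)\<bar> \<le> D * ?E l x y"
    using G unfolding edom2_def by blast
  note [measurable] = edom2_measurable[OF F] edom2_measurable[OF G]
  have S0: "0 \<le> ?S x" for x by (simp add: sum_nonneg)
  have "\<bar>F (x, y) + G (x, y)\<bar> \<le> (C + D) * ?E (k + l) x y" for x y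
  proof -
    have "?E k x y \<le> ?E (k + l) x y" "?E l x y \<le> ?E (k + l) x y"
      using 1(2) 2(2) S0 by (auto intro!: mult_mono mult_right_mono)
    then have "C * ?E k x y + D * ?E l x y \<le> (C + D) * ?E (k + l) x y"
      unfolding distrib_right using 1 2 by (intro add_mono mult_left_mono) auto
    then show ?thesis using 1(3)[of x y] 2(3)[of x y] by linarith
  qed
  moreover have "(\<lambda>p. F p + G p) \<in> borel_measurable (path_space \<Otimes>\<^sub>M path_space)" by measurable
  ultimately show ?thesis
    using 1 2 unfolding edom2_def by (intro conjI exI[of _ "C + D"] exI[of _ "k + l"]) auto
qed

lemma edom2_const: "edom2 T (\<lambda>p. c)"
  unfolding edom2_def by (intro conjI exI[of _ "\<bar>c\<bar>"] exI[of _ 0]) auto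

lemma edom2_diff:
  fixes F G :: "('t \<Rightarrow> real) \<times> ('t \<Rightarrow> real) \<Rightarrow> real"
  assumes F: "edom2 T F" and G: "edom2 T G"
  shows "edom2 T (\<lambda>p. F p - G p)"
  using edom2_add[OF F edom2_mult[OF edom2_const G], of "- 1"] by simp

lemma edom2_sum:
  fixes F :: "'i \<Rightarrow> ('t \<Rightarrow> real) \<times> ('t \<Rightarrow> real) \<Rightarrow> real"
  assumes "\<And>i. i \<in> A \<Longrightarrow> edom2 T (F i)"
  shows "edom2 T (\<lambda>p. \<Sum>i\<in>A. F i p)"
  using assms by (induction A rule: infinite_finite_induct) (simp_all add: edom2_const edom2_add)

context gaussian_path_law begin

text \<open>Expanding the square and integrating the second copy leaves its covariances; this is how
  the weights \<open>\<Gamma> s t\<close> enter the energy.\<close>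

lemma integral_linear_sq:
  assumes T: "finite T" and v: "\<And>t. t \<in> T \<Longrightarrow> edom T (v t)"
  shows "edom2 T (\<lambda>p. (\<Sum>t\<in>T. v t (fst p) * snd p t)\<^sup>2)"
    and "(\<integral>p. (\<Sum>t\<in>T. v t (fst p) * snd p t)\<^sup>2 \<partial>(\<mu> \<Otimes>\<^sub>M \<mu>)) = (\<Sum>s\<in>T. \<Sum>t\<in>T. \<Gamma> s t * (\<integral>x. v s x * v t x \<partial>\<mu>))"
proof -
  have e: "edom2 T (\<lambda>p. (v s (fst p) * v t (fst p)) * (snd p s * snd p t))" if "s \<in> T" "t \<in> T" for s t
    using edom2_mult[OF edom2_fst[OF edom_mult[OF v[OF that(1)] v[OF that(2)]]] edom2_snd[OF edom_mult[OF edom_coord[OF T that(1)] edom_coord[OF T that(2)]]]] .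
  have expand: "(\<Sum>t\<in>T. v t (fst p) * snd p t)\<^sup>2 = (\<Sum>s\<in>T. \<Sum>t\<in>T. (v s (fst p) * v t (fst p)) * (snd p s * snd p t))" for p
    unfolding power2_eq_square sum_product by (intro sum.cong refl) (simp add: mult_ac)
  have i: "integrable (\<mu> \<Otimes>\<^sub>M \<mu>) (\<lambda>p. (v s (fst p) * v t (fst p)) * (snd p s * snd p t))" if "s \<in> T" "t \<in> T" for s t
    by (rule integrable_edom2[OF T e[OF that]])
  have one: "(\<integral>p. (v s (fst p) * v t (fst p)) * (snd p s * snd p t) \<partial>(\<mu> \<Otimes>\<^sub>M \<mu>)) = \<Gamma> s t * (\<integral>x. v s x * v t x \<partial>\<mu>)"
    if "s \<in> T" "t \<in> T" for s t
    by (subst integral_fst_edom2[OF T e[OF that]]) (simp add: cov)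
  show "(\<integral>p. (\<Sum>t\<in>T. v t (fst p) * snd p t)\<^sup>2 \<partial>(\<mu> \<Otimes>\<^sub>M \<mu>)) = (\<Sum>s\<in>T. \<Sum>t\<in>T. \<Gamma> s t * (\<integral>x. v s x * v t x \<partial>\<mu>))"
    unfolding expand using i one by (simp add: Bochner_Integration.integral_sum)
  have "edom2 T (\<lambda>p. \<Sum>t\<in>T. v t (fst p) * snd p t)"
  proof (rule edom2_sum)
    fix t assume t: "t \<in> T"
    show "edom2 T (\<lambda>p. v t (fst p) * snd p t)"
      by (rule edom2_mult[OF edom2_fst[OF v[OF t]] edom2_snd[OF edom_coord[OF T t]]])
  qed
  from edom2_mult[OF this this] show "edom2 T (\<lambda>p. (\<Sum>t\<in>T. v t (fst p) * snd p t)\<^sup>2)"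
    unfolding power2_eq_square .
qed

text \<open>A bound uniform in the angle, for exchanging the average over angles with the integral
  over the noise \<open>w\<close>.\<close>

lemma edom_rot_bound:
  assumes T: "finite T" and g: "edom T g" and r: "\<bar>r\<bar> \<le> 1" and q: "\<bar>q\<bar> \<le> 1"
  obtains B k where "0 \<le> B" "0 \<le> k" "\<And>\<tau> w. \<bar>g (lin r (fst (rot \<tau> p)) q w)\<bar> \<le> B * exp (k * (\<Sum>t\<in>T. \<bar>w t\<bar>))"
proof -
  obtain C k where 1: "0 \<le> C" "0 \<le> k" "\<And>x. \<bar>g x\<bar> \<le> C * exp (k * (\<Sum>t\<in>T. \<bar>x t\<bar>))"
    using g unfolding edom_def by blast
  define b where "b = (\<Sum>t\<in>T. \<bar>fst p t\<bar> + \<bar>snd p t\<bar>)"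
  have "\<bar>g (lin r (fst (rot \<tau> p)) q w)\<bar> \<le> (C * exp (k * b)) * exp (k * (\<Sum>t\<in>T. \<bar>w t\<bar>))" for \<tau> w
  proof -
    have "(\<Sum>t\<in>T. \<bar>lin r (fst (rot \<tau> p)) q w t\<bar>) \<le> (\<Sum>t\<in>T. (\<bar>fst p t\<bar> + \<bar>snd p t\<bar>) + \<bar>w t\<bar>)"
    proof (rule sum_mono)
      fix t assume t: "t \<in> T"
      have "\<bar>lin r (fst (rot \<tau> p)) q w t\<bar> \<le> \<bar>r\<bar> * \<bar>fst (rot \<tau> p) t\<bar> + \<bar>q\<bar> * \<bar>w t\<bar>"
        unfolding abs_mult[symmetric] by (rule abs_triangle_ineq)
      also have "\<dots> \<le> 1 * \<bar>fst (rot \<tau> p) t\<bar> + 1 * \<bar>w t\<bar>"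
        using r q by (intro add_mono mult_right_mono) auto
      also have "\<dots> \<le> (\<bar>fst p t\<bar> + \<bar>snd p t\<bar>) + \<bar>w t\<bar>"
        using rot_coord_le(1)[OF T t, of \<tau> p] by simp
      finally show "\<bar>lin r (fst (rot \<tau> p)) q w t\<bar> \<le> (\<bar>fst p t\<bar> + \<bar>snd p t\<bar>) + \<bar>w t\<bar>" .
    qed
    then have "k * (\<Sum>t\<in>T. \<bar>lin r (fst (rot \<tau> p)) q w t\<bar>) \<le> k * b + k * (\<Sum>t\<in>T. \<bar>w t\<bar>)"
      using 1(2) by (simp add: sum.distrib b_def distrib_left[symmetric] mult_left_mono)
    then have "C * exp (k * (\<Sum>t\<in>T. \<bar>lin r (fst (rot \<tau> p)) q w t\<bar>)) \<le> C * exp (k * b + k * (\<Sum>t\<in>T. \<bar>w t\<bar>))"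
      using 1(1) by (intro mult_left_mono) auto
    then show ?thesis using 1(3)[of "lin r (fst (rot \<tau> p)) q w"] unfolding exp_add by linarith
  qed
  then show thesis using that[of "C * exp (k * b)" k] 1 by simp
qed

lemma edom_rot_bounded:
  assumes T: "finite T" and g: "edom T g"
  shows "\<exists>C. \<forall>\<tau>. \<bar>g (fst (rot \<tau> p))\<bar> \<le> C"
proof -
  obtain B k where B: "0 \<le> B" "0 \<le> k" "\<And>\<tau> w. \<bar>g (lin 1 (fst (rot \<tau> p)) 0 w)\<bar> \<le> B * exp (k * (\<Sum>t\<in>T. \<bar>w t\<bar>))"
    by (rule edom_rot_bound[OF T g, of 1 0 p]) simp_all
  have e: "lin 1 x 0 (\<lambda>_. 0) = x" for x by simp
  have "\<bar>g (fst (rot \<tau> p))\<bar> \<le> B" for \<tau>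
    using B(3)[of \<tau> "\<lambda>_. 0"] unfolding e by simp
  then show ?thesis by blast
qed

context
  fixes T :: "'t set" and \<beta> :: real
  assumes T: "finite T" "T \<noteq> {}" and \<beta>: "0 < \<beta>"
begin

definition tilt :: "real \<Rightarrow> ('t \<Rightarrow> real) \<Rightarrow> real" where
  "tilt k x = exp (k * smax \<beta> T x)"

text \<open>Up to the factor \<open>k\<close> the function \<open>wt k t\<close> is the derivative of \<open>tilt k\<close> in direction \<open>t\<close>.\<close>

definition wt :: "real \<Rightarrow> 't \<Rightarrow> ('t \<Rightarrow> real) \<Rightarrow> real" where
  "wt k t x = tilt k x * smp \<beta> T t x"

lemma edom_tilt: "edom T (tilt k)"
  unfolding tilt_def by (rule edom_exp_smax[OF T \<beta>])

lemma edom_wt: "t \<in> T \<Longrightarrow> edom T (wt k t)"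
  unfolding wt_def by (intro edom_mult edom_tilt edom_smp T \<beta>)

lemma tilt_pos: "0 < tilt k x" by (simp add: tilt_def)

lemma wt_nonneg: "0 \<le> wt k t x"
  unfolding wt_def using tilt_pos[of k x] smp_nonneg[OF T \<beta>] by (intro mult_nonneg_nonneg) auto

lemma sum_wt: "(\<Sum>t\<in>T. wt k t x) = tilt k x"
  unfolding wt_def sum_distrib_left[symmetric] smp_sum[OF T \<beta>] by simp

text \<open>For frozen noise \<open>w\<close> the fundamental theorem is applied to
  \<open>tilt k\<close> along the rotating argument, whose angular derivative carries the factor
  \<open>r\<close>; then the integrals over angle and noise are exchanged. In this way no derivative
  of \<open>OU r (tilt k)\<close> itself is taken.\<close>

lemma OU_tilt_diff:
  assumes r: "0 \<le> r" "r \<le> 1" and h: "0 < h"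
  shows "OU r (tilt k) (fst (rot h p)) - OU r (tilt k) (fst p)
    = h * (k * r) * (\<integral>\<tau>. (\<Sum>t\<in>T. OU r (wt k t) (fst (rot \<tau> p)) * snd (rot \<tau> p) t) \<partial>unif h)"
    and "integrable (unif h) (\<lambda>\<tau>. (\<Sum>t\<in>T. OU r (wt k t) (fst (rot \<tau> p)) * snd (rot \<tau> p) t)\<^sup>2)"
proof -
  interpret U: prob_space "unif h" by (rule prob_space_unif[OF h])
  interpret Q: pair_sigma_finite \<mu> "unif h" ..
  define q where "q = sqrt (1 - r\<^sup>2)"
  have r2: "r\<^sup>2 \<le> 1" using r by (simp add: power_le_one)
  have ar: "\<bar>r\<bar> \<le> 1" "\<bar>q\<bar> \<le> 1" using r r2 by (auto simp: q_def)
  have mr: "(\<lambda>z. lin r (fst (rot (snd z) p)) q (fst z)) \<in> measurable (path_space \<Otimes>\<^sub>M borel) path_space"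
  proof (rule measurable_into_path_space)
    have [measurable]: "(\<lambda>z. fst z t) \<in> borel_measurable (path_space \<Otimes>\<^sub>M borel)" for t by simp
    show "(\<lambda>z. lin r (fst (rot (snd z) p)) q (fst z) t) \<in> borel_measurable (path_space \<Otimes>\<^sub>M borel)" for t
      unfolding fst_conv by measurable
  qed
  have s: "sets (\<mu> \<Otimes>\<^sub>M unif h) = sets (path_space \<Otimes>\<^sub>M borel)"
    by (intro sets_pair_measure_cong sets_mu sets_unif)
  define B where "B = (\<Sum>t\<in>T. \<bar>fst p t\<bar> + \<bar>snd p t\<bar>)"
  have r_le: "\<bar>snd (rot \<tau> p) t\<bar> \<le> B" if "t \<in> T" for t \<tau>
  proof -
    have "\<bar>fst p t\<bar> + \<bar>snd p t\<bar> \<le> B" unfolding B_def using T that by (intro member_le_sum) auto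
    then show ?thesis using rot_coord_le(2)[OF T(1) that, of \<tau> p] by linarith
  qed
  have B0: "0 \<le> B" unfolding B_def by (intro sum_nonneg) auto
  let ?\<phi> = "\<lambda>t w \<tau>. wt k t (lin r (fst (rot \<tau> p)) q w) * snd (rot \<tau> p) t"
  define \<Phi> where "\<Phi> w \<tau> = (\<Sum>t\<in>T. ?\<phi> t w \<tau>)" for w \<tau>
  have \<phi>_int: "integrable (\<mu> \<Otimes>\<^sub>M unif h) (\<lambda>z. ?\<phi> t (fst z) (snd z))" if t: "t \<in> T" for t
  proof -
    obtain C l where C: "0 \<le> C" "0 \<le> l" "\<And>\<tau> w. \<bar>wt k t (lin r (fst (rot \<tau> p)) q w)\<bar> \<le> C * exp (l * (\<Sum>t\<in>T. \<bar>w t\<bar>))"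
      using edom_rot_bound[OF T(1) edom_wt[OF t, of k] ar, where p = p] by blast
    have iE: "integrable (\<mu> \<Otimes>\<^sub>M unif h) (\<lambda>z. C * B * exp (l * (\<Sum>t\<in>T. \<bar>fst z t\<bar>)))"
    proof (rule Q.Fubini_integrable)
      show "(\<lambda>z. C * B * exp (l * (\<Sum>t\<in>T. \<bar>fst z t\<bar>))) \<in> borel_measurable (\<mu> \<Otimes>\<^sub>M unif h)"
        unfolding measurable_cong_sets[OF s refl] by measurable
      show "integrable \<mu> (\<lambda>x. \<integral>y. norm (C * B * exp (l * (\<Sum>t\<in>T. \<bar>fst (x, y) t\<bar>))) \<partial>unif h)"
        using integrable_exp_abs[OF T(1) C(2)] by (simp add: U.prob_space abs_mult)
      show "AE x in \<mu>. integrable (unif h) (\<lambda>y. C * B * exp (l * (\<Sum>t\<in>T. \<bar>fst (x, y) t\<bar>)))"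
        by simp
    qed
    show ?thesis
    proof (rule Bochner_Integration.integrable_bound[OF iE])
      have 1: "(\<lambda>z. wt k t (lin r (fst (rot (snd z) p)) q (fst z))) \<in> borel_measurable (path_space \<Otimes>\<^sub>M borel)"
        by (rule measurable_compose[OF mr edom_measurable[OF edom_wt[OF t]]])
      have 2: "(\<lambda>z. snd (rot (snd z) p) t) \<in> borel_measurable (path_space \<Otimes>\<^sub>M borel)"
        unfolding snd_conv by measurable
      show "(\<lambda>z. ?\<phi> t (fst z) (snd z)) \<in> borel_measurable (\<mu> \<Otimes>\<^sub>M unif h)"
        unfolding measurable_cong_sets[OF s refl] by (rule borel_measurable_times[OF 1 2])
      have le: "\<bar>?\<phi> t w \<tau>\<bar> \<le> (C * exp (l * (\<Sum>t\<in>T. \<bar>w t\<bar>))) * B" for w \<tau>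
        unfolding abs_mult using C(1) by (intro mult_mono C(3) r_le t) auto
      show "AE z in \<mu> \<Otimes>\<^sub>M unif h. norm (?\<phi> t (fst z) (snd z)) \<le> norm (C * B * exp (l * (\<Sum>t\<in>T. \<bar>fst z t\<bar>)))"
      proof (intro AE_I2)
        fix z :: "('t \<Rightarrow> real) \<times> real"
        have "\<bar>?\<phi> t (fst z) (snd z)\<bar> \<le> C * B * exp (l * (\<Sum>t\<in>T. \<bar>fst z t\<bar>))"
        proof -
          have "C * exp (l * (\<Sum>t\<in>T. \<bar>fst z t\<bar>)) * B = C * B * exp (l * (\<Sum>t\<in>T. \<bar>fst z t\<bar>))" by simp
          with le[of "snd z" "fst z"] show ?thesis by (rule ord_le_eq_trans)
        qed
        then show "norm (?\<phi> t (fst z) (snd z)) \<le> norm (C * B * exp (l * (\<Sum>t\<in>T. \<bar>fst z t\<bar>)))"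
          unfolding real_norm_def by (rule order_trans[OF _ abs_ge_self])
      qed
    qed
  qed
  then have \<Phi>_int: "integrable (\<mu> \<Otimes>\<^sub>M unif h) (case_prod \<Phi>)"
    unfolding \<Phi>_def split_beta by (rule Bochner_Integration.integrable_sum)
  have edw: "edom T (\<lambda>w. tilt k (lin r y q w))" "t \<in> T \<Longrightarrow> edom T (\<lambda>w. wt k t (lin r y q w))" for y t
    by (auto intro!: edom_lin_right[OF T(1)] edom_tilt edom_wt)
  have FTC: "tilt k (lin r (fst (rot h p)) q w) - tilt k (lin r (fst p) q w) = h * (k * r) * (\<integral>\<tau>. \<Phi> w \<tau> \<partial>unif h)" for w
  proof -
    have du: "((\<lambda>\<tau>. lin r (fst (rot \<tau> p)) q w t) has_real_derivative r * snd (rot \<tau> p) t) (at \<tau>)" for t \<tau>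
      by (auto intro!: derivative_eq_intros)
    have cu: "isCont (\<lambda>\<tau>. lin r (fst (rot \<tau> p)) q w t) \<tau>" for t \<tau>
      using du by (rule DERIV_isCont)
    have d: "((\<lambda>\<tau>. tilt k (lin r (fst (rot \<tau> p)) q w)) has_real_derivative (k * r) * \<Phi> w \<tau>) (at \<tau>)" for \<tau>
    proof -
      have "((\<lambda>\<tau>. tilt k (lin r (fst (rot \<tau> p)) q w)) has_real_derivative
         exp (k * smax \<beta> T (lin r (fst (rot \<tau> p)) q w)) * (k * (\<Sum>t\<in>T. smp \<beta> T t (lin r (fst (rot \<tau> p)) q w) * (r * snd (rot \<tau> p) t)))) (at \<tau>)"
        unfolding tilt_def by (intro DERIV_fun_exp DERIV_cmult smax_deriv[OF T \<beta>] du)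
      also have "exp (k * smax \<beta> T (lin r (fst (rot \<tau> p)) q w)) * (k * (\<Sum>t\<in>T. smp \<beta> T t (lin r (fst (rot \<tau> p)) q w) * (r * snd (rot \<tau> p) t))) = (k * r) * \<Phi> w \<tau>"
        unfolding \<Phi>_def wt_def tilt_def sum_distrib_left by (intro sum.cong refl) (simp only: mult_ac)
      finally show ?thesis .
    qed
    have c: "isCont (\<lambda>\<tau>. (k * r) * \<Phi> w \<tau>) \<tau>" for \<tau>
      unfolding \<Phi>_def wt_def tilt_def
      by (intro continuous_intros isCont_smp[OF T \<beta> cu] isCont_smax[OF T \<beta> cu] rot_isCont)
    have "(\<integral>\<tau>. (k * r) * \<Phi> w \<tau> \<partial>unif h) = (tilt k (lin r (fst (rot h p)) q w) - tilt k (lin r (fst (rot 0 p)) q w)) / h"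
      by (rule integral_unif_deriv[OF h d c])
    moreover have "lin r (fst (rot 0 p)) q w = lin r (fst p) q w" by simp
    ultimately show ?thesis using h by (simp only: integral_mult_right_zero) (simp add: field_simps)
  qed
  have swap: "(\<integral>w. \<Phi> w \<tau> \<partial>\<mu>) = (\<Sum>t\<in>T. OU r (wt k t) (fst (rot \<tau> p)) * snd (rot \<tau> p) t)" for \<tau>
    unfolding \<Phi>_def OU_def q_def[symmetric]
    by (subst Bochner_Integration.integral_sum) (intro integrable_mult_left integrable_edom[OF T(1)] edw, simp_all only: integral_mult_left_zero)
  have "OU r (tilt k) (fst (rot h p)) - OU r (tilt k) (fst p) = (\<integral>w. tilt k (lin r (fst (rot h p)) q w) - tilt k (lin r (fst p) q w) \<partial>\<mu>)"
    unfolding OU_def q_def[symmetric]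
    by (rule Bochner_Integration.integral_diff[symmetric]) (intro integrable_edom[OF T(1)] edw)+
  also have "\<dots> = h * (k * r) * (\<integral>w. \<integral>\<tau>. \<Phi> w \<tau> \<partial>unif h \<partial>\<mu>)"
    unfolding FTC by (rule integral_mult_right_zero)
  also have "(\<integral>w. \<integral>\<tau>. \<Phi> w \<tau> \<partial>unif h \<partial>\<mu>) = (\<integral>\<tau>. \<integral>w. \<Phi> w \<tau> \<partial>\<mu> \<partial>unif h)"
    by (rule Q.Fubini_integral[OF \<Phi>_int, symmetric])
  also have "\<dots> = (\<integral>\<tau>. (\<Sum>t\<in>T. OU r (wt k t) (fst (rot \<tau> p)) * snd (rot \<tau> p) t) \<partial>unif h)"
    by (simp only: swap)
  finally show "OU r (tilt k) (fst (rot h p)) - OU r (tilt k) (fst p)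
    = h * (k * r) * (\<integral>\<tau>. (\<Sum>t\<in>T. OU r (wt k t) (fst (rot \<tau> p)) * snd (rot \<tau> p) t) \<partial>unif h)" .
  have meas: "(\<lambda>\<tau>. \<Sum>t\<in>T. OU r (wt k t) (fst (rot \<tau> p)) * snd (rot \<tau> p) t) \<in> borel_measurable (unif h)"
    using Q.integrable_snd[OF \<Phi>_int] unfolding swap by (rule borel_measurable_integrable)
  have "\<forall>t\<in>T. \<exists>C. \<forall>\<tau>. \<bar>OU r (wt k t) (fst (rot \<tau> p))\<bar> \<le> C"
    using edom_rot_bounded[OF T(1) edom_OU[OF T(1) edom_wt]] by blast
  then obtain C where "\<forall>t\<in>T. \<forall>\<tau>. \<bar>OU r (wt k t) (fst (rot \<tau> p))\<bar> \<le> C t"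
    by (rule bchoice[THEN exE]) 
  then have C: "\<bar>OU r (wt k t) (fst (rot \<tau> p))\<bar> \<le> C t" if "t \<in> T" for t \<tau>
    using that by blast
  have bd: "\<bar>\<Sum>t\<in>T. OU r (wt k t) (fst (rot \<tau> p)) * snd (rot \<tau> p) t\<bar> \<le> (\<Sum>t\<in>T. C t * B)" for \<tau>
  proof -
    have "\<bar>\<Sum>t\<in>T. OU r (wt k t) (fst (rot \<tau> p)) * snd (rot \<tau> p) t\<bar> \<le> (\<Sum>t\<in>T. \<bar>OU r (wt k t) (fst (rot \<tau> p)) * snd (rot \<tau> p) t\<bar>)"
      by (rule sum_abs)
    also have "\<dots> \<le> (\<Sum>t\<in>T. C t * B)"
      unfolding abs_mult by (intro sum_mono mult_mono C r_le) (auto intro: order_trans[OF abs_ge_zero C])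
    finally show ?thesis .
  qed
  show "integrable (unif h) (\<lambda>\<tau>. (\<Sum>t\<in>T. OU r (wt k t) (fst (rot \<tau> p)) * snd (rot \<tau> p) t)\<^sup>2)"
  proof (rule U.integrable_const_bound[where B = "(\<Sum>t\<in>T. C t * B)\<^sup>2"])
    show "AE \<tau> in unif h. norm ((\<Sum>t\<in>T. OU r (wt k t) (fst (rot \<tau> p)) * snd (rot \<tau> p) t)\<^sup>2) \<le> (\<Sum>t\<in>T. C t * B)\<^sup>2"
    proof (rule AE_I2)
      fix \<tau>
      show "norm ((\<Sum>t\<in>T. OU r (wt k t) (fst (rot \<tau> p)) * snd (rot \<tau> p) t)\<^sup>2) \<le> (\<Sum>t\<in>T. C t * B)\<^sup>2"
        using power_mono[OF bd abs_ge_zero, of \<tau> 2] by (simp only: power2_abs real_norm_def abs_power2)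
    qed
    show "(\<lambda>\<tau>. (\<Sum>t\<in>T. OU r (wt k t) (fst (rot \<tau> p)) * snd (rot \<tau> p) t)\<^sup>2) \<in> borel_measurable (unif h)"
      by (rule borel_measurable_power[OF meas])
  qed
qed

text \<open>\<open>k^2 * r^2 * energy k r\<close> is the Dirichlet form of
  \<open>OU r (tilt k)\<close>: the gradient commutes with the semigroup up to the factor
  \<open>r\<close>, and \<open>k * wt k t\<close> are the partial derivatives of
  \<open>tilt k\<close>.\<close>

definition energy :: "real \<Rightarrow> real \<Rightarrow> real" where
  "energy k r = (\<Sum>s\<in>T. \<Sum>t\<in>T. \<Gamma> s t * (\<integral>x. OU r (wt k s) x * OU r (wt k t) x \<partial>\<mu>))"

text \<open>Cauchy-Schwarz in the angle; by rotation invariance every angle contributes the same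
  second moment, which is the energy.\<close>

lemma OU_tilt_diff_sq:
  assumes r: "0 \<le> r" "r \<le> 1" and h: "0 < h"
  shows "(\<integral>p. (OU r (tilt k) (fst (rot h p)) - OU r (tilt k) (fst p))\<^sup>2 \<partial>(\<mu> \<Otimes>\<^sub>M \<mu>)) \<le> h\<^sup>2 * k\<^sup>2 * r\<^sup>2 * energy k r"
proof -
  interpret U: prob_space "unif h" by (rule prob_space_unif[OF h])
  let ?H = "\<lambda>p. \<Sum>t\<in>T. OU r (wt k t) (fst p) * snd p t"
  let ?D = "\<lambda>p. OU r (tilt k) (fst (rot h p)) - OU r (tilt k) (fst p)"
  have v: "edom T (OU r (wt k t))" if "t \<in> T" for t by (intro edom_OU T(1) edom_wt that)
  have H2: "edom2 T (\<lambda>p. (?H p)\<^sup>2)"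
    "(\<integral>p. (?H p)\<^sup>2 \<partial>(\<mu> \<Otimes>\<^sub>M \<mu>)) = energy k r"
    unfolding energy_def by (intro integral_linear_sq[OF T(1)] v; assumption)+
  have [measurable]: "?H \<in> borel_measurable (path_space \<Otimes>\<^sub>M path_space)"
    using edom_measurable[OF v] by (intro borel_measurable_sum borel_measurable_times measurable_compose[OF measurable_fst]) auto
  have pw: "ennreal ((?D p)\<^sup>2) \<le> (\<integral>\<^sup>+\<tau>. ennreal ((h * (k * r))\<^sup>2 * (?H (rot \<tau> p))\<^sup>2) \<partial>unif h)" for p
  proof -
    have i: "integrable (unif h) (\<lambda>\<tau>. (?H (rot \<tau> p))\<^sup>2)"
      using OU_tilt_diff(2)[OF r h] by simp
    have "(\<lambda>z. ?H (rot (snd z) (fst z))) \<in> borel_measurable ((path_space \<Otimes>\<^sub>M path_space) \<Otimes>\<^sub>M borel)"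
      by (rule measurable_compose[OF measurable_rot]) measurable
    from measurable_Pair2[OF this, of p]
    have m: "(\<lambda>\<tau>. ?H (rot \<tau> p)) \<in> borel_measurable (unif h)"
      unfolding measurable_cong_sets[OF sets_unif refl] by (simp add: space_pair_measure space_path_space)
    have "(?D p)\<^sup>2 = (h * (k * r))\<^sup>2 * (\<integral>\<tau>. ?H (rot \<tau> p) \<partial>unif h)\<^sup>2"
      unfolding OU_tilt_diff(1)[OF r h] power_mult_distrib by (simp only: fst_conv snd_conv)
    also have "\<dots> \<le> (h * (k * r))\<^sup>2 * (\<integral>\<tau>. (?H (rot \<tau> p))\<^sup>2 \<partial>unif h)"
      by (intro mult_left_mono U.integral_sq_le m i) simp
    finally have "ennreal ((?D p)\<^sup>2) \<le> ennreal (\<integral>\<tau>. (h * (k * r))\<^sup>2 * (?H (rot \<tau> p))\<^sup>2 \<partial>unif h)"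
      by (intro ennreal_leI) (simp only: integral_mult_right_zero)
    also have "\<dots> = (\<integral>\<^sup>+\<tau>. ennreal ((h * (k * r))\<^sup>2 * (?H (rot \<tau> p))\<^sup>2) \<partial>unif h)"
      by (rule nn_integral_eq_integral[symmetric]) (use i in \<open>auto intro!: integrable_mult_right\<close>)
    finally show ?thesis .
  qed
  have eD: "edom2 T (\<lambda>p. (?D p)\<^sup>2)"
  proof -
    have "edom2 T ?D"
      unfolding fst_conv by (rule edom2_diff[OF edom2_lin edom2_fst]; intro edom_OU T(1) edom_tilt)
    from edom2_mult[OF this this] show ?thesis unfolding power2_eq_square .
  qed
  have "ennreal (\<integral>p. (?D p)\<^sup>2 \<partial>(\<mu> \<Otimes>\<^sub>M \<mu>)) = (\<integral>\<^sup>+p. ennreal ((?D p)\<^sup>2) \<partial>(\<mu> \<Otimes>\<^sub>M \<mu>))"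
    by (rule nn_integral_eq_integral[symmetric, OF integrable_edom2[OF T(1) eD]]) simp
  also have "\<dots> \<le> (\<integral>\<^sup>+p. \<integral>\<^sup>+\<tau>. ennreal ((h * (k * r))\<^sup>2 * (?H (rot \<tau> p))\<^sup>2) \<partial>unif h \<partial>(\<mu> \<Otimes>\<^sub>M \<mu>))"
    by (rule nn_integral_mono) (rule pw)
  also have "\<dots> = (\<integral>\<^sup>+p. ennreal ((h * (k * r))\<^sup>2 * (?H p)\<^sup>2) \<partial>(\<mu> \<Otimes>\<^sub>M \<mu>))"
    by (rule nn_integral_rot[OF h, of "\<lambda>p. ennreal ((h * (k * r))\<^sup>2 * (?H p)\<^sup>2)"]) measurable
  also have "\<dots> = ennreal (\<integral>p. (h * (k * r))\<^sup>2 * (?H p)\<^sup>2 \<partial>(\<mu> \<Otimes>\<^sub>M \<mu>))"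
    by (rule nn_integral_eq_integral[OF integrable_mult_right[OF integrable_edom2[OF T(1) H2(1)]]]) auto
  also have "(\<integral>p. (h * (k * r))\<^sup>2 * (?H p)\<^sup>2 \<partial>(\<mu> \<Otimes>\<^sub>M \<mu>)) = h\<^sup>2 * k\<^sup>2 * r\<^sup>2 * energy k r"
    unfolding integral_mult_right_zero H2(2) by (simp add: power_mult_distrib)
  finally have le: "ennreal (\<integral>p. (?D p)\<^sup>2 \<partial>(\<mu> \<Otimes>\<^sub>M \<mu>)) \<le> ennreal (h\<^sup>2 * k\<^sup>2 * r\<^sup>2 * energy k r)" .
  have "0 \<le> energy k r" unfolding H2(2)[symmetric] by simp
  then have "0 \<le> h\<^sup>2 * k\<^sup>2 * r\<^sup>2 * energy k r" by simp
  then show ?thesis using le by (simp only: ennreal_le_iff)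
qed

text \<open>For \<open>v = OU r (tilt k)\<close> the rotated copy of \<open>v\<close> has the same
  second moment as \<open>v\<close>, so half the mean square of their difference is <v, v> - <v, OU
  (cos h) v>. By the composition law these two numbers are correlations of \<open>tilt k\<close> at
  the parameters r^2 and r^2 cos h.\<close>

lemma energy_increment:
  assumes r: "0 \<le> r" "r \<le> 1" and h: "0 < h" "h \<le> pi / 2"
  shows "(\<integral>x. tilt k x * OU (r * r) (tilt k) x \<partial>\<mu>) - (\<integral>x. tilt k x * OU (r * r * cos h) (tilt k) x \<partial>\<mu>)
    \<le> h\<^sup>2 * k\<^sup>2 * r\<^sup>2 * energy k r / 2"
proof -
  let ?v = "OU r (tilt k)"
  have v: "edom T ?v" by (intro edom_OU T(1) edom_tilt)
  have c: "0 \<le> cos h" "cos h \<le> 1" using h by (auto intro!: cos_ge_zero)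
  have sh: "sqrt (1 - (cos h)\<^sup>2) = sin h"
    using h by (simp add: sin_squared_eq[symmetric] sin_ge_zero)
  have 1: "(\<integral>x. ?v x * ?v x \<partial>\<mu>) = (\<integral>x. tilt k x * OU (r * r) (tilt k) x \<partial>\<mu>)"
    by (rule integral_OU_OU[OF T(1) edom_tilt edom_tilt r r])
  have "(\<integral>x. ?v x * OU (cos h) ?v x \<partial>\<mu>) = (\<integral>x. ?v x * OU (cos h * r) (tilt k) x \<partial>\<mu>)"
    by (simp only: OU_OU[OF T(1) edom_tilt c r])
  also have "\<dots> = (\<integral>x. tilt k x * OU (r * (cos h * r)) (tilt k) x \<partial>\<mu>)"
    using r c by (intro integral_OU_OU[OF T(1) edom_tilt edom_tilt r] mult_nonneg_nonneg mult_le_one)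
  finally have 2: "(\<integral>x. ?v x * OU (cos h) ?v x \<partial>\<mu>) = (\<integral>x. tilt k x * OU (r * r * cos h) (tilt k) x \<partial>\<mu>)"
    by (simp only: mult_ac)
  have 3: "(\<integral>x. ?v x * OU (cos h) ?v x \<partial>\<mu>) = (\<integral>p. ?v (fst p) * ?v (fst (rot h p)) \<partial>(\<mu> \<Otimes>\<^sub>M \<mu>))"
    unfolding integral_mult_OU[OF T(1) v v] sh fst_conv ..
  have i1: "integrable (\<mu> \<Otimes>\<^sub>M \<mu>) (\<lambda>p. ?v (fst p) * ?v (fst p))"
    by (intro integrable_edom2[OF T(1)] edom2_mult edom2_fst v)
  have i2: "integrable (\<mu> \<Otimes>\<^sub>M \<mu>) (\<lambda>p. ?v (fst (rot h p)) * ?v (fst (rot h p)))"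
    unfolding fst_conv by (intro integrable_edom2[OF T(1)] edom2_mult edom2_lin v)
  have i3: "integrable (\<mu> \<Otimes>\<^sub>M \<mu>) (\<lambda>p. ?v (fst p) * ?v (fst (rot h p)))"
    unfolding fst_conv by (intro integrable_edom2[OF T(1)] edom2_mult edom2_lin edom2_fst v)
  have 4: "(\<integral>p. ?v (fst p) * ?v (fst p) \<partial>(\<mu> \<Otimes>\<^sub>M \<mu>)) = (\<integral>x. ?v x * ?v x \<partial>\<mu>)"
    by (subst integral_fst_edom2[OF T(1) edom2_mult[OF edom2_fst[OF v] edom2_fst[OF v]]]) (simp add: prob_space)
  have "(\<integral>p. ?v (fst (rot h p)) * ?v (fst (rot h p)) \<partial>(\<mu> \<Otimes>\<^sub>M \<mu>)) = (\<integral>p. ?v (fst p) * ?v (fst p) \<partial>(\<mu> \<Otimes>\<^sub>M \<mu>))"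
  proof (rule integral_orthogonal[of "cos h" "sin h" "- sin h" "cos h" "\<lambda>p. ?v (fst p) * ?v (fst p)"])
    show "(\<lambda>p. ?v (fst p) * ?v (fst p)) \<in> borel_measurable (path_space \<Otimes>\<^sub>M path_space)"
      using edom_measurable[OF v] by measurable
  qed (simp_all add: algebra_simps)
  then have 5: "(\<integral>p. ?v (fst (rot h p)) * ?v (fst (rot h p)) \<partial>(\<mu> \<Otimes>\<^sub>M \<mu>)) = (\<integral>x. ?v x * ?v x \<partial>\<mu>)"
    unfolding 4 .
  have "(\<integral>p. (?v (fst (rot h p)) - ?v (fst p))\<^sup>2 \<partial>(\<mu> \<Otimes>\<^sub>M \<mu>)) =
     (\<integral>p. (?v (fst (rot h p)) * ?v (fst (rot h p)) + ?v (fst p) * ?v (fst p)) - 2 * (?v (fst p) * ?v (fst (rot h p))) \<partial>(\<mu> \<Otimes>\<^sub>M \<mu>))"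
    by (intro Bochner_Integration.integral_cong refl) (simp only: power2_eq_square algebra_simps mult_2)
  also have "\<dots> = ((\<integral>x. ?v x * ?v x \<partial>\<mu>) + (\<integral>x. ?v x * ?v x \<partial>\<mu>)) - 2 * (\<integral>x. ?v x * OU (cos h) ?v x \<partial>\<mu>)"
    using i1 i2 i3 by (simp only: Bochner_Integration.integral_diff Bochner_Integration.integral_add integrable_mult_right Bochner_Integration.integrable_add integral_mult_right_zero 3 4 5)
  finally show ?thesis
    using OU_tilt_diff_sq[OF r h(1), of k] unfolding 1 2 by linarith
qed

end

end

section \<open>Hypercontractivity\<close>

lemma weighted_am_gm:
  fixes x y :: real
  assumes "0 \<le> x" "0 \<le> y" and a: "0 < a" "a < 1"
  shows "x powr a * y powr (1 - a) \<le> a * x + (1 - a) * y"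
proof (cases "x = 0 \<or> y = 0")
  case True
  then show ?thesis using assms by auto
next
  case False
  then have p: "0 < x" "0 < y" using assms by auto
  have "exp (a * ln x + (1 - a) * ln y) \<le> a * exp (ln x) + (1 - a) * exp (ln y)"
    using exp_convex[unfolded convex_on_def, THEN conjunct2, rule_format, of "ln x" "ln y" a "1 - a"] a by simp
  then show ?thesis using p by (simp add: powr_def exp_add)
qed

lemma integral_Holder:
  fixes u v :: "'a \<Rightarrow> real"
  assumes u: "integrable M u" and v: "integrable M v" and u0: "\<And>x. 0 \<le> u x" and v0: "\<And>x. 0 \<le> v x"
    and a: "0 < a" "a < 1"
  shows "integrable M (\<lambda>x. u x powr a * v x powr (1 - a))"
    and "(\<integral>x. u x powr a * v x powr (1 - a) \<partial>M) \<le> (\<integral>x. u x \<partial>M) powr a * (\<integral>x. v x \<partial>M) powr (1 - a)"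
proof -
  note [measurable] = borel_measurable_integrable[OF u] borel_measurable_integrable[OF v]
  show i: "integrable M (\<lambda>x. u x powr a * v x powr (1 - a))"
  proof (rule Bochner_Integration.integrable_bound[OF Bochner_Integration.integrable_add[OF integrable_mult_right[OF u, of a] integrable_mult_right[OF v, of "1 - a"]]])
    show "AE x in M. norm (u x powr a * v x powr (1 - a)) \<le> norm (a * u x + (1 - a) * v x)"
      using weighted_am_gm[OF u0 v0 a] a u0 v0 by (intro AE_I2) (simp add: abs_of_nonneg)
  qed measurable
  define U where "U = (\<integral>x. u x \<partial>M)"
  define V where "V = (\<integral>x. v x \<partial>M)"
  have UV: "0 \<le> U" "0 \<le> V" using u0 v0 by (simp_all add: U_def V_def)
  show "(\<integral>x. u x powr a * v x powr (1 - a) \<partial>M) \<le> (\<integral>x. u x \<partial>M) powr a * (\<integral>x. v x \<partial>M) powr (1 - a)"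
  proof (cases "U = 0 \<or> V = 0")
    case True
    have "AE x in M. u x powr a * v x powr (1 - a) = 0"
      using True
    proof
      assume "U = 0"
      then have "AE x in M. u x = 0"
        using u u0 by (subst (asm) U_def, subst (asm) integral_nonneg_eq_0_iff_AE) auto
      then show ?thesis by eventually_elim simp
    next
      assume "V = 0"
      then have "AE x in M. v x = 0"
        using v v0 by (subst (asm) V_def, subst (asm) integral_nonneg_eq_0_iff_AE) auto
      then show ?thesis by eventually_elim simp
    qed
    then have "(\<integral>x. u x powr a * v x powr (1 - a) \<partial>M) = 0"
      by (rule integral_eq_zero_AE)
    then show ?thesis by simp
  next
    case False
    then have p: "0 < U" "0 < V" using UV by auto
    have "(\<integral>x. u x powr a * v x powr (1 - a) \<partial>M) / (U powr a * V powr (1 - a)) = (\<integral>x. (u x / U) powr a * (v x / V) powr (1 - a) \<partial>M)"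
      using p u0 v0 by (simp add: powr_divide)
    also have "\<dots> \<le> (\<integral>x. a * (u x / U) + (1 - a) * (v x / V) \<partial>M)"
    proof (rule integral_mono)
      show "integrable M (\<lambda>x. (u x / U) powr a * (v x / V) powr (1 - a))"
        using i p u0 v0 by (simp add: powr_divide)
      show "integrable M (\<lambda>x. a * (u x / U) + (1 - a) * (v x / V))" using u v by simp
      show "(u x / U) powr a * (v x / V) powr (1 - a) \<le> a * (u x / U) + (1 - a) * (v x / V)" for x
        using p u0 v0 a by (intro weighted_am_gm) auto
    qed
    also have "\<dots> = 1" using u v p by (simp add: U_def[symmetric] V_def[symmetric])
    finally show ?thesis using p by (simp add: U_def[symmetric] V_def[symmetric] field_simps)
  qed
qed

lemma Fubini_bounded:
  fixes F :: "'a \<Rightarrow> 'b \<Rightarrow> real"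
  assumes M: "prob_space M" and N: "prob_space N"
    and [measurable]: "(\<lambda>p. F (fst p) (snd p)) \<in> borel_measurable (M \<Otimes>\<^sub>M N)"
    and b: "\<And>x y. \<bar>F x y\<bar> \<le> B"
  shows "(\<integral>x. \<integral>y. F x y \<partial>N \<partial>M) = (\<integral>y. \<integral>x. F x y \<partial>M \<partial>N)"
    and "(\<integral>p. F (fst p) (snd p) \<partial>(M \<Otimes>\<^sub>M N)) = (\<integral>x. \<integral>y. F x y \<partial>N \<partial>M)"
proof -
  interpret M: prob_space M by fact
  interpret N: prob_space N by fact
  interpret P: pair_prob_space M N ..
  have i: "integrable (M \<Otimes>\<^sub>M N) (\<lambda>p. F (fst p) (snd p))"
    using b by (intro P.integrable_const_bound[where B = B]) auto
  show "(\<integral>x. \<integral>y. F x y \<partial>N \<partial>M) = (\<integral>y. \<integral>x. F x y \<partial>M \<partial>N)"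
  proof -
    have "integrable (M \<Otimes>\<^sub>M N) (case_prod F)" using i by (simp add: case_prod_beta')
    then show ?thesis by (rule P.Fubini_integral[symmetric])
  qed
  show "(\<integral>p. F (fst p) (snd p) \<partial>(M \<Otimes>\<^sub>M N)) = (\<integral>x. \<integral>y. F x y \<partial>N \<partial>M)"
    using P.integral_fst'[OF i] by simp
qed

section \<open>The Mehler kernel on the line and contraction from L2 to L4\<close>

abbreviation nrm :: "real measure" where "nrm \<equiv> std_normal_distribution"

interpretation nrm: prob_space nrm
  by (rule prob_space_normal_density) simp

lemma nrm_UNIV: "measure nrm UNIV = 1"
  using nrm.prob_space by simp

lemma normal_density_alt: "0 < s \<Longrightarrow> normal_density m s x = 1 / (sqrt (2 * pi) * s) * exp (- ((x - m)\<^sup>2 / (2 * s\<^sup>2)))"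
  by (simp add: normal_density_def real_sqrt_mult)

lemma std_normal_density_alt: "std_normal_density x = 1 / sqrt (2 * pi) * exp (- (x\<^sup>2 / 2))"
  by (simp add: std_normal_density_def)

lemma integral_nrm: "f \<in> borel_measurable borel \<Longrightarrow> (\<integral>x. f x \<partial>nrm) = (\<integral>x. std_normal_density x * f x \<partial>lborel)" for f :: "real \<Rightarrow> real"
  by (subst integral_density) auto

lemma nrm_bounded_integrable:
  fixes f :: "real \<Rightarrow> real"
  assumes "f \<in> borel_measurable borel" "\<And>x. \<bar>f x\<bar> \<le> B"
  shows "integrable nrm f"
  using assms by (intro nrm.integrable_const_bound[where B = B]) auto

text \<open>The Mehler kernel at correlation 1/4: the density, relative to the standard normal law,
  of x/4 plus independent normal noise of variance 1 - 1/16 = 15/16.\<close>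

definition mehler :: "real \<Rightarrow> real \<Rightarrow> real" where
  "mehler x v = normal_density (x / 4) (sqrt 15 / 4) v / std_normal_density v"

text \<open>The squared L2 norm of \<open>mehler x\<close>. By the composition law it is the
  diagonal value at \<open>x\<close> of the Mehler kernel with correlation 1/16.\<close>

definition mehler_sq :: "real \<Rightarrow> real" where
  "mehler_sq x = 16 / sqrt 255 * exp (x\<^sup>2 / 17)"

lemma std_normal_density_pos: "0 < std_normal_density x"
  by (simp add: normal_density_pos)

lemma std_normal_density_nz: "std_normal_density x \<noteq> 0"
  using std_normal_density_pos[of x] by simp

lemma mehler_measurable [measurable]: "(\<lambda>p. mehler (fst p) (snd p)) \<in> borel_measurable (borel \<Otimes>\<^sub>M borel)"
  unfolding mehler_def normal_density_def by measurable

lemma mehler_measurable2 [measurable]: "mehler x \<in> borel_measurable borel"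
  unfolding mehler_def[abs_def] by measurable

lemma mehler_nonneg: "0 \<le> mehler x v" by (simp add: mehler_def)

lemma mehler_sym: "mehler x v = mehler v x"
proof -
  have e: "- ((v - x / 4)\<^sup>2 / (2 * (sqrt 15 / 4)\<^sup>2)) + v\<^sup>2 / 2 = - ((x - v / 4)\<^sup>2 / (2 * (sqrt 15 / 4)\<^sup>2)) + x\<^sup>2 / 2"
    by (simp add: power_divide power2_eq_square field_simps)
  have m: "mehler x v = 4 / sqrt 15 * exp (- ((v - x / 4)\<^sup>2 / (2 * (sqrt 15 / 4)\<^sup>2)) + v\<^sup>2 / 2)" for x v
  proof -
    have c: "1 / (w * (sqrt 15 / 4)) * A / (1 / w * B) = 4 / sqrt 15 * (A * inverse B)" if "w \<noteq> 0" "B \<noteq> 0" for w A B :: real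
      using that by (simp add: field_simps)
    have nd: "normal_density (x / 4) (sqrt 15 / 4) v = 1 / (sqrt (2 * pi) * (sqrt 15 / 4)) * exp (- ((v - x / 4)\<^sup>2 / (2 * (sqrt 15 / 4)\<^sup>2)))"
      by (rule normal_density_alt) simp
    have w: "sqrt (2 * pi) \<noteq> 0" by simp
    show ?thesis
      unfolding mehler_def std_normal_density_alt nd c[OF w exp_not_eq_zero] by (simp only: exp_add exp_minus inverse_inverse_eq)
  qed
  show ?thesis unfolding m e ..
qed

lemma integral_mehler:
  fixes h :: "real \<Rightarrow> real"
  assumes [measurable]: "h \<in> borel_measurable borel"
  shows "(\<integral>y. h (x / 4 + sqrt 15 / 4 * y) \<partial>nrm) = (\<integral>v. h v * mehler x v \<partial>nrm)"
proof -
  have d: "sqrt 15 / 4 * normal_density (x / 4) (sqrt 15 / 4) (x / 4 + sqrt 15 / 4 * y) = std_normal_density y" for y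
  proof -
    have e: "(x / 4 + sqrt 15 / 4 * y - x / 4)\<^sup>2 / (2 * (sqrt 15 / 4)\<^sup>2) = y\<^sup>2 / 2"
      by (simp add: power_mult_distrib power_divide)
    show ?thesis by (subst normal_density_alt) (simp_all only: e std_normal_density_alt, simp_all)
  qed
  have "(\<integral>v. h v * mehler x v \<partial>nrm) = (\<integral>v. h v * normal_density (x / 4) (sqrt 15 / 4) v \<partial>lborel)"
    by (subst integral_nrm) (auto simp: mehler_def std_normal_density_nz intro!: Bochner_Integration.integral_cong)
  also have "\<dots> = sqrt 15 / 4 * (\<integral>y. h (x / 4 + sqrt 15 / 4 * y) * normal_density (x / 4) (sqrt 15 / 4) (x / 4 + sqrt 15 / 4 * y) \<partial>lborel)"
    by (subst lborel_integral_real_affine[of "sqrt 15 / 4" _ "x / 4"]) auto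
  also have "\<dots> = (\<integral>y. std_normal_density y * h (x / 4 + sqrt 15 / 4 * y) \<partial>lborel)"
    unfolding integral_mult_right_zero[symmetric] d[symmetric] by (intro Bochner_Integration.integral_cong) auto
  also have "\<dots> = (\<integral>y. h (x / 4 + sqrt 15 / 4 * y) \<partial>nrm)"
    by (subst integral_nrm) auto
  finally show ?thesis ..
qed

lemma has_integral_mehler: "has_bochner_integral nrm (mehler x) 1"
proof -
  have "has_bochner_integral lborel (\<lambda>v. std_normal_density v *\<^sub>R mehler x v) 1"
    by (simp add: mehler_def std_normal_density_nz has_bochner_integral_iff)
  then show ?thesis by (intro has_bochner_integral_density) (auto)
qed

lemma has_integral_mehler_sq: "has_bochner_integral nrm (\<lambda>v. (mehler x v)\<^sup>2) (mehler_sq x)"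
proof -
  have s255: "sqrt 255 = sqrt 15 * sqrt 17" by (simp flip: real_sqrt_mult)
  \<comment> \<open>Completing the square in \<open>v\<close> gives a normal density with mean 8x/17
    and variance 15/17, times a factor depending on \<open>x\<close>.\<close>
  have e: "(normal_density (x / 4) (sqrt 15 / 4) v)\<^sup>2 = std_normal_density v * (mehler_sq x * normal_density (8 * x / 17) (sqrt 15 / sqrt 17) v)" for v
  proof -
    have ex: "2 * (- ((v - x / 4)\<^sup>2 / (2 * (sqrt 15 / 4)\<^sup>2))) = - (v\<^sup>2 / 2) + (x\<^sup>2 / 17 + - ((v - 8 * x / 17)\<^sup>2 / (2 * (sqrt 15 / sqrt 17)\<^sup>2)))"
      by (simp add: power_divide power2_eq_square field_simps)
    have c: "(1 / (sqrt (2 * pi) * (sqrt 15 / 4)))\<^sup>2 = 1 / sqrt (2 * pi) * (16 / sqrt 255 * (1 / (sqrt (2 * pi) * (sqrt 15 / sqrt 17))))"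
    proof -
      have "(1 / (w * (sqrt 15 / 4)))\<^sup>2 = 1 / w * (16 / (sqrt 15 * sqrt 17) * (1 / (w * (sqrt 15 / sqrt 17))))" if "w \<noteq> 0" for w :: real
        using that by (simp add: power2_eq_square field_simps)
      from this[of "sqrt (2 * pi)"] show ?thesis unfolding s255 by simp
    qed
    have "(normal_density (x / 4) (sqrt 15 / 4) v)\<^sup>2 = (1 / (sqrt (2 * pi) * (sqrt 15 / 4)))\<^sup>2 * exp (2 * (- ((v - x / 4)\<^sup>2 / (2 * (sqrt 15 / 4)\<^sup>2))))"
      by (subst normal_density_alt) (simp_all only: power_mult_distrib exp_double, simp_all)
    also have "\<dots> = 1 / sqrt (2 * pi) * (16 / sqrt 255 * (1 / (sqrt (2 * pi) * (sqrt 15 / sqrt 17)))) * (exp (- (v\<^sup>2 / 2)) * (exp (x\<^sup>2 / 17) * exp (- ((v - 8 * x / 17)\<^sup>2 / (2 * (sqrt 15 / sqrt 17)\<^sup>2)))))"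
      unfolding ex c exp_add ..
    also have "\<dots> = std_normal_density v * (mehler_sq x * normal_density (8 * x / 17) (sqrt 15 / sqrt 17) v)"
      unfolding std_normal_density_alt mehler_sq_def by (subst normal_density_alt) (simp, simp only: mult_ac)
    finally show ?thesis .
  qed
  have "std_normal_density v *\<^sub>R (mehler x v)\<^sup>2 = mehler_sq x * normal_density (8 * x / 17) (sqrt 15 / sqrt 17) v" for v
    unfolding mehler_def power_divide e using std_normal_density_nz[of v] by (simp add: power2_eq_square)
  moreover have "has_bochner_integral lborel (\<lambda>v. mehler_sq x * normal_density (8 * x / 17) (sqrt 15 / sqrt 17) v) (mehler_sq x * 1)"
    by (intro has_bochner_integral_mult_right) (simp add: has_bochner_integral_iff)
  ultimately show ?thesis by (intro has_bochner_integral_density) (auto)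
qed

lemma nrm_exp_square:
  assumes s: "0 < s" and c: "1 / 2 - c = 1 / (2 * s\<^sup>2)"
  shows "has_bochner_integral nrm (\<lambda>x. exp (c * x\<^sup>2)) s"
proof -
  have "std_normal_density x *\<^sub>R exp (c * x\<^sup>2) = s * normal_density 0 s x" for x
  proof -
    have "- (x\<^sup>2 / 2) + c * x\<^sup>2 = - (x\<^sup>2 * (1 / 2 - c))" by (simp add: algebra_simps)
    then have "- (x\<^sup>2 / 2) + c * x\<^sup>2 = - (x\<^sup>2 / (2 * s\<^sup>2))" unfolding c by simp
    then have "exp (- (x\<^sup>2 / 2)) * exp (c * x\<^sup>2) = exp (- (x\<^sup>2 / (2 * s\<^sup>2)))" by (simp flip: exp_add)
    then show ?thesis using s unfolding std_normal_density_alt normal_density_alt[OF s]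
      by (simp add: mult.assoc)
  qed
  moreover have "has_bochner_integral lborel (\<lambda>x. s * normal_density 0 s x) (s * 1)"
    using s by (intro has_bochner_integral_mult_right) (simp add: has_bochner_integral_iff)
  ultimately show ?thesis by (intro has_bochner_integral_density) (auto)
qed

text \<open>The value 16/15 is the trace of the semigroup at correlation 1/16, the sum of the
  eigenvalues 16^(-j).\<close>

lemma nrm_mehler_sq: "has_bochner_integral nrm mehler_sq (16 / 15)"
proof -
  have "has_bochner_integral nrm (\<lambda>x. 16 / sqrt 255 * exp ((1 / 17) * x\<^sup>2)) (16 / sqrt 255 * (sqrt 17 / sqrt 15))"
    by (intro has_bochner_integral_mult_right nrm_exp_square) (simp_all add: power_divide)
  moreover have val: "16 / sqrt 255 * (sqrt 17 / sqrt 15) = 16 / (15::real)"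
  proof -
    have "sqrt 255 = sqrt 15 * sqrt 17" by (simp flip: real_sqrt_mult)
    then show ?thesis by simp
  qed
  moreover have "mehler_sq = (\<lambda>x. 16 / sqrt 255 * exp ((1 / 17) * x\<^sup>2))"
    by (simp add: mehler_sq_def fun_eq_iff)
  ultimately show ?thesis by (simp only:)
qed

lemma nrm_mehler_sq_sq: "has_bochner_integral nrm (\<lambda>x. (mehler_sq x)\<^sup>2) (256 / 255 * (sqrt 17 / sqrt 13))"
proof -
  have "has_bochner_integral nrm (\<lambda>x. 256 / 255 * exp ((2 / 17) * x\<^sup>2)) (256 / 255 * (sqrt 17 / sqrt 13))"
    by (intro has_bochner_integral_mult_right nrm_exp_square) (simp_all add: power_divide)
  moreover have "(\<lambda>x. (mehler_sq x)\<^sup>2) = (\<lambda>x. 256 / 255 * exp ((2 / 17) * x\<^sup>2))"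
    by (simp add: mehler_sq_def power_mult_distrib power_divide exp_double[symmetric] fun_eq_iff)
  ultimately show ?thesis by (simp only:)
qed

lemma mehler_sq_measurable [measurable]: "mehler_sq \<in> borel_measurable borel"
  unfolding mehler_sq_def[abs_def] by measurable

definition noise1 :: "(real \<Rightarrow> real) \<Rightarrow> real \<Rightarrow> real" where
  "noise1 h x = (\<integral>y. h (x / 4 + sqrt 15 / 4 * y) \<partial>nrm)"

lemma noise1_measurable [measurable]:
  assumes [measurable]: "h \<in> borel_measurable borel" shows "noise1 h \<in> borel_measurable borel"
  unfolding noise1_def[abs_def] by (intro nrm.borel_measurable_lebesgue_integral) measurable

lemma noise1_bound:
  assumes h: "\<And>x. \<bar>h x\<bar> \<le> B" shows "\<bar>noise1 h x\<bar> \<le> B"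
proof (cases "integrable nrm (\<lambda>y. h (x / 4 + sqrt 15 / 4 * y))")
  case True
  have "\<bar>noise1 h x\<bar> \<le> (\<integral>y. \<bar>h (x / 4 + sqrt 15 / 4 * y)\<bar> \<partial>nrm)" unfolding noise1_def by simp
  also have "\<dots> \<le> (\<integral>y. B \<partial>nrm)" using True h by (intro integral_mono) auto
  finally show ?thesis by (simp add: nrm_UNIV)
next
  case False
  then show ?thesis using h[of 0] by (simp add: noise1_def not_integrable_integral_eq)
qed

text \<open>Fubini and the symmetry of the kernel: integrated in its first argument it also gives
  1.\<close>

lemma integral_noise1:
  assumes [measurable]: "h \<in> borel_measurable borel" and h: "\<And>x. \<bar>h x\<bar> \<le> B"
  shows "(\<integral>x. noise1 h x \<partial>nrm) = (\<integral>x. h x \<partial>nrm)"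
proof -
  interpret P: pair_sigma_finite nrm nrm ..
  have "integrable (nrm \<Otimes>\<^sub>M nrm) (\<lambda>p. h (snd p) * mehler (fst p) (snd p))"
  proof (rule P.Fubini_integrable)
    show "(\<lambda>p. h (snd p) * mehler (fst p) (snd p)) \<in> borel_measurable (nrm \<Otimes>\<^sub>M nrm)"
      by measurable
    have hm: "integrable nrm (\<lambda>y. h y * mehler x y)" for x
    proof (rule Bochner_Integration.integrable_bound[OF integrable_mult_right[of B]])
      show "integrable nrm (mehler x)" using has_integral_mehler by (auto simp: has_bochner_integral_iff)
      show "AE y in nrm. norm (h y * mehler x y) \<le> norm (B * mehler x y)"
        using h order_trans[OF abs_ge_zero h] by (auto simp: abs_mult mehler_nonneg intro!: AE_I2 mult_right_mono)
    qed simp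
    then show "AE x in nrm. integrable nrm (\<lambda>y. h (snd (x, y)) * mehler (fst (x, y)) (snd (x, y)))" by simp
    have "(\<integral>y. \<bar>h y\<bar> * mehler x y \<partial>nrm) = noise1 (\<lambda>y. \<bar>h y\<bar>) x" for x
      unfolding noise1_def by (rule integral_mehler[symmetric]) simp
    moreover have "integrable nrm (noise1 (\<lambda>y. \<bar>h y\<bar>))"
      using noise1_bound[of "\<lambda>y. \<bar>h y\<bar>" B] h by (intro nrm_bounded_integrable[where B = B]) auto
    ultimately show "integrable nrm (\<lambda>x. \<integral>y. norm (h (snd (x, y)) * mehler (fst (x, y)) (snd (x, y))) \<partial>nrm)"
      by (simp add: abs_mult mehler_nonneg)
  qed
  then have "(\<integral>x. \<integral>v. h v * mehler x v \<partial>nrm \<partial>nrm) = (\<integral>v. \<integral>x. h v * mehler x v \<partial>nrm \<partial>nrm)"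
    using P.Fubini_integral[of "\<lambda>x v. h v * mehler x v", symmetric] by (simp only: case_prod_beta')
  moreover have "(\<integral>x. mehler x v \<partial>nrm) = 1" for v
    using has_integral_mehler[of v] by (simp add: mehler_sym[of _ v] has_bochner_integral_iff)
  ultimately show ?thesis
    unfolding noise1_def integral_mehler[OF assms(1)] by simp
qed

text \<open>Write \<open>noise1 h = a + u\<close> with \<open>a\<close> the mean of \<open>h\<close>.  Then \<open>u\<^sup>2\<close> is at most the variance of \<open>h\<close>
  times \<open>mehler_sq - 1\<close> by the Cauchy-Schwarz inequality, and this factor is so small that
  the terms of fourth order can be absorbed.\<close>

lemma noise1_four_norm:
  assumes [measurable]: "h \<in> borel_measurable borel" and h: "\<And>x. \<bar>h x\<bar> \<le> B"
  shows "(\<integral>x. (noise1 h x)^4 \<partial>nrm) \<le> (\<integral>x. (h x)\<^sup>2 \<partial>nrm)\<^sup>2"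
proof -
  have B0: "0 \<le> B" using h[of 0] abs_ge_zero[of "h 0"] by linarith
  define a where "a = (\<integral>x. h x \<partial>nrm)"
  define D where "D = (\<integral>x. (h x - a)\<^sup>2 \<partial>nrm)"
  define u where "u x = noise1 h x - a" for x
  have aB: "\<bar>a\<bar> \<le> B"
  proof -
    have "\<bar>a\<bar> \<le> (\<integral>x. \<bar>h x\<bar> \<partial>nrm)" unfolding a_def by simp
    also have "\<dots> \<le> (\<integral>x. B \<partial>nrm)" using h B0 by (intro integral_mono nrm_bounded_integrable[where B = B]) auto
    finally show ?thesis by (simp add: nrm_UNIV)
  qed
  have ih: "integrable nrm h" by (rule nrm_bounded_integrable[OF _ h]) simp
  have hB2: "\<bar>(h x)\<^sup>2\<bar> \<le> B\<^sup>2" for x using power_mono[OF h abs_ge_zero, of x 2] by simp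
  have ih2: "integrable nrm (\<lambda>x. (h x)\<^sup>2)" by (rule nrm_bounded_integrable[OF _ hB2]) simp
  have D_eq: "D = (\<integral>x. (h x)\<^sup>2 \<partial>nrm) - a\<^sup>2"
  proof -
    have "D = (\<integral>x. (h x)\<^sup>2 - 2 * a * h x + a\<^sup>2 \<partial>nrm)"
      unfolding D_def by (intro Bochner_Integration.integral_cong) (auto simp: power2_diff)
    also have "\<dots> = (\<integral>x. (h x)\<^sup>2 \<partial>nrm) - 2 * a * a + a\<^sup>2"
      using ih ih2 by (simp add: a_def nrm_UNIV)
    finally show ?thesis by (simp add: power2_eq_square)
  qed
  have D0: "0 \<le> D" by (simp add: D_def)
  have im: "integrable nrm (mehler x)" "integrable nrm (\<lambda>v. (mehler x v)\<^sup>2)"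
    "(\<integral>v. mehler x v \<partial>nrm) = 1" "(\<integral>v. (mehler x v)\<^sup>2 \<partial>nrm) = mehler_sq x" for x
    using has_integral_mehler[of x] has_integral_mehler_sq[of x] by (auto simp: has_bochner_integral_iff)
  have m1: "(\<integral>v. (mehler x v - 1)\<^sup>2 \<partial>nrm) = mehler_sq x - 1" "integrable nrm (\<lambda>v. (mehler x v - 1)\<^sup>2)" for x
  proof -
    have e: "(mehler x v - 1)\<^sup>2 = (mehler x v)\<^sup>2 - 2 * mehler x v + 1" for v by (simp add: power2_diff)
    show "(\<integral>v. (mehler x v - 1)\<^sup>2 \<partial>nrm) = mehler_sq x - 1" unfolding e using im[of x] by (simp add: nrm_UNIV)
    show "integrable nrm (\<lambda>v. (mehler x v - 1)\<^sup>2)" unfolding e using im[of x] by simp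
  qed
  have ihm: "integrable nrm (\<lambda>v. h v * mehler x v)" for x
  proof (rule Bochner_Integration.integrable_bound[OF integrable_mult_right[OF im(1), of B x]])
    show "AE y in nrm. norm (h y * mehler x y) \<le> norm (B * mehler x y)"
      using h B0 by (auto simp: abs_mult mehler_nonneg intro!: AE_I2 mult_right_mono)
  qed simp
  have u_eq: "u x = (\<integral>v. (h v - a) * (mehler x v - 1) \<partial>nrm)" for x
  proof -
    have "(\<integral>v. (h v - a) * (mehler x v - 1) \<partial>nrm) = (\<integral>v. h v * mehler x v - h v - a * mehler x v + a \<partial>nrm)"
      by (intro Bochner_Integration.integral_cong) (auto simp: algebra_simps)
    also have "\<dots> = noise1 h x - a"
    proof -
      have nh: "noise1 h x = (\<integral>v. h v * mehler x v \<partial>nrm)" unfolding noise1_def by (rule integral_mehler) simp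
      show ?thesis using ihm[of x] ih im[of x] by (simp add: nrm_UNIV nh a_def[symmetric])
    qed
    finally show ?thesis by (simp add: u_def)
  qed
  have iha: "integrable nrm (\<lambda>v. (h v - a)\<^sup>2)"
  proof -
    have e: "(h v - a)\<^sup>2 = (h v)\<^sup>2 - 2 * a * h v + a\<^sup>2" for v by (simp add: power2_diff)
    show ?thesis unfolding e using ih ih2 by simp
  qed
  have u2: "(u x)\<^sup>2 \<le> D * (mehler_sq x - 1)" for x
    unfolding u_eq D_def m1(1)[symmetric] by (rule integral_CauchySchwarz(1)) (auto simp: iha m1)
  have [measurable]: "u \<in> borel_measurable borel" unfolding u_def[abs_def] by measurable
  have uB: "\<bar>u x\<bar> \<le> 2 * B" for x
    using noise1_bound[of h B x, OF h] aB unfolding u_def by linarith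
  have iu: "integrable nrm u" by (rule nrm_bounded_integrable[OF _ uB]) simp
  have u_mean: "(\<integral>x. u x \<partial>nrm) = 0"
  proof -
    have i: "integrable nrm (noise1 h)" by (rule nrm_bounded_integrable[OF _ noise1_bound[of h B, OF h]]) simp
    have "(\<integral>x. u x \<partial>nrm) = (\<integral>x. noise1 h x \<partial>nrm) - a"
      unfolding u_def using i by (simp add: nrm_UNIV)
    also have "\<dots> = 0" using integral_noise1[of h B, OF _ h] by (simp add: a_def)
    finally show ?thesis .
  qed
  have iK: "integrable nrm mehler_sq" "integrable nrm (\<lambda>x. (mehler_sq x)\<^sup>2)"
     "(\<integral>x. mehler_sq x \<partial>nrm) = 16 / 15" "(\<integral>x. (mehler_sq x)\<^sup>2 \<partial>nrm) = 256 / 255 * (sqrt 17 / sqrt 13)"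
    using nrm_mehler_sq nrm_mehler_sq_sq by (auto simp: has_bochner_integral_iff)
  have s: "sqrt 17 / sqrt 13 \<le> (6 / 5 :: real)"
  proof -
    have "sqrt 17 / sqrt 13 = sqrt (17 / 13)" by (simp add: real_sqrt_divide)
    also have "\<dots> \<le> sqrt ((6 / 5)\<^sup>2)" by (rule real_sqrt_le_mono) (simp add: power_divide)
    finally show ?thesis by simp
  qed
  \<comment> \<open>The factor 3 in front of this term in \<open>quart\<close> makes 1/3 exactly
    what the summand \<open>D^2\<close> of \<open>(a^2 + D)^2\<close> can absorb.\<close>
  have K2: "(\<integral>x. (mehler_sq x)\<^sup>2 - 2 * mehler_sq x + 1 \<partial>nrm) \<le> 1 / 3"
    using iK s by (simp add: nrm_UNIV)
  have quart: "(noise1 h x)^4 \<le> a^4 + 4 * a^3 * u x + 8 * a\<^sup>2 * (D * (mehler_sq x - 1)) + 3 * (D\<^sup>2 * ((mehler_sq x)\<^sup>2 - 2 * mehler_sq x + 1))" for x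
  proof -
    have n: "noise1 h x = a + u x" by (simp add: u_def)
    \<comment> \<open>The subtracted square takes care of the cubic term 4 a u^3; the linear term
      vanishes on integration because \<open>u\<close> has mean 0.\<close>
    have e: "(a + u x)^4 = a^4 + 4 * a^3 * u x + 8 * a\<^sup>2 * (u x)\<^sup>2 + 3 * (u x)^4 - 2 * (u x)\<^sup>2 * (a - u x)\<^sup>2"
      by algebra
    have "(u x)^4 \<le> (D * (mehler_sq x - 1))\<^sup>2"
      using power_mono[OF u2 zero_le_power2, of x 2] by simp
    also have "\<dots> = D\<^sup>2 * ((mehler_sq x)\<^sup>2 - 2 * mehler_sq x + 1)"
      by (simp add: power_mult_distrib power2_diff)
    finally have 4: "(u x)^4 \<le> D\<^sup>2 * ((mehler_sq x)\<^sup>2 - 2 * mehler_sq x + 1)" .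
    have "8 * a\<^sup>2 * (u x)\<^sup>2 \<le> 8 * a\<^sup>2 * (D * (mehler_sq x - 1))" using u2[of x] by (intro mult_left_mono) auto
    moreover have "0 \<le> 2 * (u x)\<^sup>2 * (a - u x)\<^sup>2" by simp
    ultimately show ?thesis unfolding n e using 4 by linarith
  qed
  have "(\<integral>x. (noise1 h x)^4 \<partial>nrm) \<le> (\<integral>x. a^4 + 4 * a^3 * u x + 8 * a\<^sup>2 * (D * (mehler_sq x - 1)) + 3 * (D\<^sup>2 * ((mehler_sq x)\<^sup>2 - 2 * mehler_sq x + 1)) \<partial>nrm)"
  proof (rule integral_mono[OF _ _ quart])
    have "\<bar>(noise1 h x)^4\<bar> \<le> B^4" for x
      using power_mono[OF noise1_bound[of h B x, OF h] abs_ge_zero, of 4] by simp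
    then show "integrable nrm (\<lambda>x. (noise1 h x)^4)" by (rule nrm_bounded_integrable[rotated]) simp
    show "integrable nrm (\<lambda>x. a^4 + 4 * a^3 * u x + 8 * a\<^sup>2 * (D * (mehler_sq x - 1)) + 3 * (D\<^sup>2 * ((mehler_sq x)\<^sup>2 - 2 * mehler_sq x + 1)))"
      using iu iK by simp
  qed
  also have "\<dots> = a^4 + 8 * a\<^sup>2 * (D * (16 / 15 - 1)) + 3 * (D\<^sup>2 * (\<integral>x. (mehler_sq x)\<^sup>2 - 2 * mehler_sq x + 1 \<partial>nrm))"
    using iu iK u_mean by (simp add: nrm_UNIV)
  also have "\<dots> \<le> (a\<^sup>2 + D)\<^sup>2"
  proof -
    have "D\<^sup>2 * (\<integral>x. (mehler_sq x)\<^sup>2 - 2 * mehler_sq x + 1 \<partial>nrm) \<le> D\<^sup>2 * (1 / 3)"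
      by (rule mult_left_mono[OF K2]) simp
    moreover have "8 * a\<^sup>2 * (D * (16 / 15 - 1)) = 8 / 15 * (a\<^sup>2 * D)" by simp
    moreover have "0 \<le> a\<^sup>2 * D" using D0 by simp
    moreover have "(a\<^sup>2 + D)\<^sup>2 = a^4 + 2 * (a\<^sup>2 * D) + D\<^sup>2" by algebra
    ultimately show ?thesis by linarith
  qed
  finally show ?thesis unfolding D_eq by simp
qed

text \<open>Hoelder's inequality with exponents 4/3 and 4 reduces the pairing to the fourth moment
  of the noised function \<open>h = sqrt H\<close>, whose second moment is the integral of
  \<open>H\<close>.\<close>

lemma hyper_1d:
  fixes G H :: "real \<Rightarrow> real"
  assumes [measurable]: "G \<in> borel_measurable borel" "H \<in> borel_measurable borel"
    and G: "\<And>x. 0 \<le> G x" "\<And>x. G x \<le> B" and H: "\<And>x. 0 \<le> H x" "\<And>x. H x \<le> B"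
  shows "(\<integral>x. \<integral>y. G x powr (3/4) * sqrt (H (x / 4 + sqrt 15 / 4 * y)) \<partial>nrm \<partial>nrm) \<le> (\<integral>x. G x \<partial>nrm) powr (3/4) * sqrt (\<integral>x. H x \<partial>nrm)"
proof -
  define h where "h x = sqrt (H x)" for x
  have [measurable]: "h \<in> borel_measurable borel" unfolding h_def[abs_def] by measurable
  have hB: "\<bar>h x\<bar> \<le> sqrt B" for x using H by (simp add: h_def)
  have n0: "0 \<le> noise1 h x" for x unfolding noise1_def h_def using H by simp
  have n4: "\<bar>(noise1 h x)^4\<bar> \<le> (sqrt B)^4" for x
    using power_mono[OF noise1_bound[of h "sqrt B" x, OF hB] abs_ge_zero, of 4] by simp
  have i4: "integrable nrm (\<lambda>x. (noise1 h x)^4)" by (rule nrm_bounded_integrable[OF _ n4]) simp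
  have iG: "integrable nrm G" using G by (intro nrm_bounded_integrable[where B = B]) auto
  have p4: "(z^4) powr (1/4) = z" if "0 \<le> z" for z :: real
  proof (cases "z = 0")
    case False
    then show ?thesis using that powr_powr[of z 4 "1/4"] by (simp add: powr_numeral)
  qed simp
  have "(\<integral>x. \<integral>y. G x powr (3/4) * sqrt (H (x / 4 + sqrt 15 / 4 * y)) \<partial>nrm \<partial>nrm) = (\<integral>x. G x powr (3/4) * ((noise1 h x)^4) powr (1 - 3/4) \<partial>nrm)"
    using p4[OF n0] by (simp add: noise1_def h_def)
  also have "\<dots> \<le> (\<integral>x. G x \<partial>nrm) powr (3/4) * (\<integral>x. (noise1 h x)^4 \<partial>nrm) powr (1 - 3/4)"
    using G by (intro integral_Holder(2)[OF iG i4]) auto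
  also have "\<dots> \<le> (\<integral>x. G x \<partial>nrm) powr (3/4) * ((\<integral>x. (h x)\<^sup>2 \<partial>nrm)\<^sup>2) powr (1 - 3/4)"
    using noise1_four_norm[OF _ hB] by (intro mult_left_mono powr_mono2) auto
  also have "((\<integral>x. (h x)\<^sup>2 \<partial>nrm)\<^sup>2) powr (1 - 3/4) = sqrt (\<integral>x. H x \<partial>nrm)"
  proof -
    define w where "w = (\<integral>x. H x \<partial>nrm)"
    have w0: "0 \<le> w" unfolding w_def using H by simp
    have "(\<integral>x. (h x)\<^sup>2 \<partial>nrm) = w" using H by (simp add: h_def w_def)
    moreover have "(w\<^sup>2) powr (1/4) = sqrt w"
    proof -
      have "(sqrt w)^4 = ((sqrt w)\<^sup>2)\<^sup>2" by (simp flip: power_mult)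
      then show ?thesis using p4[of "sqrt w"] w0 by simp
    qed
    ultimately show ?thesis by (simp add: w_def)
  qed
  finally show ?thesis .
qed

section \<open>The dual inequality on the path space and its stability under rank-one
  updates\<close>

definition mix4 :: "('t \<Rightarrow> real) \<Rightarrow> ('t \<Rightarrow> real) \<Rightarrow> 't \<Rightarrow> real" where
  "mix4 x y t = x t / 4 + sqrt 15 / 4 * y t"

definition shift_by :: "('t \<Rightarrow> real) \<Rightarrow> ('t \<Rightarrow> real) \<Rightarrow> real \<Rightarrow> 't \<Rightarrow> real" where
  "shift_by d x z t = x t + z * d t"

text \<open>Hypercontractivity at correlation \<open>1/4\<close> in dual form.  For the exponents \<open>4/3\<close> and \<open>2\<close> it
  holds up to correlation \<open>1 / sqrt 3\<close>; the smaller value admits an elementary proof.\<close>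

definition hypercontractive :: "('t \<Rightarrow> real) measure \<Rightarrow> bool" where
  "hypercontractive \<nu> \<longleftrightarrow> (\<forall>G H B. G \<in> borel_measurable path_space \<longrightarrow> H \<in> borel_measurable path_space \<longrightarrow>
     (\<forall>x. 0 \<le> G x \<and> G x \<le> B \<and> 0 \<le> H x \<and> H x \<le> B) \<longrightarrow>
     (\<integral>x. \<integral>y. G x powr (3/4) * sqrt (H (mix4 x y)) \<partial>\<nu> \<partial>\<nu>) \<le> (\<integral>x. G x \<partial>\<nu>) powr (3/4) * sqrt (\<integral>x. H x \<partial>\<nu>))"

lemma hypercontractiveD:
  assumes "hypercontractive \<nu>" "G \<in> borel_measurable path_space" "H \<in> borel_measurable path_space"
    "\<And>x. 0 \<le> G x" "\<And>x. G x \<le> B" "\<And>x. 0 \<le> H x" "\<And>x. H x \<le> B"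
  shows "(\<integral>x. \<integral>y. G x powr (3/4) * sqrt (H (mix4 x y)) \<partial>\<nu> \<partial>\<nu>) \<le> (\<integral>x. G x \<partial>\<nu>) powr (3/4) * sqrt (\<integral>x. H x \<partial>\<nu>)"
  using assms unfolding hypercontractive_def by blast

lemma measurable_mix4: "(\<lambda>p. mix4 (fst p) (snd p)) \<in> measurable (path_space \<Otimes>\<^sub>M path_space) path_space"
  unfolding mix4_def[abs_def] by (rule measurable_into_path_space) measurable

lemma measurable_shift_by: "(\<lambda>p. shift_by d (fst p) (snd p)) \<in> measurable (path_space \<Otimes>\<^sub>M borel) path_space"
  unfolding shift_by_def[abs_def] by (rule measurable_into_path_space) measurable

lemma mix4_shift_by: "mix4 (shift_by d x z) (shift_by d y z') = shift_by d (mix4 x y) (z / 4 + sqrt 15 / 4 * z')"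
  by (simp add: mix4_def shift_by_def fun_eq_iff field_simps)

lemma prob_integral_bound:
  fixes f :: "'a \<Rightarrow> real"
  assumes "prob_space M" and b: "\<And>x. \<bar>f x\<bar> \<le> B"
  shows "\<bar>\<integral>x. f x \<partial>M\<bar> \<le> B"
proof -
  interpret prob_space M by fact
  show ?thesis
  proof (cases "integrable M f")
    case True
    have "\<bar>\<integral>x. f x \<partial>M\<bar> \<le> (\<integral>x. \<bar>f x\<bar> \<partial>M)" by simp
    also have "\<dots> \<le> (\<integral>x. B \<partial>M)" using True b by (intro integral_mono) auto
    finally show ?thesis by (simp add: prob_space)
  next
    case False
    then show ?thesis using b[of undefined] abs_ge_zero[of "f undefined"] by (simp add: not_integrable_integral_eq)
  qed
qed

lemma hypercontractive_return: "hypercontractive (return path_space (\<lambda>_. 0))"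
  unfolding hypercontractive_def
proof (intro allI impI)
  fix G H :: "('a \<Rightarrow> real) \<Rightarrow> real" and B :: real
  assume [measurable]: "G \<in> borel_measurable path_space" "H \<in> borel_measurable path_space"
  have [measurable]: "(\<lambda>y. mix4 (\<lambda>_. 0) y) \<in> measurable path_space path_space"
    unfolding mix4_def[abs_def] by (rule measurable_into_path_space) measurable
  have m: "(\<lambda>p. G (fst p) powr (3/4) * sqrt (H (mix4 (fst p) (snd p)))) \<in> borel_measurable (path_space \<Otimes>\<^sub>M path_space)"
    using measurable_compose[OF measurable_mix4 \<open>H \<in> _\<close>] by measurable
  interpret R: prob_space "return path_space (\<lambda>_. 0 :: real)"
    by (rule prob_space_return) (simp add: space_path_space)
  have 0: "(\<lambda>_. 0) \<in> space path_space" by (simp add: space_path_space)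
  have m2: "(\<lambda>x. \<integral>y. G x powr (3/4) * sqrt (H (mix4 x y)) \<partial>return path_space (\<lambda>_. 0)) \<in> borel_measurable path_space"
    using m by (intro R.borel_measurable_lebesgue_integral) (simp add: split_beta cong: measurable_cong_sets)
  have z: "mix4 (\<lambda>_. 0) (\<lambda>_. 0) = (\<lambda>_. 0 :: real)" by (simp add: mix4_def fun_eq_iff)
  have "(\<integral>x. \<integral>y. G x powr (3/4) * sqrt (H (mix4 x y)) \<partial>return path_space (\<lambda>_. 0) \<partial>return path_space (\<lambda>_. 0)) = G (\<lambda>_. 0) powr (3/4) * sqrt (H (\<lambda>_. 0))"
    using m2 by (simp add: integral_return 0 z)
  then show "(\<integral>x. \<integral>y. G x powr (3/4) * sqrt (H (mix4 x y)) \<partial>return path_space (\<lambda>_. 0) \<partial>return path_space (\<lambda>_. 0))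
     \<le> (\<integral>x. G x \<partial>return path_space (\<lambda>_. 0)) powr (3/4) * sqrt (\<integral>x. H x \<partial>return path_space (\<lambda>_. 0))"
    by (simp add: integral_return 0)
qed

lemma nrm_cos: "(\<integral>z. cos (s * z) \<partial>nrm) = exp (- s\<^sup>2 / 2)" and nrm_sin: "(\<integral>z. sin (s * z) \<partial>nrm) = 0"
proof -
  have i: "integrable nrm (\<lambda>z. cos (s * z))" "integrable nrm (\<lambda>z. sin (s * z))"
    by (auto intro!: nrm_bounded_integrable[where B = 1])
  have "char nrm s = (\<integral>z. (of_real (cos (s * z)) + \<i> * of_real (sin (s * z))) \<partial>nrm)"
    unfolding char_def by (intro Bochner_Integration.integral_cong) (auto simp: cis_conv_exp[symmetric] complex_eq_iff simp del: of_real_mult)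
  also have "\<dots> = of_real (\<integral>z. cos (s * z) \<partial>nrm) + \<i> * of_real (\<integral>z. sin (s * z) \<partial>nrm)"
    using i by (subst Bochner_Integration.integral_add) auto
  finally have "of_real (exp (- s\<^sup>2 / 2)) = of_real (\<integral>z. cos (s * z) \<partial>nrm) + \<i> * of_real (\<integral>z. sin (s * z) \<partial>nrm)"
    by (simp only: char_std_normal_distribution)
  then have "Re (of_real (exp (- s\<^sup>2 / 2))) = Re (of_real (\<integral>z. cos (s * z) \<partial>nrm) + \<i> * of_real (\<integral>z. sin (s * z) \<partial>nrm))"
    and "Im (of_real (exp (- s\<^sup>2 / 2))) = Im (of_real (\<integral>z. cos (s * z) \<partial>nrm) + \<i> * of_real (\<integral>z. sin (s * z) \<partial>nrm))"
    by (simp_all only:)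
  then show "(\<integral>z. cos (s * z) \<partial>nrm) = exp (- s\<^sup>2 / 2)" "(\<integral>z. sin (s * z) \<partial>nrm) = 0"
    by (simp_all only: complex.sel plus_complex.sel Re_complex_of_real Im_complex_of_real times_complex.sel imaginary_unit.sel)
qed

text \<open>A rank-one Gaussian update: an independent standard normal multiple of the path
  \<open>d\<close> is added. The centred Gaussian laws on finitely many sites arise from a point
  mass by finitely many such updates.\<close>

definition add_normal :: "('t \<Rightarrow> real) \<Rightarrow> ('t \<Rightarrow> real) measure \<Rightarrow> ('t \<Rightarrow> real) measure" where
  "add_normal d \<nu> = distr (\<nu> \<Otimes>\<^sub>M nrm) path_space (\<lambda>p. shift_by d (fst p) (snd p))"

context
  fixes \<nu> :: "('t \<Rightarrow> real) measure" and d :: "'t \<Rightarrow> real"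
  assumes prob: "prob_space \<nu>" and sets_nu[measurable_cong]: "sets \<nu> = sets path_space"
begin

interpretation prob_space \<nu> by (rule prob)

lemma measurable_shift_nu [measurable]: "(\<lambda>p. shift_by d (fst p) (snd p)) \<in> measurable (\<nu> \<Otimes>\<^sub>M nrm) path_space"
  using measurable_shift_by by (simp add: measurable_cong_sets[OF sets_pair_measure_cong[OF sets_nu] refl, of nrm borel])

lemma prob_space_add_normal: "prob_space (add_normal d \<nu>)"
proof -
  interpret P: pair_prob_space \<nu> nrm ..
  show ?thesis unfolding add_normal_def by (rule P.prob_space_distr) simp
qed

lemma sets_add_normal: "sets (add_normal d \<nu>) = sets path_space"
  by (simp add: add_normal_def)

lemma integral_add_normal:
  fixes F :: "('t \<Rightarrow> real) \<Rightarrow> real"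
  assumes [measurable]: "F \<in> borel_measurable path_space" and b: "\<And>x. \<bar>F x\<bar> \<le> B"
  shows "(\<integral>x. F x \<partial>add_normal d \<nu>) = (\<integral>z. \<integral>x. F (shift_by d x z) \<partial>\<nu> \<partial>nrm)"
proof -
  have m: "(\<lambda>p. F (shift_by d (fst p) (snd p))) \<in> borel_measurable (\<nu> \<Otimes>\<^sub>M nrm)"
    by (rule measurable_compose[OF measurable_shift_nu]) simp
  have "(\<integral>x. F x \<partial>add_normal d \<nu>) = (\<integral>p. F (shift_by d (fst p) (snd p)) \<partial>(\<nu> \<Otimes>\<^sub>M nrm))"
    unfolding add_normal_def by (rule integral_distr) simp_all
  also have "\<dots> = (\<integral>x. \<integral>z. F (shift_by d x z) \<partial>nrm \<partial>\<nu>)"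
    by (rule Fubini_bounded(2)[OF prob nrm.prob_space_axioms m b])
  also have "\<dots> = (\<integral>z. \<integral>x. F (shift_by d x z) \<partial>\<nu> \<partial>nrm)"
    by (rule Fubini_bounded(1)[OF prob nrm.prob_space_axioms m b])
  finally show ?thesis .
qed

text \<open>Tensorization. At fixed normal variables \<open>z\<close> and \<open>z'\<close> the
  inequality for \<nu> bounds the inner integrals by a power of \<open>g z\<close> and a root of
  \<open>k (z / 4 + sqrt 15 / 4 * z')\<close>; the remaining integral over \<open>z\<close> and
  \<open>z'\<close> is the one-dimensional inequality. The dual form makes this a plain
  iteration.\<close>

lemma hypercontractive_add_normal:
  assumes hyp: "hypercontractive \<nu>"
  shows "hypercontractive (add_normal d \<nu>)"
  unfolding hypercontractive_def
proof (intro allI impI)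
  fix G H :: "('t \<Rightarrow> real) \<Rightarrow> real" and B :: real
  assume mG[measurable]: "G \<in> borel_measurable path_space" and mH[measurable]: "H \<in> borel_measurable path_space"
    and GH: "\<forall>x. 0 \<le> G x \<and> G x \<le> B \<and> 0 \<le> H x \<and> H x \<le> B"
  interpret A: prob_space "add_normal d \<nu>" by (rule prob_space_add_normal)
  have GB: "\<bar>G x\<bar> \<le> B" "\<bar>H x\<bar> \<le> B" for x using GH by auto
  define C where "C = B powr (3/4) * sqrt B"
  define \<Phi> where "\<Phi> x y = G x powr (3/4) * sqrt (H (mix4 x y))" for x y
  have \<Phi>0: "0 \<le> \<Phi> x y" for x y unfolding \<Phi>_def using GH by simp
  have \<Phi>C: "\<bar>\<Phi> x y\<bar> \<le> C" for x y
  proof -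
    have "\<Phi> x y \<le> C" unfolding \<Phi>_def C_def using GH by (intro mult_mono powr_mono2 real_sqrt_le_mono) auto
    then show ?thesis using \<Phi>0 by simp
  qed
  have m\<Phi>: "(\<lambda>p. \<Phi> (fst p) (snd p)) \<in> borel_measurable (path_space \<Otimes>\<^sub>M path_space)"
    unfolding \<Phi>_def using measurable_compose[OF measurable_mix4 mH] by measurable
  let ?a = "shift_by d"
  have mQ: "(\<lambda>q. \<Phi> (?a (snd (fst q)) (fst (fst (fst q)))) (?a (snd q) (snd (fst (fst q))))) \<in> borel_measurable (((borel \<Otimes>\<^sub>M borel) \<Otimes>\<^sub>M path_space) \<Otimes>\<^sub>M path_space)"
  proof -
    have 1: "(\<lambda>q. ?a (snd (fst q)) (fst (fst (fst q)))) \<in> measurable (((borel \<Otimes>\<^sub>M borel) \<Otimes>\<^sub>M path_space) \<Otimes>\<^sub>M path_space) path_space"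
      using measurable_compose[OF _ measurable_shift_by, of "\<lambda>q. (snd (fst q), fst (fst (fst q)))" "((borel \<Otimes>\<^sub>M borel) \<Otimes>\<^sub>M path_space) \<Otimes>\<^sub>M path_space"] by simp
    have 2: "(\<lambda>q. ?a (snd q) (snd (fst (fst q)))) \<in> measurable (((borel \<Otimes>\<^sub>M borel) \<Otimes>\<^sub>M path_space) \<Otimes>\<^sub>M path_space) path_space"
      using measurable_compose[OF _ measurable_shift_by, of "\<lambda>q. (snd q, snd (fst (fst q)))" "((borel \<Otimes>\<^sub>M borel) \<Otimes>\<^sub>M path_space) \<Otimes>\<^sub>M path_space"] by simp
    show ?thesis using measurable_compose[OF measurable_Pair[OF 1 2] m\<Phi>] by simp
  qed
  define V where "V z z' x = (\<integral>y. \<Phi> (?a x z) (?a y z') \<partial>\<nu>)" for z z' x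
  have mV: "(\<lambda>r. V (fst (fst r)) (snd (fst r)) (snd r)) \<in> borel_measurable ((borel \<Otimes>\<^sub>M borel) \<Otimes>\<^sub>M path_space)"
    unfolding V_def using mQ by (intro borel_measurable_lebesgue_integral) (simp add: split_beta)
  define W where "W z z' = (\<integral>x. V z z' x \<partial>\<nu>)" for z z'
  have mW: "(\<lambda>r. W (fst r) (snd r)) \<in> borel_measurable (borel \<Otimes>\<^sub>M borel)"
    unfolding W_def using mV by (intro borel_measurable_lebesgue_integral) (simp add: split_beta)
  have VC: "\<bar>V z z' x\<bar> \<le> C" for z z' x unfolding V_def by (rule prob_integral_bound[OF prob \<Phi>C])
  have WC: "\<bar>W z z'\<bar> \<le> C" for z z' unfolding W_def by (rule prob_integral_bound[OF prob VC])
  have sec: "\<Phi> x \<in> borel_measurable path_space" for x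
    using measurable_Pair2[OF m\<Phi>, of x] by (simp add: space_path_space)
  have F2: "(\<integral>y. \<Phi> x y \<partial>add_normal d \<nu>) = (\<integral>z'. \<integral>y. \<Phi> x (?a y z') \<partial>\<nu> \<partial>nrm)" for x
    by (rule integral_add_normal[OF sec \<Phi>C])
  have mF2: "(\<lambda>x. \<integral>y. \<Phi> x y \<partial>add_normal d \<nu>) \<in> borel_measurable path_space"
    using m\<Phi> by (intro A.borel_measurable_lebesgue_integral) (simp add: split_beta measurable_cong_sets[OF sets_pair_measure_cong[OF refl sets_add_normal] refl])
  have "(\<integral>x. \<integral>y. \<Phi> x y \<partial>add_normal d \<nu> \<partial>add_normal d \<nu>) = (\<integral>z. \<integral>x. (\<integral>y. \<Phi> (?a x z) y \<partial>add_normal d \<nu>) \<partial>\<nu> \<partial>nrm)"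
    by (rule integral_add_normal[OF mF2 prob_integral_bound[OF prob_space_add_normal \<Phi>C]])
  also have "\<dots> = (\<integral>z. \<integral>x. \<integral>z'. V z z' x \<partial>nrm \<partial>\<nu> \<partial>nrm)"
    unfolding F2 V_def ..
  also have "\<dots> = (\<integral>z. \<integral>z'. W z z' \<partial>nrm \<partial>nrm)"
  proof -
    have "(\<integral>x. \<integral>z'. V z z' x \<partial>nrm \<partial>\<nu>) = (\<integral>z'. W z z' \<partial>nrm)" for z
    proof -
      have "(\<lambda>p. V (fst (fst ((z, snd p), fst p))) (snd (fst ((z, snd p), fst p))) (snd ((z, snd p), fst p))) \<in> borel_measurable (path_space \<Otimes>\<^sub>M borel)"
        by (rule measurable_compose[OF _ mV]) measurable
      then have "(\<lambda>p. V z (snd p) (fst p)) \<in> borel_measurable (\<nu> \<Otimes>\<^sub>M nrm)"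
        by (simp add: measurable_cong_sets[OF sets_pair_measure_cong[OF sets_nu] refl, of nrm borel])
      then show ?thesis unfolding W_def by (rule Fubini_bounded(1)[OF prob nrm.prob_space_axioms _ VC])
    qed
    then show ?thesis by simp
  qed
  also have "\<dots> \<le> (\<integral>z. \<integral>z'. (\<integral>x. G (?a x z) \<partial>\<nu>) powr (3/4) * sqrt (\<integral>x. H (?a x (z / 4 + sqrt 15 / 4 * z')) \<partial>\<nu>) \<partial>nrm \<partial>nrm)"
  proof -
    define g where "g z = (\<integral>x. G (?a x z) \<partial>\<nu>)" for z
    define k where "k z = (\<integral>x. H (?a x z) \<partial>\<nu>)" for z
    have sw: "(\<lambda>p. F (?a (snd p) (fst p))) \<in> borel_measurable (borel \<Otimes>\<^sub>M path_space)" if F: "F \<in> borel_measurable path_space" for F :: "_ \<Rightarrow> real"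
      using measurable_compose[OF measurable_compose[OF _ measurable_shift_by] F, of "\<lambda>p. (snd p, fst p)"] by simp
    have [measurable]: "g \<in> borel_measurable borel" "k \<in> borel_measurable borel"
      unfolding g_def[abs_def] k_def[abs_def] using sw[OF mG] sw[OF mH] by (auto intro!: borel_measurable_lebesgue_integral simp: split_beta)
    have gb: "0 \<le> g z" "\<bar>g z\<bar> \<le> B" "0 \<le> k z" "\<bar>k z\<bar> \<le> B" for z
      unfolding g_def k_def by (rule Bochner_Integration.integral_nonneg prob_integral_bound[OF prob GB(1)] prob_integral_bound[OF prob GB(2)]; use GH in simp)+
    have gb': "g z \<le> B" "k z \<le> B" for z using gb(2,4)[of z] by auto
    \<comment> \<open>Mixing acts on each component separately, see \<open>mix4_shift_by\<close>, so
      for fixed shifts both functions are translates and \<nu> alone is integrated.\<close>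
    have le: "W z z' \<le> g z powr (3/4) * sqrt (k (z / 4 + sqrt 15 / 4 * z'))" for z z'
    proof -
      have s: "(\<lambda>x. F (?a x z)) \<in> borel_measurable path_space" if F: "F \<in> borel_measurable path_space" for F :: "_ \<Rightarrow> real" and z
        using measurable_compose[OF measurable_compose[OF _ measurable_shift_by] F, of "\<lambda>x. (x, z)"] by simp
      show ?thesis
        unfolding W_def V_def \<Phi>_def g_def k_def mix4_shift_by
        using GH by (intro hypercontractiveD[OF hyp s[OF mG] s[OF mH], where B = B]) auto
    qed
    define R where "R z z' = g z powr (3/4) * sqrt (k (z / 4 + sqrt 15 / 4 * z'))" for z z'
    have RC: "\<bar>R z z'\<bar> \<le> C" for z z'
    proof -
      have "R z z' \<le> C" unfolding R_def C_def using gb gb' by (intro mult_mono powr_mono2 real_sqrt_le_mono) auto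
      moreover have "0 \<le> R z z'" unfolding R_def using gb by simp
      ultimately show ?thesis by simp
    qed
    have mR: "(\<lambda>r. R (fst r) (snd r)) \<in> borel_measurable (borel \<Otimes>\<^sub>M borel)"
      unfolding R_def by measurable
    have int: "integrable nrm (Q z)" "integrable nrm (\<lambda>z. \<integral>z'. Q z z' \<partial>nrm)"
      if mQ: "(\<lambda>r. Q (fst r) (snd r)) \<in> borel_measurable (borel \<Otimes>\<^sub>M borel)" and QC: "\<And>z z'. \<bar>Q z z'\<bar> \<le> C" for Q :: "real \<Rightarrow> real \<Rightarrow> real" and z
    proof -
      have "(\<lambda>z'. Q (fst (z, z')) (snd (z, z'))) \<in> borel_measurable borel"
        by (rule measurable_Pair2[OF mQ]) simp
      then show "integrable nrm (Q z)" using QC by (intro nrm_bounded_integrable[where B = C]) auto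
      have "(\<lambda>z. \<integral>z'. Q z z' \<partial>nrm) \<in> borel_measurable borel"
        using mQ by (intro nrm.borel_measurable_lebesgue_integral) (simp add: split_beta)
      then show "integrable nrm (\<lambda>z. \<integral>z'. Q z z' \<partial>nrm)"
        using prob_integral_bound[OF nrm.prob_space_axioms QC] by (intro nrm_bounded_integrable[where B = C]) auto
    qed
    have "(\<integral>z. \<integral>z'. W z z' \<partial>nrm \<partial>nrm) \<le> (\<integral>z. \<integral>z'. R z z' \<partial>nrm \<partial>nrm)"
      using le by (intro integral_mono int mW WC mR RC) (auto simp: R_def)
    then show ?thesis unfolding R_def g_def k_def .
  qed
  also have "\<dots> \<le> (\<integral>z. \<integral>x. G (?a x z) \<partial>\<nu> \<partial>nrm) powr (3/4) * sqrt (\<integral>z. \<integral>x. H (?a x z) \<partial>\<nu> \<partial>nrm)"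
  proof (rule hyper_1d[where B = B])
    have sw: "(\<lambda>p. F (?a (snd p) (fst p))) \<in> borel_measurable (borel \<Otimes>\<^sub>M path_space)" if F: "F \<in> borel_measurable path_space" for F :: "_ \<Rightarrow> real"
      using measurable_compose[OF measurable_compose[OF _ measurable_shift_by] F, of "\<lambda>p. (snd p, fst p)"] by simp
    show "(\<lambda>z. \<integral>x. G (?a x z) \<partial>\<nu>) \<in> borel_measurable borel" "(\<lambda>z. \<integral>x. H (?a x z) \<partial>\<nu>) \<in> borel_measurable borel"
      using sw[OF mG] sw[OF mH] by (auto intro!: borel_measurable_lebesgue_integral simp: split_beta)
    have "\<bar>\<integral>x. G (?a x z) \<partial>\<nu>\<bar> \<le> B" "\<bar>\<integral>x. H (?a x z) \<partial>\<nu>\<bar> \<le> B" for z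
      by (rule prob_integral_bound[OF prob GB(1)] prob_integral_bound[OF prob GB(2)])+
    then show "(\<integral>x. G (?a x z) \<partial>\<nu>) \<le> B" "(\<integral>x. H (?a x z) \<partial>\<nu>) \<le> B" for z by (auto dest: abs_le_D1)
    show "0 \<le> (\<integral>x. G (?a x z) \<partial>\<nu>)" "0 \<le> (\<integral>x. H (?a x z) \<partial>\<nu>)" for z using GH by auto
  qed
  also have "\<dots> = (\<integral>x. G x \<partial>add_normal d \<nu>) powr (3/4) * sqrt (\<integral>x. H x \<partial>add_normal d \<nu>)"
    using GH by (subst (1 2) integral_add_normal[where B = B]) auto
  finally show "(\<integral>x. \<integral>y. G x powr (3/4) * sqrt (H (mix4 x y)) \<partial>add_normal d \<nu> \<partial>add_normal d \<nu>)
    \<le> (\<integral>x. G x \<partial>add_normal d \<nu>) powr (3/4) * sqrt (\<integral>x. H x \<partial>add_normal d \<nu>)"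
    unfolding \<Phi>_def .
qed

lemma char_add_normal:
  assumes K: "finite K" 
    and c: "(\<integral>x. cos (\<Sum>t\<in>K. a t * x t) \<partial>\<nu>) = exp (- q / 2)" and s: "(\<integral>x. sin (\<Sum>t\<in>K. a t * x t) \<partial>\<nu>) = 0"
  shows "(\<integral>x. cos (\<Sum>t\<in>K. a t * x t) \<partial>add_normal d \<nu>) = exp (- (q + (\<Sum>t\<in>K. a t * d t)\<^sup>2) / 2)"
    and "(\<integral>x. sin (\<Sum>t\<in>K. a t * x t) \<partial>add_normal d \<nu>) = 0"
proof -
  define e where "e = (\<Sum>t\<in>K. a t * d t)"
  define S where "S x = (\<Sum>t\<in>K. a t * x t)" for x :: "'t \<Rightarrow> real"
  have [measurable]: "S \<in> borel_measurable path_space" "S \<in> borel_measurable \<nu>" unfolding S_def by measurable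
  have sh: "S (shift_by d x z) = S x + e * z" for x z
    unfolding S_def e_def shift_by_def sum_distrib_right sum.distrib[symmetric] by (intro sum.cong) (auto simp: algebra_simps)
  have i: "integrable \<nu> (\<lambda>x. cos (S x))" "integrable \<nu> (\<lambda>x. sin (S x))"
    by (auto intro!: integrable_const_bound[where B = 1])
  have "(\<integral>x. cos (S x) \<partial>add_normal d \<nu>) = (\<integral>z. \<integral>x. cos (S (shift_by d x z)) \<partial>\<nu> \<partial>nrm)"
    by (rule integral_add_normal[where B = 1]) auto
  also have "\<dots> = (\<integral>z. exp (- q / 2) * cos (e * z) \<partial>nrm)"
    using i c s unfolding sh cos_add by (simp add: S_def[symmetric])
  also have "\<dots> = exp (- (q + e\<^sup>2) / 2)"
    unfolding integral_mult_right_zero nrm_cos by (simp add: exp_add[symmetric] add_divide_distrib[symmetric] diff_divide_distrib)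
  finally show "(\<integral>x. cos (\<Sum>t\<in>K. a t * x t) \<partial>add_normal d \<nu>) = exp (- (q + (\<Sum>t\<in>K. a t * d t)\<^sup>2) / 2)"
    unfolding S_def e_def .
  have "(\<integral>x. sin (S x) \<partial>add_normal d \<nu>) = (\<integral>z. \<integral>x. sin (S (shift_by d x z)) \<partial>\<nu> \<partial>nrm)"
    by (rule integral_add_normal[where B = 1]) auto
  also have "\<dots> = (\<integral>z. exp (- q / 2) * sin (e * z) \<partial>nrm)"
    using i c s unfolding sh sin_add by (simp add: S_def[symmetric])
  also have "\<dots> = 0" unfolding integral_mult_right_zero nrm_sin by simp
  finally show "(\<integral>x. sin (\<Sum>t\<in>K. a t * x t) \<partial>add_normal d \<nu>) = 0"
    unfolding S_def .
qed

end

section \<open>Gaussian laws on finitely many sites from a Cholesky factorisation\<close>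

definition quad :: "'t set \<Rightarrow> ('t \<Rightarrow> 't \<Rightarrow> real) \<Rightarrow> ('t \<Rightarrow> real) \<Rightarrow> real" where
  "quad T \<Gamma> b = (\<Sum>s\<in>T. \<Sum>t\<in>T. b s * b t * \<Gamma> s t)"

lemma quad_cong: "(\<And>t. t \<in> T \<Longrightarrow> b t = c t) \<Longrightarrow> quad T \<Gamma> b = quad T \<Gamma> c"
  unfolding quad_def by (intro sum.cong) auto

lemma quad_insert:
  assumes T: "finite T" "j \<notin> T" and sym: "\<And>s t. \<Gamma> s t = \<Gamma> t s"
  shows "quad (insert j T) \<Gamma> b = (b j)\<^sup>2 * \<Gamma> j j + 2 * b j * (\<Sum>t\<in>T. b t * \<Gamma> j t) + quad T \<Gamma> b"
proof -
  have "quad (insert j T) \<Gamma> b = b j * b j * \<Gamma> j j + (\<Sum>t\<in>T. b j * b t * \<Gamma> j t) + ((\<Sum>s\<in>T. b s * b j * \<Gamma> s j) + quad T \<Gamma> b)"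
    unfolding quad_def using T by (simp add: sum.distrib)
  moreover have "(\<Sum>t\<in>T. b j * b t * \<Gamma> j t) = b j * (\<Sum>t\<in>T. b t * \<Gamma> j t)"
    by (simp add: sum_distrib_left mult.assoc)
  moreover have "(\<Sum>s\<in>T. b s * b j * \<Gamma> s j) = b j * (\<Sum>t\<in>T. b t * \<Gamma> j t)"
    unfolding sum_distrib_left using sym[of _ j] by (intro sum.cong) (auto simp: mult_ac)
  ultimately show ?thesis by (simp add: power2_eq_square algebra_simps)
qed

text \<open>Elimination of one site \<open>j\<close>: the Schur complement \<Gamma>' is again
  positive semidefinite, and the rank-one part removed is restored by adding a normal multiple of
  \<open>d\<close>. If \<Gamma> j j = 0, semidefiniteness forces the covariances of \<open>j\<close>
  with \<open>T\<close> to vanish, and the law for \<open>T\<close> serves as it is.\<close>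

lemma exists_hypercontractive:
  fixes \<Gamma> :: "'t \<Rightarrow> 't \<Rightarrow> real"
  assumes "finite T" and "\<And>s t. \<Gamma> s t = \<Gamma> t s" and "\<And>b. 0 \<le> quad T \<Gamma> b"
  shows "\<exists>\<nu>. prob_space \<nu> \<and> sets \<nu> = sets path_space \<and> hypercontractive \<nu> \<and>
    (\<forall>K a. finite K \<longrightarrow>
      (\<integral>x. cos (\<Sum>t\<in>K. a t * x t) \<partial>\<nu>) = exp (- quad T \<Gamma> (\<lambda>t. if t \<in> K then a t else 0) / 2) \<and>
      (\<integral>x. sin (\<Sum>t\<in>K. a t * x t) \<partial>\<nu>) = 0)"
  using assms
proof (induction T arbitrary: \<Gamma> rule: finite_induct)
  case empty
  show ?case
  proof (intro exI[of _ "return path_space (\<lambda>_. 0)"] conjI allI impI)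
    show "prob_space (return path_space (\<lambda>_. 0 :: real))" by (rule prob_space_return) (simp add: space_path_space)
    fix K :: "'t set" and a :: "'t \<Rightarrow> real"
    have 0: "(\<lambda>_. 0) \<in> space path_space" by (simp add: space_path_space)
    show "(\<integral>x. cos (\<Sum>t\<in>K. a t * x t) \<partial>return path_space (\<lambda>_. 0)) = exp (- quad {} \<Gamma> (\<lambda>t. if t \<in> K then a t else 0) / 2)"
      by (subst integral_return[OF 0]) (simp_all add: quad_def)
    show "(\<integral>x. sin (\<Sum>t\<in>K. a t * x t) \<partial>return path_space (\<lambda>_. 0)) = 0"
      by (subst integral_return[OF 0]) simp_all
  qed (simp_all add: hypercontractive_return)
next
  case (insert j T)
  note sym = insert.prems(1) and psd = insert.prems(2)
  note qi = quad_insert[OF insert.hyps(1,2), of \<Gamma>, OF sym]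
  let ?L = "\<lambda>b. \<Sum>t\<in>T. b t * \<Gamma> j t"
  have upd: "?L (b(j := c)) = ?L b" "quad T \<Gamma> (b(j := c)) = quad T \<Gamma> b" for b c
    using insert.hyps(2) by (auto intro!: sum.cong quad_cong)
  have P: "0 \<le> c\<^sup>2 * \<Gamma> j j + 2 * c * ?L b + quad T \<Gamma> b" for b c
    using psd[of "b(j := c)"] unfolding qi upd by simp
  have psdT: "0 \<le> quad T \<Gamma> b" for b using P[of 0 b] by simp
  have jj: "0 \<le> \<Gamma> j j" using P[of 1 "\<lambda>_. 0"] by (simp add: quad_def)
  show ?case
  proof (cases "\<Gamma> j j = 0")
    case True
    have L0: "?L b = 0" for b
    proof (rule ccontr)
      assume "?L b \<noteq> 0"
      \<comment> \<open>With \<Gamma> j j = 0 the polynomial in \<open>P\<close> is affine in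
        \<open>c\<close>, and this \<open>c\<close> gives it the value -1.\<close>
      then show False using P[of "- (quad T \<Gamma> b + 1) / (2 * ?L b)" b] True by (simp add: field_simps)
    qed
    have "quad (insert j T) \<Gamma> b = quad T \<Gamma> b" for b unfolding qi L0 True by simp
    then show ?thesis using insert.IH[OF sym psdT] by simp
  next
    case False
    with jj have jj: "0 < \<Gamma> j j" by simp
    define \<Gamma>' where "\<Gamma>' s t = \<Gamma> s t - \<Gamma> j s * \<Gamma> j t / \<Gamma> j j" for s t
    have q': "quad T \<Gamma>' b = quad T \<Gamma> b - (?L b)\<^sup>2 / \<Gamma> j j" for b
    proof -
      have "(?L b)\<^sup>2 / \<Gamma> j j = (\<Sum>s\<in>T. \<Sum>t\<in>T. b s * b t * (\<Gamma> j s * \<Gamma> j t / \<Gamma> j j))"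
        unfolding power2_eq_square sum_product sum_divide_distrib by (intro sum.cong refl) (simp add: mult_ac)
      then show ?thesis unfolding quad_def \<Gamma>'_def right_diff_distrib sum_subtractf by simp
    qed
    have psd': "0 \<le> quad T \<Gamma>' b" for b
    proof -
      \<comment> \<open>This \<open>c\<close> minimises the quadratic polynomial in
        \<open>P\<close>; the minimum is the Schur complement.\<close>
      have "0 \<le> (- ?L b / \<Gamma> j j)\<^sup>2 * \<Gamma> j j + 2 * (- ?L b / \<Gamma> j j) * ?L b + quad T \<Gamma> b" by (rule P)
      also have "\<dots> = quad T \<Gamma>' b" unfolding q' using jj by (simp add: field_simps power2_eq_square)
      finally show ?thesis .
    qed
    have sym': "\<Gamma>' s t = \<Gamma>' t s" for s t by (simp add: \<Gamma>'_def sym[of s t] mult.commute)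
    from insert.IH[OF sym' psd'] obtain \<nu> where \<nu>: "prob_space \<nu>" "sets \<nu> = sets path_space" "hypercontractive \<nu>"
      and ch: "\<And>K a. finite K \<Longrightarrow> (\<integral>x. cos (\<Sum>t\<in>K. a t * x t) \<partial>\<nu>) = exp (- quad T \<Gamma>' (\<lambda>t. if t \<in> K then a t else 0) / 2)"
        "\<And>K a. finite K \<Longrightarrow> (\<integral>x. sin (\<Sum>t\<in>K. a t * x t) \<partial>\<nu>) = 0" by blast
    define d where "d t = (if t \<in> insert j T then \<Gamma> j t / sqrt (\<Gamma> j j) else 0)" for t
    have qq: "quad T \<Gamma>' (\<lambda>t. if t \<in> K then a t else 0) + (\<Sum>t\<in>K. a t * d t)\<^sup>2 = quad (insert j T) \<Gamma> (\<lambda>t. if t \<in> K then a t else 0)"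
      if K: "finite K" for K a
    proof -
      define b where "b t = (if t \<in> K then a t else 0)" for t
      have "(\<Sum>t\<in>K. a t * d t) = (\<Sum>t\<in>K \<inter> insert j T. a t * d t)"
        using K by (intro sum.mono_neutral_right) (auto simp: d_def)
      also have "\<dots> = (\<Sum>t\<in>insert j T. b t * d t)"
        using insert.hyps(1) by (intro sum.mono_neutral_cong_left) (auto simp: b_def)
      also have "\<dots> = (\<Sum>t\<in>insert j T. b t * \<Gamma> j t / sqrt (\<Gamma> j j))"
        by (intro sum.cong) (auto simp: d_def)
      also have "\<dots> = (b j * \<Gamma> j j + ?L b) / sqrt (\<Gamma> j j)"
        using insert.hyps by (simp add: sum_divide_distrib add_divide_distrib)
      finally have "(\<Sum>t\<in>K. a t * d t)\<^sup>2 = (b j * \<Gamma> j j + ?L b)\<^sup>2 / \<Gamma> j j" using jj by (simp add: power_divide)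
      also have "\<dots> = (b j)\<^sup>2 * \<Gamma> j j + 2 * b j * ?L b + (?L b)\<^sup>2 / \<Gamma> j j"
        using jj by (simp add: field_simps power2_eq_square)
      finally show ?thesis unfolding b_def[symmetric] q' qi by simp
    qed
    show ?thesis
    proof (intro exI[of _ "add_normal d \<nu>"] conjI allI impI)
      show "prob_space (add_normal d \<nu>)" by (rule prob_space_add_normal[OF \<nu>(1,2)])
      show "sets (add_normal d \<nu>) = sets path_space" by (rule sets_add_normal[OF \<nu>(1,2)])
      show "hypercontractive (add_normal d \<nu>)" by (rule hypercontractive_add_normal[OF \<nu>])
      fix K :: "'t set" and a :: "'t \<Rightarrow> real" assume K: "finite K"
      show "(\<integral>x. cos (\<Sum>t\<in>K. a t * x t) \<partial>add_normal d \<nu>) = exp (- quad (insert j T) \<Gamma> (\<lambda>t. if t \<in> K then a t else 0) / 2)"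
        unfolding char_add_normal(1)[OF \<nu>(1,2) K ch(1)[OF K] ch(2)[OF K]] qq[OF K] ..
      show "(\<integral>x. sin (\<Sum>t\<in>K. a t * x t) \<partial>add_normal d \<nu>) = 0"
        by (rule char_add_normal(2)[OF \<nu>(1,2) K ch(1)[OF K] ch(2)[OF K]])
    qed
  qed
qed

definition restr :: "'t set \<Rightarrow> ('t \<Rightarrow> real) \<Rightarrow> 't \<Rightarrow> real" where
  "restr T x t = (if t \<in> T then x t else 0)"

lemma measurable_restr: "restr T \<in> measurable path_space path_space"
proof (rule measurable_into_path_space)
  show "(\<lambda>x. restr T x t) \<in> borel_measurable path_space" for t
    unfolding restr_def by (cases "t \<in> T") simp_all
qed

definition local_fun :: "'t set \<Rightarrow> (('t \<Rightarrow> real) \<Rightarrow> real) \<Rightarrow> bool" where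
  "local_fun T f \<longleftrightarrow> (\<forall>x. f (restr T x) = f x)"

lemma local_funI: "(\<And>x. f (restr T x) = f x) \<Longrightarrow> local_fun T f"
  by (simp add: local_fun_def)

context gaussian_path_law begin

context
  fixes T :: "'t set" assumes T: "finite T"
begin

lemma quad_psd: "0 \<le> quad T \<Gamma> b"
proof -
  have i: "integrable \<mu> (\<lambda>x. x s * x t)" if "s \<in> T" "t \<in> T" for s t
    by (rule integrable_edom[OF T edom_mult[OF edom_coord[OF T that(1)] edom_coord[OF T that(2)]]])
  have "0 \<le> (\<integral>x. (\<Sum>t\<in>T. b t * x t)\<^sup>2 \<partial>\<mu>)" by simp
  also have "\<dots> = (\<integral>x. (\<Sum>s\<in>T. \<Sum>t\<in>T. b s * b t * (x s * x t)) \<partial>\<mu>)"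
    unfolding power2_eq_square sum_product by (intro Bochner_Integration.integral_cong refl sum.cong) (simp add: mult_ac)
  also have "\<dots> = quad T \<Gamma> b"
    unfolding quad_def using i by (simp add: Bochner_Integration.integral_sum cov)
  finally show ?thesis .
qed

text \<open>The law constructed by rank-one updates has the same characteristic functional as the
  restriction of \<mu> to \<open>T\<close>, so the two coincide and the inequality carries
  over.\<close>

lemma hypercontractive_restr: "hypercontractive (distr \<mu> path_space (restr T))"
proof -
  from exists_hypercontractive[OF T cov_sym quad_psd]
  obtain \<nu> where \<nu>: "prob_space \<nu>" "sets \<nu> = sets path_space" "hypercontractive \<nu>"
    and ch: "\<And>K a. finite K \<Longrightarrow> (\<integral>x. cos (\<Sum>t\<in>K. a t * x t) \<partial>\<nu>) = exp (- quad T \<Gamma> (\<lambda>t. if t \<in> K then a t else 0) / 2)"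
      "\<And>K a. finite K \<Longrightarrow> (\<integral>x. sin (\<Sum>t\<in>K. a t * x t) \<partial>\<nu>) = 0"
    by blast
  have m: "restr T \<in> measurable \<mu> path_space"
    using measurable_restr by (simp add: measurable_cong_sets[OF sets_mu refl])
  have "distr \<mu> path_space (restr T) = \<nu>"
  proof (rule path_law_eqI)
    show "prob_space (distr \<mu> path_space (restr T))" by (rule prob_space_distr[OF m])
    fix K :: "'t set" and a :: "'t \<Rightarrow> real" assume K: "finite K"
    have s: "(\<Sum>t\<in>K. a t * restr T x t) = (\<Sum>t\<in>T. (if t \<in> K then a t else 0) * x t)" for x
    proof -
      have "(\<Sum>t\<in>K. a t * restr T x t) = (\<Sum>t\<in>K \<inter> T. a t * x t)"
        using K by (intro sum.mono_neutral_cong_right) (auto simp: restr_def)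
      also have "\<dots> = (\<Sum>t\<in>T. (if t \<in> K then a t else 0) * x t)"
        using T by (intro sum.mono_neutral_cong_left) auto
      finally show ?thesis .
    qed
    have "(\<integral>x. cos (\<Sum>t\<in>K. a t * x t) \<partial>distr \<mu> path_space (restr T)) = (\<integral>x. cos (\<Sum>t\<in>K. a t * restr T x t) \<partial>\<mu>)"
      by (rule integral_distr[OF m]) measurable
    then show "(\<integral>x. cos (\<Sum>t\<in>K. a t * x t) \<partial>distr \<mu> path_space (restr T)) = (\<integral>x. cos (\<Sum>t\<in>K. a t * x t) \<partial>\<nu>)"
      unfolding s cos_char[OF T] ch(1)[OF K] quad_def .
    have "(\<integral>x. sin (\<Sum>t\<in>K. a t * x t) \<partial>distr \<mu> path_space (restr T)) = (\<integral>x. sin (\<Sum>t\<in>K. a t * restr T x t) \<partial>\<mu>)"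
      by (rule integral_distr[OF m]) measurable
    then show "(\<integral>x. sin (\<Sum>t\<in>K. a t * x t) \<partial>distr \<mu> path_space (restr T)) = (\<integral>x. sin (\<Sum>t\<in>K. a t * x t) \<partial>\<nu>)"
      unfolding s sin_char[OF T] ch(2)[OF K] .
  qed (simp_all add: \<nu>)
  then show ?thesis using \<nu>(3) by simp
qed

lemma hyper_local:
  assumes mG: "G \<in> borel_measurable path_space" and mH: "H \<in> borel_measurable path_space"
    and b: "\<And>x. 0 \<le> G x" "\<And>x. G x \<le> B" "\<And>x. 0 \<le> H x" "\<And>x. H x \<le> B"
    and l: "local_fun T G" "local_fun T H"
  shows "(\<integral>p. G (fst p) powr (3/4) * sqrt (H (mix4 (fst p) (snd p))) \<partial>(\<mu> \<Otimes>\<^sub>M \<mu>)) \<le> (\<integral>x. G x \<partial>\<mu>) powr (3/4) * sqrt (\<integral>x. H x \<partial>\<mu>)"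
proof -
  let ?\<nu> = "distr \<mu> path_space (restr T)"
  have m: "restr T \<in> measurable \<mu> path_space"
    using measurable_restr by (simp add: measurable_cong_sets[OF sets_mu refl])
  interpret V: prob_space ?\<nu> by (rule prob_space_distr[OF m])
  define C where "C = B powr (3/4) * sqrt B"
  define \<Phi> where "\<Phi> x y = G x powr (3/4) * sqrt (H (mix4 x y))" for x y
  have \<Phi>C: "\<bar>\<Phi> x y\<bar> \<le> C" for x y
  proof -
    have "\<Phi> x y \<le> C" unfolding \<Phi>_def C_def using b by (intro mult_mono powr_mono2 real_sqrt_le_mono) auto
    moreover have "0 \<le> \<Phi> x y" unfolding \<Phi>_def using b by simp
    ultimately show ?thesis by simp
  qed
  have m\<Phi>: "(\<lambda>p. \<Phi> (fst p) (snd p)) \<in> borel_measurable (path_space \<Otimes>\<^sub>M path_space)"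
    unfolding \<Phi>_def using measurable_compose[OF measurable_mix4 mH] mG by measurable
  have sec: "\<Phi> x \<in> borel_measurable path_space" for x
    using measurable_Pair2[OF m\<Phi>, of x] by (simp add: space_path_space)
  have mI: "(\<lambda>x. \<integral>y. \<Phi> x y \<partial>?\<nu>) \<in> borel_measurable path_space"
    using m\<Phi> by (intro V.borel_measurable_lebesgue_integral) (simp add: split_beta measurable_cong_sets[OF sets_pair_measure_cong[OF refl sets_distr] refl])
  have mr: "mix4 (restr T x) (restr T y) = restr T (mix4 x y)" for x y
    by (auto simp: mix4_def restr_def fun_eq_iff)
  have \<Phi>l: "\<Phi> (restr T x) (restr T y) = \<Phi> x y" for x y
    using l by (simp add: \<Phi>_def mr local_fun_def)
  have "(\<integral>p. \<Phi> (fst p) (snd p) \<partial>(\<mu> \<Otimes>\<^sub>M \<mu>)) = (\<integral>x. \<integral>y. \<Phi> x y \<partial>\<mu> \<partial>\<mu>)"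
    by (rule Fubini_bounded(2)[OF prob_space_axioms prob_space_axioms _ \<Phi>C]) (use m\<Phi> in \<open>simp add: measurable_cong_sets[OF sets_pair refl]\<close>)
  also have "\<dots> = (\<integral>x. \<integral>y. \<Phi> x y \<partial>?\<nu> \<partial>?\<nu>)"
    by (subst integral_distr[OF m mI]) (simp only: integral_distr[OF m sec] \<Phi>l)
  also have "\<dots> \<le> (\<integral>x. G x \<partial>?\<nu>) powr (3/4) * sqrt (\<integral>x. H x \<partial>?\<nu>)"
    unfolding \<Phi>_def by (rule hypercontractiveD[OF hypercontractive_restr mG mH b])
  also have "(\<integral>x. G x \<partial>?\<nu>) = (\<integral>x. G x \<partial>\<mu>)" unfolding integral_distr[OF m mG] using l by (simp add: local_fun_def)
  also have "(\<integral>x. H x \<partial>?\<nu>) = (\<integral>x. H x \<partial>\<mu>)" unfolding integral_distr[OF m mH] using l by (simp add: local_fun_def)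
  finally show ?thesis unfolding \<Phi>_def .
qed

lemma sqrt_1_sixteenth: "sqrt (1 - (1 / 4)\<^sup>2) = sqrt 15 / (4 :: real)"
proof -
  have "(1 - (1 / 4)\<^sup>2 :: real) = 15 / 4\<^sup>2" by (simp add: power2_eq_square)
  then show ?thesis by (simp only: real_sqrt_divide) simp
qed

lemma OU_local: assumes "local_fun T f" shows "local_fun T (OU r f)"
proof (rule local_funI)
  fix x
  have "f (lin r (restr T x) q w) = f (lin r x q w)" for q w
  proof -
    have "restr T (lin r (restr T x) q w) = restr T (lin r x q w)" by (auto simp: restr_def fun_eq_iff)
    then show ?thesis using assms unfolding local_fun_def by metis
  qed
  then show "OU r f (restr T x) = OU r f x" unfolding OU_def by simp
qed

text \<open>Duality: for \<open>v = OU (1/4) h\<close> self-adjointness turns the squared norm of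
  \<open>v\<close> into the pairing of \<open>h\<close> with \<open>OU (1/4) v\<close>. The dual
  inequality, with \<open>h powr (4/3)\<close> and the square of \<open>v\<close>, bounds it by the
  norm of \<open>h\<close> with exponent 4/3 times the L2 norm of \<open>v\<close>, and one factor
  of the latter cancels.\<close>

lemma OU_hypercontractive:
  assumes h: "edom T h" and h0: "\<And>x. 0 \<le> h x" and l: "local_fun T h"
  shows "(\<integral>x. (OU (1/4) h x)\<^sup>2 \<partial>\<mu>) \<le> (\<integral>x. h x powr (4/3) \<partial>\<mu>) powr (3/2)"
    and "integrable \<mu> (\<lambda>x. h x powr (4/3))"
proof -
  define v where "v = OU (1/4) h"
  have v: "edom T v" unfolding v_def by (rule edom_OU[OF T h])
  have v0: "0 \<le> v x" for x unfolding v_def by (rule OU_nonneg[OF h0])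
  have lv: "local_fun T v" unfolding v_def by (rule OU_local[OF l])
  have [measurable]: "h \<in> borel_measurable path_space" "v \<in> borel_measurable path_space"
    using edom_measurable[OF h] edom_measurable[OF v] by auto
  define g where "g x = h x powr (4/3)" for x
  have g: "edom T g"
  proof (rule edom_mono[OF edom_add[OF edom_const[of T 1] edom_power2[OF h]]])
    show "g \<in> borel_measurable path_space" unfolding g_def[abs_def] by measurable
    fix x
    have "h x powr (4/3) \<le> 1 + (h x)\<^sup>2"
    proof (cases "h x \<le> 1")
      case True
      then have "h x powr (4/3) \<le> 1" using h0 by (intro powr_le1) auto
      then show ?thesis by (simp add: add_increasing2)
    next
      case False
      then have "h x powr (4/3) \<le> h x powr 2" by (intro powr_mono) auto
      then show ?thesis using False by (simp add: powr_numeral)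
    qed
    then show "\<bar>g x\<bar> \<le> \<bar>1 + (h x)\<^sup>2\<bar>" by (simp add: g_def)
  qed
  have ig: "integrable \<mu> g" by (rule integrable_edom[OF T g])
  then show "integrable \<mu> (\<lambda>x. h x powr (4/3))" by (simp add: g_def[abs_def])
  have iv2: "integrable \<mu> (\<lambda>x. (v x)\<^sup>2)" by (rule integrable_edom[OF T edom_power2[OF v]])
  define A where "A = (\<integral>x. g x \<partial>\<mu>)"
  define W where "W = (\<integral>x. (v x)\<^sup>2 \<partial>\<mu>)"
  have A0: "0 \<le> A" unfolding A_def g_def by simp
  have W0: "0 \<le> W" unfolding W_def by simp
  \<comment> \<open>The dual inequality concerns bounded functions, hence the truncation at
    \<open>n\<close>; dominated convergence removes it.\<close>
  define G where "G n x = min (g x) (real n)" for n x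
  define H where "H n x = min ((v x)\<^sup>2) (real n)" for n x
  have mG: "G n \<in> borel_measurable path_space" and mH: "H n \<in> borel_measurable path_space" for n
    unfolding G_def[abs_def] H_def[abs_def] g_def[abs_def] by measurable
  define \<Phi> where "\<Phi> n p = G n (fst p) powr (3/4) * sqrt (H n (mix4 (fst p) (snd p)))" for n p
  have e: "lin (1/4) x (sqrt (1 - (1/4)\<^sup>2)) y = mix4 x y" for x y
    unfolding sqrt_1_sixteenth mix4_def by (simp add: fun_eq_iff)
  have edom2: "edom2 T (\<lambda>p. h (fst p) * v (mix4 (fst p) (snd p)))"
    using edom2_mult[OF edom2_fst[OF h] edom2_lin[OF v, of "1/4" "sqrt (1 - (1/4)\<^sup>2)"]] unfolding e .
  have step: "(\<integral>p. \<Phi> n p \<partial>(\<mu> \<Otimes>\<^sub>M \<mu>)) \<le> A powr (3/4) * sqrt W" for n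
  proof -
    have "(\<integral>p. \<Phi> n p \<partial>(\<mu> \<Otimes>\<^sub>M \<mu>)) \<le> (\<integral>x. G n x \<partial>\<mu>) powr (3/4) * sqrt (\<integral>x. H n x \<partial>\<mu>)"
      unfolding \<Phi>_def
    proof (rule hyper_local[OF mG mH, where B = "real n"])
      show "local_fun T (G n)" "local_fun T (H n)"
        using l lv by (auto simp: local_fun_def G_def H_def g_def)
    qed (auto simp: G_def H_def g_def)
    also have "\<dots> \<le> A powr (3/4) * sqrt W"
    proof (intro mult_mono powr_mono2 real_sqrt_le_mono)
      show "(\<integral>x. G n x \<partial>\<mu>) \<le> A" unfolding A_def
        by (rule integral_mono[OF _ ig]) (use mG ig in \<open>auto simp: G_def g_def intro!: Bochner_Integration.integrable_bound[OF ig]\<close>)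
      show "(\<integral>x. H n x \<partial>\<mu>) \<le> W" unfolding W_def
        by (rule integral_mono[OF _ iv2]) (use mH iv2 in \<open>auto simp: H_def intro!: Bochner_Integration.integrable_bound[OF iv2]\<close>)
      show "0 \<le> (\<integral>x. G n x \<partial>\<mu>)" by (simp add: G_def g_def)
      show "0 \<le> sqrt (\<integral>x. H n x \<partial>\<mu>)" by (simp add: H_def)
    qed simp_all
    finally show ?thesis .
  qed
  have hv: "(g x) powr (3/4) * sqrt ((v y)\<^sup>2) = h x * v y" for x y
    using h0[of x] v0[of y] by (simp add: g_def powr_powr)
  have lim: "(\<lambda>n. \<integral>p. \<Phi> n p \<partial>(\<mu> \<Otimes>\<^sub>M \<mu>)) \<longlonglongrightarrow> (\<integral>p. h (fst p) * v (mix4 (fst p) (snd p)) \<partial>(\<mu> \<Otimes>\<^sub>M \<mu>))"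
  proof (rule integral_dominated_convergence[where w = "\<lambda>p. h (fst p) * v (mix4 (fst p) (snd p))"])
    show "(\<lambda>p. h (fst p) * v (mix4 (fst p) (snd p))) \<in> borel_measurable (\<mu> \<Otimes>\<^sub>M \<mu>)"
      using edom2_measurable[OF edom2] by (simp add: measurable_cong_sets[OF sets_pair refl])
    show "integrable (\<mu> \<Otimes>\<^sub>M \<mu>) (\<lambda>p. h (fst p) * v (mix4 (fst p) (snd p)))"
      by (rule integrable_edom2[OF T edom2])
    show "\<Phi> n \<in> borel_measurable (\<mu> \<Otimes>\<^sub>M \<mu>)" for n
      unfolding \<Phi>_def[abs_def] measurable_cong_sets[OF sets_pair refl]
      using measurable_compose[OF measurable_mix4 mH] mG by measurable
    show "AE p in \<mu> \<Otimes>\<^sub>M \<mu>. (\<lambda>n. \<Phi> n p) \<longlonglongrightarrow> h (fst p) * v (mix4 (fst p) (snd p))"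
    proof (rule AE_I2)
      fix p :: "('t \<Rightarrow> real) \<times> ('t \<Rightarrow> real)"
      obtain N1 where N1: "g (fst p) \<le> real N1" using real_arch_simple by blast
      obtain N2 where N2: "(v (mix4 (fst p) (snd p)))\<^sup>2 \<le> real N2" using real_arch_simple by blast
      have "\<forall>\<^sub>F n in sequentially. \<Phi> n p = h (fst p) * v (mix4 (fst p) (snd p))"
        using eventually_ge_at_top[of "max N1 N2"]
      proof eventually_elim
        case (elim n)
        then have "real N1 \<le> real n" "real N2 \<le> real n" by auto
        then have "G n (fst p) = g (fst p)" "H n (mix4 (fst p) (snd p)) = (v (mix4 (fst p) (snd p)))\<^sup>2"
          using N1 N2 unfolding G_def H_def by (auto simp: min_def)
        then show ?case unfolding \<Phi>_def by (simp only: hv)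
      qed
      then show "(\<lambda>n. \<Phi> n p) \<longlonglongrightarrow> h (fst p) * v (mix4 (fst p) (snd p))"
        by (rule tendsto_eventually)
    qed
    show "AE p in \<mu> \<Otimes>\<^sub>M \<mu>. norm (\<Phi> n p) \<le> h (fst p) * v (mix4 (fst p) (snd p))" for n
    proof (rule AE_I2)
      fix p :: "('t \<Rightarrow> real) \<times> ('t \<Rightarrow> real)"
      have "\<Phi> n p \<le> (g (fst p)) powr (3/4) * sqrt ((v (mix4 (fst p) (snd p)))\<^sup>2)"
        unfolding \<Phi>_def by (intro mult_mono powr_mono2 real_sqrt_le_mono) (auto simp: G_def H_def g_def)
      moreover have "0 \<le> \<Phi> n p" unfolding \<Phi>_def by (simp add: G_def H_def g_def)
      ultimately show "norm (\<Phi> n p) \<le> h (fst p) * v (mix4 (fst p) (snd p))" unfolding hv by simp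
    qed
  qed
  have "(\<integral>p. h (fst p) * v (mix4 (fst p) (snd p)) \<partial>(\<mu> \<Otimes>\<^sub>M \<mu>)) = (\<integral>x. h x * OU (1/4) v x \<partial>\<mu>)"
    unfolding integral_mult_OU[OF T v h] e ..
  also have "\<dots> = (\<integral>x. v x * v x \<partial>\<mu>)"
    using OU_adjoint[OF T v h, of "1/4"] by (simp add: v_def)
  also have "\<dots> = W" by (simp add: W_def power2_eq_square)
  finally have "(\<lambda>n. \<integral>p. \<Phi> n p \<partial>(\<mu> \<Otimes>\<^sub>M \<mu>)) \<longlonglongrightarrow> W" using lim by simp
  then have main: "W \<le> A powr (3/4) * sqrt W"
    by (rule LIMSEQ_le_const2) (use step in auto)
  have "W \<le> A powr (3/2)"
  proof (cases "W = 0")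
    case False
    then have p: "0 < sqrt W" using W0 by simp
    have "sqrt W * sqrt W \<le> A powr (3/4) * sqrt W" using main W0 by simp
    then have "sqrt W \<le> A powr (3/4)" using p by (simp only: mult_le_cancel_right_pos)
    then have "(sqrt W)\<^sup>2 \<le> (A powr (3/4))\<^sup>2" using p by (intro power_mono) auto
    also have "\<dots> = A powr (3/2)" by (simp add: power2_eq_square powr_add[symmetric])
    finally show ?thesis using W0 by simp
  qed simp
  then show "(\<integral>x. (OU (1/4) h x)\<^sup>2 \<partial>\<mu>) \<le> (\<integral>x. h x powr (4/3) \<partial>\<mu>) powr (3/2)"
    by (simp add: W_def A_def g_def v_def)
qed

end

end

section \<open>Variance of the exponential of the soft maximum\<close>

lemma mult_cos_le_sin:
  fixes h :: real
  assumes "0 \<le> h" "h \<le> pi / 2" shows "h * cos h \<le> sin h"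
proof -
  have "sin 0 - 0 * cos 0 \<le> sin h - h * cos h"
  proof (rule DERIV_nonneg_imp_nondecreasing[OF assms(1), of "\<lambda>h. sin h - h * cos h"])
    fix x assume x: "0 \<le> x" "x \<le> h"
    have "DERIV (\<lambda>h. sin h - h * cos h) x :> x * sin x"
      by (auto intro!: derivative_eq_intros)
    moreover have "0 \<le> x * sin x" using x assms by (intro mult_nonneg_nonneg sin_ge_zero) auto
    ultimately show "\<exists>y. DERIV (\<lambda>h. sin h - h * cos h) x :> y \<and> 0 \<le> y" by blast
  qed
  then show ?thesis by simp
qed

text \<open>The number 16^(-1/2^j). Each value is the square of the next, which suits both the
  composition law and the rotation increments, and \<open>scale 1 = 1/4\<close> is the correlation
  of the hypercontractive inequality.\<close>

definition scale :: "nat \<Rightarrow> real" where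
  "scale j = exp (- (ln 16) / 2 ^ j)"

lemma scale_0: "scale 0 = 1 / 16"
  by (simp add: scale_def exp_minus inverse_eq_divide)

lemma scale_Suc_sq: "scale (Suc j) * scale (Suc j) = scale j"
  by (simp add: scale_def exp_add[symmetric] field_simps)

lemma scale_bounds: "0 < scale j" "scale j < 1"
  by (simp_all add: scale_def)

lemma scale_1: "scale 1 = 1 / 4"
proof -
  have "scale 1 * scale 1 = (1/4) * (1/4)" using scale_Suc_sq[of 0] scale_0 by simp
  then have "(scale 1)\<^sup>2 = (1/4)\<^sup>2" by (simp only: power2_eq_square)
  then show ?thesis by (rule power2_eq_imp_eq) (use scale_bounds(1)[of 1] in simp_all)
qed

lemma scale_lim: "scale \<longlonglongrightarrow> 1"
proof -
  have "(\<lambda>j. - (ln 16) * (1 / 2) ^ j :: real) \<longlonglongrightarrow> - (ln 16) * 0"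
    by (intro tendsto_mult tendsto_const LIMSEQ_realpow_zero) auto
  then have "(\<lambda>j. exp (- (ln 16) * (1 / 2) ^ j) :: real) \<longlonglongrightarrow> exp (- (ln 16) * 0)"
    by (rule tendsto_exp)
  moreover have "(\<lambda>j. exp (- (ln 16) * (1 / 2) ^ j)) = scale"
    by (simp add: scale_def fun_eq_iff power_one_over)
  ultimately show ?thesis by simp
qed

lemma ln_16_le: "ln (16::real) \<le> 3"
proof -
  have "(16::real) \<le> exp 3"
  proof -
    have "(2 :: real) \<le> exp (3 / 4)"
      using exp_lower_Taylor_quadratic[of "3 / 4"] by (simp add: power2_eq_square)
    then have "(2 :: real) ^ 4 \<le> exp (3 / 4) ^ 4" by (intro power_mono) auto
    then show ?thesis by (simp add: exp_of_nat_mult[symmetric])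
  qed
  then show ?thesis using ln_le_cancel_iff[of 16 "exp 3"] by simp
qed

text \<open>The angle \<open>arccos \<rho>\<close> is at most its tangent, and \<open>1 / \<rho> - \<rho> = 2 sinh (ln 16 / 2 ^ (j + 1))\<close>
  for \<open>\<rho> = scale (Suc j)\<close>.\<close>

lemma arccos_scale_sq: "(arccos (scale (Suc j)))\<^sup>2 * scale (Suc j) \<le> 24 / 2 ^ Suc j"
proof -
  define \<rho> where "\<rho> = scale (Suc j)"
  define t :: real where "t = ln 16 / 2 ^ Suc j"
  have \<rho>: "0 < \<rho>" "\<rho> < 1" unfolding \<rho>_def by (rule scale_bounds)+
  have \<rho>t: "\<rho> = exp (- t)" unfolding \<rho>_def scale_def t_def by simp
  define h where "h = arccos \<rho>"
  have h: "0 \<le> h" "h \<le> pi / 2" "cos h = \<rho>"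
    using \<rho> arccos_lbound[of \<rho>] arccos_le_pi2[of \<rho>] unfolding h_def by simp_all
  have "(h * \<rho>)\<^sup>2 \<le> (sin h)\<^sup>2"
    using mult_cos_le_sin[OF h(1,2)] h \<rho> by (intro power_mono) auto
  also have "\<dots> = 1 - \<rho>\<^sup>2" by (simp add: sin_squared_eq h(3))
  finally have "h\<^sup>2 * \<rho> * \<rho> \<le> 1 - \<rho>\<^sup>2" by (simp add: power2_eq_square mult_ac)
  then have 1: "h\<^sup>2 * \<rho> \<le> (1 - \<rho>\<^sup>2) / \<rho>" using \<rho> by (simp add: pos_le_divide_eq)
  have "1 + - (2 * t) \<le> exp (- (2 * t))" by (rule exp_ge_add_one_self)
  also have "\<dots> = \<rho>\<^sup>2" unfolding \<rho>t by (simp add: exp_double[symmetric])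
  finally have 2: "1 - \<rho>\<^sup>2 \<le> 2 * t" by simp
  have "1 / 4 \<le> \<rho>"
  proof -
    have "(2::real) ^ 1 \<le> 2 ^ Suc j" by (rule power_increasing) auto
    then have "t \<le> ln 16 / 2" unfolding t_def by (intro divide_left_mono) auto
    then have "exp (- (ln 16 / 2)) \<le> \<rho>" unfolding \<rho>t by simp
    moreover have "exp (- (ln 16 / 2)) = scale 1" by (simp add: scale_def)
    ultimately show ?thesis using scale_1 by simp
  qed
  have t0: "0 \<le> t" by (simp add: t_def)
  \<comment> \<open>The numerator is at most 2 t, the denominator at least 1/4, and ln 16 \<le> 3:
    this makes 8 times 3, the constant 24.\<close>
  have "(1 - \<rho>\<^sup>2) / \<rho> \<le> 2 * t / (1 / 4)"
    using 2 t0 \<open>1 / 4 \<le> \<rho>\<close> \<rho> by (intro frac_le) auto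
  also have "\<dots> \<le> 24 / 2 ^ Suc j"
    unfolding t_def using ln_16_le by (simp add: divide_right_mono)
  finally show ?thesis using 1 unfolding h_def \<rho>_def by linarith
qed

text \<open>Up to a constant, a Riemann sum at dyadic points for the integral of exp (- L y) over
  [0, 1]. The inequality 1 + y/2 \<le> exp (y/2) compares each term with an increment of exp (- L /
  2^j), and these telescope.\<close>

lemma telescoping_exp_sum:
  fixes L :: real
  assumes L: "0 < L"
  shows "(\<Sum>j<n. (1 / 2 ^ Suc j) * exp (- (L / 2 ^ Suc j))) \<le> 2 / L"
proof -
  define e where "e j = exp (- (L / 2 ^ j))" for j :: nat
  have step: "(1 / 2 ^ j) * e j \<le> 2 / L * (e (Suc j) - e j)" for j
  proof -
    define y :: real where "y = L / 2 ^ j"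
    have "1 + y / 2 \<le> exp (y / 2)" by (rule exp_ge_add_one_self)
    then have "exp (- y) * (1 + y / 2) \<le> exp (- y) * exp (y / 2)" by (intro mult_left_mono) auto
    also have "\<dots> = e (Suc j)" unfolding e_def y_def by (simp add: exp_add[symmetric] field_simps)
    finally have "e j + y / 2 * e j \<le> e (Suc j)" unfolding e_def y_def by (simp add: algebra_simps)
    then have "y / 2 * e j \<le> e (Suc j) - e j" by simp
    then have "2 / L * (y / 2 * e j) \<le> 2 / L * (e (Suc j) - e j)" using L by (intro mult_left_mono) auto
    moreover have "2 / L * (y / 2 * e j) = (1 / 2 ^ j) * e j" unfolding y_def using L by simp
    ultimately show ?thesis by simp
  qed
  have "(\<Sum>j<n. (1 / 2 ^ Suc j) * e (Suc j)) \<le> (\<Sum>j<n. 2 / L * (e (Suc (Suc j)) - e (Suc j)))"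
    by (intro sum_mono step)
  also have "\<dots> = 2 / L * (e (Suc n) - e (Suc 0))"
    unfolding sum_distrib_left[symmetric] using sum_lessThan_telescope[of "\<lambda>j. e (Suc j)" n] by simp
  also have "\<dots> \<le> 2 / L * 1"
  proof -
    have "e (Suc n) \<le> 1" "0 \<le> e (Suc 0)" using L by (simp_all add: e_def)
    then show ?thesis using L by (intro mult_left_mono) auto
  qed
  finally show ?thesis by (simp add: e_def)
qed

lemma geometric_sum_le_1: "(\<Sum>j<n. 1 / 2 ^ Suc j :: real) \<le> 1"
proof -
  have "(\<Sum>j<n. 1 / 2 ^ Suc j :: real) = 1 - 1 / 2 ^ n"
    by (induction n) (simp_all add: field_simps)
  then show ?thesis by simp
qed

lemma sum_rotate: "(\<Sum>s\<in>A. \<Sum>t\<in>B. \<Sum>z\<in>C. F s t z) = (\<Sum>z\<in>C. \<Sum>s\<in>A. \<Sum>t\<in>B. F s t z)"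
  by (rule trans[OF sum.cong[OF refl sum.swap] sum.swap])

section \<open>The energy split into patches of sites\<close>

context gaussian_path_law begin

lemma cov_le_1: "\<Gamma> s t \<le> 1"
proof -
  let ?T = "{s, t}"
  have T: "finite ?T" by simp
  have e: "edom ?T (\<lambda>x. x s)" "edom ?T (\<lambda>x. x t)" by (auto intro!: edom_coord)
  note i = integrable_edom[OF T edom_mult[OF e(1) e(1)]] integrable_edom[OF T edom_mult[OF e(2) e(2)]] integrable_edom[OF T edom_mult[OF e(1) e(2)]]
  have "2 * (\<integral>x. x s * x t \<partial>\<mu>) = (\<integral>x. 2 * (x s * x t) \<partial>\<mu>)" by simp
  also have "\<dots> \<le> (\<integral>x. x s * x s + x t * x t \<partial>\<mu>)"
    using i sum_squares_bound by (intro integral_mono) (auto simp: power2_eq_square mult.assoc)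
  also have "\<dots> = \<Gamma> s s + \<Gamma> t t" using i by (simp add: cov)
  finally show ?thesis by (simp add: cov unit_var)
qed

context
  fixes T :: "'t set" and \<beta> :: real
  assumes T: "finite T" "T \<noteq> {}" and \<beta>: "0 < \<beta>"
begin

abbreviation "f \<equiv> tilt T \<beta>"
abbreviation "g \<equiv> wt T \<beta>"

lemma smax_restr: "smax \<beta> T (restr T x) = smax \<beta> T x"
  unfolding smax_def smz_def by (intro arg_cong[where f = "\<lambda>z. ln z / \<beta>"] sum.cong) (auto simp: restr_def)

lemma wt_restr: "t \<in> T \<Longrightarrow> g k t (restr T x) = g k t x"
proof -
  have "smz \<beta> T (restr T x) = smz \<beta> T x" unfolding smz_def by (intro sum.cong) (auto simp: restr_def)
  then show "t \<in> T \<Longrightarrow> g k t (restr T x) = g k t x"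
    unfolding wt_def[OF T \<beta>] tilt_def[OF T \<beta>] smax_restr smp_def by (simp add: restr_def)
qed

text \<open>The integrals of \<open>OU r (g k s) * OU r (g k t)\<close> are nonnegative, so each
  covariance, of whatever sign, may be replaced by its upper bound. The constant \<open>K\<close>
  then sums to the full function, where the semigroup contracts L2, and each patch
  \<open>D z\<close> sums to a square of its own.\<close>

lemma energy_le:
  assumes r: "0 \<le> r" "r \<le> 1" and K: "0 \<le> K" and Z: "finite Z"
    and cover: "\<And>s t. s \<in> T \<Longrightarrow> t \<in> T \<Longrightarrow> \<Gamma> s t \<le> K + real (card {z \<in> Z. s \<in> D z \<and> t \<in> D z})"
  shows "energy T \<beta> k r \<le> K * (\<integral>x. (f k x)\<^sup>2 \<partial>\<mu>) + (\<Sum>z\<in>Z. \<integral>x. (OU r (\<lambda>x. \<Sum>t\<in>T \<inter> D z. g k t x) x)\<^sup>2 \<partial>\<mu>)"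
proof -
  let ?I = "\<lambda>s t. \<integral>x. OU r (g k s) x * OU r (g k t) x \<partial>\<mu>"
  note ed = edom_wt[OF T \<beta>]
  have eo: "edom T (OU r (g k t))" if "t \<in> T" for t by (rule edom_OU[OF T(1) ed[OF that]])
  have i: "integrable \<mu> (\<lambda>x. OU r (g k s) x * OU r (g k t) x)" if "s \<in> T" "t \<in> T" for s t
    by (rule integrable_edom[OF T(1) edom_mult[OF eo[OF that(1)] eo[OF that(2)]]])
  have I0: "0 \<le> ?I s t" for s t
    by (intro Bochner_Integration.integral_nonneg mult_nonneg_nonneg OU_nonneg wt_nonneg[OF T \<beta>])
  have sq: "(\<integral>x. (OU r (\<lambda>x. \<Sum>t\<in>A. g k t x) x)\<^sup>2 \<partial>\<mu>) = (\<Sum>s\<in>A. \<Sum>t\<in>A. ?I s t)" if A: "A \<subseteq> T" for A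
  proof -
    have "OU r (\<lambda>x. \<Sum>t\<in>A. g k t x) x = (\<Sum>t\<in>A. OU r (g k t) x)" for x
      by (rule OU_sum[OF T(1)]) (use A ed in blast)
    then have "(\<integral>x. (OU r (\<lambda>x. \<Sum>t\<in>A. g k t x) x)\<^sup>2 \<partial>\<mu>) = (\<integral>x. (\<Sum>s\<in>A. \<Sum>t\<in>A. OU r (g k s) x * OU r (g k t) x) \<partial>\<mu>)"
      by (simp only: power2_eq_square sum_product)
    also have "\<dots> = (\<Sum>s\<in>A. \<Sum>t\<in>A. ?I s t)"
    proof -
      have i2: "integrable \<mu> (\<lambda>x. OU r (g k s) x * OU r (g k t) x)" if "s \<in> A" "t \<in> A" for s t
        using that A by (intro i) auto
      have i1: "integrable \<mu> (\<lambda>x. \<Sum>t\<in>A. OU r (g k s) x * OU r (g k t) x)" if "s \<in> A" for s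
        by (rule Bochner_Integration.integrable_sum) (rule i2[OF that])
      have "(\<integral>x. (\<Sum>s\<in>A. \<Sum>t\<in>A. OU r (g k s) x * OU r (g k t) x) \<partial>\<mu>) = (\<Sum>s\<in>A. \<integral>x. (\<Sum>t\<in>A. OU r (g k s) x * OU r (g k t) x) \<partial>\<mu>)"
        by (rule Bochner_Integration.integral_sum) (rule i1)
      also have "\<dots> = (\<Sum>s\<in>A. \<Sum>t\<in>A. ?I s t)"
        by (rule sum.cong[OF refl], rule Bochner_Integration.integral_sum) (rule i2)
      finally show ?thesis .
    qed
    finally show ?thesis .
  qed
  let ?J = "\<lambda>z s t. if s \<in> D z \<and> t \<in> D z then ?I s t else 0"
  have E1: "energy T \<beta> k r \<le> (\<Sum>s\<in>T. \<Sum>t\<in>T. (K + real (card {z \<in> Z. s \<in> D z \<and> t \<in> D z})) * ?I s t)"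
    unfolding energy_def[OF T \<beta>] by (intro sum_mono mult_right_mono cover I0)
  have split: "(K + real (card {z \<in> Z. s \<in> D z \<and> t \<in> D z})) * ?I s t = K * ?I s t + (\<Sum>z\<in>Z. ?J z s t)" for s t
    using Z by (simp add: distrib_right sum.If_cases Int_def)
  have E2: "(\<Sum>s\<in>T. \<Sum>t\<in>T. (K + real (card {z \<in> Z. s \<in> D z \<and> t \<in> D z})) * ?I s t) =
      K * (\<Sum>s\<in>T. \<Sum>t\<in>T. ?I s t) + (\<Sum>s\<in>T. \<Sum>t\<in>T. \<Sum>z\<in>Z. ?J z s t)"
    unfolding split sum.distrib sum_distrib_left ..
  have inner: "(\<Sum>t\<in>T. ?J z s t) = (if s \<in> D z then (\<Sum>t\<in>T \<inter> D z. ?I s t) else 0)" for z s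
    using T(1) by (simp add: sum.inter_restrict)
  have "(\<Sum>s\<in>T. \<Sum>t\<in>T. ?J z s t) = (\<Sum>s\<in>T \<inter> D z. \<Sum>t\<in>T \<inter> D z. ?I s t)" for z
    unfolding inner by (rule sum.inter_restrict[OF T(1), symmetric])
  then have "(\<Sum>s\<in>T. \<Sum>t\<in>T. ?J z s t) = (\<integral>x. (OU r (\<lambda>x. \<Sum>t\<in>T \<inter> D z. g k t x) x)\<^sup>2 \<partial>\<mu>)" for z
    using sq[of "T \<inter> D z"] by simp
  then have E3: "(\<Sum>s\<in>T. \<Sum>t\<in>T. \<Sum>z\<in>Z. ?J z s t) = (\<Sum>z\<in>Z. \<integral>x. (OU r (\<lambda>x. \<Sum>t\<in>T \<inter> D z. g k t x) x)\<^sup>2 \<partial>\<mu>)"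
    by (simp only: sum_rotate)
  have E4: "(\<Sum>s\<in>T. \<Sum>t\<in>T. ?I s t) = (\<integral>x. (OU r (f k) x)\<^sup>2 \<partial>\<mu>)"
    using sq[OF subset_refl] unfolding sum_wt[OF T \<beta>] by simp
  have "energy T \<beta> k r \<le> K * (\<integral>x. (OU r (f k) x)\<^sup>2 \<partial>\<mu>) + (\<Sum>z\<in>Z. \<integral>x. (OU r (\<lambda>x. \<Sum>t\<in>T \<inter> D z. g k t x) x)\<^sup>2 \<partial>\<mu>)"
    by (rule ord_le_eq_trans[OF ord_le_eq_trans[OF E1 E2] arg_cong2[where f = "(+)", OF arg_cong[where f = "(*) K", OF E4] E3]])
  also have "\<dots> \<le> K * (\<integral>x. (f k x)\<^sup>2 \<partial>\<mu>) + (\<Sum>z\<in>Z. \<integral>x. (OU r (\<lambda>x. \<Sum>t\<in>T \<inter> D z. g k t x) x)\<^sup>2 \<partial>\<mu>)"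
    by (rule add_right_mono[OF mult_left_mono[OF integral_OU_sq[OF T(1) edom_tilt[OF T \<beta>] r] K]])
  finally show ?thesis .
qed

definition mass :: "'t set \<Rightarrow> ('t \<Rightarrow> real) \<Rightarrow> real" where
  "mass A x = (\<Sum>t\<in>T \<inter> A. smp \<beta> T t x)"

lemma mass_bounds: "0 \<le> mass A x" "mass A x \<le> 1"
proof -
  show "0 \<le> mass A x" unfolding mass_def by (intro sum_nonneg smp_nonneg[OF T \<beta>])
  have "mass A x \<le> (\<Sum>t\<in>T. smp \<beta> T t x)"
    unfolding mass_def using T(1) smp_nonneg[OF T \<beta>] by (intro sum_mono2) auto
  then show "mass A x \<le> 1" by (simp add: smp_sum[OF T \<beta>])
qed

lemma edom_mass: "edom T (mass A)"
  unfolding mass_def[abs_def] by (intro edom_sum edom_smp T \<beta>) auto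

text \<open>The Cauchy-Schwarz inequality gives logarithmic convexity along the scale, and the
  hypercontractive inequality the initial value.\<close>

lemma OU_wt_sum_sq:
  assumes small: "(\<integral>x. mass A x \<partial>\<mu>) \<le> exp (- L)"
  shows "(\<integral>x. (OU (scale (Suc j)) (\<lambda>x. \<Sum>t\<in>T \<inter> A. g k t x) x)\<^sup>2 \<partial>\<mu>) \<le> (\<integral>x. (f k x)\<^sup>2 * mass A x \<partial>\<mu>) * exp (- (L / 2 / 2 ^ j))"
proof -
  define h where "h x = (\<Sum>t\<in>T \<inter> A. g k t x)" for x
  have h_eq: "h x = f k x * mass A x" for x
    unfolding h_def mass_def wt_def[OF T \<beta>] sum_distrib_left ..
  have eh: "edom T h" unfolding h_def[abs_def] by (intro edom_sum edom_wt T \<beta>) auto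
  have h0: "0 \<le> h x" for x unfolding h_def by (intro sum_nonneg wt_nonneg[OF T \<beta>])
  have lh: "local_fun T h" unfolding h_def by (intro local_funI sum.cong refl wt_restr) auto
  note [simp] = mass_bounds
  have ef: "edom T (f k)" by (rule edom_tilt[OF T \<beta>])
  have f0: "0 \<le> f k x" for x using tilt_pos[OF T \<beta>, of k x] by simp
  define S where "S = (\<integral>x. (f k x)\<^sup>2 * mass A x \<partial>\<mu>)"
  have iS: "integrable \<mu> (\<lambda>x. (f k x)\<^sup>2 * mass A x)"
    by (rule integrable_edom[OF T(1) edom_mult[OF edom_power2[OF ef] edom_mass]])
  have S0: "0 \<le> S" unfolding S_def by (intro Bochner_Integration.integral_nonneg) auto
  define a where "a j = (\<integral>x. (OU (scale (Suc j)) h x)\<^sup>2 \<partial>\<mu>)" for j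
  have a0: "0 \<le> a j" for j unfolding a_def by simp
  have h2: "(\<integral>x. (h x)\<^sup>2 \<partial>\<mu>) \<le> S" unfolding S_def
  proof (rule integral_mono[OF integrable_edom[OF T(1) edom_power2[OF eh]] iS])
    fix x
    have "(mass A x)\<^sup>2 \<le> mass A x" using mult_left_le[of "mass A x" "mass A x"] by (simp add: power2_eq_square)
    then show "(h x)\<^sup>2 \<le> (f k x)\<^sup>2 * mass A x" unfolding h_eq power_mult_distrib by (intro mult_left_mono) auto
  qed
  have sc: "0 \<le> scale i" "scale i \<le> 1" for i using scale_bounds[of i] by auto
  have corr: "(\<integral>x. h x * OU (scale j) h x \<partial>\<mu>) = a j" for j
    using integral_OU_OU[OF T(1) eh eh sc sc, of "Suc j" "Suc j"] unfolding scale_Suc_sq a_def power2_eq_square by simp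
  \<comment> \<open>Pointwise \<open>h powr (4/3)\<close> is at most the power 2/3 of
    \<open>(f k)^2 * mass A\<close> times the power 1/3 of \<open>mass A\<close>, because
    \<open>mass A\<close> is at most 1. Hoelder's inequality and the small mean of
    \<open>mass A\<close> give the factor exp (- L / 3), and the outer power 3/2 makes it exp (- L /
    2).\<close>
  have base: "a 0 \<le> S * exp (- (L / 2))"
  proof -
    have "a 0 \<le> (\<integral>x. h x powr (4/3) \<partial>\<mu>) powr (3/2)"
      unfolding a_def scale_1[unfolded One_nat_def] by (rule OU_hypercontractive(1)[OF T(1) eh h0 lh])
    also have "\<dots> \<le> (S powr (2/3) * (exp (- L)) powr (1 - 2/3)) powr (3/2)"
    proof (intro powr_mono2)
      have "(\<integral>x. h x powr (4/3) \<partial>\<mu>) \<le> (\<integral>x. ((f k x)\<^sup>2 * mass A x) powr (2/3) * mass A x powr (1 - 2/3) \<partial>\<mu>)"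
      proof (rule integral_mono[OF OU_hypercontractive(2)[OF T(1) eh h0 lh]])
        show "integrable \<mu> (\<lambda>x. ((f k x)\<^sup>2 * mass A x) powr (2/3) * mass A x powr (1 - 2/3))"
          by (rule integral_Holder(1)[OF iS integrable_edom[OF T(1) edom_mass]]) auto
        fix x
        have "((f k x)\<^sup>2) powr (2/3) = f k x powr (4/3)"
        proof -
          have "(f k x)\<^sup>2 = f k x powr 2" using tilt_pos[OF T \<beta>, of k x] by (simp add: powr_numeral)
          then show ?thesis by (simp add: powr_powr)
        qed
        then have "((f k x)\<^sup>2 * mass A x) powr (2/3) * mass A x powr (1 - 2/3) = f k x powr (4/3) * (mass A x powr (2/3) * mass A x powr (1 - 2/3))"
          by (simp add: powr_mult)
        also have "mass A x powr (2/3) * mass A x powr (1 - 2/3) = mass A x powr 1"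
          by (simp only: powr_add[symmetric]) simp
        finally have e: "((f k x)\<^sup>2 * mass A x) powr (2/3) * mass A x powr (1 - 2/3) = f k x powr (4/3) * mass A x powr 1" .
        have "mass A x powr (4/3) \<le> mass A x powr 1"
          by (rule powr_mono') auto
        then show "h x powr (4/3) \<le> ((f k x)\<^sup>2 * mass A x) powr (2/3) * mass A x powr (1 - 2/3)"
        proof -
          have "h x powr (4/3) = f k x powr (4/3) * mass A x powr (4/3)"
            unfolding h_eq using f0 by (simp add: powr_mult)
          also have "\<dots> \<le> f k x powr (4/3) * mass A x powr 1"
            by (rule mult_left_mono[OF \<open>mass A x powr (4/3) \<le> mass A x powr 1\<close>]) simp
          finally show ?thesis unfolding e .
        qed
      qed
      also have "\<dots> \<le> S powr (2/3) * (\<integral>x. mass A x \<partial>\<mu>) powr (1 - 2/3)"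
        unfolding S_def by (rule integral_Holder(2)[OF iS integrable_edom[OF T(1) edom_mass]]) auto
      also have "\<dots> \<le> S powr (2/3) * (exp (- L)) powr (1 - 2/3)"
        using small by (intro mult_left_mono powr_mono2) auto
      finally show "(\<integral>x. h x powr (4/3) \<partial>\<mu>) \<le> S powr (2/3) * (exp (- L)) powr (1 - 2/3)" .
    qed auto
    also have "\<dots> = S * exp (- (L / 2))"
      using S0 by (simp add: powr_mult powr_powr exp_powr_real)
    finally show ?thesis .
  qed
  have "a j \<le> S * exp (- (L / 2 / 2 ^ j))" for j
  proof (induction j)
    case 0
    then show ?case using base by simp
  next
    case (Suc j)
    have eo: "edom T (OU (scale (Suc j)) h)" by (rule edom_OU[OF T(1) eh])
    \<comment> \<open>By \<open>corr\<close> the left side is an inner product of \<open>h\<close>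
      with the function whose squared norm is \<open>a j\<close>. Cauchy-Schwarz takes the geometric
      mean of the trivial bound \<open>S\<close> and the previous one, which halves the
      exponent.\<close>
    have "(a (Suc j))\<^sup>2 = (\<integral>x. h x * OU (scale (Suc j)) h x \<partial>\<mu>)\<^sup>2" unfolding corr ..
    also have "\<dots> \<le> (\<integral>x. (h x)\<^sup>2 \<partial>\<mu>) * a j"
      unfolding a_def using edom_measurable[OF eh] edom_measurable[OF eo]
      by (intro integral_CauchySchwarz(1) integrable_edom[OF T(1)] edom_power2 eh eo) simp_all
    also have "\<dots> \<le> S * (S * exp (- (L / 2 / 2 ^ j)))"
      using h2 Suc a0 S0 by (intro mult_mono) auto
    also have "\<dots> = (S * exp (- (L / 2 / 2 ^ Suc j)))\<^sup>2"
    proof -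
      have "(exp (- (L / 2 / 2 ^ Suc j)))\<^sup>2 = exp (- (L / 2 / 2 ^ j))"
        by (simp add: exp_double[symmetric])
      then show ?thesis by (simp add: power_mult_distrib power2_eq_square)
    qed
    finally have "(a (Suc j))\<^sup>2 \<le> (S * exp (- (L / 2 / 2 ^ Suc j)))\<^sup>2" .
    then show ?case by (rule power2_le_imp_le) (use S0 in simp)
  qed
  then show ?thesis unfolding a_def S_def h_def by simp
qed

end

end

section \<open>From energies to variances and exponential moments\<close>

lemma exp_le_quadratic: "exp y \<le> 1 + y + y\<^sup>2 * exp \<bar>y\<bar>" for y :: real
proof -
  have 1: "exp y - 1 \<le> y * exp y"
  proof -
    have "exp y * (1 + - y) \<le> exp y * exp (- y)" by (intro mult_left_mono exp_ge_add_one_self) auto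
    then show ?thesis by (simp add: exp_minus algebra_simps)
  qed
  have "y * (exp y - 1) \<le> y\<^sup>2 * exp \<bar>y\<bar>"
  proof (cases "0 \<le> y")
    case True
    have "y * (exp y - 1) \<le> y * (y * exp y)" using 1 True by (rule mult_left_mono)
    then show ?thesis using True by (simp add: power2_eq_square)
  next
    case False
    have "y \<le> exp y - 1" using exp_ge_add_one_self[of y] by linarith
    then have "y * (exp y - 1) \<le> y * y" using False by (intro mult_left_mono_neg) auto
    also have "\<dots> \<le> y * y * exp \<bar>y\<bar>" using mult_left_mono[of 1 "exp \<bar>y\<bar>" "y * y"] by simp
    finally show ?thesis by (simp add: power2_eq_square)
  qed
  moreover have "exp y - 1 - y \<le> y * (exp y - 1)" using 1 by (simp add: algebra_simps)
  ultimately show ?thesis by linarith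
qed

context gaussian_path_law begin

context
  fixes T :: "'t set" and \<beta> :: real
  assumes T: "finite T" "T \<noteq> {}" and \<beta>: "0 < \<beta>"
begin

text \<open>The correlation \<open>b r\<close> runs from the squared mean of
  \<open>tilt T \<beta> k\<close> at \<open>r = 0\<close> to its second moment at
  \<open>r = 1\<close>. The range is cut at 1/16 and at \<open>scale n\<close>: up to 1/16 one
  quarter turn is enough, between the cuts the increments along \<open>scale\<close> are summed, and
  the rest tends to 0 with \<open>n\<close>.\<close>

theorem smax_variance:
  fixes D :: "'z \<Rightarrow> 't set" and k :: real
  assumes K: "0 \<le> K" and Z: "finite Z" and m: "0 \<le> m" and L: "0 < L"
    and cover: "\<And>s t. s \<in> T \<Longrightarrow> t \<in> T \<Longrightarrow> \<Gamma> s t \<le> K + real (card {z \<in> Z. s \<in> D z \<and> t \<in> D z})"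
    and mult: "\<And>t. t \<in> T \<Longrightarrow> real (card {z \<in> Z. t \<in> D z}) \<le> m"
    and small: "\<And>z. z \<in> Z \<Longrightarrow> (\<integral>x. mass T \<beta> (D z) x \<partial>\<mu>) \<le> exp (- L)"
  shows "(\<integral>x. (tilt T \<beta> k x)\<^sup>2 \<partial>\<mu>) - (\<integral>x. tilt T \<beta> k x \<partial>\<mu>)\<^sup>2 \<le> 50 * (K + m / L) * k\<^sup>2 * (\<integral>x. (tilt T \<beta> k x)\<^sup>2 \<partial>\<mu>)"
proof -
  define F where "F = (\<integral>x. (tilt T \<beta> k x)\<^sup>2 \<partial>\<mu>)"
  define b where "b r = (\<integral>x. tilt T \<beta> k x * OU r (tilt T \<beta> k) x \<partial>\<mu>)" for r
  define e where "e j = exp (- (L / 2 / 2 ^ j))" for j :: nat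
  have F0: "0 \<le> F" by (simp add: F_def)
  note et = edom_tilt[OF T \<beta>]
  have sc: "0 \<le> scale i" "scale i \<le> 1" for i using scale_bounds[of i] by auto
  have masses: "(\<Sum>z\<in>Z. \<integral>x. (tilt T \<beta> k x)\<^sup>2 * mass T \<beta> (D z) x \<partial>\<mu>) \<le> m * F"
  proof -
    have i: "integrable \<mu> (\<lambda>x. (tilt T \<beta> k x)\<^sup>2 * mass T \<beta> (D z) x)" for z
      by (rule integrable_edom[OF T(1) edom_mult[OF edom_power2[OF et] edom_mass[OF T \<beta>]]])
    \<comment> \<open>The Gibbs weights sum to 1 and each site is counted at most \<open>m\<close>
      times.\<close>
    have sm: "(\<Sum>z\<in>Z. mass T \<beta> (D z) x) \<le> m" for x
    proof -
      have "(\<Sum>z\<in>Z. mass T \<beta> (D z) x) = (\<Sum>z\<in>Z. \<Sum>t\<in>T. if t \<in> D z then smp \<beta> T t x else 0)"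
        unfolding mass_def[OF T \<beta>] using T(1) by (intro sum.cong refl sum.inter_restrict)
      also have "\<dots> = (\<Sum>t\<in>T. \<Sum>z\<in>Z. if t \<in> D z then smp \<beta> T t x else 0)" by (rule sum.swap)
      also have "\<dots> = (\<Sum>t\<in>T. real (card {z \<in> Z. t \<in> D z}) * smp \<beta> T t x)"
        using Z by (intro sum.cong refl) (simp add: sum.If_cases Int_def)
      also have "\<dots> \<le> (\<Sum>t\<in>T. m * smp \<beta> T t x)"
        by (intro sum_mono mult_right_mono mult smp_nonneg[OF T \<beta>])
      also have "\<dots> = m" by (simp add: sum_distrib_left[symmetric] smp_sum[OF T \<beta>])
      finally show ?thesis .
    qed
    have "(\<Sum>z\<in>Z. \<integral>x. (tilt T \<beta> k x)\<^sup>2 * mass T \<beta> (D z) x \<partial>\<mu>) = (\<integral>x. (\<Sum>z\<in>Z. (tilt T \<beta> k x)\<^sup>2 * mass T \<beta> (D z) x) \<partial>\<mu>)"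
      by (rule Bochner_Integration.integral_sum[symmetric]) (rule i)
    also have "\<dots> \<le> (\<integral>x. m * (tilt T \<beta> k x)\<^sup>2 \<partial>\<mu>)"
    proof (rule integral_mono)
      show "integrable \<mu> (\<lambda>x. \<Sum>z\<in>Z. (tilt T \<beta> k x)\<^sup>2 * mass T \<beta> (D z) x)" by (rule Bochner_Integration.integrable_sum) (rule i)
      show "integrable \<mu> (\<lambda>x. m * (tilt T \<beta> k x)\<^sup>2)" by (rule integrable_edom[OF T(1) edom_cmult[OF edom_power2[OF et]]])
      show "(\<Sum>z\<in>Z. (tilt T \<beta> k x)\<^sup>2 * mass T \<beta> (D z) x) \<le> m * (tilt T \<beta> k x)\<^sup>2" for x
        unfolding sum_distrib_left[symmetric] mult.commute[of m] by (rule mult_left_mono[OF sm zero_le_power2])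
    qed
    finally show ?thesis by (simp add: F_def)
  qed
  have E: "energy T \<beta> k (scale (Suc j)) \<le> F * (K + m * e j)" for j
  proof -
    have "energy T \<beta> k (scale (Suc j)) \<le> K * F + (\<Sum>z\<in>Z. \<integral>x. (OU (scale (Suc j)) (\<lambda>x. \<Sum>t\<in>T \<inter> D z. wt T \<beta> k t x) x)\<^sup>2 \<partial>\<mu>)"
      unfolding F_def by (rule energy_le[OF T \<beta> sc K Z cover])
    also have "\<dots> \<le> K * F + (\<Sum>z\<in>Z. (\<integral>x. (tilt T \<beta> k x)\<^sup>2 * mass T \<beta> (D z) x \<partial>\<mu>) * e j)"
      unfolding e_def by (intro add_left_mono sum_mono OU_wt_sum_sq[OF T \<beta>] small)
    also have "\<dots> = K * F + (\<Sum>z\<in>Z. \<integral>x. (tilt T \<beta> k x)\<^sup>2 * mass T \<beta> (D z) x \<partial>\<mu>) * e j"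
      by (simp only: sum_distrib_right)
    also have "\<dots> \<le> K * F + m * F * e j"
      by (intro add_left_mono mult_right_mono masses) (simp add: e_def)
    finally show ?thesis by (simp add: algebra_simps)
  qed
  \<comment> \<open>The radius \<open>scale (Suc (Suc j))\<close> has square
    \<open>scale (Suc j)\<close>. A rotation whose cosine is again \<open>scale (Suc j)\<close>
    leads from there to the parameter \<open>scale j\<close>.\<close>
  have step: "b (scale (Suc j)) - b (scale j) \<le> 12 * k\<^sup>2 * F * (1 / 2 ^ Suc j * K + m * (1 / 2 ^ Suc j * e (Suc j)))" for j
  proof -
    let ?r = "scale (Suc (Suc j))" and ?h = "arccos (scale (Suc j))"
    have "arccos 1 < ?h" using scale_bounds[of "Suc j"] by (intro arccos_less_arccos) auto
    then have h: "0 < ?h" by simp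
    have h2: "?h \<le> pi / 2" using arccos_le_pi2[of "scale (Suc j)"] scale_bounds[of "Suc j"] by simp
    have ch: "cos ?h = scale (Suc j)" using scale_bounds[of "Suc j"] by (intro cos_arccos) auto
    have r2: "?r\<^sup>2 = scale (Suc j)" by (simp only: power2_eq_square scale_Suc_sq)
    have X: "0 \<le> F * (K + m * e (Suc j))" using F0 K m by (simp add: e_def)
    have "b (scale (Suc j)) - b (scale j) \<le> ?h\<^sup>2 * k\<^sup>2 * ?r\<^sup>2 * energy T \<beta> k ?r / 2"
      using energy_increment[OF T \<beta> sc h h2, of k "Suc (Suc j)"] unfolding scale_Suc_sq ch b_def .
    also have "\<dots> \<le> ?h\<^sup>2 * k\<^sup>2 * ?r\<^sup>2 * (F * (K + m * e (Suc j))) / 2"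
      by (intro divide_right_mono mult_left_mono E) auto
    also have "\<dots> = (?h\<^sup>2 * scale (Suc j)) * (k\<^sup>2 * (F * (K + m * e (Suc j))) / 2)"
      unfolding r2 by simp
    also have "\<dots> \<le> (24 / 2 ^ Suc j) * (k\<^sup>2 * (F * (K + m * e (Suc j))) / 2)"
      using X by (intro mult_right_mono arccos_scale_sq) auto
    also have "\<dots> = 12 * k\<^sup>2 * F * (1 / 2 ^ Suc j * K + m * (1 / 2 ^ Suc j * e (Suc j)))"
      by (simp add: algebra_simps)
    finally show ?thesis .
  qed
  have middle: "b (scale n) - b (scale 0) \<le> 12 * k\<^sup>2 * F * (K + m * (4 / L))" for n
  proof -
    have "b (scale n) - b (scale 0) = (\<Sum>j<n. b (scale (Suc j)) - b (scale j))"
      using sum_lessThan_telescope[of "\<lambda>j. b (scale j)" n] by simp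
    also have "\<dots> \<le> (\<Sum>j<n. 12 * k\<^sup>2 * F * (1 / 2 ^ Suc j * K + m * (1 / 2 ^ Suc j * e (Suc j))))"
      by (intro sum_mono step)
    also have "\<dots> = 12 * k\<^sup>2 * F * ((\<Sum>j<n. 1 / 2 ^ Suc j) * K + m * (\<Sum>j<n. 1 / 2 ^ Suc j * e (Suc j)))"
      by (simp only: sum_distrib_left[symmetric] sum.distrib sum_distrib_right)
    also have "\<dots> \<le> 12 * k\<^sup>2 * F * (1 * K + m * (4 / L))"
    proof (intro mult_left_mono add_mono mult_right_mono)
      show "(\<Sum>j<n. 1 / 2 ^ Suc j :: real) \<le> 1" by (rule geometric_sum_le_1)
      show "(\<Sum>j<n. 1 / 2 ^ Suc j * e (Suc j)) \<le> 4 / L"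
        using telescoping_exp_sum[of "L / 2" n] L unfolding e_def by simp
    qed (use K m F0 in auto)
    finally show ?thesis by simp
  qed
  \<comment> \<open>A quarter turn has cosine 0, so one increment leads from 1/16 down to 0. The
    energy is taken at the radius 1/4, where the hypercontractive bound is available.\<close>
  have last: "b (scale 0) - (\<integral>x. tilt T \<beta> k x \<partial>\<mu>)\<^sup>2 \<le> k\<^sup>2 * F * (K + m * (2 / L))"
  proof -
    have r: "(0::real) \<le> 1 / 4" "1 / 4 \<le> (1::real)" by auto
    have s1: "scale (Suc 0) = 1 / 4" using scale_1 by (simp only: One_nat_def)
    have "b (1 / 4 * (1 / 4)) - b (1 / 4 * (1 / 4) * cos (pi / 2)) \<le> (pi / 2)\<^sup>2 * k\<^sup>2 * (1 / 4)\<^sup>2 * energy T \<beta> k (1 / 4) / 2"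
      unfolding b_def by (rule energy_increment[OF T \<beta> r]) auto
    moreover have "b (1 / 4 * (1 / 4) * cos (pi / 2)) = (\<integral>x. tilt T \<beta> k x \<partial>\<mu>)\<^sup>2"
    proof -
      have "b (1 / 4 * (1 / 4) * cos (pi / 2)) = b 0" by simp
      then show ?thesis unfolding b_def OU_zero by (simp add: power2_eq_square)
    qed
    moreover have "(pi / 2)\<^sup>2 * k\<^sup>2 * (1 / 4)\<^sup>2 * energy T \<beta> k (1 / 4) / 2 \<le> k\<^sup>2 * F * (K + m * (2 / L))"
    proof -
      have e0: "e 0 \<le> 2 / L"
      proof -
        have "L / 2 \<le> exp (L / 2)" using exp_ge_add_one_self[of "L / 2"] by linarith
        then have "1 / exp (L / 2) \<le> 1 / (L / 2)" using L by (intro divide_left_mono) auto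
        then show ?thesis by (simp add: e_def exp_minus inverse_eq_divide)
      qed
      have X: "energy T \<beta> k (1 / 4) \<le> F * (K + m * (2 / L))"
      proof -
        have "energy T \<beta> k (1 / 4) \<le> F * (K + m * e 0)" using E[of 0] unfolding s1 .
        also have "\<dots> \<le> F * (K + m * (2 / L))"
          using F0 m e0 by (intro mult_left_mono add_left_mono)
        finally show ?thesis .
      qed
      have Y: "0 \<le> F * (K + m * (2 / L))" using F0 K m L by simp
      have "(pi / 2)\<^sup>2 * k\<^sup>2 * (1 / 4)\<^sup>2 * energy T \<beta> k (1 / 4) / 2 \<le> (pi / 2)\<^sup>2 * k\<^sup>2 * (1 / 4)\<^sup>2 * (F * (K + m * (2 / L))) / 2"
        by (intro divide_right_mono mult_left_mono X) auto
      also have "\<dots> = (pi / 2)\<^sup>2 * (1 / 32) * (k\<^sup>2 * (F * (K + m * (2 / L))))" by (simp add: power2_eq_square)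
      also have "\<dots> \<le> 1 * (k\<^sup>2 * (F * (K + m * (2 / L))))"
      proof (rule mult_right_mono)
        have "(pi / 2)\<^sup>2 \<le> 2\<^sup>2" using pi_less_4 pi_gt_zero by (intro power_mono) auto
        then show "(pi / 2)\<^sup>2 * (1 / 32) \<le> 1" by simp
        show "0 \<le> k\<^sup>2 * (F * (K + m * (2 / L)))" using Y by simp
      qed
      finally show ?thesis by (simp only: mult_1 mult.assoc)
    qed
    ultimately have "b (1 / 4 * (1 / 4)) - (\<integral>x. tilt T \<beta> k x \<partial>\<mu>)\<^sup>2 \<le> k\<^sup>2 * F * (K + m * (2 / L))" by linarith
    moreover have "1 / 4 * (1 / 4) = scale 0" by (simp add: scale_0)
    ultimately show ?thesis by (simp only:)
  qed
  \<comment> \<open>Close to 1 the crude energy at radius 1 is good enough, since the angle tends to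
    0.\<close>
  have first: "F - b (scale n) \<le> (arccos (scale n))\<^sup>2 * (k\<^sup>2 * energy T \<beta> k 1 / 2)" for n
  proof -
    have r: "(0::real) \<le> 1" "1 \<le> (1::real)" by auto
    have h: "0 < arccos (scale n)"
      using arccos_less_arccos[of "scale n" 1] scale_bounds[of n] by simp
    have h2: "arccos (scale n) \<le> pi / 2" using arccos_le_pi2[of "scale n"] scale_bounds[of n] by simp
    have ch: "cos (arccos (scale n)) = scale n" using scale_bounds[of n] by (intro cos_arccos) auto
    have "b (1 * 1) - b (1 * 1 * cos (arccos (scale n))) \<le> (arccos (scale n))\<^sup>2 * k\<^sup>2 * 1\<^sup>2 * energy T \<beta> k 1 / 2"
      unfolding b_def by (rule energy_increment[OF T \<beta> r h h2])
    moreover have "b (1 * 1) = F" unfolding b_def F_def mult_1 OU_one by (simp add: power2_eq_square)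
    ultimately show ?thesis unfolding ch by simp
  qed
  define V where "V = F - (\<integral>x. tilt T \<beta> k x \<partial>\<mu>)\<^sup>2"
  define R where "R = 12 * k\<^sup>2 * F * (K + m * (4 / L)) + k\<^sup>2 * F * (K + m * (2 / L))"
  have le: "V \<le> R + (arccos (scale n))\<^sup>2 * (k\<^sup>2 * energy T \<beta> k 1 / 2)" for n
    using first[of n] middle[of n] last unfolding V_def R_def by linarith
  have "(\<lambda>n. arccos (scale n)) \<longlonglongrightarrow> arccos 1"
  proof (rule continuous_on_tendsto_compose[OF continuous_on_arccos' scale_lim])
    show "\<forall>\<^sub>F n in sequentially. scale n \<in> {-1..1}"
      using sc by (intro always_eventually allI) (auto intro: order_trans[of "-1" 0])
  qed simp
  then have "(\<lambda>n. R + (arccos (scale n))\<^sup>2 * (k\<^sup>2 * energy T \<beta> k 1 / 2)) \<longlonglongrightarrow> R + (arccos 1)\<^sup>2 * (k\<^sup>2 * energy T \<beta> k 1 / 2)"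
    by (intro tendsto_intros)
  then have "V \<le> R + (arccos 1)\<^sup>2 * (k\<^sup>2 * energy T \<beta> k 1 / 2)"
    by (rule LIMSEQ_le_const) (use le in auto)
  then have "V \<le> R" by simp
  \<comment> \<open>The factor 13 is 12 + 1, and 50 is 12 times 4 plus 2; the former is then
    enlarged to 50.\<close>
  also have "R = (13 * K + 50 * (m / L)) * k\<^sup>2 * F"
    unfolding R_def by (simp add: field_simps)
  also have "\<dots> \<le> (50 * (K + m / L)) * k\<^sup>2 * F"
    using K F0 by (intro mult_right_mono) auto
  finally show ?thesis unfolding V_def F_def by (simp only: mult.assoc)
qed

text \<open>Since the square of \<open>tilt T \<beta> (s / 2)\<close> is
  \<open>tilt T \<beta> s\<close>, the variance bound at s/2 estimates \<psi> s by the square of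
  \<psi> (s / 2), up to a factor close to 1. After n halvings the 2^n-th power of \<psi> (\<theta> /
  2^n) remains, and its limit is at most 1 because the variable is centred.\<close>

theorem smax_exp_moment:
  assumes B: "0 \<le> B"
    and var: "\<And>k. (\<integral>x. (tilt T \<beta> k x)\<^sup>2 \<partial>\<mu>) - (\<integral>x. tilt T \<beta> k x \<partial>\<mu>)\<^sup>2 \<le> B * k\<^sup>2 * (\<integral>x. (tilt T \<beta> k x)\<^sup>2 \<partial>\<mu>)"
    and \<theta>: "\<theta>\<^sup>2 * B \<le> 1"
  shows "(\<integral>x. exp (\<theta> * (smax \<beta> T x - (\<integral>y. smax \<beta> T y \<partial>\<mu>))) \<partial>\<mu>) \<le> exp (2 / 3)"
proof -
  define m0 where "m0 = (\<integral>y. smax \<beta> T y \<partial>\<mu>)"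
  define \<psi> where "\<psi> s = (\<integral>x. exp (s * (smax \<beta> T x - m0)) \<partial>\<mu>)" for s
  have ed: "edom T (\<lambda>x. exp (s * (smax \<beta> T x - m0)))" for s
  proof -
    have "edom T (\<lambda>x. exp (- s * m0) * exp (s * smax \<beta> T x))" by (intro edom_cmult edom_exp_smax T \<beta>)
    then show ?thesis by (simp add: exp_add[symmetric] algebra_simps)
  qed
  have eY: "edom T (\<lambda>x. smax \<beta> T x - m0)"
    by (intro edom_diff edom_smax edom_const T \<beta>)
  have \<psi>_tilt: "\<psi> s = exp (- s * m0) * (\<integral>x. tilt T \<beta> s x \<partial>\<mu>)" for s
    unfolding \<psi>_def tilt_def[OF T \<beta>] integral_mult_right_zero[symmetric]
    by (intro Bochner_Integration.integral_cong refl) (simp add: exp_add[symmetric] algebra_simps)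
  have \<psi>0: "0 \<le> \<psi> s" for s unfolding \<psi>_def by simp
  have half: "\<psi> s \<le> (\<psi> (s / 2))\<^sup>2 * exp (s\<^sup>2 * B / 3)" if s: "s\<^sup>2 * B \<le> 1" for s
  proof -
    have sq: "(tilt T \<beta> (s / 2) x)\<^sup>2 = tilt T \<beta> s x" for x
      unfolding tilt_def[OF T \<beta>] by (simp add: exp_double[symmetric])
    define x where "x = s\<^sup>2 * B / 4"
    have x: "0 \<le> x" "x \<le> 1 / 4" using s B by (auto simp: x_def)
    define P where "P = (\<integral>x. tilt T \<beta> s x \<partial>\<mu>)"
    define Q where "Q = (\<integral>x. tilt T \<beta> (s / 2) x \<partial>\<mu>)"
    have P0: "0 \<le> P" unfolding P_def using tilt_pos[OF T \<beta>] by (intro Bochner_Integration.integral_nonneg) (simp add: less_imp_le)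
    have "P - Q\<^sup>2 \<le> B * (s / 2)\<^sup>2 * P" using var[of "s / 2"] unfolding sq P_def Q_def .
    then have 1: "P * (1 - x) \<le> Q\<^sup>2" by (simp add: x_def algebra_simps power_divide)
    \<comment> \<open>On [0, 1/4] the reciprocal of 1 - x is at most 1 + 4x/3; this is where s^2 B
      \<le> 1 is used.\<close>
    have 2: "1 \<le> (1 - x) * (1 + 4 / 3 * x)"
    proof -
      have "0 \<le> x * (1 / 3 - 4 / 3 * x)" using x by (intro mult_nonneg_nonneg) auto
      then show ?thesis by (simp add: algebra_simps)
    qed
    have "P \<le> P * ((1 - x) * (1 + 4 / 3 * x))" using mult_left_mono[OF 2 P0] by simp
    also have "\<dots> = (P * (1 - x)) * (1 + 4 / 3 * x)" by simp
    also have "\<dots> \<le> Q\<^sup>2 * (1 + 4 / 3 * x)" using 1 x by (intro mult_right_mono) auto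
    also have "\<dots> \<le> Q\<^sup>2 * exp (4 / 3 * x)" by (intro mult_left_mono exp_ge_add_one_self) auto
    also have "4 / 3 * x = s\<^sup>2 * B / 3" by (simp add: x_def)
    finally have "exp (- s * m0) * P \<le> exp (- s * m0) * (Q\<^sup>2 * exp (s\<^sup>2 * B / 3))" by (rule mult_left_mono) simp
    also have "\<dots> = (exp (- (s / 2) * m0) * Q)\<^sup>2 * exp (s\<^sup>2 * B / 3)"
      by (simp add: power_mult_distrib exp_double[symmetric])
    finally show ?thesis unfolding \<psi>_tilt P_def Q_def .
  qed
  \<comment> \<open>The n-th halving costs \<theta>^2 B / 3 times 2^(-n) in the exponent, and the
    geometric series sums to the 2/3 of the conclusion.\<close>
  have iter: "\<psi> \<theta> \<le> \<psi> (\<theta> / 2 ^ n) ^ (2 ^ n) * exp (2 / 3 * (\<theta>\<^sup>2 * B) * (1 - 1 / 2 ^ n))" for n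
  proof (induction n)
    case 0
    then show ?case by simp
  next
    case (Suc n)
    define s where "s = \<theta> / 2 ^ n"
    have s2: "s\<^sup>2 * B = \<theta>\<^sup>2 * B / 4 ^ n" unfolding s_def by (simp add: power_divide power_mult_distrib[symmetric] power2_eq_square)
    have "s\<^sup>2 * B \<le> 1"
    proof -
      have "\<theta>\<^sup>2 * B / 4 ^ n \<le> \<theta>\<^sup>2 * B / 1" using B by (intro divide_left_mono) auto
      then show ?thesis unfolding s2 using \<theta> by linarith
    qed
    from half[OF this] have "\<psi> s ^ (2 ^ n) \<le> ((\<psi> (s / 2))\<^sup>2 * exp (s\<^sup>2 * B / 3)) ^ (2 ^ n)"
      using \<psi>0 by (intro power_mono) auto
    also have "\<dots> = \<psi> (s / 2) ^ (2 ^ Suc n) * exp (\<theta>\<^sup>2 * B / 3 / 2 ^ n)"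
    proof -
      have "exp (s\<^sup>2 * B / 3) ^ (2 ^ n) = exp (of_nat (2 ^ n) * (s\<^sup>2 * B / 3))" by (rule exp_of_nat_mult[symmetric])
      also have "of_nat (2 ^ n) * (s\<^sup>2 * B / 3) = \<theta>\<^sup>2 * B / 3 / 2 ^ n"
      proof -
        have "(4::real) ^ n = 2 ^ n * 2 ^ n" by (simp add: power_mult_distrib[symmetric])
        then show ?thesis unfolding s2 by simp
      qed
      finally show ?thesis by (simp add: power_mult_distrib power_mult[symmetric])
    qed
    finally have "\<psi> s ^ (2 ^ n) * exp (2 / 3 * (\<theta>\<^sup>2 * B) * (1 - 1 / 2 ^ n)) \<le> \<psi> (s / 2) ^ (2 ^ Suc n) * exp (\<theta>\<^sup>2 * B / 3 / 2 ^ n) * exp (2 / 3 * (\<theta>\<^sup>2 * B) * (1 - 1 / 2 ^ n))"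
      by (rule mult_right_mono) simp
    also have "\<dots> = \<psi> (s / 2) ^ (2 ^ Suc n) * exp (2 / 3 * (\<theta>\<^sup>2 * B) * (1 - 1 / 2 ^ Suc n))"
      by (simp add: mult.assoc exp_add[symmetric] field_simps)
    finally show ?case using Suc unfolding s_def by (simp add: mult.commute)
  qed
  define C where "C = (\<integral>x. (smax \<beta> T x - m0)\<^sup>2 * (exp (\<theta> * (smax \<beta> T x - m0)) + exp (- \<theta> * (smax \<beta> T x - m0))) \<partial>\<mu>)"
  \<comment> \<open>Centring removes the first-order term. At s = \<theta> / 2^n the 2^n-th power of
    this bound has exponent \<theta>^2 C / 2^n, which vanishes in the limit.\<close>
  have small: "\<psi> s \<le> exp (s\<^sup>2 * C)" if s: "\<bar>s\<bar> \<le> \<bar>\<theta>\<bar>" for s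
  proof -
    let ?Y = "\<lambda>x. smax \<beta> T x - m0"
    let ?w = "\<lambda>x. (?Y x)\<^sup>2 * (exp (\<theta> * ?Y x) + exp (- \<theta> * ?Y x))"
    have ew: "edom T ?w" by (intro edom_mult[OF edom_power2[OF eY] edom_add[OF ed ed]])
    have iw: "integrable \<mu> ?w" and iY: "integrable \<mu> ?Y" by (rule integrable_edom[OF T(1)], rule ew eY)+
    have "\<psi> s \<le> (\<integral>x. 1 + s * ?Y x + s\<^sup>2 * ?w x \<partial>\<mu>)"
      unfolding \<psi>_def
    proof (rule integral_mono[OF integrable_edom[OF T(1) ed]])
      show "integrable \<mu> (\<lambda>x. 1 + s * ?Y x + s\<^sup>2 * ?w x)"
        using iw iY by (intro Bochner_Integration.integrable_add integrable_mult_right) simp_all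
      fix x
      have "\<bar>s * ?Y x\<bar> \<le> \<bar>\<theta> * ?Y x\<bar>" unfolding abs_mult using s by (rule mult_right_mono) simp
      then have "exp \<bar>s * ?Y x\<bar> \<le> exp \<bar>\<theta> * ?Y x\<bar>" by simp
      also have "\<dots> \<le> exp (\<theta> * ?Y x) + exp (- \<theta> * ?Y x)" by (cases "0 \<le> \<theta> * ?Y x") (auto simp: abs_of_nonneg abs_of_neg)
      finally have "(s * ?Y x)\<^sup>2 * exp \<bar>s * ?Y x\<bar> \<le> (s * ?Y x)\<^sup>2 * (exp (\<theta> * ?Y x) + exp (- \<theta> * ?Y x))"
        by (rule mult_left_mono) simp
      then show "exp (s * ?Y x) \<le> 1 + s * ?Y x + s\<^sup>2 * ?w x"
        using exp_le_quadratic[of "s * ?Y x"] unfolding power_mult_distrib mult.assoc by linarith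
    qed
    also have "\<dots> = (\<integral>x. 1 + s * ?Y x \<partial>\<mu>) + (\<integral>x. s\<^sup>2 * ?w x \<partial>\<mu>)"
      using iw iY by (intro Bochner_Integration.integral_add Bochner_Integration.integrable_add integrable_mult_right) simp_all
    also have "(\<integral>x. 1 + s * ?Y x \<partial>\<mu>) = 1"
      using integrable_edom[OF T(1) edom_smax[OF T \<beta>]] by (simp add: prob_space m0_def)
    also have "(\<integral>x. s\<^sup>2 * ?w x \<partial>\<mu>) = s\<^sup>2 * C" unfolding C_def by (rule integral_mult_right_zero)
    also have "1 + s\<^sup>2 * C \<le> exp (s\<^sup>2 * C)" by (rule exp_ge_add_one_self)
    finally show ?thesis .
  qed
  have bound: "\<psi> \<theta> \<le> exp (2 / 3 + \<theta>\<^sup>2 * C / 2 ^ n)" for n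
  proof -
    have "\<bar>\<theta> / 2 ^ n\<bar> \<le> \<bar>\<theta>\<bar> / 1" unfolding abs_divide by (intro frac_le) auto
    then have "\<psi> (\<theta> / 2 ^ n) \<le> exp ((\<theta> / 2 ^ n)\<^sup>2 * C)" by (intro small) simp
    then have "\<psi> (\<theta> / 2 ^ n) ^ (2 ^ n) \<le> exp ((\<theta> / 2 ^ n)\<^sup>2 * C) ^ (2 ^ n)" using \<psi>0 by (intro power_mono) auto
    also have "\<dots> = exp (of_nat (2 ^ n) * ((\<theta> / 2 ^ n)\<^sup>2 * C))" by (rule exp_of_nat_mult[symmetric])
    also have "of_nat (2 ^ n) * ((\<theta> / 2 ^ n)\<^sup>2 * C) = \<theta>\<^sup>2 * C / 2 ^ n" by (simp add: power2_eq_square)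
    finally have 1: "\<psi> (\<theta> / 2 ^ n) ^ (2 ^ n) \<le> exp (\<theta>\<^sup>2 * C / 2 ^ n)" .
    have "2 / 3 * (\<theta>\<^sup>2 * B) * (1 - 1 / 2 ^ n) \<le> 2 / 3 * 1 * 1"
      using \<theta> B by (intro mult_mono) auto
    then have 2: "exp (2 / 3 * (\<theta>\<^sup>2 * B) * (1 - 1 / 2 ^ n)) \<le> exp (2 / 3)" by simp
    have "\<psi> \<theta> \<le> exp (\<theta>\<^sup>2 * C / 2 ^ n) * exp (2 / 3)"
      by (rule order_trans[OF iter[of n] mult_mono[OF 1 2]]) auto
    then show ?thesis by (simp add: exp_add mult.commute)
  qed
  have "(\<lambda>n. exp (2 / 3 + \<theta>\<^sup>2 * C * (1 / 2) ^ n)) \<longlonglongrightarrow> exp (2 / 3 + \<theta>\<^sup>2 * C * 0)"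
    by (intro tendsto_intros LIMSEQ_realpow_zero) auto
  then have "\<psi> \<theta> \<le> exp (2 / 3 + \<theta>\<^sup>2 * C * 0)"
    by (rule LIMSEQ_le_const) (use bound in \<open>auto simp: power_one_over\<close>)
  then show ?thesis by (simp add: \<psi>_def m0_def)
qed

end

end

section \<open>Expected maxima\<close>

definition fmax :: "'t set \<Rightarrow> ('t \<Rightarrow> real) \<Rightarrow> real" where
  "fmax T x = Max (x ` T)"

text \<open>The density decreases on the interval from \<open>l\<close> to \<open>l + 1\<close>,
  which has length 1. The crude bound has the right order in the exponent.\<close>

lemma std_normal_tail:
  assumes l: "0 \<le> l" shows "std_normal_density (l + 1) \<le> measure nrm {l..}"
proof -
  have "ennreal (std_normal_density (l + 1)) = (\<integral>\<^sup>+x. ennreal (std_normal_density (l + 1)) * indicator {l..l + 1} x \<partial>lborel)"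
    by (simp add: nn_integral_cmult)
  also have "\<dots> \<le> (\<integral>\<^sup>+x. ennreal (std_normal_density x) * indicator {l..} x \<partial>lborel)"
  proof (rule nn_integral_mono)
    fix x :: real
    show "ennreal (std_normal_density (l + 1)) * indicator {l..l + 1} x \<le> ennreal (std_normal_density x) * indicator {l..} x"
    proof (cases "x \<in> {l..l + 1}")
      case True
      then have "x\<^sup>2 \<le> (l + 1)\<^sup>2" using l by (intro power_mono) auto
      then have "std_normal_density (l + 1) \<le> std_normal_density x" unfolding std_normal_density_alt by (intro mult_left_mono) auto
      then show ?thesis using True by (auto intro: ennreal_leI)
    qed simp
  qed
  also have "\<dots> = emeasure nrm {l..}" by (subst emeasure_density) auto
  also have "\<dots> = ennreal (measure nrm {l..})" by (rule nrm.emeasure_eq_measure)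
  finally show ?thesis by (simp add: ennreal_le_iff)
qed

context gaussian_path_law begin

lemma cov_ge: "- 1 \<le> \<Gamma> s t"
proof -
  let ?T = "{s, t}"
  have T: "finite ?T" by simp
  have e: "edom ?T (\<lambda>x. x s)" "edom ?T (\<lambda>x. x t)" by (auto intro!: edom_coord)
  note i = integrable_edom[OF T edom_mult[OF e(1) e(1)]] integrable_edom[OF T edom_mult[OF e(2) e(2)]] integrable_edom[OF T edom_mult[OF e(1) e(2)]]
  have "- (\<Gamma> s s + \<Gamma> t t) = (\<integral>x. - (x s * x s + x t * x t) \<partial>\<mu>)" using i by (simp add: cov)
  also have "\<dots> \<le> (\<integral>x. 2 * (x s * x t) \<partial>\<mu>)"
  proof (rule integral_mono)
    fix x :: "'t \<Rightarrow> real"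
    have "0 \<le> (x s + x t)\<^sup>2" by simp
    then show "- (x s * x s + x t * x t) \<le> 2 * (x s * x t)" by (simp add: power2_eq_square algebra_simps)
  qed (use i in auto)
  also have "\<dots> = 2 * \<Gamma> s t" by (simp add: cov)
  finally show ?thesis by (simp add: unit_var)
qed

text \<open>Replacing the component of an independent copy along the coordinate \<open>i\<close> by the original one
  does not change the law.\<close>

lemma distr_regression:
  "distr (\<mu> \<Otimes>\<^sub>M \<mu>) path_space (\<lambda>p t. snd p t + \<Gamma> t i * (fst p i - snd p i)) = \<mu>"
proof (rule path_law_eqI)
  have [measurable]: "(\<lambda>p t. snd p t + \<Gamma> t i * (fst p i - snd p i)) \<in> measurable (\<mu> \<Otimes>\<^sub>M \<mu>) path_space"
    unfolding measurable_cong_sets[OF sets_pair refl] by (rule measurable_into_path_space) measurable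
  show "prob_space (distr (\<mu> \<Otimes>\<^sub>M \<mu>) path_space (\<lambda>p t. snd p t + \<Gamma> t i * (fst p i - snd p i)))"
    by (rule PP.prob_space_distr) simp
  show "prob_space \<mu>" by (rule prob_space_axioms)
  show "sets \<mu> = sets path_space" by (rule sets_mu)
  fix K :: "'t set" and a :: "'t \<Rightarrow> real" assume K: "finite K"
  define K' where "K' = insert i K"
  have K': "finite K'" using K by (simp add: K'_def)
  define A where "A = (\<Sum>t\<in>K. a t * \<Gamma> t i)"
  define a' where "a' t = (if t \<in> K then a t else 0)" for t
  define u where "u t = (if t = i then A else 0)" for t
  have KK: "(\<Sum>t\<in>K'. a' t * h t) = (\<Sum>t\<in>K. a t * h t)" for h
    unfolding K'_def a'_def using K by (intro sum.mono_neutral_cong_right) auto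
  have Ki: "(\<Sum>t\<in>K'. u t * h t) = A * h i" for h
  proof -
    have "(\<Sum>t\<in>K'. u t * h t) = (\<Sum>t\<in>K'. if t = i then A * h t else 0)"
      by (intro sum.cong) (auto simp: u_def)
    then show ?thesis using K by (simp add: K'_def)
  qed
  have rw: "(\<Sum>t\<in>K. a t * (y t + \<Gamma> t i * (x i - y i))) = (\<Sum>t\<in>K'. u t * x t) + (\<Sum>t\<in>K'. lin 1 a' (- 1) u t * y t)" for x y
  proof -
    have "(\<Sum>t\<in>K. a t * (y t + \<Gamma> t i * (x i - y i))) = (\<Sum>t\<in>K. a t * y t) + A * (x i - y i)"
      unfolding A_def sum_distrib_right sum.distrib[symmetric] by (intro sum.cong) (auto simp: algebra_simps)
    moreover have "(\<Sum>t\<in>K'. lin 1 a' (- 1) u t * y t) = (\<Sum>t\<in>K'. a' t * y t) - (\<Sum>t\<in>K'. u t * y t)"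
      unfolding sum_subtractf[symmetric] by (intro sum.cong) (auto simp: algebra_simps)
    ultimately show ?thesis unfolding KK Ki by (simp add: algebra_simps)
  qed
  have q1: "qf K' a' u = A * A"
  proof -
    have "qf K' a' u = (\<Sum>s\<in>K'. a' s * (\<Sum>t\<in>K'. u t * \<Gamma> s t))"
      unfolding qf_def sum_distrib_left by (simp add: mult.assoc)
    also have "\<dots> = (\<Sum>s\<in>K'. a' s * (A * \<Gamma> s i))" unfolding Ki ..
    also have "\<dots> = A * (\<Sum>s\<in>K'. a' s * \<Gamma> s i)" unfolding sum_distrib_left by (intro sum.cong) auto
    finally show ?thesis unfolding KK A_def .
  qed
  have q2: "qf K' u u = A * A"
  proof -
    have "qf K' u u = (\<Sum>s\<in>K'. u s * (\<Sum>t\<in>K'. u t * \<Gamma> s t))"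
      unfolding qf_def sum_distrib_left by (simp add: mult.assoc)
    then show ?thesis unfolding Ki by (simp add: unit_var)
  qed
  have q3: "qf K' a' a' = qf K a a"
  proof -
    have "qf K' a' a' = (\<Sum>s\<in>K'. a' s * (\<Sum>t\<in>K'. a' t * \<Gamma> s t))"
      unfolding qf_def sum_distrib_left by (simp add: mult.assoc)
    then show ?thesis unfolding KK by (simp add: qf_def sum_distrib_left mult.assoc)
  qed
  have q: "qf K' u u + qf K' (lin 1 a' (- 1) u) (lin 1 a' (- 1) u) = qf K a a"
    unfolding qf_lin q1 q2 q3 by (simp add: algebra_simps)
  show "(\<integral>x. cos (\<Sum>t\<in>K. a t * x t) \<partial>distr (\<mu> \<Otimes>\<^sub>M \<mu>) path_space (\<lambda>p t. snd p t + \<Gamma> t i * (fst p i - snd p i))) = (\<integral>x. cos (\<Sum>t\<in>K. a t * x t) \<partial>\<mu>)"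
    by (subst integral_distr, simp, simp, simp only: rw pair_char[OF K'] q cos_char[OF K] qf_def[symmetric])
  show "(\<integral>x. sin (\<Sum>t\<in>K. a t * x t) \<partial>distr (\<mu> \<Otimes>\<^sub>M \<mu>) path_space (\<lambda>p t. snd p t + \<Gamma> t i * (fst p i - snd p i))) = (\<integral>x. sin (\<Sum>t\<in>K. a t * x t) \<partial>\<mu>)"
    by (subst integral_distr, simp, simp, simp only: rw pair_char[OF K'] sin_char[OF K])
qed simp_all

lemma coord_mean: "(\<integral>x. x t \<partial>\<mu>) = 0" and coord_abs_mean: "(\<integral>x. \<bar>x t\<bar> \<partial>\<mu>) \<le> 1"
  and coord_integrable: "integrable \<mu> (\<lambda>x. x t)"
proof -
  have T: "finite {t}" by simp
  have e: "edom {t} (\<lambda>x. x t)" by (auto intro!: edom_coord)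
  show i: "integrable \<mu> (\<lambda>x. x t)" by (rule integrable_edom[OF T e])
  have "(\<integral>x. x t \<partial>\<mu>) = (\<integral>z. z \<partial>distr \<mu> borel (\<lambda>x. x t))" by (rule integral_distr[symmetric]) auto
  then show "(\<integral>x. x t \<partial>\<mu>) = 0"
    unfolding distr_coord using integral_std_normal_distribution_moment_odd[of 1] by simp
  have e2: "edom {t} (\<lambda>x. \<bar>x t\<bar>)" by (rule edom_mono[OF e]) auto
  have "(\<integral>x. \<bar>x t\<bar> \<partial>\<mu>)\<^sup>2 \<le> (\<integral>x. \<bar>x t\<bar>\<^sup>2 \<partial>\<mu>)"
    by (rule integral_sq_le) (auto intro!: integrable_edom[OF T] edom_power2 e e2)
  also have "\<dots> = 1\<^sup>2" using cov[of t t] by (simp add: unit_var power2_eq_square)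
  finally show "(\<integral>x. \<bar>x t\<bar> \<partial>\<mu>) \<le> 1" by (rule power2_le_imp_le) simp
qed

context
  fixes T :: "'t set" and \<beta> :: real
  assumes T: "finite T" "T \<noteq> {}" and \<beta>: "0 < \<beta>"
begin

lemma integrable_smax: "integrable \<mu> (smax \<beta> T)"
  by (rule integrable_edom[OF T(1) edom_smax[OF T \<beta>]])

lemma smax_mean_nonneg: "0 \<le> (\<integral>x. smax \<beta> T x \<partial>\<mu>)"
proof -
  obtain t where t: "t \<in> T" using T by blast
  have "(\<integral>x. x t \<partial>\<mu>) \<le> (\<integral>x. smax \<beta> T x \<partial>\<mu>)"
    by (intro integral_mono coord_integrable integrable_smax smax_ge[OF T \<beta> t])
  then show ?thesis by (simp add: coord_mean)
qed

text \<open>A lower bound for the expected maximum in the manner of Sudakov: each coordinate \<open>i\<close> in \<open>S\<close>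
  is the strict maximum with probability at least half of the probability that a standard normal
  variable exceeds \<open>lam\<close>, and these events are disjoint.\<close>

theorem separated_card_le:
  assumes S: "S \<subseteq> T" and \<rho>: "\<rho> < 1" and sep: "\<And>s t. s \<in> S \<Longrightarrow> t \<in> S \<Longrightarrow> s \<noteq> t \<Longrightarrow> \<Gamma> s t \<le> \<rho>"
  defines "lam \<equiv> 2 * ((\<integral>x. smax \<beta> T x \<partial>\<mu>) + 1) / (1 - \<rho>)"
  shows "real (card S) * std_normal_density (lam + 1) \<le> 2"
proof -
  define m where "m = (\<integral>x. smax \<beta> T x \<partial>\<mu>)"
  have m0: "0 \<le> m" unfolding m_def by (rule smax_mean_nonneg)
  \<comment> \<open>The level \<open>lam\<close> makes the advantage
    \<open>lam * (1 - \<rho>)\<close> of the coordinate \<open>i\<close> equal to 2 (m + 1), the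
    threshold for which Markov's inequality leaves probability at least 1/2 to the event
    \<open>B\<close> below.\<close>
  have lam: "0 < lam" "lam * (1 - \<rho>) = 2 * (m + 1)" using m0 \<rho> unfolding lam_def m_def[symmetric] by auto
  have finS: "finite S" using S T(1) finite_subset by blast
  define C where "C i = {x \<in> space \<mu>. \<forall>j\<in>S - {i}. x j < x i}" for i
  have Cm: "C i \<in> sets \<mu>" for i unfolding C_def using finS by (intro sets.sets_Collect_finite_All) (auto, measurable)
  have half: "measure nrm {lam..} / 2 \<le> prob (C i)" if i: "i \<in> S" for i
  proof -
    let ?X = "\<lambda>p t. snd p t + \<Gamma> t i * (fst p i - snd p i)"
    have iT: "i \<in> T" using i S by blast
    define A where "A = {x \<in> space \<mu>. lam \<le> x i}"
    define B where "B = {x \<in> space \<mu>. smax \<beta> T x + \<bar>x i\<bar> < 2 * (m + 1)}"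
    have Am: "A \<in> sets \<mu>" unfolding A_def by measurable
    have Bm: "B \<in> sets \<mu>" unfolding B_def by measurable
    have PA: "prob A = measure nrm {lam..}"
      unfolding distr_coord[of i, symmetric] by (subst measure_distr) (auto simp: A_def vimage_def Int_def conj_commute)
    have PB: "1 / 2 \<le> prob B"
    proof -
      have i1: "integrable \<mu> (\<lambda>x. smax \<beta> T x + \<bar>x i\<bar>)"
        by (intro Bochner_Integration.integrable_add integrable_smax integrable_abs coord_integrable)
      have nn: "0 \<le> smax \<beta> T x + \<bar>x i\<bar>" for x using smax_ge[OF T \<beta> iT, of x] by linarith
      have "prob {x \<in> space \<mu>. 2 * (m + 1) \<le> smax \<beta> T x + \<bar>x i\<bar>} \<le> (\<integral>x. smax \<beta> T x + \<bar>x i\<bar> \<partial>\<mu>) / (2 * (m + 1))"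
        using m0 nn by (intro integral_Markov_inequality_measure[OF i1, where A = "{}"]) auto
      also have "\<dots> \<le> (m + 1) / (2 * (m + 1))"
      proof (rule divide_right_mono)
        have "(\<integral>x. smax \<beta> T x + \<bar>x i\<bar> \<partial>\<mu>) = m + (\<integral>x. \<bar>x i\<bar> \<partial>\<mu>)"
          unfolding m_def by (intro Bochner_Integration.integral_add integrable_smax integrable_abs coord_integrable)
        then show "(\<integral>x. smax \<beta> T x + \<bar>x i\<bar> \<partial>\<mu>) \<le> m + 1" using coord_abs_mean[of i] by linarith
      qed (use m0 in simp)
      also have "\<dots> = 1 / 2" using m0 by simp
      finally have le: "prob {x \<in> space \<mu>. 2 * (m + 1) \<le> smax \<beta> T x + \<bar>x i\<bar>} \<le> 1 / 2" .
      have "{x \<in> space \<mu>. 2 * (m + 1) \<le> smax \<beta> T x + \<bar>x i\<bar>} = space \<mu> - B" unfolding B_def by auto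
      then show ?thesis using le prob_compl[OF Bm] by simp
    qed
    have Xm: "?X \<in> measurable (\<mu> \<Otimes>\<^sub>M \<mu>) path_space"
      unfolding measurable_cong_sets[OF sets_pair refl] by (rule measurable_into_path_space) measurable
    have sub: "A \<times> B \<subseteq> ?X -` C i \<inter> space (\<mu> \<Otimes>\<^sub>M \<mu>)"
    proof
      \<comment> \<open>With x and y for the two copies, the new path has the value x_i at
        \<open>i\<close>, and at \<open>j\<close> the value y_j + \<Gamma> (x_i - y_i) where
        \<Gamma> stands for \<Gamma> j i. So it remains to compare y_j - \<Gamma> y_i, which is
        below 2 (m + 1) on \<open>B\<close>, with (1 - \<Gamma>) x_i, which is at least
        \<open>lam * (1 - \<rho>)\<close> on \<open>A\<close>.\<close>
      fix p assume p: "p \<in> A \<times> B"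
      have xi: "lam \<le> fst p i" and y: "smax \<beta> T (snd p) + \<bar>snd p i\<bar> < 2 * (m + 1)" using p by (auto simp: A_def B_def)
      have "?X p j < ?X p i" if j: "j \<in> S - {i}" for j
      proof -
        have jT: "j \<in> T" and G: "\<Gamma> j i \<le> \<rho>" using j i S sep[of j i] by auto
        have "lam * (1 - \<rho>) \<le> fst p i * (1 - \<Gamma> j i)"
          using xi lam(1) G \<rho> by (intro mult_mono) auto
        moreover have "- (\<Gamma> j i * snd p i) \<le> \<bar>snd p i\<bar>"
        proof -
          have "\<bar>\<Gamma> j i * snd p i\<bar> \<le> 1 * \<bar>snd p i\<bar>" unfolding abs_mult
            using cov_le_1[of j i] cov_ge[of j i] by (intro mult_right_mono) auto
          then show ?thesis by linarith
        qed
        moreover have "snd p j \<le> smax \<beta> T (snd p)" by (rule smax_ge[OF T \<beta> jT])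
        ultimately have "snd p j - \<Gamma> j i * snd p i < fst p i * (1 - \<Gamma> j i)" using y lam(2) by linarith
        then show ?thesis by (simp add: unit_var algebra_simps)
      qed
      then show "p \<in> ?X -` C i \<inter> space (\<mu> \<Otimes>\<^sub>M \<mu>)"
        by (simp add: C_def space_mu space_pair_measure)
    qed
    have "prob A * prob B = measure (\<mu> \<Otimes>\<^sub>M \<mu>) (A \<times> B)"
      using Am Bm by (simp add: measure_def emeasure_pair_measure_Times enn2real_mult)
    also have "\<dots> \<le> measure (\<mu> \<Otimes>\<^sub>M \<mu>) (?X -` C i \<inter> space (\<mu> \<Otimes>\<^sub>M \<mu>))"
      using Cm measurable_sets[OF Xm, of "C i"] sets_mu by (intro PP.finite_measure_mono sub) auto
    also have "\<dots> = measure (distr (\<mu> \<Otimes>\<^sub>M \<mu>) path_space ?X) (C i)"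
      using Xm Cm sets_mu by (intro measure_distr[symmetric]) auto
    finally have "prob A * prob B \<le> prob (C i)" unfolding distr_regression .
    moreover have "prob A * (1 / 2) \<le> prob A * prob B" using PB by (intro mult_left_mono) auto
    ultimately show ?thesis using PA by simp
  qed
  have "real (card S) * (measure nrm {lam..} / 2) \<le> (\<Sum>i\<in>S. prob (C i))"
    using sum_bounded_below[of S "measure nrm {lam..} / 2" "\<lambda>i. prob (C i)"] half by simp
  also have "\<dots> = prob (\<Union>i\<in>S. C i)"
  proof (rule finite_measure_finite_Union[symmetric, OF finS])
    show "C ` S \<subseteq> sets \<mu>" using Cm by auto
    show "disjoint_family_on C S"
      unfolding disjoint_family_on_def C_def by (auto) (metis Diff_iff empty_iff insert_iff not_less_iff_gr_or_eq)
  qed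
  also have "\<dots> \<le> 1" by simp
  finally have "real (card S) * measure nrm {lam..} \<le> 2" by simp
  moreover have "real (card S) * std_normal_density (lam + 1) \<le> real (card S) * measure nrm {lam..}"
    using std_normal_tail[of lam] lam(1) by (intro mult_left_mono) auto
  ultimately show ?thesis by linarith
qed

text \<open>If the mean were more than 3 above \<open>c\<close>, the event would force a downward
  deviation by 3. Concentration gives this probability at most exp (pi^2 / 8 - 3) \<le> exp (- 1) <
  1/2.\<close>

lemma smax_mean_le_of_prob:
  assumes a: "1 / 2 \<le> prob {x \<in> space \<mu>. \<forall>t\<in>T. x t \<le> a}"
  shows "(\<integral>x. smax \<beta> T x \<partial>\<mu>) \<le> a + ln (card T) / \<beta> + 3"
proof (rule ccontr)
  define m where "m = (\<integral>x. smax \<beta> T x \<partial>\<mu>)"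
  define c where "c = a + ln (card T) / \<beta>"
  assume "\<not> ?thesis"
  then have gap: "3 < m - c" by (simp add: m_def c_def)
  have ie: "integrable \<mu> (\<lambda>x. exp (- 1 * (smax \<beta> T x - m)))"
  proof -
    have "edom T (\<lambda>x. exp m * exp (- 1 * smax \<beta> T x))" by (intro edom_cmult edom_exp_smax T \<beta>)
    then have "edom T (\<lambda>x. exp (- 1 * (smax \<beta> T x - m)))" by (simp add: exp_add[symmetric])
    then show ?thesis by (rule integrable_edom[OF T(1)])
  qed
  have "prob {x \<in> space \<mu>. \<forall>t\<in>T. x t \<le> a} \<le> prob {x \<in> space \<mu>. exp 3 \<le> exp (- 1 * (smax \<beta> T x - m))}"
  proof (rule finite_measure_mono)
    show "{x \<in> space \<mu>. \<forall>t\<in>T. x t \<le> a} \<subseteq> {x \<in> space \<mu>. exp 3 \<le> exp (- 1 * (smax \<beta> T x - m))}"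
    proof (intro subsetI CollectI conjI)
      fix x assume "x \<in> {x \<in> space \<mu>. \<forall>t\<in>T. x t \<le> a}"
      then have "smax \<beta> T x \<le> c" unfolding c_def by (intro smax_le[OF T \<beta>]) auto
      then show "exp 3 \<le> exp (- 1 * (smax \<beta> T x - m))" using gap by simp
    qed (simp add: space_mu)
    show "{x \<in> space \<mu>. exp 3 \<le> exp (- 1 * (smax \<beta> T x - m))} \<in> sets \<mu>" by measurable
  qed
  also have "\<dots> \<le> (\<integral>x. exp (- 1 * (smax \<beta> T x - m)) \<partial>\<mu>) / exp 3"
    by (intro integral_Markov_inequality_measure[OF ie, where A = "{}"]) auto
  also have "\<dots> \<le> exp ((- 1)\<^sup>2 * pi\<^sup>2 / 8) / exp 3"
    unfolding m_def by (intro divide_right_mono smax_exp_concentration[OF T \<beta>]) simp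
  also have "\<dots> \<le> exp 2 / exp 3"
  proof -
    have "pi\<^sup>2 \<le> 4\<^sup>2" using pi_less_4 pi_gt_zero by (intro power_mono) auto
    then show ?thesis by (intro divide_right_mono) auto
  qed
  also have "\<dots> = exp (- 1)" by (simp flip: exp_diff)
  also have "\<dots> < 1 / 2"
  proof -
    have "2 < exp (1::real)" using exp_lower_Taylor_quadratic[of 1] by simp
    then have "1 / exp 1 < 1 / (2::real)" by (intro divide_strict_left_mono) auto
    then show ?thesis by (simp add: exp_minus inverse_eq_divide)
  qed
  finally show False using a by simp
qed

text \<open>The Gibbs mass of \<open>F\<close> is the exponential of \<beta> times a nonpositive
  difference of soft maxima, so \<beta> may be lowered to any \<open>l\<close> below it.
  Cauchy-Schwarz and concentration of both soft maxima bound the mean by exp (8 l^2 - l \<gamma>),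
  and l = \<gamma>/16 minimises the exponent.\<close>

lemma piece_mass_le:
  assumes F: "F \<subseteq> T" "F \<noteq> {}" and \<gamma>: "0 \<le> \<gamma>" "\<gamma> / 16 \<le> \<beta>"
    and gap: "(\<integral>x. smax \<beta> F x \<partial>\<mu>) + \<gamma> \<le> (\<integral>x. smax \<beta> T x \<partial>\<mu>)"
  shows "(\<integral>x. mass T \<beta> F x \<partial>\<mu>) \<le> exp (- (\<gamma>\<^sup>2 / 32))"
proof -
  have finF: "finite F" using F T(1) finite_subset by blast
  define l where "l = \<gamma> / 16"
  have l: "0 \<le> l" "l \<le> \<beta>" using \<gamma> by (auto simp: l_def)
  define mF where "mF = (\<integral>x. smax \<beta> F x \<partial>\<mu>)"
  define mT where "mT = (\<integral>x. smax \<beta> T x \<partial>\<mu>)"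
  define u where "u x = exp (l * (smax \<beta> F x - mF))" for x
  define v where "v x = exp (- l * (smax \<beta> T x - mT))" for x
  have pw: "mass T \<beta> F x \<le> exp (l * (mF - mT)) * (u x * v x)" for x
  proof -
    have TF: "T \<inter> F = F" using F by blast
    have z: "smz \<beta> A x = exp (\<beta> * smax \<beta> A x)" if "finite A" "A \<noteq> {}" for A :: "'t set"
      using smz_pos[OF that \<beta>, of x] \<beta> by (simp add: smax_def)
    have "mass T \<beta> F x = smz \<beta> F x / smz \<beta> T x"
      unfolding mass_def[OF T \<beta>] TF smp_def sum_divide_distrib[symmetric] smz_def ..
    also have "\<dots> = exp (\<beta> * (smax \<beta> F x - smax \<beta> T x))"
      unfolding z[OF finF F(2)] z[OF T] by (simp add: exp_diff right_diff_distrib)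
    also have "\<dots> \<le> exp (l * (smax \<beta> F x - smax \<beta> T x))"
    proof -
      have "smz \<beta> F x \<le> smz \<beta> T x" unfolding smz_def using F T(1) by (intro sum_mono2) auto
      then have "smax \<beta> F x \<le> smax \<beta> T x"
        unfolding smax_def using \<beta> smz_pos[OF finF F(2) \<beta>, of x] by (intro divide_right_mono) (auto simp: ln_mono)
      then have "\<beta> * (smax \<beta> F x - smax \<beta> T x) \<le> l * (smax \<beta> F x - smax \<beta> T x)"
        using l by (intro mult_right_mono_neg) auto
      then show ?thesis by simp
    qed
    also have "\<dots> = exp (l * (mF - mT)) * (u x * v x)"
      unfolding u_def v_def exp_add[symmetric] by (simp add: algebra_simps)
    finally show ?thesis .
  qed
  have eu: "edom F u"
  proof -
    have "edom F (\<lambda>x. exp (- l * mF) * exp (l * smax \<beta> F x))" by (intro edom_cmult edom_exp_smax finF F(2) \<beta>)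
    moreover have "(\<lambda>x. exp (- l * mF) * exp (l * smax \<beta> F x)) = u" by (simp add: u_def exp_add[symmetric] algebra_simps fun_eq_iff)
    ultimately show ?thesis by simp
  qed
  have ev: "edom T v"
  proof -
    have "edom T (\<lambda>x. exp (l * mT) * exp (- l * smax \<beta> T x))" by (intro edom_cmult edom_exp_smax T \<beta>)
    moreover have "(\<lambda>x. exp (l * mT) * exp (- l * smax \<beta> T x)) = v" by (simp add: v_def exp_add[symmetric] algebra_simps fun_eq_iff)
    ultimately show ?thesis by simp
  qed
  note [measurable] = edom_measurable[OF eu] edom_measurable[OF ev]
  have iu: "integrable \<mu> (\<lambda>x. (u x)\<^sup>2)" and iv: "integrable \<mu> (\<lambda>x. (v x)\<^sup>2)"
    by (rule integrable_edom[OF finF edom_power2[OF eu]], rule integrable_edom[OF T(1) edom_power2[OF ev]])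
  have CS: "(\<integral>x. u x * v x \<partial>\<mu>)\<^sup>2 \<le> (\<integral>x. (u x)\<^sup>2 \<partial>\<mu>) * (\<integral>x. (v x)\<^sup>2 \<partial>\<mu>)" and iuv: "integrable \<mu> (\<lambda>x. u x * v x)"
    using integral_CauchySchwarz[OF _ _ iu iv] by auto
  have "(2 * l)\<^sup>2 * pi\<^sup>2 / 8 \<le> 8 * l\<^sup>2"
  proof -
    have "pi\<^sup>2 \<le> 4\<^sup>2" using pi_less_4 pi_gt_zero by (intro power_mono) auto
    then have "l\<^sup>2 * pi\<^sup>2 \<le> l\<^sup>2 * 4\<^sup>2" by (intro mult_left_mono) auto
    then show ?thesis by (simp add: power_mult_distrib mult.commute)
  qed
  then have e8: "exp ((2 * l)\<^sup>2 * pi\<^sup>2 / 8) \<le> exp (8 * l\<^sup>2)" "exp ((- 2 * l)\<^sup>2 * pi\<^sup>2 / 8) \<le> exp (8 * l\<^sup>2)" by (simp_all add: power_mult_distrib)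
  have u2: "(\<integral>x. (u x)\<^sup>2 \<partial>\<mu>) \<le> exp (8 * l\<^sup>2)"
  proof -
    have "(\<integral>x. (u x)\<^sup>2 \<partial>\<mu>) = (\<integral>x. exp ((2 * l) * (smax \<beta> F x - mF)) \<partial>\<mu>)" by (simp add: u_def exp_double[symmetric] mult.assoc)
    also have "\<dots> \<le> exp ((2 * l)\<^sup>2 * pi\<^sup>2 / 8)" unfolding mF_def by (rule smax_exp_concentration[OF finF F(2) \<beta>])
    finally show ?thesis using e8(1) by linarith
  qed
  have v2: "(\<integral>x. (v x)\<^sup>2 \<partial>\<mu>) \<le> exp (8 * l\<^sup>2)"
  proof -
    have "(\<integral>x. (v x)\<^sup>2 \<partial>\<mu>) = (\<integral>x. exp ((- 2 * l) * (smax \<beta> T x - mT)) \<partial>\<mu>)" by (simp add: v_def exp_double[symmetric] mult.assoc)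
    also have "\<dots> \<le> exp ((- 2 * l)\<^sup>2 * pi\<^sup>2 / 8)" unfolding mT_def by (rule smax_exp_concentration[OF T \<beta>])
    finally show ?thesis using e8(2) by linarith
  qed
  have "(\<integral>x. u x * v x \<partial>\<mu>)\<^sup>2 \<le> exp (8 * l\<^sup>2) * exp (8 * l\<^sup>2)"
    by (rule order_trans[OF CS mult_mono[OF u2 v2]]) auto
  then have "(\<integral>x. u x * v x \<partial>\<mu>)\<^sup>2 \<le> (exp (8 * l\<^sup>2))\<^sup>2" by (simp only: power2_eq_square)
  then have uv: "(\<integral>x. u x * v x \<partial>\<mu>) \<le> exp (8 * l\<^sup>2)" by (rule power2_le_imp_le) simp
  have "(\<integral>x. mass T \<beta> F x \<partial>\<mu>) \<le> (\<integral>x. exp (l * (mF - mT)) * (u x * v x) \<partial>\<mu>)"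
    using iuv by (intro integral_mono integrable_edom[OF T(1) edom_mass[OF T \<beta>]] integrable_mult_right pw)
  also have "\<dots> = exp (l * (mF - mT)) * (\<integral>x. u x * v x \<partial>\<mu>)" by (rule integral_mult_right_zero)
  also have "\<dots> \<le> exp (l * (- \<gamma>)) * exp (8 * l\<^sup>2)"
  proof (rule mult_mono[OF _ uv])
    have "l * (mF - mT) \<le> l * (- \<gamma>)" using gap l(1) unfolding mF_def mT_def by (intro mult_left_mono) auto
    then show "exp (l * (mF - mT)) \<le> exp (l * (- \<gamma>))" by simp
  qed (auto simp: u_def v_def)
  also have "\<dots> = exp (- (\<gamma>\<^sup>2 / 32))"
    unfolding exp_add[symmetric] l_def by (simp add: power2_eq_square)
  finally show ?thesis .
qed

end

section \<open>From the soft maximum to the maximum\<close>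

lemma fmax_measurable:
  assumes T: "finite T" "T \<noteq> {}" shows "fmax T \<in> borel_measurable path_space"
  unfolding fmax_def[abs_def] using T by (intro borel_measurable_Max) auto

lemma fmax_smax:
  assumes T: "finite T" "T \<noteq> {}" and \<beta>: "0 < \<beta>"
  shows "fmax T x \<le> smax \<beta> T x" "smax \<beta> T x \<le> fmax T x + ln (card T) / \<beta>"
proof -
  show "fmax T x \<le> smax \<beta> T x" unfolding fmax_def using T smax_ge[OF T \<beta>] by (subst Max_le_iff) auto
  show "smax \<beta> T x \<le> fmax T x + ln (card T) / \<beta>"
    by (rule smax_le[OF T \<beta>]) (use T in \<open>auto simp: fmax_def\<close>)
qed

lemma integrable_fmax:
  assumes T: "finite T" "T \<noteq> {}" shows "integrable \<mu> (fmax T)"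
proof -
  have "edom T (fmax T)"
  proof (rule edom_mono[OF edom_add[OF edom_const[of T "ln (card T)"] edom_power2[OF edom_add[OF edom_const[of T 1] edom_power2[OF edom_smax[OF T, of 1]]]]]])
    show "fmax T \<in> borel_measurable path_space" by (rule fmax_measurable[OF T])
    fix x
    have n: "0 \<le> ln (card T)" using T by (simp add: Suc_leI card_gt_0_iff)
    have le: "\<bar>fmax T x\<bar> \<le> \<bar>smax 1 T x\<bar> + ln (card T)" using fmax_smax[OF T, of 1 x] n by auto
    have sq: "\<bar>s\<bar> \<le> (1 + s\<^sup>2)\<^sup>2" for s :: real
    proof -
      have "0 \<le> (\<bar>s\<bar> - 1)\<^sup>2" by simp
      then have "\<bar>s\<bar> \<le> 1 + s\<^sup>2" unfolding power2_diff by simp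
      also have "\<dots> \<le> (1 + s\<^sup>2)\<^sup>2" by (rule self_le_power) auto
      finally show ?thesis .
    qed
    show "\<bar>fmax T x\<bar> \<le> \<bar>ln (card T) + (1 + (smax 1 T x)\<^sup>2)\<^sup>2\<bar>"
      using le sq[of "smax 1 T x"] abs_ge_self[of "ln (card T) + (1 + (smax 1 T x)\<^sup>2)\<^sup>2"] by linarith
  qed simp
  then show ?thesis by (rule integrable_edom[OF T(1)])
qed

text \<open>The parameter \<beta> is taken so large, depending on \<open>card T\<close> and
  \<theta>, that passing to the soft maximum costs at most the factor exp (1/3). Together with exp
  (2/3) this makes e \<le> 3, and no trace of \<open>card T\<close> is left.\<close>

theorem fmax_exp_moment:
  assumes T: "finite T" "T \<noteq> {}" and B: "0 \<le> B" and \<theta>: "\<theta>\<^sup>2 * B \<le> 1"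
    and var: "\<And>\<beta> k. \<beta>0 \<le> \<beta> \<Longrightarrow> 0 < \<beta> \<Longrightarrow> (\<integral>x. (tilt T \<beta> k x)\<^sup>2 \<partial>\<mu>) - (\<integral>x. tilt T \<beta> k x \<partial>\<mu>)\<^sup>2 \<le> B * k\<^sup>2 * (\<integral>x. (tilt T \<beta> k x)\<^sup>2 \<partial>\<mu>)"
  shows "(\<integral>\<^sup>+x. ennreal (exp (\<theta> * (fmax T x - (\<integral>y. fmax T y \<partial>\<mu>)))) \<partial>\<mu>) \<le> 3"
proof -
  have n: "0 \<le> ln (card T)" using T by (simp add: Suc_leI card_gt_0_iff)
  define \<beta> where "\<beta> = max (max \<beta>0 1) (6 * \<bar>\<theta>\<bar> * ln (card T))"
  have \<beta>: "\<beta>0 \<le> \<beta>" "1 \<le> \<beta>" "6 * \<bar>\<theta>\<bar> * ln (card T) \<le> \<beta>" unfolding \<beta>_def by auto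
  then have \<beta>0: "0 < \<beta>" by simp
  define \<epsilon> where "\<epsilon> = ln (card T) / \<beta>"
  have \<epsilon>: "0 \<le> \<epsilon>" "\<bar>\<theta>\<bar> * \<epsilon> \<le> 1 / 6" using n \<beta> \<beta>0 by (auto simp: \<epsilon>_def field_simps)
  define m where "m = (\<integral>y. smax \<beta> T y \<partial>\<mu>)"
  define m' where "m' = (\<integral>y. fmax T y \<partial>\<mu>)"
  have isx: "integrable \<mu> (smax \<beta> T)" by (rule integrable_smax[OF T \<beta>0])
  have 1: "m' \<le> m" unfolding m_def m'_def by (intro integral_mono integrable_fmax[OF T] isx fmax_smax(1)[OF T \<beta>0])
  have 2: "m \<le> m' + \<epsilon>"
  proof -
    have "m \<le> (\<integral>y. fmax T y + \<epsilon> \<partial>\<mu>)" unfolding m_def \<epsilon>_def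
      using integrable_fmax[OF T] by (intro integral_mono isx fmax_smax(2)[OF T \<beta>0]) auto
    also have "\<dots> = m' + \<epsilon>" using integrable_fmax[OF T] by (simp add: m'_def prob_space)
    finally show ?thesis .
  qed
  have pw: "exp (\<theta> * (fmax T x - m')) \<le> exp (1 / 3) * exp (\<theta> * (smax \<beta> T x - m))" for x
  proof -
    have "\<bar>(fmax T x - m') - (smax \<beta> T x - m)\<bar> \<le> \<epsilon>"
      using 1 2 fmax_smax[OF T \<beta>0, of x] unfolding \<epsilon>_def[symmetric] by auto
    then have "\<bar>\<theta>\<bar> * \<bar>(fmax T x - m') - (smax \<beta> T x - m)\<bar> \<le> \<bar>\<theta>\<bar> * \<epsilon>" by (intro mult_left_mono) auto
    then have "\<theta> * ((fmax T x - m') - (smax \<beta> T x - m)) \<le> 1 / 3" using \<epsilon>(2) unfolding abs_mult[symmetric] by linarith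
    then have "\<theta> * (fmax T x - m') \<le> 1 / 3 + \<theta> * (smax \<beta> T x - m)" by (simp add: right_diff_distrib)
    then show ?thesis unfolding exp_add[symmetric] by simp
  qed
  have "edom T (\<lambda>x. exp (- \<theta> * m) * exp (\<theta> * smax \<beta> T x))" by (intro edom_cmult edom_exp_smax T \<beta>0)
  then have "edom T (\<lambda>x. exp (\<theta> * (smax \<beta> T x - m)))" by (simp add: exp_add[symmetric] algebra_simps)
  then have ie: "integrable \<mu> (\<lambda>x. exp (\<theta> * (smax \<beta> T x - m)))" by (rule integrable_edom[OF T(1)])
  have "(\<integral>\<^sup>+x. ennreal (exp (\<theta> * (fmax T x - m'))) \<partial>\<mu>) \<le> (\<integral>\<^sup>+x. ennreal (exp (1 / 3) * exp (\<theta> * (smax \<beta> T x - m))) \<partial>\<mu>)"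
    by (intro nn_integral_mono ennreal_leI pw)
  also have "\<dots> = ennreal (\<integral>x. exp (1 / 3) * exp (\<theta> * (smax \<beta> T x - m)) \<partial>\<mu>)"
    using ie by (intro nn_integral_eq_integral) auto
  also have "\<dots> \<le> ennreal (exp (1 / 3) * exp (2 / 3))"
  proof (rule ennreal_leI)
    have "(\<integral>x. exp (\<theta> * (smax \<beta> T x - m)) \<partial>\<mu>) \<le> exp (2 / 3)"
      unfolding m_def by (rule smax_exp_moment[OF T \<beta>0 B var[OF \<beta>(1) \<beta>0] \<theta>])
    then show "(\<integral>x. exp (1 / 3) * exp (\<theta> * (smax \<beta> T x - m)) \<partial>\<mu>) \<le> exp (1 / 3) * exp (2 / 3)"
      unfolding integral_mult_right_zero by (rule mult_left_mono) simp
  qed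
  also have "\<dots> \<le> ennreal 3"
  proof (rule ennreal_leI)
    have "exp (1 / 3) * exp (2 / 3) = exp (1 :: real)" by (simp flip: exp_add)
    then show "exp (1 / 3) * exp (2 / 3) \<le> (3 :: real)" using exp_le by simp
  qed
  finally show ?thesis by (simp add: m'_def)
qed

end

section \<open>Isotropic covariances\<close>

lemma card_int_boxes_le:
  fixes lo hi :: "'n::finite \<Rightarrow> int" and Q :: "('n \<Rightarrow> int) set" and b :: real
  assumes Q: "\<And>q i. q \<in> Q \<Longrightarrow> lo i \<le> q i \<and> q i \<le> hi i" and b: "\<And>i. real_of_int (hi i - lo i + 1) \<le> b" "0 \<le> b"
  shows "finite Q \<and> real (card Q) \<le> b ^ CARD('n)"
proof -
  have sub: "Q \<subseteq> PiE UNIV (\<lambda>i. {lo i..hi i})" using Q by (auto simp: PiE_def)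
  have fin: "finite (PiE UNIV (\<lambda>i. {lo i..hi i}))" by (intro finite_PiE) auto
  have "real (card Q) \<le> real (card (PiE UNIV (\<lambda>i. {lo i..hi i})))"
    using card_mono[OF fin sub] by simp
  also have "\<dots> = (\<Prod>i\<in>UNIV. real (card {lo i..hi i}))" by (subst card_PiE) auto
  also have "\<dots> \<le> (\<Prod>i\<in>(UNIV :: 'n set). b)"
  proof (rule prod_mono)
    fix i :: 'n
    have "real (nat (hi i - lo i + 1)) \<le> b" using b(1)[of i] b(2) by (cases "0 \<le> hi i - lo i + 1") auto
    then show "0 \<le> real (card {lo i..hi i}) \<and> real (card {lo i..hi i}) \<le> b" by (simp add: algebra_simps)
  qed
  finally show ?thesis using finite_subset[OF sub fin] by simp
qed

text \<open>\<open>ball_prob\<close> is what finiteness of suprema leaves behind in the law of the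
  path: one level for the finite subsets of all unit balls. Since only finite sets occur, it is a
  statement about the product \<sigma>-algebra, and two fields with the same path law share the same
  \<open>a\<close>.\<close>

locale isotropic_path_law = gaussian_path_law \<mu> "\<lambda>s t. \<phi> (norm (s - t))"
  for \<mu> :: "((real ^ 'n) \<Rightarrow> real) measure" and \<phi> :: "real \<Rightarrow> real" +
  fixes a :: real
  assumes antimono: "antimono_on {0..} \<phi>" and phi_1: "\<phi> 1 < 1 / 2" and a_nonneg: "0 \<le> a"
    and ball_prob: "finite F \<Longrightarrow> F \<subseteq> cball w 1 \<Longrightarrow> 1 / 2 \<le> prob {x \<in> space \<mu>. \<forall>t\<in>F. x t \<le> a}"
begin

lemma phi_mono: "0 \<le> u \<Longrightarrow> u \<le> v \<Longrightarrow> \<phi> v \<le> \<phi> u"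
  using antimono by (auto simp: monotone_on_def)

section \<open>Grid cells, patches and unit pieces\<close>

definition cell :: "real \<Rightarrow> real ^ 'n \<Rightarrow> 'n \<Rightarrow> int" where
  "cell r t i = \<lfloor>t $ i / r\<rfloor>"

text \<open>The block of 3^d grid cells of side \<open>r\<close> around the cell \<open>z\<close>.
  The extra layer of cells puts any two points at distance below \<open>r\<close> into a common
  patch.\<close>

definition patch :: "real \<Rightarrow> ('n \<Rightarrow> int) \<Rightarrow> (real ^ 'n) set" where
  "patch r z = {t. \<forall>i. z i - 1 \<le> cell r t i \<and> cell r t i \<le> z i + 1}"

lemma patch_self: "t \<in> patch r (cell r t)"
  by (simp add: patch_def)

lemma patch_near:
  assumes r: "0 < r" and st: "norm (s - t) < r" shows "t \<in> patch r (cell r s)"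
proof -
  have *: "\<bar>s $ i / r - t $ i / r\<bar> < 1" for i
  proof -
    have "\<bar>s $ i - t $ i\<bar> < r" using component_le_norm_cart[of "s - t" i] st by simp
    then show ?thesis using r by (simp add: diff_divide_distrib[symmetric] abs_divide)
  qed
  have "\<lfloor>s $ i / r\<rfloor> - 1 \<le> \<lfloor>t $ i / r\<rfloor> \<and> \<lfloor>t $ i / r\<rfloor> \<le> \<lfloor>s $ i / r\<rfloor> + 1" for i
    using *[of i] by linarith
  then show ?thesis by (simp add: patch_def cell_def)
qed

lemma card_patches_le: "real (card {z \<in> Z. t \<in> patch r z}) \<le> 3 ^ CARD('n)"
proof -
  have b: "cell r t i - 1 \<le> z i \<and> z i \<le> cell r t i + 1" if "z \<in> {z \<in> Z. t \<in> patch r z}" for z i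
  proof -
    have "z i - 1 \<le> cell r t i \<and> cell r t i \<le> z i + 1" using that by (simp add: patch_def)
    then show ?thesis by linarith
  qed
  have "finite {z \<in> Z. t \<in> patch r z} \<and> real (card {z \<in> Z. t \<in> patch r z}) \<le> 3 ^ CARD('n)"
    by (rule card_int_boxes_le[where lo = "\<lambda>i. cell r t i - 1" and hi = "\<lambda>i. cell r t i + 1"]) (rule b, auto)
  then show ?thesis ..
qed

text \<open>A patch is a cube of side 3r and meets at most 3 d r + 2 \<le> 5 d r slabs of width 1/d
  in each direction, since d r \<ge> 1.\<close>

lemma card_pieces_le:
  assumes r: "1 \<le> r" and F: "F \<subseteq> patch r z"
  shows "finite (cell (1 / CARD('n)) ` F) \<and> real (card (cell (1 / CARD('n)) ` F)) \<le> (5 * real CARD('n) * r) ^ CARD('n)"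
proof (rule card_int_boxes_le)
  define d where "d = real CARD('n)"
  have d: "1 \<le> d" unfolding d_def by (simp add: Suc_leI)
  have dr: "1 \<le> d * r" using mult_mono[of 1 d 1 r] d r by simp
  fix i
  show "real_of_int (\<lfloor>d * r * (z i + 2)\<rfloor> - \<lfloor>d * r * (z i - 1)\<rfloor> + 1) \<le> 5 * real CARD('n) * r"
  proof -
    have "d * r * (z i + 2) = d * r * (z i - 1) + 3 * (d * r)" by (simp add: algebra_simps)
    then have "real_of_int \<lfloor>d * r * (z i + 2)\<rfloor> \<le> d * r * (z i - 1) + 3 * (d * r)" by (metis of_int_floor_le)
    moreover have "d * r * (z i - 1) - 1 < real_of_int \<lfloor>d * r * (z i - 1)\<rfloor>" by linarith
    ultimately show ?thesis using dr unfolding d_def[symmetric] of_int_add of_int_diff mult.assoc of_int_1 by linarith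
  qed
  fix q assume "q \<in> cell (1 / CARD('n)) ` F"
  then obtain t where t: "t \<in> F" "q = cell (1 / d) t" by (auto simp: d_def)
  have c: "z i - 1 \<le> \<lfloor>t $ i / r\<rfloor>" "\<lfloor>t $ i / r\<rfloor> \<le> z i + 1" using t(1) F by (auto simp: patch_def cell_def)
  have 1: "real_of_int (z i - 1) \<le> t $ i / r" using c(1) by (simp add: le_floor_iff)
  have "t $ i / r < real_of_int (z i + 2)" using c(2) by linarith
  then have 2: "t $ i / r \<le> real_of_int (z i + 2)" by simp
  have e: "(d * r) * (t $ i / r) = t $ i / (1 / d)" using r by simp
  have "d * r * (z i - 1) \<le> (d * r) * (t $ i / r)" "(d * r) * (t $ i / r) \<le> d * r * (z i + 2)"
    using mult_left_mono[OF 1, of "d * r"] mult_left_mono[OF 2, of "d * r"] dr by simp_all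
  then show "\<lfloor>d * r * (z i - 1)\<rfloor> \<le> q i \<and> q i \<le> \<lfloor>d * r * (z i + 2)\<rfloor>"
    unfolding e t(2) cell_def by (simp add: floor_mono)
qed (use r in simp)

text \<open>The side 1/d keeps the l1 distance, and hence the Euclidean one, at most 1.\<close>

lemma piece_subset_cball:
  assumes "cell (1 / CARD('n)) s = cell (1 / CARD('n)) t"
  shows "t \<in> cball s 1"
proof -
  define d where "d = real CARD('n)"
  have d: "0 < d" unfolding d_def by simp
  have "\<bar>(s - t) $ i\<bar> \<le> 1 / d" for i
  proof -
    have "\<lfloor>s $ i / (1 / d)\<rfloor> = \<lfloor>t $ i / (1 / d)\<rfloor>" using fun_cong[OF assms, of i] by (simp add: cell_def d_def)
    then have "\<lfloor>d * s $ i\<rfloor> = \<lfloor>d * t $ i\<rfloor>" using d by (simp add: mult.commute)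
    then have "\<bar>d * s $ i - d * t $ i\<bar> \<le> 1" by linarith
    then have "d * \<bar>s $ i - t $ i\<bar> \<le> 1" using d by (simp add: right_diff_distrib[symmetric] abs_mult)
    then show ?thesis using d by (simp add: field_simps)
  qed
  then have "(\<Sum>i\<in>UNIV. \<bar>(s - t) $ i\<bar>) \<le> real CARD('n) * (1 / d)"
    by (intro sum_bounded_above) auto
  also have "\<dots> = 1" using d by (simp add: d_def)
  finally show ?thesis using norm_le_l1_cart[of "s - t"] by (simp add: dist_norm)
qed

section \<open>Expected soft maxima on patches and on separated sets; the variance bound\<close>

lemma smax_mean_local_le:
  assumes F: "finite F" "F \<noteq> {}" "F \<subseteq> cball w 1" and \<beta>: "0 < \<beta>" "ln (card F) \<le> \<beta>"
  shows "(\<integral>x. smax \<beta> F x \<partial>\<mu>) \<le> a + 4"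
proof -
  have "(\<integral>x. smax \<beta> F x \<partial>\<mu>) \<le> a + ln (card F) / \<beta> + 3"
    by (rule smax_mean_le_of_prob[OF F(1,2) \<beta>(1) ball_prob[OF F(1,3)]])
  moreover have "ln (card F) / \<beta> \<le> 1" using \<beta> by (simp add: field_simps)
  ultimately show ?thesis by linarith
qed

text \<open>A union bound over the unit pieces of the patch. The 4 in \<open>gap\<close> is 3 for
  the passage from a level of probability 1/2 to the mean, plus 1 for the error of the soft
  maximum.\<close>

lemma patch_mass_le:
  assumes T: "finite T" "T \<noteq> {}" and \<beta>: "0 < \<beta>" "ln (card T) \<le> \<beta>" and r: "1 \<le> r"
    and \<gamma>: "0 \<le> \<gamma>" "\<gamma> / 16 \<le> \<beta>" and gap: "a + 4 + \<gamma> \<le> (\<integral>x. smax \<beta> T x \<partial>\<mu>)"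
  shows "(\<integral>x. mass T \<beta> (patch r z) x \<partial>\<mu>) \<le> (5 * real CARD('n) * r) ^ CARD('n) * exp (- (\<gamma>\<^sup>2 / 32))"
proof -
  let ?c = "cell (1 / CARD('n))"
  define F where "F = T \<inter> patch r z"
  define P where "P q = {t \<in> F. ?c t = q}" for q
  have finF: "finite F" using T by (simp add: F_def)
  have card: "real (card (?c ` F)) \<le> (5 * real CARD('n) * r) ^ CARD('n)"
    using card_pieces_le[OF r, of F z] by (auto simp: F_def)
  have sum: "mass T \<beta> (patch r z) x = (\<Sum>q\<in>?c ` F. mass T \<beta> (P q) x)" for x
  proof -
    have TP: "T \<inter> P q = P q" for q by (auto simp: P_def F_def)
    have "mass T \<beta> (patch r z) x = (\<Sum>t\<in>F. smp \<beta> T t x)" unfolding mass_def[OF T \<beta>(1)] F_def ..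
    also have "\<dots> = (\<Sum>q\<in>?c ` F. \<Sum>t\<in>P q. smp \<beta> T t x)" unfolding P_def by (rule sum.image_gen[OF finF])
    finally show ?thesis unfolding mass_def[OF T \<beta>(1)] TP .
  qed
  have "(\<integral>x. mass T \<beta> (patch r z) x \<partial>\<mu>) = (\<Sum>q\<in>?c ` F. \<integral>x. mass T \<beta> (P q) x \<partial>\<mu>)"
    unfolding sum by (intro Bochner_Integration.integral_sum integrable_edom[OF T(1) edom_mass[OF T \<beta>(1)]])
  also have "\<dots> \<le> real (card (?c ` F)) * exp (- (\<gamma>\<^sup>2 / 32))"
  proof (rule sum_bounded_above)
    fix q assume "q \<in> ?c ` F"
    then obtain s where s: "s \<in> F" "?c s = q" by auto
    have P: "P q \<subseteq> T" "P q \<noteq> {}" using s by (auto simp: P_def F_def)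
    have finP: "finite (P q)" using finite_subset[OF P(1) T(1)] .
    have ball: "P q \<subseteq> cball s 1"
    proof
      fix t assume "t \<in> P q"
      then show "t \<in> cball s 1" using s by (intro piece_subset_cball) (simp add: P_def)
    qed
    have "1 \<le> card (P q)" "card (P q) \<le> card T" using P finP T by (auto simp: Suc_leI card_gt_0_iff card_mono)
    then have "ln (card (P q)) \<le> ln (card T)" by (intro ln_mono) auto
    then have "(\<integral>x. smax \<beta> (P q) x \<partial>\<mu>) \<le> a + 4"
      using \<beta> by (intro smax_mean_local_le[OF finP P(2) ball]) auto
    then show "(\<integral>x. mass T \<beta> (P q) x \<partial>\<mu>) \<le> exp (- (\<gamma>\<^sup>2 / 32))"
      using gap by (intro piece_mass_le[OF T \<beta>(1) P \<gamma>]) auto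
  qed
  also have "\<dots> \<le> (5 * real CARD('n) * r) ^ CARD('n) * exp (- (\<gamma>\<^sup>2 / 32))"
    using card by (intro mult_right_mono) auto
  finally show ?thesis .
qed

text \<open>With \<rho> = 1/2 the level in \<open>separated_card_le\<close> is 4 (E + 1), so the
  density is evaluated at 4 E + 5. The 6 is 2 times the bound 3 for sqrt (2 pi), and N \<ge> 36
  absorbs it through N \<le> (N/6)^2.\<close>

lemma smax_mean_lower:
  assumes T: "finite T" "T \<noteq> {}" and \<beta>: "0 < \<beta>" and S: "S \<subseteq> T" and N: "36 \<le> N" "N \<le> real (card S)"
    and sep: "\<And>s t. s \<in> S \<Longrightarrow> t \<in> S \<Longrightarrow> s \<noteq> t \<Longrightarrow> 1 < dist s t"
  shows "sqrt (ln N) \<le> 4 * (\<integral>x. smax \<beta> T x \<partial>\<mu>) + 5"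
proof -
  define E where "E = (\<integral>x. smax \<beta> T x \<partial>\<mu>)"
  have E: "0 \<le> E" unfolding E_def by (rule smax_mean_nonneg[OF T \<beta>])
  have "\<phi> (norm (s - t)) \<le> 1 / 2" if "s \<in> S" "t \<in> S" "s \<noteq> t" for s t
    using phi_mono[of 1 "norm (s - t)"] sep[OF that] phi_1 by (simp add: dist_norm)
  from separated_card_le[OF T \<beta> S _ this]
  have "real (card S) * std_normal_density (2 * (E + 1) / (1 - 1 / 2) + 1) \<le> 2" by (simp add: E_def)
  moreover have "2 * (E + 1) / (1 - 1 / 2) + 1 = 4 * E + 5" by simp
  ultimately have "real (card S) * std_normal_density (4 * E + 5) \<le> 2" by metis
  moreover have "N * std_normal_density (4 * E + 5) \<le> real (card S) * std_normal_density (4 * E + 5)"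
    using N by (intro mult_right_mono) auto
  ultimately have "N * std_normal_density (4 * E + 5) \<le> 2" by linarith
  then have "N / sqrt (2 * pi) * exp (- (4 * E + 5)\<^sup>2 / 2) \<le> 2" by (simp add: std_normal_density_def)
  moreover have "N / 3 * exp (- (4 * E + 5)\<^sup>2 / 2) \<le> N / sqrt (2 * pi) * exp (- (4 * E + 5)\<^sup>2 / 2)"
  proof -
    have "sqrt (2 * pi) \<le> 3" by (rule real_le_lsqrt) (use pi_less_4 pi_gt_zero in auto)
    then show ?thesis using N by (intro mult_right_mono divide_left_mono) auto
  qed
  ultimately have "N / 3 * exp (- (4 * E + 5)\<^sup>2 / 2) \<le> 2" by linarith
  then have "N / 6 * exp (- ((4 * E + 5)\<^sup>2 / 2)) \<le> 1" by simp
  then have "N / 6 \<le> exp ((4 * E + 5)\<^sup>2 / 2)" by (simp add: exp_minus field_simps)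
  then have "ln (N / 6) \<le> ln (exp ((4 * E + 5)\<^sup>2 / 2))" using N by (intro ln_mono) auto
  then have "2 * ln (N / 6) \<le> (4 * E + 5)\<^sup>2" by simp
  moreover have "ln N \<le> 2 * ln (N / 6)"
  proof -
    have "ln N \<le> ln ((N / 6) ^ 2)" using N by (intro ln_mono) (auto simp: power2_eq_square)
    also have "\<dots> = 2 * ln (N / 6)" using N by (subst ln_realpow) auto
    finally show ?thesis .
  qed
  ultimately have "sqrt (ln N) \<le> sqrt ((4 * E + 5)\<^sup>2)" by (intro real_sqrt_le_mono) linarith
  then show ?thesis using E by (simp add: E_def)
qed

text \<open>The exponent is so small that the number of unit pieces of a patch, at most
  \<open>(5 * d * N powr exponent) ^ d\<close>, is absorbed by the bound \<open>exp (- ln N / 2048)\<close> on the mass of a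
  piece as soon as \<open>ln N\<close> exceeds the threshold.  For smaller \<open>N\<close> the trivial bound on the variance
  suffices.\<close>

definition exponent :: real where
  "exponent = 1 / (8192 * real CARD('n))"

text \<open>The summands serve in turn the lower bound \<open>smax_mean_lower\<close>, the gap
  between the expected soft maxima over \<open>T\<close> and over a unit piece, and the constant
  factor in the number of pieces.\<close>

definition threshold :: real where
  "threshold = ln 36 + 64 * (a + 6)\<^sup>2 + 8192 * real CARD('n) * ln (5 * real CARD('n))"

text \<open>The first summand pays for \<open>ln N\<close> above the threshold, the second for
  \<open>ln N\<close> below it.\<close>

definition var_factor :: real where
  "var_factor = 50 * (1 + 4096 * 3 ^ CARD('n)) + 50 * threshold"

lemma threshold_ge: "ln 36 \<le> threshold" "64 * (a + 6)\<^sup>2 \<le> threshold"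
  "8192 * real CARD('n) * ln (5 * real CARD('n)) \<le> threshold" "0 < threshold"
proof -
  have "1 \<le> real CARD('n)" by (simp add: Suc_leI)
  then have "1 \<le> 5 * real CARD('n)" by linarith
  then have "0 \<le> ln (36::real)" "0 \<le> ln (5 * real CARD('n))" by auto
  moreover have "0 < 64 * (a + 6)\<^sup>2" using a_nonneg by simp
  ultimately show "ln 36 \<le> threshold" "64 * (a + 6)\<^sup>2 \<le> threshold"
    "8192 * real CARD('n) * ln (5 * real CARD('n)) \<le> threshold" "0 < threshold"
    unfolding threshold_def by (auto intro!: add_nonneg_nonneg add_pos_nonneg)
qed

lemma constants_pos: "0 < exponent" "0 < var_factor"
  using threshold_ge(4) by (auto simp: exponent_def var_factor_def intro!: add_pos_pos)

text \<open>Above the threshold \<open>smax_variance\<close> is used with patches at scale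
  \<open>N powr exponent\<close>, below it without patches. In both cases 1 / ln N \<le> K turns the
  outcome into a multiple of \<open>K\<close>.\<close>

theorem variance_bound:
  assumes T: "finite T" "T \<noteq> {}" and S: "S \<subseteq> T" and N: "2 \<le> N" "N \<le> real (card S)"
    and sep: "\<And>s t. s \<in> S \<Longrightarrow> t \<in> S \<Longrightarrow> s \<noteq> t \<Longrightarrow> 1 < dist s t"
    and \<beta>: "ln (card T) + sqrt (ln N) \<le> \<beta>" "0 < \<beta>"
  defines "K \<equiv> max (\<phi> (N powr exponent)) (1 / ln N)"
  shows "(\<integral>x. (tilt T \<beta> k x)\<^sup>2 \<partial>\<mu>) - (\<integral>x. tilt T \<beta> k x \<partial>\<mu>)\<^sup>2 \<le> var_factor * K * k\<^sup>2 * (\<integral>x. (tilt T \<beta> k x)\<^sup>2 \<partial>\<mu>)"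
proof -
  have lnN: "0 < ln N" using N by simp
  have K: "1 / ln N \<le> K" "\<phi> (N powr exponent) \<le> K" unfolding K_def by auto
  have K0: "0 < K" by (rule less_le_trans[OF _ K(1)]) (use lnN in simp)
  have final: ?thesis if le: "50 * B \<le> var_factor * K"
    and v: "(\<integral>x. (tilt T \<beta> k x)\<^sup>2 \<partial>\<mu>) - (\<integral>x. tilt T \<beta> k x \<partial>\<mu>)\<^sup>2 \<le> 50 * B * k\<^sup>2 * (\<integral>x. (tilt T \<beta> k x)\<^sup>2 \<partial>\<mu>)" for B
    by (rule order_trans[OF v]) (intro mult_right_mono le, auto)
  show ?thesis
  proof (cases "threshold \<le> ln N")
    case False
    \<comment> \<open>All correlations are at most 1, so the variance estimate applies with the
      constant 1 in place of \<open>K\<close> and no patches; this is the Gaussian Poincare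
      inequality up to a constant factor.\<close>
    show ?thesis
    proof (rule final[of "1 + 0 / 1"])
      show "(\<integral>x. (tilt T \<beta> k x)\<^sup>2 \<partial>\<mu>) - (\<integral>x. tilt T \<beta> k x \<partial>\<mu>)\<^sup>2 \<le> 50 * (1 + 0 / 1) * k\<^sup>2 * (\<integral>x. (tilt T \<beta> k x)\<^sup>2 \<partial>\<mu>)"
        by (rule smax_variance[OF T \<beta>(2), where Z = "{} :: nat set" and D = "\<lambda>_. {}"]) (use cov_le_1 in auto)
      have "1 \<le> threshold * (1 / ln N)" using False lnN by (simp add: field_simps)
      also have "\<dots> \<le> threshold * K" using K(1) threshold_ge(4) by (intro mult_left_mono) auto
      finally have "50 \<le> 50 * threshold * K" by simp
      also have "\<dots> \<le> var_factor * K" unfolding var_factor_def using K0 by (intro mult_right_mono) auto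
      finally show "50 * (1 + 0 / 1) \<le> var_factor * K" by simp
    qed
  next
    case big: True
    define r where "r = N powr exponent"
    \<comment> \<open>The balance of exponents: a piece has mass at most exp (- ln N / 2048), the
      power of \<open>r\<close> in the number of pieces costs ln N / 8192, and the constant factor
      at most another ln N / 8192. What is left is ln N / 4096.\<close>
    define L where "L = ln N / 4096"
    define \<gamma> where "\<gamma> = sqrt (ln N) / 8"
    define d where "d = real CARD('n)"
    have d: "1 \<le> d" by (simp add: d_def Suc_leI)
    have L: "0 < L" using lnN by (simp add: L_def)
    have r: "1 \<le> r" unfolding r_def using N constants_pos(1) by (intro ge_one_powr_ge_zero) auto
    have N36: "36 \<le> N"
    proof -
      have "ln 36 \<le> ln N" using big threshold_ge(1) by linarith
      then show ?thesis using N by simp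
    qed
    have \<gamma>: "0 \<le> \<gamma>" "\<gamma> / 16 \<le> \<beta>" and \<beta>T: "ln (card T) \<le> \<beta>"
    proof -
      have "0 \<le> ln (card T)" using T by (simp add: Suc_leI card_gt_0_iff)
      moreover have "0 \<le> sqrt (ln N)" using lnN by simp
      ultimately show "0 \<le> \<gamma>" "\<gamma> / 16 \<le> \<beta>" "ln (card T) \<le> \<beta>" using \<beta> unfolding \<gamma>_def by linarith+
    qed
    \<comment> \<open>Of the lower bound sqrt (ln N) / 4 - 5/4 for the mean, sqrt (ln N) / 8 becomes
      \<gamma>; the other half is at least a + 6 by the threshold and pays for a + 4 and the
      5/4.\<close>
    have gap: "a + 4 + \<gamma> \<le> (\<integral>x. smax \<beta> T x \<partial>\<mu>)"
    proof -
      have "sqrt ((8 * (a + 6))\<^sup>2) \<le> sqrt (ln N)"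
        using big threshold_ge(2) unfolding power_mult_distrib by (intro real_sqrt_le_mono) simp
      then have "8 * (a + 6) \<le> sqrt (ln N)" using a_nonneg by simp
      moreover have "sqrt (ln N) \<le> 4 * (\<integral>x. smax \<beta> T x \<partial>\<mu>) + 5"
        by (rule smax_mean_lower[OF T \<beta>(2) S N36 N(2) sep])
      moreover have "a + 4 + q / 8 \<le> e" if "8 * (a + 6) \<le> q" "q \<le> 4 * e + 5" for q e using that by argo
      ultimately show ?thesis unfolding \<gamma>_def by blast
    qed
    have small: "(\<integral>x. mass T \<beta> (patch r z) x \<partial>\<mu>) \<le> exp (- L)" for z
    proof -
      have g: "\<gamma>\<^sup>2 / 32 = ln N / 2048" using lnN by (simp add: \<gamma>_def power_divide)
      have "(5 * d * r) ^ CARD('n) = exp (d * ln (5 * d * r))"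
        using d r by (simp add: powr_realpow[symmetric] powr_def d_def)
      also have "d * ln (5 * d * r) = d * ln (5 * d) + d * (exponent * ln N)"
        using d r N by (subst ln_mult_pos) (auto simp: r_def ln_powr algebra_simps)
      also have "d * (exponent * ln N) = ln N / 8192" using d by (simp add: exponent_def d_def)
      finally have e: "(5 * d * r) ^ CARD('n) = exp (d * ln (5 * d) + ln N / 8192)" .
      have "(\<integral>x. mass T \<beta> (patch r z) x \<partial>\<mu>) \<le> (5 * d * r) ^ CARD('n) * exp (- (\<gamma>\<^sup>2 / 32))"
        unfolding d_def by (rule patch_mass_le[OF T \<beta>(2) \<beta>T r \<gamma> gap])
      also have "\<dots> = exp (d * ln (5 * d) + ln N / 8192 - ln N / 2048)"
        unfolding e g exp_add[symmetric] by simp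
      also have "\<dots> \<le> exp (- L)"
      proof -
        have "8192 * (d * ln (5 * d)) \<le> ln N" using threshold_ge(3) big by (simp add: d_def)
        then show ?thesis by (simp add: L_def)
      qed
      finally show ?thesis .
    qed
    define Z where "Z = cell r ` T"
    have finZ: "finite Z" using T by (simp add: Z_def)
    show ?thesis
    proof (rule final[of "K + 3 ^ CARD('n) / L"])
      show "(\<integral>x. (tilt T \<beta> k x)\<^sup>2 \<partial>\<mu>) - (\<integral>x. tilt T \<beta> k x \<partial>\<mu>)\<^sup>2 \<le> 50 * (K + 3 ^ CARD('n) / L) * k\<^sup>2 * (\<integral>x. (tilt T \<beta> k x)\<^sup>2 \<partial>\<mu>)"
      proof (rule smax_variance[OF T \<beta>(2), where Z = Z and D = "patch r"])
        fix s t assume st: "s \<in> T" "t \<in> T"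
        show "\<phi> (norm (s - t)) \<le> K + real (card {z \<in> Z. s \<in> patch r z \<and> t \<in> patch r z})"
        proof (cases "norm (s - t) < r")
          case True
          have "cell r s \<in> {z \<in> Z. s \<in> patch r z \<and> t \<in> patch r z}"
            using st patch_self patch_near[OF _ True] r by (auto simp: Z_def)
          then have "{z \<in> Z. s \<in> patch r z \<and> t \<in> patch r z} \<noteq> {}" by blast
          then have "0 < card {z \<in> Z. s \<in> patch r z \<and> t \<in> patch r z}" using finZ by (subst card_gt_0_iff) simp
          then have "1 \<le> card {z \<in> Z. s \<in> patch r z \<and> t \<in> patch r z}" by linarith
          then show ?thesis using cov_le_1[of s t] K0 by linarith
        next
          case False
          then have "\<phi> (norm (s - t)) \<le> \<phi> r" using r by (intro phi_mono) auto
          then show ?thesis using K(2) unfolding r_def by linarith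
        qed
      qed (use K0 finZ L small card_patches_le in auto)
      have "3 ^ CARD('n) / L = 4096 * 3 ^ CARD('n) * (1 / ln N)" by (simp add: L_def)
      also have "\<dots> \<le> 4096 * 3 ^ CARD('n) * K" using K(1) by (intro mult_left_mono) auto
      finally have "50 * (K + 3 ^ CARD('n) / L) \<le> 50 * (K + 4096 * 3 ^ CARD('n) * K)" by (intro mult_left_mono add_left_mono) auto
      also have "\<dots> = 50 * (1 + 4096 * 3 ^ CARD('n)) * K" by (simp only: distrib_right mult.assoc mult_1 distrib_left)
      also have "\<dots> \<le> var_factor * K" unfolding var_factor_def using K0 threshold_ge(4) by (intro mult_right_mono) auto
      finally show "50 * (K + 3 ^ CARD('n) / L) \<le> var_factor * K" .
    qed
  qed
qed

theorem finite_exp_moment: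
  assumes T: "finite T" "T \<noteq> {}" and S: "S \<subseteq> T" and N: "2 \<le> N" "N \<le> real (card S)"
    and sep: "\<And>s t. s \<in> S \<Longrightarrow> t \<in> S \<Longrightarrow> s \<noteq> t \<Longrightarrow> 1 < dist s t"
    and \<theta>: "\<bar>\<theta>\<bar> = 1 / sqrt var_factor / sqrt (max (\<phi> (N powr exponent)) (1 / ln N))"
  shows "(\<integral>\<^sup>+x. ennreal (exp (\<theta> * (fmax T x - (\<integral>y. fmax T y \<partial>\<mu>)))) \<partial>\<mu>) \<le> 3"
proof -
  define K where "K = max (\<phi> (N powr exponent)) (1 / ln N)"
  have "0 < 1 / ln N" using N by simp
  then have K: "0 < K" unfolding K_def by linarith
  show ?thesis
  proof (rule fmax_exp_moment[OF T, where B = "var_factor * K" and ?\<beta>0.0 = "ln (card T) + sqrt (ln N)"])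
    have "\<theta>\<^sup>2 = \<bar>\<theta>\<bar>\<^sup>2" by simp
    also have "\<dots> = 1 / (var_factor * K)" unfolding \<theta> K_def[symmetric] using K constants_pos by (simp add: power_divide power_mult_distrib)
    finally show "\<theta>\<^sup>2 * (var_factor * K) \<le> 1" using K constants_pos by simp
  qed (use variance_bound[OF T S N sep] K constants_pos in \<open>auto simp: K_def\<close>)
qed

end

section \<open>Stationary Gaussian fields\<close>

lemma (in prob_space) char_of_gaussian_law:
  assumes Y [measurable]: "random_variable borel Y" and g: "gaussian_law (distr M borel Y)"
    and mean: "expectation Y = 0" and var: "expectation (\<lambda>\<omega>. (Y \<omega>)\<^sup>2) = q"
  shows "expectation (\<lambda>\<omega>. cos (Y \<omega>)) = exp (- q / 2)" "expectation (\<lambda>\<omega>. sin (Y \<omega>)) = 0"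
proof -
  obtain m \<sigma> where \<sigma>: "0 \<le> \<sigma>"
    and law: "distr M borel Y = (if \<sigma> = 0 then return borel m else density lborel (\<lambda>x. ennreal (normal_density m \<sigma> x)))"
    using g unfolding gaussian_law_def by blast
  have push: "expectation (\<lambda>\<omega>. h (Y \<omega>)) = (\<integral>z. h z \<partial>distr M borel Y)" if [measurable]: "h \<in> borel_measurable borel" for h :: "real \<Rightarrow> real"
    by (rule integral_distr[symmetric]) auto
  have "expectation (\<lambda>\<omega>. cos (Y \<omega>)) = exp (- q / 2) \<and> expectation (\<lambda>\<omega>. sin (Y \<omega>)) = 0"
  proof (cases "\<sigma> = 0")
    case True
    then have law: "distr M borel Y = return borel m" using law by simp
    have r: "(\<integral>z. h z \<partial>return borel m) = h m" if "h \<in> borel_measurable borel" for h :: "real \<Rightarrow> real"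
      using that by (intro integral_return) auto
    have "m = 0" using push[of "\<lambda>z. z"] mean unfolding law by (simp add: r)
    moreover have "q = m\<^sup>2" using push[of "\<lambda>z. z\<^sup>2"] var unfolding law by (simp add: r)
    ultimately show ?thesis unfolding push[of cos, simplified] push[of sin, simplified] law using r[of cos] r[of sin] by simp
  next
    case False
    then have \<sigma>0: "0 < \<sigma>" using \<sigma> by simp
    have "distr M lborel Y = distr M borel Y" by (rule distr_cong) auto
    then have D: "distributed M lborel Y (normal_density m \<sigma>)"
      using law False unfolding distributed_def by auto
    have m: "m = 0" using normal_distributed_expectation[OF \<sigma>0 D] mean by simp
    have q: "q = \<sigma>\<^sup>2" using normal_distributed_variance[OF \<sigma>0 D] mean var by simp
    define V where "V \<omega> = Y \<omega> / \<sigma>" for \<omega>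
    have [measurable]: "V \<in> borel_measurable M" unfolding V_def by measurable
    have "distributed M lborel V std_normal_density"
      using D unfolding normal_standard_normal_convert[OF \<sigma>0] V_def m by simp
    then have "distr M lborel V = nrm" by (simp add: distributed_def)
    moreover have "distr M lborel V = distr M borel V" by (rule distr_cong) auto
    ultimately have V: "distr M borel V = nrm" by simp
    have YV: "Y \<omega> = \<sigma> * V \<omega>" for \<omega> using \<sigma>0 by (simp add: V_def)
    have "expectation (\<lambda>\<omega>. cos (Y \<omega>)) = (\<integral>z. cos (\<sigma> * z) \<partial>nrm)"
      unfolding V[symmetric] YV by (rule integral_distr[symmetric]) auto
    moreover have "expectation (\<lambda>\<omega>. sin (Y \<omega>)) = (\<integral>z. sin (\<sigma> * z) \<partial>nrm)"
      unfolding V[symmetric] YV by (rule integral_distr[symmetric]) auto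
    ultimately show ?thesis unfolding nrm_cos nrm_sin q by simp
  qed
  then show "expectation (\<lambda>\<omega>. cos (Y \<omega>)) = exp (- q / 2)" "expectation (\<lambda>\<omega>. sin (Y \<omega>)) = 0" by auto
qed

text \<open>The reason why a level \<open>a\<close> found for one field is good for all fields with
  the same covariance.\<close>

lemma gaussian_path_law_unique:
  assumes "gaussian_path_law \<mu> \<Gamma>" "gaussian_path_law \<nu> \<Gamma>" shows "\<mu> = \<nu>"
proof -
  interpret \<mu>: gaussian_path_law \<mu> \<Gamma> by fact
  interpret \<nu>: gaussian_path_law \<nu> \<Gamma> by fact
  show ?thesis
    by (rule path_law_eqI) (simp_all add: \<mu>.prob_space_axioms \<nu>.prob_space_axioms \<mu>.sets_mu \<nu>.sets_mu
      \<mu>.cos_char \<nu>.cos_char \<mu>.sin_char \<nu>.sin_char)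
qed

lemma (in prob_space) exp_tail:
  assumes [measurable]: "random_variable borel Z"
    and le: "(\<integral>\<^sup>+\<omega>. ennreal (exp (Z \<omega>)) \<partial>M) \<le> 3"
  shows "prob {\<omega> \<in> space M. s \<le> Z \<omega>} \<le> 3 * exp (- s)"
proof -
  have "{\<omega> \<in> space M. s \<le> Z \<omega>} = {\<omega> \<in> space M. 1 \<le> ennreal (exp (- s)) * ennreal (exp (Z \<omega>))}"
    by (auto simp: ennreal_mult'[symmetric] exp_add[symmetric] ennreal_ge_1)
  then have "emeasure M {\<omega> \<in> space M. s \<le> Z \<omega>} = emeasure M {\<omega> \<in> space M. 1 \<le> ennreal (exp (- s)) * ennreal (exp (Z \<omega>))}"
    by (rule arg_cong)
  also have "\<dots> \<le> ennreal (exp (- s)) * (\<integral>\<^sup>+\<omega>. ennreal (exp (Z \<omega>)) * indicator (space M) \<omega> \<partial>M)"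
    by (rule nn_integral_Markov_inequality) auto
  also have "(\<integral>\<^sup>+\<omega>. ennreal (exp (Z \<omega>)) * indicator (space M) \<omega> \<partial>M) = (\<integral>\<^sup>+\<omega>. ennreal (exp (Z \<omega>)) \<partial>M)"
    by (intro nn_integral_cong) auto
  also have "ennreal (exp (- s)) * (\<integral>\<^sup>+\<omega>. ennreal (exp (Z \<omega>)) \<partial>M) \<le> ennreal (exp (- s)) * 3"
    by (intro mult_left_mono le) auto
  also have "\<dots> = ennreal (3 * exp (- s))" by (simp add: ennreal_mult' mult.commute)
  finally show ?thesis unfolding emeasure_eq_measure by simp
qed

text \<open>Greedy choice: fewer than \<open>covering_number A\<close> closed unit balls around
  points already chosen do not cover \<open>A\<close>, so a further point at distance larger than 1
  from all of them exists.\<close>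

lemma separated_subset_exists:
  fixes A :: "(real ^ 'n) set"
  assumes k: "k \<le> covering_number A"
  shows "\<exists>S. finite S \<and> card S = k \<and> S \<subseteq> A \<and> (\<forall>s\<in>S. \<forall>t\<in>S. s \<noteq> t \<longrightarrow> 1 < dist s t)"
  using k
proof (induction k)
  case 0
  show ?case by (intro exI[of _ "{}"]) auto
next
  case (Suc k)
  then obtain S where S: "finite S" "card S = k" "S \<subseteq> A" "\<forall>s\<in>S. \<forall>t\<in>S. s \<noteq> t \<longrightarrow> 1 < dist s t" by auto
  have "\<not> A \<subseteq> (\<Union>z\<in>S. cball z 1)"
    using Suc.prems not_less_Least[of k "\<lambda>k. \<exists>Z. finite Z \<and> card Z = k \<and> A \<subseteq> (\<Union>z\<in>Z. cball z 1)"] S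
    unfolding covering_number_def by auto
  then obtain u where uA: "u \<in> A" "u \<notin> (\<Union>z\<in>S. cball z 1)" by blast
  have u: "u \<in> A" "\<And>s. s \<in> S \<Longrightarrow> 1 < dist s u" using uA by (auto simp: not_le[symmetric])
  then have "u \<notin> S" by force
  then show ?case using S u
    by (intro exI[of _ "insert u S"]) (auto simp: dist_commute)
qed

section \<open>The law of the sample path of a field\<close>

context unit_stationary_gaussian_field begin

declare random_variable [measurable]

definition path_law :: "(real ^ 'n \<Rightarrow> real) measure" where
  "path_law = distr P path_space (\<lambda>\<omega> t. X t \<omega>)"

lemma measurable_path [measurable]: "(\<lambda>\<omega> t. X t \<omega>) \<in> measurable P path_space"
  by (rule measurable_into_path_space) simp

lemma integrable_prod: "integrable P (\<lambda>\<omega>. X s \<omega> * X t \<omega>)" and integrable_value: "integrable P (X t)"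
proof -
  have sq: "integrable P (\<lambda>\<omega>. (X t \<omega>)\<^sup>2)" for t
    using second_moment[of t] not_integrable_integral_eq[of P "\<lambda>\<omega>. (X t \<omega>)\<^sup>2"] by fastforce
  show "integrable P (\<lambda>\<omega>. X s \<omega> * X t \<omega>)"
    using integral_CauchySchwarz[OF _ _ sq[of s] sq[of t]] by auto
  show "integrable P (X t)" by (rule square_integrable_imp_integrable[OF _ sq]) simp
qed

lemma product_moment: "expectation (\<lambda>\<omega>. X s \<omega> * X t \<omega>) = \<phi> (norm (s - t))"
  using covariance[of s t] by (simp add: centered)

text \<open>A centred Gaussian linear combination is determined by its variance, which the
  covariance function gives by expansion of the square.\<close>

lemma gaussian_path_law: "gaussian_path_law path_law (\<lambda>s t. \<phi> (norm (s - t)))"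
proof -
  interpret L: prob_space path_law unfolding path_law_def by (rule prob_space_distr) simp
  have push: "(\<integral>x. h x \<partial>path_law) = expectation (\<lambda>\<omega>. h (\<lambda>t. X t \<omega>))" if "h \<in> borel_measurable path_space" for h :: "_ \<Rightarrow> real"
    unfolding path_law_def using that by (intro integral_distr) auto
  have ch: "expectation (\<lambda>\<omega>. cos (\<Sum>t\<in>K. a t * X t \<omega>)) = exp (- (\<Sum>s\<in>K. \<Sum>t\<in>K. a s * a t * \<phi> (norm (s - t))) / 2)"
    "expectation (\<lambda>\<omega>. sin (\<Sum>t\<in>K. a t * X t \<omega>)) = 0" if K: "finite K" for K a
  proof -
    have m: "expectation (\<lambda>\<omega>. \<Sum>t\<in>K. a t * X t \<omega>) = 0"
      using integrable_value by (simp add: Bochner_Integration.integral_sum centered)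
    have "expectation (\<lambda>\<omega>. (\<Sum>t\<in>K. a t * X t \<omega>)\<^sup>2) = expectation (\<lambda>\<omega>. \<Sum>s\<in>K. \<Sum>t\<in>K. (a s * a t) * (X s \<omega> * X t \<omega>))"
      unfolding power2_eq_square sum_product by (simp add: ac_simps)
    also have "\<dots> = (\<Sum>s\<in>K. \<Sum>t\<in>K. a s * a t * \<phi> (norm (s - t)))"
      using integrable_prod by (simp add: Bochner_Integration.integral_sum product_moment del: integral_mult_right)
    finally have v: "expectation (\<lambda>\<omega>. (\<Sum>t\<in>K. a t * X t \<omega>)\<^sup>2) = (\<Sum>s\<in>K. \<Sum>t\<in>K. a s * a t * \<phi> (norm (s - t)))" .
    have g: "gaussian_law (distr P borel (\<lambda>\<omega>. \<Sum>t\<in>K. a t * X t \<omega>))"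
      using gaussian K unfolding gaussian_field_def by blast
    show "expectation (\<lambda>\<omega>. cos (\<Sum>t\<in>K. a t * X t \<omega>)) = exp (- (\<Sum>s\<in>K. \<Sum>t\<in>K. a s * a t * \<phi> (norm (s - t))) / 2)"
      "expectation (\<lambda>\<omega>. sin (\<Sum>t\<in>K. a t * X t \<omega>)) = 0"
      by (rule char_of_gaussian_law[OF _ g m v], simp)+
  qed
  show ?thesis
  proof unfold_locales
    show "sets path_law = sets path_space" by (simp add: path_law_def)
    show "\<phi> (norm (t - t)) = 1" for t :: "real ^ 'n"
      using product_moment[of t t] second_moment[of t] by (simp add: power2_eq_square)
    show "(\<integral>x. x s * x t \<partial>path_law) = \<phi> (norm (s - t))" for s t by (subst push) (auto simp: product_moment)
  qed (subst push, simp, simp add: ch)+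
qed

text \<open>Almost sure finiteness of the supremum over the unit ball at the origin yields a level
  that holds with probability above 1/2, by continuity of the measure. Stationarity moves the level
  to every other unit ball.\<close>

lemma ball_level_exists:
  "\<exists>a\<ge>0. \<forall>F w. finite F \<and> F \<subseteq> cball w 1 \<longrightarrow> 1 / 2 \<le> prob {\<omega> \<in> space P. \<forall>t\<in>F. X t \<omega> \<le> a}"
proof -
  have "bounded (cball (0 :: real ^ 'n) 1) \<and> cball (0 :: real ^ 'n) 1 \<noteq> {}" by auto
  from regular[unfolded regular_suprema_def, rule_format, OF this] obtain D where D: "countable D" "D \<noteq> {}" "D \<subseteq> cball 0 1"
    and AE: "AE \<omega> in P. bdd_above ((\<lambda>s. X s \<omega>) ` cball 0 1) \<and> field_sup X (cball 0 1) \<omega> = field_sup X D \<omega>"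
    by (elim exE conjE)
  define E where "E k = {\<omega> \<in> space P. \<forall>t\<in>D. X t \<omega> \<le> real k}" for k :: nat
  have Em: "range E \<subseteq> sets P" unfolding E_def using D(1) by (auto intro!: sets.sets_Collect_countable_Ball)
  have inc: "incseq E" unfolding E_def incseq_def by (auto intro: order_trans)
  have "prob (\<Union>k. E k) = 1"
  proof (rule prob_eq_1[THEN iffD2])
    show "(\<Union>k. E k) \<in> sets P" using Em by auto
    show "AE \<omega> in P. \<omega> \<in> (\<Union>k. E k)"
      using AE AE_space
    proof eventually_elim
      case (elim \<omega>)
      then have "\<exists>B. \<forall>s\<in>cball 0 1. X s \<omega> \<le> B" by (simp add: bdd_above_def)
      then obtain B where B: "\<And>s. s \<in> cball 0 1 \<Longrightarrow> X s \<omega> \<le> B" by blast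
      obtain k :: nat where "B \<le> real k" using real_arch_simple by blast
      then have "X s \<omega> \<le> real k" if "s \<in> D" for s using B[OF subsetD[OF D(3) that]] by linarith
      then have "\<omega> \<in> E k" using elim(2) by (simp add: E_def)
      then show ?case by blast
    qed
  qed
  then have "(\<lambda>k. prob (E k)) \<longlonglongrightarrow> 1" using finite_Lim_measure_incseq[OF Em inc] by simp
  then have "eventually (\<lambda>k. 1 / 2 < prob (E k)) sequentially" by (rule order_tendstoD) simp
  then obtain k where k: "1 / 2 < prob (E k)" by (auto simp: eventually_sequentially)
  have origin: "1 / 2 \<le> prob {\<omega> \<in> space P. \<forall>t\<in>F. X t \<omega> \<le> real k}" if F: "finite F" "F \<subseteq> cball 0 1" for F
  proof -
    have "prob (E k) \<le> prob {\<omega> \<in> space P. \<forall>t\<in>F. X t \<omega> \<le> real k}"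
    proof (rule finite_measure_mono_AE)
      show "{\<omega> \<in> space P. \<forall>t\<in>F. X t \<omega> \<le> real k} \<in> sets P" using F(1) by (auto intro!: sets.sets_Collect_finite_All)
      show "AE \<omega> in P. \<omega> \<in> E k \<longrightarrow> \<omega> \<in> {\<omega> \<in> space P. \<forall>t\<in>F. X t \<omega> \<le> real k}"
        using AE
      proof eventually_elim
        case (elim \<omega>)
        show ?case
        proof
          assume w: "\<omega> \<in> E k"
          \<comment> \<open>The finite set \<open>F\<close> need not meet the countable set
            \<open>D\<close>; the bound on \<open>D\<close> reaches it through the almost sure
            equality of the suprema over \<open>D\<close> and over the ball.\<close>
          then have 1: "field_sup X D \<omega> \<le> real k" unfolding field_sup_def E_def by (intro cSUP_least D) auto
          have 2: "X t \<omega> \<le> field_sup X (cball 0 1) \<omega>" if "t \<in> F" for t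
            unfolding field_sup_def using elim F that by (intro cSUP_upper) auto
          have "X t \<omega> \<le> real k" if "t \<in> F" for t using 1 2[OF that] elim by simp
          then show "\<omega> \<in> {\<omega> \<in> space P. \<forall>t\<in>F. X t \<omega> \<le> real k}" using w by (auto simp: E_def)
        qed
      qed
    qed
    then show ?thesis using k by linarith
  qed
  have "1 / 2 \<le> prob {\<omega> \<in> space P. \<forall>t\<in>F. X t \<omega> \<le> real k}" if F: "finite F" "F \<subseteq> cball w 1" for F w
  proof -
    \<comment> \<open>Stationarity speaks of finite-dimensional laws, so the event is expressed as a
      set \<open>S\<close> in the product over the translated finite set.\<close>
    define T where "T = (\<lambda>t. t - w) ` F"
    have T: "finite T" "T \<subseteq> cball 0 1" using F by (auto simp: T_def dist_norm norm_minus_commute)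
    define S where "S = {y \<in> space (PiM T (\<lambda>_. borel)). \<forall>t\<in>T. y t \<le> real k}"
    have S: "S \<in> sets (PiM T (\<lambda>_. borel :: real measure))"
      unfolding S_def using T(1) by (intro sets.sets_Collect_finite_All) auto
    have eq: "measure (distr P (PiM T (\<lambda>_. borel)) (\<lambda>\<omega>. \<lambda>t\<in>T. X (t + h) \<omega>)) S = prob {\<omega> \<in> space P. \<forall>t\<in>T. X (t + h) \<omega> \<le> real k}" for h
      using S by (subst measure_distr) (auto simp: S_def space_PiM intro!: arg_cong[where f = prob])
    have "prob {\<omega> \<in> space P. \<forall>t\<in>T. X (t + w) \<omega> \<le> real k} = prob {\<omega> \<in> space P. \<forall>t\<in>T. X (t + 0) \<omega> \<le> real k}"
      using stationary[unfolded stationary_field_def, rule_format, OF T(1), of w] unfolding eq[symmetric] by simp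
    moreover have "(\<forall>t\<in>T. X (t + w) \<omega> \<le> real k) = (\<forall>t\<in>F. X t \<omega> \<le> real k)" for \<omega> by (auto simp: T_def)
    ultimately show ?thesis using origin[OF T] by simp
  qed
  then show ?thesis by (intro exI[of _ "real k"]) auto
qed

lemma isotropic_path_law_exists:
  assumes "antimono_on {0..} \<phi>" "\<phi> 1 < 1 / 2"
  shows "\<exists>a. isotropic_path_law path_law \<phi> a"
proof -
  obtain a where a: "0 \<le> a" "\<And>F w. finite F \<Longrightarrow> F \<subseteq> cball w 1 \<Longrightarrow> 1 / 2 \<le> prob {\<omega> \<in> space P. \<forall>t\<in>F. X t \<omega> \<le> a}"
    using ball_level_exists by blast
  interpret L: gaussian_path_law path_law "\<lambda>s t. \<phi> (norm (s - t))" by (rule gaussian_path_law)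
  have "1 / 2 \<le> L.prob {x \<in> space path_law. \<forall>t\<in>F. x t \<le> a}" if F: "finite F" "F \<subseteq> cball w 1" for F w
  proof -
    have "{x \<in> space path_space. \<forall>t\<in>F. x t \<le> a} \<in> sets (path_space :: (real ^ 'n \<Rightarrow> real) measure)"
      using F(1) by (intro sets.sets_Collect_finite_All) auto
    then have "L.prob {x \<in> space path_space. \<forall>t\<in>F. x t \<le> a} = prob {\<omega> \<in> space P. \<forall>t\<in>F. X t \<omega> \<le> a}"
      unfolding path_law_def by (subst measure_distr) (auto simp: space_path_space intro!: arg_cong[where f = prob])
    then show ?thesis using a(2)[OF F] by (simp add: L.space_mu space_path_space)
  qed
  then show ?thesis using assms a(1) by (intro exI[of _ a] isotropic_path_law.intro isotropic_path_law_axioms.intro L.gaussian_path_law_axioms) auto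
qed

text \<open>The supremum over \<open>A\<close> is almost surely the increasing limit of maxima over
  finite sets. Their exponential moments are bounded uniformly, which first keeps the means bounded,
  so that monotone convergence identifies their limit as the mean of the supremum, and then passes
  to the limit itself. The tails on both sides contribute 3 each.\<close>

theorem concentration:
  assumes iso: "isotropic_path_law path_law \<phi> a"
    and A: "bounded A" "1 < covering_number A" and Mm [measurable]: "field_sup X A \<in> borel_measurable P" and t: "0 \<le> t"
  shows "prob {\<omega> \<in> space P. t \<le> \<bar>field_sup X A \<omega> - expectation (field_sup X A)\<bar>}
    \<le> 6 * exp (- (1 / sqrt (isotropic_path_law.var_factor TYPE('n) a)) * t
        / sqrt (K_rate \<phi> (isotropic_path_law.exponent TYPE('n)) (covering_number A)))"
proof -
  interpret I: isotropic_path_law path_law \<phi> a by (rule iso)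
  define N where "N = real (covering_number A)"
  define K where "K = max (\<phi> (N powr I.exponent)) (1 / ln N)"
  define \<theta> where "\<theta> = 1 / sqrt I.var_factor / sqrt K"
  have N: "2 \<le> N" using A(2) by (simp add: N_def)
  have "0 < 1 / ln N" using N by simp
  then have K: "0 < K" unfolding K_def by linarith
  have \<theta>: "0 < \<theta>" using K I.constants_pos by (simp add: \<theta>_def)
  obtain S where S: "finite S" "real (card S) = N" "S \<subseteq> A" "\<And>s t. s \<in> S \<Longrightarrow> t \<in> S \<Longrightarrow> s \<noteq> t \<Longrightarrow> 1 < dist s t"
    using separated_subset_exists[of "covering_number A" A] unfolding N_def by auto
  have Sne: "S \<noteq> {}" using S(2) N by auto
  then have "bounded A \<and> A \<noteq> {}" using S(3) A(1) by auto
  from regular[unfolded regular_suprema_def, rule_format, OF this] obtain D where D: "countable D" "D \<noteq> {}" "D \<subseteq> A"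
    and AE: "AE \<omega> in P. bdd_above ((\<lambda>s. X s \<omega>) ` A) \<and> field_sup X A \<omega> = field_sup X D \<omega>"
    by (elim exE conjE)
  \<comment> \<open>Every approximating set contains the separated set \<open>S\<close>, so that
    \<theta> and the rate are the same for all \<open>n\<close>.\<close>
  define T where "T n = S \<union> from_nat_into D ` {..n}" for n :: nat
  have T: "finite (T n)" "T n \<noteq> {}" "S \<subseteq> T n" for n using S(1) Sne by (auto simp: T_def)
  have TA: "T n \<subseteq> A" for n using S(3) D from_nat_into[OF D(2)] by (auto simp: T_def)
  have Tmono: "T m \<subseteq> T n" if "m \<le> n" for m n using that by (auto simp: T_def)
  have DT: "\<exists>n. s \<in> T n" if "s \<in> D" for s
    using from_nat_into_surj[OF D(1) that] by (auto simp: T_def)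
  define M where "M n \<omega> = fmax (T n) (\<lambda>t. X t \<omega>)" for n \<omega>
  define e where "e n = expectation (M n)" for n
  have fm: "fmax (T n) \<in> borel_measurable path_space" for n by (rule I.fmax_measurable[OF T(1,2)])
  have M_meas [measurable]: "M n \<in> borel_measurable P" for n
    unfolding M_def[abs_def] by (rule measurable_compose[OF measurable_path fm])
  have M_int: "integrable P (M n)" for n
    using I.integrable_fmax[OF T(1,2)[of n]] unfolding M_def[abs_def] path_law_def
    by (rule integrable_distr[OF measurable_path])
  have e_eq: "e n = (\<integral>x. fmax (T n) x \<partial>path_law)" for n
    unfolding e_def M_def[abs_def] path_law_def by (rule integral_distr[OF measurable_path fm, symmetric])
  have mom: "(\<integral>\<^sup>+\<omega>. ennreal (exp (u * (M n \<omega> - e n))) \<partial>P) \<le> 3" if u: "\<bar>u\<bar> = \<theta>" for u n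
  proof -
    have "(\<integral>\<^sup>+x. ennreal (exp (u * (fmax (T n) x - e n))) \<partial>path_law) \<le> 3"
      unfolding e_eq using S(2) u
      by (intro I.finite_exp_moment[OF T N _ S(4)]) (auto simp: \<theta>_def K_def)
    then show ?thesis unfolding path_law_def M_def
      using fm[of n] by (subst (asm) nn_integral_distr) auto
  qed
  have M_le: "M n \<omega> \<le> field_sup X A \<omega>" if "bdd_above ((\<lambda>s. X s \<omega>) ` A)" for n \<omega>
    unfolding M_def fmax_def using T TA that
    by (subst Max_le_iff) (auto simp: field_sup_def intro!: cSUP_upper subsetD[OF TA])
  have M_ge: "X s \<omega> \<le> M n \<omega>" if "s \<in> T n" for s n \<omega>
    unfolding M_def fmax_def using T that by (intro Max_ge) auto
  have M_mono: "mono (\<lambda>n. M n \<omega>)" for \<omega>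
    unfolding M_def fmax_def using T by (intro monoI Max_mono image_mono Tmono) auto
  have M_lim: "AE \<omega> in P. (\<lambda>n. M n \<omega>) \<longlonglongrightarrow> field_sup X A \<omega>"
    using AE
  proof eventually_elim
    case (elim \<omega>)
    show ?case
    proof (rule increasing_tendsto)
      show "eventually (\<lambda>n. M n \<omega> \<le> field_sup X A \<omega>) sequentially" by (rule always_eventually) (use M_le elim in blast)
      fix y assume "y < field_sup X A \<omega>"
      then have "y < field_sup X D \<omega>" using elim by simp
      then obtain s where s: "s \<in> D" "y < X s \<omega>"
        unfolding field_sup_def using D(2) elim by (subst (asm) less_cSUP_iff) (auto intro: bdd_above_mono[OF _ image_mono[OF D(3)]])
      obtain m where sm: "s \<in> T m" using DT[OF s(1)] by blast
      then have "y < M n \<omega>" if "m \<le> n" for n 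
        using s(2) M_ge[OF subsetD[OF Tmono[OF that] sm], of \<omega>] by linarith
      then show "eventually (\<lambda>n. y < M n \<omega>) sequentially" by (auto simp: eventually_sequentially)
    qed
  qed
  \<comment> \<open>A real-valued random variable has a finite level of probability above 1/2. It
    anchors the means before integrability of the supremum is known.\<close>
  obtain b where b: "1 / 2 < prob {\<omega> \<in> space P. field_sup X A \<omega> \<le> b}"
  proof -
    define F where "F k = {\<omega> \<in> space P. field_sup X A \<omega> \<le> real k}" for k :: nat
    have "range F \<subseteq> sets P" unfolding F_def by auto
    moreover have "incseq F" unfolding F_def incseq_def by auto
    ultimately have "(\<lambda>k. prob (F k)) \<longlonglongrightarrow> prob (\<Union>k. F k)" by (rule finite_Lim_measure_incseq)
    moreover have "(\<Union>k. F k) = space P" using real_arch_simple by (auto simp: F_def)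
    ultimately have "(\<lambda>k. prob (F k)) \<longlonglongrightarrow> 1" by (simp add: prob_space)
    then have "eventually (\<lambda>k. 1 / 2 < prob (F k)) sequentially" by (rule order_tendstoD) simp
    then obtain k where "1 / 2 < prob (F k)" by (auto simp: eventually_sequentially)
    then show ?thesis using that unfolding F_def by blast
  qed
  \<comment> \<open>If \<open>e n\<close> were larger, the event behind \<open>b\<close> would force
    \<open>M n\<close> to lie at least ln 6 / \<theta> below its mean, which has probability at most
    3 exp (- ln 6) = 1/2.\<close>
  have e_bound: "e n \<le> b + ln 6 / \<theta>" for n
  proof (rule ccontr)
    assume *: "\<not> ?thesis"
    have "prob {\<omega> \<in> space P. field_sup X A \<omega> \<le> b} \<le> prob {\<omega> \<in> space P. ln 6 \<le> (- \<theta>) * (M n \<omega> - e n)}"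
    proof (rule finite_measure_mono_AE)
      show "AE \<omega> in P. \<omega> \<in> {\<omega> \<in> space P. field_sup X A \<omega> \<le> b} \<longrightarrow> \<omega> \<in> {\<omega> \<in> space P. ln 6 \<le> (- \<theta>) * (M n \<omega> - e n)}"
        using AE
      proof eventually_elim
        case (elim \<omega>)
        have "ln 6 \<le> (- \<theta>) * (M n \<omega> - e n)" if "field_sup X A \<omega> \<le> b"
        proof -
          have "ln 6 / \<theta> \<le> e n - M n \<omega>" using M_le[of \<omega> n] elim that * by auto
          then have "ln 6 \<le> (e n - M n \<omega>) * \<theta>" using \<theta> by (simp add: pos_divide_le_eq)
          then show ?thesis by (simp add: algebra_simps)
        qed
        then show ?case by auto
      qed
    qed measurable
    also have "\<dots> \<le> 3 * exp (- ln 6)" using \<theta> by (intro exp_tail mom) auto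
    also have "\<dots> = 1 / 2" by (simp add: exp_minus)
    finally show False using b by simp
  qed
  have "incseq e" unfolding e_def by (intro monoI integral_mono M_int) (use M_mono in \<open>auto simp: mono_def\<close>)
  moreover have "bdd_above (range e)" using e_bound by (auto simp: bdd_above_def)
  ultimately have "e \<longlonglongrightarrow> (SUP n. e n)" by (intro LIMSEQ_incseq_SUP)
  then obtain l where l: "e \<longlonglongrightarrow> l" ..
  have mean: "expectation (field_sup X A) = l"
    using M_mono M_lim l unfolding e_def by (intro integral_monotone_convergence[OF M_int]) auto
  have tail: "prob {\<omega> \<in> space P. \<theta> * t \<le> u * (field_sup X A \<omega> - l)} \<le> 3 * exp (- (\<theta> * t))" if u: "\<bar>u\<bar> = \<theta>" for u
  proof (rule exp_tail)
    \<comment> \<open>The maxima and their means both converge, so Fatou's lemma carries the bound 3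
      to the limit.\<close>
    have "AE \<omega> in P. ennreal (exp (u * (field_sup X A \<omega> - l))) = liminf (\<lambda>n. ennreal (exp (u * (M n \<omega> - e n))))"
      using M_lim
    proof eventually_elim
      case (elim \<omega>)
      have "(\<lambda>n. ennreal (exp (u * (M n \<omega> - e n)))) \<longlonglongrightarrow> ennreal (exp (u * (field_sup X A \<omega> - l)))"
        by (intro tendsto_ennrealI tendsto_intros elim l)
      then show ?case by (rule lim_imp_Liminf[OF sequentially_bot, symmetric])
    qed
    then have "(\<integral>\<^sup>+\<omega>. ennreal (exp (u * (field_sup X A \<omega> - l))) \<partial>P) = (\<integral>\<^sup>+\<omega>. liminf (\<lambda>n. ennreal (exp (u * (M n \<omega> - e n)))) \<partial>P)"
      by (rule nn_integral_cong_AE)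
    also have "\<dots> \<le> liminf (\<lambda>n. \<integral>\<^sup>+\<omega>. ennreal (exp (u * (M n \<omega> - e n))) \<partial>P)"
      by (rule nn_integral_liminf) simp
    also have "\<dots> \<le> liminf (\<lambda>n. 3)" using mom[OF u] by (intro Liminf_mono) auto
    finally show "(\<integral>\<^sup>+\<omega>. ennreal (exp (u * (field_sup X A \<omega> - l))) \<partial>P) \<le> 3" by (simp add: Liminf_const)
  qed simp
  have "prob {\<omega> \<in> space P. t \<le> \<bar>field_sup X A \<omega> - l\<bar>}
    \<le> prob ({\<omega> \<in> space P. \<theta> * t \<le> \<theta> * (field_sup X A \<omega> - l)} \<union> {\<omega> \<in> space P. \<theta> * t \<le> (- \<theta>) * (field_sup X A \<omega> - l)})"
  proof (rule finite_measure_mono)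
    show "{\<omega> \<in> space P. t \<le> \<bar>field_sup X A \<omega> - l\<bar>}
      \<subseteq> {\<omega> \<in> space P. \<theta> * t \<le> \<theta> * (field_sup X A \<omega> - l)} \<union> {\<omega> \<in> space P. \<theta> * t \<le> (- \<theta>) * (field_sup X A \<omega> - l)}"
    proof
      fix \<omega> assume w: "\<omega> \<in> {\<omega> \<in> space P. t \<le> \<bar>field_sup X A \<omega> - l\<bar>}"
      then consider "t \<le> field_sup X A \<omega> - l" | "t \<le> - (field_sup X A \<omega> - l)" by fastforce
      then show "\<omega> \<in> {\<omega> \<in> space P. \<theta> * t \<le> \<theta> * (field_sup X A \<omega> - l)} \<union> {\<omega> \<in> space P. \<theta> * t \<le> (- \<theta>) * (field_sup X A \<omega> - l)}"
      proof cases
        case 1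
        then have "\<theta> * t \<le> \<theta> * (field_sup X A \<omega> - l)" using \<theta> by (intro mult_left_mono) auto
        then show ?thesis using w by blast
      next
        case 2
        then have "\<theta> * t \<le> \<theta> * (- (field_sup X A \<omega> - l))" using \<theta> by (intro mult_left_mono) auto
        then show ?thesis using w unfolding minus_mult_right[symmetric] minus_mult_left by blast
      qed
    qed
  qed measurable
  also have "\<dots> \<le> 3 * exp (- (\<theta> * t)) + 3 * exp (- (\<theta> * t))"
    by (rule order_trans[OF measure_Un_le]) (use tail[of \<theta>] tail[of "- \<theta>"] \<theta> in \<open>auto intro!: add_mono\<close>)
  also have "\<dots> = 6 * exp (- (1 / sqrt I.var_factor) * t / sqrt (K_rate \<phi> I.exponent (covering_number A)))"
    by (simp add: \<theta>_def K_rate_def K_def N_def)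
  finally show ?thesis unfolding mean .
qed

end

section \<open>Transfer of a field to the space of sample paths\<close>

context unit_stationary_gaussian_field begin

text \<open>The largest \<open>\<sigma>\<close>-algebra on the sample paths for which the path is a measurable function on the
  completion of \<open>P\<close>: suprema over uncountable sets need not be measurable for \<open>path_space\<close>.\<close>

definition path_events :: "(real ^ 'n \<Rightarrow> real) set set" where
  "path_events = {S. (\<lambda>\<omega> t. X t \<omega>) -` S \<inter> space P \<in> sets (completion P)}"

definition path_measure :: "(real ^ 'n \<Rightarrow> real) measure" where
  "path_measure = distr (completion P) (sigma UNIV path_events) (\<lambda>\<omega> t. X t \<omega>)"

lemma sigma_algebra_path_events: "sigma_algebra UNIV path_events"
  unfolding sigma_algebra_iff2
proof (intro conjI ballI allI impI)
  show "path_events \<subseteq> Pow UNIV" "{} \<in> path_events" by (auto simp: path_events_def)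
  fix S :: "(real ^ 'n \<Rightarrow> real) set" assume "S \<in> path_events"
  then have "space (completion P) - ((\<lambda>\<omega> t. X t \<omega>) -` S \<inter> space P) \<in> sets (completion P)"
    unfolding path_events_def by (intro sets.compl_sets) simp
  moreover have "space (completion P) - ((\<lambda>\<omega> t. X t \<omega>) -` S \<inter> space P) = (\<lambda>\<omega> t. X t \<omega>) -` (UNIV - S) \<inter> space P" by auto
  ultimately show "UNIV - S \<in> path_events" by (simp add: path_events_def)
next
  fix S :: "nat \<Rightarrow> (real ^ 'n \<Rightarrow> real) set" assume "range S \<subseteq> path_events"
  then have "(\<Union>i. (\<lambda>\<omega> t. X t \<omega>) -` S i \<inter> space P) \<in> sets (completion P)"
    unfolding path_events_def by (intro sets.countable_UN) auto
  moreover have "(\<Union>i. (\<lambda>\<omega> t. X t \<omega>) -` S i \<inter> space P) = (\<lambda>\<omega> t. X t \<omega>) -` (\<Union>i. S i) \<inter> space P" by auto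
  ultimately show "(\<Union>i. S i) \<in> path_events" by (simp add: path_events_def)
qed

lemma sets_path_measure: "sets path_measure = path_events" and space_path_measure: "space path_measure = UNIV"
  using sigma_algebra.sets_measure_of_eq[OF sigma_algebra_path_events] by (auto simp: path_measure_def)

lemma measurable_completion_path: "(\<lambda>\<omega> t. X t \<omega>) \<in> measurable (completion P) (sigma UNIV path_events)"
proof (rule measurableI)
  fix S assume "S \<in> sets (sigma UNIV path_events)"
  then have "S \<in> path_events" using sigma_algebra.sets_measure_of_eq[OF sigma_algebra_path_events] by simp
  then show "(\<lambda>\<omega> t. X t \<omega>) -` S \<inter> space (completion P) \<in> sets (completion P)" by (simp add: path_events_def)
qed simp

lemma prob_space_path_measure: "prob_space path_measure"
  unfolding path_measure_def
  by (rule prob_space.prob_space_distr[OF prob_space_completion measurable_completion_path])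

context
  fixes g :: "(real ^ 'n \<Rightarrow> real) \<Rightarrow> 'b" and N :: "'b measure"
  assumes g: "(\<lambda>\<omega>. g (\<lambda>t. X t \<omega>)) \<in> measurable P N" and into: "\<And>x. g x \<in> space N"
begin

lemma measurable_path_measure: "g \<in> measurable path_measure N"
proof (rule measurableI)
  show "g x \<in> space N" for x by (rule into)
  fix S assume "S \<in> sets N"
  then have "(\<lambda>\<omega>. g (\<lambda>t. X t \<omega>)) -` S \<inter> space P \<in> sets P" by (rule measurable_sets[OF g])
  moreover have "(\<lambda>\<omega>. g (\<lambda>t. X t \<omega>)) -` S \<inter> space P = (\<lambda>\<omega> t. X t \<omega>) -` (g -` S) \<inter> space P" by auto
  ultimately show "g -` S \<inter> space path_measure \<in> sets path_measure"
    unfolding sets_path_measure space_path_measure by (simp add: path_events_def)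
qed

lemma distr_path_measure: "distr path_measure N g = distr P N (\<lambda>\<omega>. g (\<lambda>t. X t \<omega>))"
proof -
  have "distr path_measure N g = distr (completion P) N (g \<circ> (\<lambda>\<omega> t. X t \<omega>))"
    using measurable_path_measure measurable_completion_path unfolding path_measure_def
    by (intro distr_distr) (auto simp: measurable_def)
  also have "\<dots> = distr P N (\<lambda>\<omega>. g (\<lambda>t. X t \<omega>))" unfolding comp_def by (rule distr_completion[OF g])
  finally show ?thesis .
qed

end

lemma borel_path_measure:
  assumes g: "(\<lambda>\<omega>. g (\<lambda>t. X t \<omega>)) \<in> borel_measurable P"
  shows "g \<in> borel_measurable path_measure" "distr path_measure borel g = distr P borel (\<lambda>\<omega>. g (\<lambda>t. X t \<omega>))"
  using measurable_path_measure[OF g] distr_path_measure[OF g] by simp_all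

lemma integral_path_measure:
  fixes g :: "_ \<Rightarrow> real"
  assumes g: "(\<lambda>\<omega>. g (\<lambda>t. X t \<omega>)) \<in> borel_measurable P"
  shows "(\<integral>x. g x \<partial>path_measure) = expectation (\<lambda>\<omega>. g (\<lambda>t. X t \<omega>))"
proof -
  have "(\<integral>x. g x \<partial>path_measure) = (\<integral>z. z \<partial>distr path_measure borel g)"
    by (rule integral_distr[OF borel_path_measure(1)[OF g], symmetric]) simp
  also have "\<dots> = expectation (\<lambda>\<omega>. g (\<lambda>t. X t \<omega>))"
    unfolding borel_path_measure(2)[OF g] by (rule integral_distr[OF g]) auto
  finally show ?thesis .
qed

text \<open>The property \<open>Q\<close> of the path may fail to be measurable under
  \<open>P\<close>. Its exceptional set lies in a null set, hence is measurable for the completion,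
  which puts the set of good paths into \<open>path_events\<close>.\<close>

lemma AE_path_measure:
  assumes AE: "AE \<omega> in P. Q (\<lambda>t. X t \<omega>)" shows "AE x in path_measure. Q x"
proof -
  obtain N where N: "N \<in> null_sets P" "{\<omega> \<in> space P. \<not> Q (\<lambda>t. X t \<omega>)} \<subseteq> N"
    using AE by (auto simp: eventually_ae_filter)
  have "{\<omega> \<in> space P. \<not> Q (\<lambda>t. X t \<omega>)} \<in> sets (completion P)" by (rule sets_completionI_sub[OF N])
  then have "space (completion P) - {\<omega> \<in> space P. \<not> Q (\<lambda>t. X t \<omega>)} \<in> sets (completion P)"
    by (intro sets.compl_sets)
  moreover have "space (completion P) - {\<omega> \<in> space P. \<not> Q (\<lambda>t. X t \<omega>)} = (\<lambda>\<omega> t. X t \<omega>) -` {x. Q x} \<inter> space P" by auto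
  ultimately have "{x. Q x} \<in> path_events" by (simp add: path_events_def)
  then have "{x \<in> space (sigma UNIV path_events). Q x} \<in> sets (sigma UNIV path_events)"
    using sigma_algebra.sets_measure_of_eq[OF sigma_algebra_path_events] by simp
  then show ?thesis
    unfolding path_measure_def by (subst AE_distr_iff[OF measurable_completion_path]) (auto intro: AE_completion AE)
qed

text \<open>Each clause concerns laws or moments of functions of the path, or almost sure properties
  of it, and all of these are the same under the image measure.\<close>

lemma coordinate_field: "unit_stationary_gaussian_field path_measure (\<lambda>t x. x t) \<phi>"
proof -
  interpret Q: prob_space path_measure by (rule prob_space_path_measure)
  have mean: "Q.expectation (\<lambda>x. x t) = 0" for t by (subst integral_path_measure) (auto simp: centered)
  show ?thesis
  proof unfold_locales
    show "(\<lambda>x. x t) \<in> borel_measurable path_measure" for t by (rule measurable_path_measure) simp_all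
    show "gaussian_field path_measure (\<lambda>t x. x t)"
      unfolding gaussian_field_def
    proof (intro allI impI)
      fix T :: "(real ^ 'n) set" and a :: "real ^ 'n \<Rightarrow> real" assume T: "finite T"
      have eq: "distr path_measure borel (\<lambda>x. \<Sum>t\<in>T. a t * x t) = distr P borel (\<lambda>\<omega>. \<Sum>t\<in>T. a t * X t \<omega>)"
        by (rule distr_path_measure) simp_all
      then show "gaussian_law (distr path_measure borel (\<lambda>x. \<Sum>t\<in>T. a t * x t))"
        unfolding eq using gaussian T unfolding gaussian_field_def by blast
    qed
    show "stationary_field path_measure (\<lambda>t x. x t)"
      unfolding stationary_field_def
    proof (intro allI impI)
      fix T :: "(real ^ 'n) set" and h :: "real ^ 'n" assume T: "finite T"
      have d: "distr path_measure (PiM T (\<lambda>_. borel)) (\<lambda>x. \<lambda>t\<in>T. x (t + h)) = distr P (PiM T (\<lambda>_. borel)) (\<lambda>\<omega>. \<lambda>t\<in>T. X (t + h) \<omega>)" for h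
        by (rule distr_path_measure, measurable) (simp add: space_PiM)
      show "distr path_measure (PiM T (\<lambda>_. borel)) (\<lambda>x. \<lambda>t\<in>T. x (t + h)) = distr path_measure (PiM T (\<lambda>_. borel)) (\<lambda>x. \<lambda>t\<in>T. x t)"
        using stationary T d[of h] d[of 0] unfolding stationary_field_def by simp
    qed
    show "Q.expectation (\<lambda>x. x t) = 0" for t by (rule mean)
    show "Q.expectation (\<lambda>x. (x t)\<^sup>2) = 1" for t by (subst integral_path_measure) (auto simp: second_moment)
    show "Q.expectation (\<lambda>x. (x s - Q.expectation (\<lambda>x. x s)) * (x t - Q.expectation (\<lambda>x. x t))) = \<phi> (norm (s - t))" for s t
      unfolding mean by (subst integral_path_measure) (auto simp: product_moment)
    show "regular_suprema path_measure (\<lambda>t x. x t)"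
      unfolding regular_suprema_def
    proof (intro allI impI)
      fix A :: "(real ^ 'n) set" assume "bounded A \<and> A \<noteq> {}"
      from regular[unfolded regular_suprema_def, rule_format, OF this] obtain D where D: "countable D" "D \<noteq> {}" "D \<subseteq> A"
        and AE: "AE \<omega> in P. bdd_above ((\<lambda>s. X s \<omega>) ` A) \<and> field_sup X A \<omega> = field_sup X D \<omega>"
        by (elim exE conjE)
      have "AE x in path_measure. bdd_above ((\<lambda>s. x s) ` A) \<and> field_sup (\<lambda>t x. x t) A x = field_sup (\<lambda>t x. x t) D x"
        by (rule AE_path_measure) (use AE in \<open>simp add: field_sup_def\<close>)
      then show "\<exists>D. countable D \<and> D \<noteq> {} \<and> D \<subseteq> A \<and>
          (AE x in path_measure. bdd_above ((\<lambda>s. x s) ` A) \<and> field_sup (\<lambda>t x. x t) A x = field_sup (\<lambda>t x. x t) D x)"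
        using D by blast
    qed
  qed
qed

end

text \<open>If some field with covariance \<phi> lives over \<open>'w\<close>, the level
  \<open>a\<close> is taken from it once; every other such field has the same path law, hence the
  same constants. If there is no field at all, the claim is vacuous and any positive constants
  do.\<close>

lemma superconcentration_constants_exist:
  fixes \<phi> :: "real \<Rightarrow> real"
  assumes \<phi>: "antimono_on {0..} \<phi>" "\<phi> 1 < 1 / 2"
  shows "\<exists>C>0. \<exists>c>0. superconcentration_constants TYPE('w) TYPE('n::finite) \<phi> C c"
proof (cases "\<exists>(P :: 'w measure) (X :: real ^ 'n \<Rightarrow> 'w \<Rightarrow> real). unit_stationary_gaussian_field P X \<phi>")
  case False
  then have "superconcentration_constants TYPE('w) TYPE('n) \<phi> 1 1" unfolding superconcentration_constants_def by blast
  then show ?thesis by (intro exI[of _ 1] conjI) simp_all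
next
  case True
  then obtain P0 :: "'w measure" and X0 :: "real ^ 'n \<Rightarrow> 'w \<Rightarrow> real" where "unit_stationary_gaussian_field P0 X0 \<phi>" by blast
  then interpret F: unit_stationary_gaussian_field P0 X0 \<phi> .
  obtain a where iso: "isotropic_path_law F.path_law \<phi> a" using F.isotropic_path_law_exists[OF \<phi>] by blast
  interpret I: isotropic_path_law F.path_law \<phi> a by (rule iso)
  have "superconcentration_constants TYPE('w) TYPE('n) \<phi> I.exponent (1 / sqrt I.var_factor)"
    unfolding superconcentration_constants_def
  proof (intro allI impI, elim conjE)
    fix P :: "'w measure" and X :: "real ^ 'n \<Rightarrow> 'w \<Rightarrow> real" and A :: "(real ^ 'n) set" and t :: real
    assume X: "unit_stationary_gaussian_field P X \<phi>" and A: "bounded A" "1 < covering_number A"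
      "field_sup X A \<in> borel_measurable P" "0 \<le> t"
    interpret X: unit_stationary_gaussian_field P X \<phi> by (rule X)
    have "X.path_law = F.path_law" by (rule gaussian_path_law_unique[OF X.gaussian_path_law F.gaussian_path_law])
    then have iso': "isotropic_path_law X.path_law \<phi> a" using iso by simp
    show "measure P {\<omega> \<in> space P. t \<le> \<bar>field_sup X A \<omega> - integral\<^sup>L P (field_sup X A)\<bar>}
      \<le> 6 * exp (- (1 / sqrt I.var_factor) * t / sqrt (K_rate \<phi> I.exponent (covering_number A)))"
      by (rule X.concentration[OF iso' A])
  qed
  moreover have "0 < 1 / sqrt I.var_factor" using I.constants_pos(2) by simp
  ultimately show ?thesis using I.constants_pos(1) by blast
qed

text \<open>The supremum over \<open>A\<close> factors through the sample path. It has the same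
  distribution for \<open>X\<close> as for the coordinate field under \<open>X.path_measure\<close>,
  and the estimate involves this distribution alone.\<close>

lemma superconcentration_constants_transfer:
  assumes const: "superconcentration_constants TYPE('n::finite path) TYPE('n) \<phi> C c"
  shows "superconcentration_constants TYPE('w) TYPE('n) \<phi> C c"
  unfolding superconcentration_constants_def
proof (intro allI impI, elim conjE)
  fix P :: "'w measure" and X :: "real ^ 'n \<Rightarrow> 'w \<Rightarrow> real" and A :: "(real ^ 'n) set" and t :: real
  assume X: "unit_stationary_gaussian_field P X \<phi>" and A: "bounded A" "1 < covering_number A"
    and m: "field_sup X A \<in> borel_measurable P" and t: "0 \<le> t"
  interpret X: unit_stationary_gaussian_field P X \<phi> by (rule X)
  let ?M = "field_sup (\<lambda>t x. x t) A"
  have e: "field_sup X A = (\<lambda>\<omega>. ?M (\<lambda>t. X t \<omega>))" by (simp add: field_sup_def fun_eq_iff)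
  have gm: "(\<lambda>\<omega>. ?M (\<lambda>t. X t \<omega>)) \<in> borel_measurable P" using m unfolding e .
  have M [measurable]: "?M \<in> borel_measurable X.path_measure" by (rule X.borel_path_measure(1)[OF gm])
  define E where "E = integral\<^sup>L P (field_sup X A)"
  have E: "integral\<^sup>L X.path_measure ?M = E" unfolding E_def e by (rule X.integral_path_measure[OF gm])
  have "measure X.path_measure {x \<in> space X.path_measure. t \<le> \<bar>?M x - integral\<^sup>L X.path_measure ?M\<bar>}
      \<le> 6 * exp (- c * t / sqrt (K_rate \<phi> C (covering_number A)))"
    using const X.coordinate_field A M t unfolding superconcentration_constants_def by blast
  moreover have "measure X.path_measure {x \<in> space X.path_measure. t \<le> \<bar>?M x - E\<bar>} = measure (distr X.path_measure borel ?M) {z. t \<le> \<bar>z - E\<bar>}"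
    by (subst measure_distr) (auto intro!: arg_cong[where f = "measure X.path_measure"])
  moreover have "\<dots> = measure P {\<omega> \<in> space P. t \<le> \<bar>field_sup X A \<omega> - E\<bar>}"
    unfolding X.borel_path_measure(2)[OF gm] e
    by (subst measure_distr[OF gm]) (auto intro!: arg_cong[where f = "measure P"])
  ultimately show "measure P {\<omega> \<in> space P. t \<le> \<bar>field_sup X A \<omega> - integral\<^sup>L P (field_sup X A)\<bar>}
      \<le> 6 * exp (- c * t / sqrt (K_rate \<phi> C (covering_number A)))"
    unfolding E E_def[symmetric] by simp
qed

theorem theorem4:
  fixes \<phi> :: "real \<Rightarrow> real"
  assumes "antimono_on {0..} \<phi>"
    and "\<phi> 1 < 1 / 2"
  shows "(\<exists>C>0. \<exists>c>0. superconcentration_constants TYPE('n::finite path) TYPE('n) \<phi> C c) \<and>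
    (\<forall>C>0. \<forall>c>0. superconcentration_constants TYPE('n path) TYPE('n) \<phi> C c \<longrightarrow>
       superconcentration_constants TYPE('w) TYPE('n) \<phi> C c)"
  using superconcentration_constants_exist[OF assms] superconcentration_constants_transfer by blast

end
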